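(* Let $\mathcal{D}$ be a lemon billiard table, let $\varepsilon>0$, let $\nu_\varepsilon=\rho\,d\mathbf{m}$ be any noise distribution on $\mathbb{R}^2$ whose density $\rho$ has support containing the ball $B_\varepsilon(0,0)$, and let $P$ be the Markov transition function on the collision space $M$ obtained by applying the billiard map $F$ of $\mathcal{D}$ and then the random perturbation with law $\nu_\varepsilon$. Then the resulting random billiard is ergodic and hyperbolic; that is, the probability measure $m$ with $dm=\frac{1}{2|\partial\mathcal{D}|}\,dr\,ds$ is ergodic with respect to $P$, and the largest Lyapunov exponent $\lambda_1$ associated to the derivative map $DF$ along the Markov process with transition function $P$ and initial distribution $m$ satisfies $\lambda_1>0$.
   Context: Lemon billiard. A lemon billiard table is the convex region formed by the intersection of two closed disks in $\mathbb{R}^2$ whose boundary circles meet in exactly two points, so that its boundary consists of two circular arcs, one from each circle (the radii may differ). Billiard map. The boundary $\partial\mathcal{D}$ is a simple closed (piecewise smooth) curve of length $L=|\partial\mathcal{D}|$, parametrized by arclength $r\in[0,L]$ with the interior $\mathcal{D}_0$ on its left. A point particle moves in $\mathcal{D}_0$ with constant velocity and reflects at the smooth part of the boundary by $v^+=v^--2(v^-,n)n$, $n$ the inward unit normal. A collision is described by $(r,s)$, where $r$ is the arclength parameter of the collision point and $s=\sin\varphi$, with $\varphi\in[-\pi/2,\pi/2]$ the signed angle from the post-collisional velocity $v$ to $n$. The collision space $M$ is the cylinder obtained from $R=[0,L]\times[-1,1]$ by identifying the edges $\{r=0\}$ and $\{r=L\}$, with Borel $\sigma$-algebra $\mathcal{B}$,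 and $F:M\to M$ is the billiard map sending a collision $(r,s)$ to the next collision $(r_1,s_1)$; it is defined $m$-almost everywhere (off the trajectories that hit corners). It preserves the probability measure $dm=\frac{1}{2|\partial\mathcal{D}|}\,dr\,ds$. $DF(x)$ denotes the $2\times2$ Jacobian matrix of $F$ at $x$ in the coordinates $(r,s)$; it is defined for $m$-a.e. $x$ and has determinant $1$. Random perturbation. Fix $\varepsilon>0$ and a probability measure $\nu_\varepsilon$ on $\mathbb{R}^2$ with $d\nu_\varepsilon=\rho\,d\mathbf{m}$, $\mathbf{m}$ Lebesgue measure, where $\rho$ is measurable and its support contains the ball $B_\varepsilon(0,0)$ of radius $\varepsilon$ about the origin, meaning that $\rho$ is positive on this ball. Let $\Lambda=L\mathbb{Z}\times 2\mathbb{Z}$. For $x\in M$ and $B\in\mathcal{B}$ put $\eta_\varepsilon^x(B)=\nu_\varepsilon\{u\in\mathbb{R}^2: u+x\in B \bmod \Lambda\}=\int_B\sum_{v\in\Lambda}\rho(u-x-v)\,\mathbf{m}(du)$. The Markov transition function is $P(x,B)=\eta_\varepsilon^{F(x)}(B)$ for $m$-a.e. $x\in M$ and $B\in\mathcal{B}$. The measure $m$ is invariant with respect to $P$, i.e. $m(B)=\int_M P(x,B)\,m(dx)$ for all $B\in\mathcal{B}$. Ergodicity. Let $\Omega$ be the space of sequences $\omega=(x_0,x_1,\dots)$ in $M$ with product $\sigma$-algebra $\mathcal{A}$, shift $\theta(x_0,x_1,\dots)=(x_1,x_2,\dots)$, and let $\mathbf{P}_m$ be the law on $\Omega$ of the Markov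 process with transition function $P$ and initial distribution $m$. The measure $m$ is ergodic with respect to $P$ if $A\in\mathcal{A}$, $\theta^{-1}(A)=A$ implies $\mathbf{P}_m(A)\in\{0,1\}$. Lyapunov exponents. Put $A^{(n)}(\omega)=DF(x_{n-1})DF(x_{n-2})\cdots DF(x_0)$ for $n\ge1$. The Lyapunov exponents $\lambda_1\ge\lambda_2$ are defined by $\lambda_1=\lim_{n\to\infty}\frac1n\int_\Omega\log\|A^{(n)}(\omega)\|\,\mathbf{P}_m(d\omega)$ and $\lambda_1+\lambda_2=\lim_{n\to\infty}\frac1n\int_\Omega\log|\det A^{(n)}(\omega)|\,\mathbf{P}_m(d\omega)$, where $\|\cdot\|$ is the operator norm. The random billiard is called hyperbolic if $\lambda_1>0$. *)

theory Defs
  imports "HOL-Probability.Probability"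
begin

section \<open>Tables and boundary parametrizations\<close>

text \<open>The plane containing the table is \<^typ>\<open>complex\<close>. The radii are automatically positive,
  because otherwise the circles could not share two points.\<close>

definition lemon_table :: "complex set \<Rightarrow> bool" where
  "lemon_table D \<longleftrightarrow>
     (\<exists>c1 R1 c2 R2. D = cball c1 R1 \<inter> cball c2 R2 \<and> card (sphere c1 R1 \<inter> sphere c2 R2) = 2)"

text \<open>The parametrization is extended periodically, so that the parameters \<open>0\<close> and \<open>L\<close> play no
  special role; the base point is arbitrary and may or may not be a corner. Unit speed and
  injectivity on a period force \<open>L\<close> to be the length of the boundary.\<close>

definition arclength_boundary :: "complex set \<Rightarrow> real \<Rightarrow> (real \<Rightarrow> complex) \<Rightarrow> bool" where
  "arclength_boundary D L \<gamma> \<longleftrightarrow>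
     0 < L \<and>
     (\<forall>r. \<gamma> (r + L) = \<gamma> r) \<and>
     \<gamma> piecewise_C1_differentiable_on {0..L} \<and>
     inj_on \<gamma> {0..<L} \<and>
     \<gamma> ` {0..<L} = frontier D \<and>
     (\<forall>r. \<gamma> differentiable (at r) \<longrightarrow> norm (vector_derivative \<gamma> (at r)) = 1) \<and>
     (\<forall>r. \<gamma> differentiable (at r) \<longrightarrow>
        (\<exists>\<delta>>0. \<forall>t\<in>{0<..<\<delta>}. \<gamma> r + of_real t * (\<i> * vector_derivative \<gamma> (at r)) \<in> interior D))"


section \<open>The billiard map\<close>

text \<open>The cylinder is represented by the fundamental domain of the identification of \<open>r = 0\<close>
  with \<open>r = L\<close>; its Borel sets correspond to those of the quotient.\<close>

definition collision_space :: "real \<Rightarrow> (real \<times> real) set" where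
  "collision_space L = {0..<L} \<times> {-1..1}"

definition collision_measure :: "real \<Rightarrow> (real \<times> real) measure" where
  "collision_measure L =
     density (restrict_space lborel (collision_space L)) (\<lambda>_. ennreal (1 / (2 * L)))"

definition inward_normal :: "(real \<Rightarrow> complex) \<Rightarrow> real \<Rightarrow> complex" where
  "inward_normal \<gamma> r = \<i> * vector_derivative \<gamma> (at r)"

text \<open>The angle from the velocity to the normal is \<open>arcsin s\<close>, so the velocity is the normal
  turned by \<open>- arcsin s\<close>; its tangential component is \<open>s\<close>.\<close>

definition post_velocity :: "(real \<Rightarrow> complex) \<Rightarrow> real \<times> real \<Rightarrow> complex" where
  "post_velocity \<gamma> = (\<lambda>(r, s). inward_normal \<gamma> r * cis (- arcsin s))"

text \<open>Parameters at which \<open>\<gamma>\<close> is not differentiable are the corners. There is no next collision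
  from a corner, from a tangential velocity, or along a trajectory that runs into a corner.\<close>

definition next_collision ::
    "complex set \<Rightarrow> real \<Rightarrow> (real \<Rightarrow> complex) \<Rightarrow> real \<times> real \<Rightarrow> real \<times> real \<Rightarrow> bool" where
  "next_collision D L \<gamma> x y \<longleftrightarrow>
     x \<in> collision_space L \<and> y \<in> collision_space L \<and>
     \<gamma> differentiable (at (fst x)) \<and> \<gamma> differentiable (at (fst y)) \<and>
     (\<exists>T>0. (\<forall>t\<in>{0<..<T}. \<gamma> (fst x) + of_real t * post_velocity \<gamma> x \<in> interior D) \<and>
            \<gamma> (fst y) = \<gamma> (fst x) + of_real T * post_velocity \<gamma> x) \<and>
     (let v = post_velocity \<gamma> x; n = inward_normal \<gamma> (fst y)
      in post_velocity \<gamma> y = v - (2 * (v \<bullet> n)) *\<^sub>R n)"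

definition billiard_map ::
    "complex set \<Rightarrow> real \<Rightarrow> (real \<Rightarrow> complex) \<Rightarrow> real \<times> real \<Rightarrow> real \<times> real" where
  "billiard_map D L \<gamma> x = (THE y. next_collision D L \<gamma> x y)"

text \<open>The matrix is meaningful only where the Frechet derivative exists, which is the case almost
  everywhere: the curves missed are those on which the map is undefined and those across which
  \<open>r\<close> jumps between \<open>0\<close> and \<open>L\<close> in the fundamental domain.\<close>

definition jacobian2 :: "(real \<times> real \<Rightarrow> real \<times> real) \<Rightarrow> real \<times> real \<Rightarrow> real^2^2" where
  "jacobian2 F x =
     (let F' = frechet_derivative F (at x)
      in vector [vector [fst (F' (1, 0)), fst (F' (0, 1))],
                 vector [snd (F' (1, 0)), snd (F' (0, 1))]])"


section \<open>Random perturbation\<close>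

definition noise_lattice :: "real \<Rightarrow> (real \<times> real) set" where
  "noise_lattice L = {(L * of_int j, 2 * of_int k) | j k. True}"

definition noise_density :: "real \<Rightarrow> (real \<times> real \<Rightarrow> real) \<Rightarrow> bool" where
  "noise_density \<epsilon> \<rho> \<longleftrightarrow>
     \<rho> \<in> borel_measurable borel \<and> (\<forall>u. 0 \<le> \<rho> u) \<and>
     prob_space (density lborel (\<lambda>u. ennreal (\<rho> u))) \<and>
     (\<forall>u\<in>ball 0 \<epsilon>. 0 < \<rho> u)"

definition perturbed ::
    "real \<Rightarrow> (real \<times> real \<Rightarrow> real) \<Rightarrow> real \<times> real \<Rightarrow> (real \<times> real) set \<Rightarrow> ennreal" where
  "perturbed L \<rho> x B =
     emeasure (density lborel (\<lambda>u. ennreal (\<rho> u))) {u. \<exists>w\<in>noise_lattice L. u + x + w \<in> B}"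

text \<open>The transition function is determined by the billiard map only almost everywhere;
  any version that is a Markov kernel is admitted.\<close>

definition random_billiard ::
    "complex set \<Rightarrow> real \<Rightarrow> (real \<Rightarrow> complex) \<Rightarrow> (real \<times> real \<Rightarrow> real) \<Rightarrow>
     (real \<times> real \<Rightarrow> (real \<times> real) measure) \<Rightarrow> bool" where
  "random_billiard D L \<gamma> \<rho> P \<longleftrightarrow>
     P \<in> collision_measure L \<rightarrow>\<^sub>M prob_algebra (collision_measure L) \<and>
     (AE x in collision_measure L. \<forall>B\<in>sets (collision_measure L).
        emeasure (P x) B = perturbed L \<rho> (billiard_map D L \<gamma> x) B)"


section \<open>Markov processes, ergodicity, Lyapunov exponents\<close>

text \<open>The Ionescu-Tulcea construction of the law of the process with initial distribution \<open>m\<close>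
  and transition function \<open>P\<close>: coordinate \<open>0\<close> has law \<open>m\<close>, and the conditional law of
  coordinate \<open>Suc n\<close> given the earlier ones is \<open>P\<close> at coordinate \<open>n\<close>.\<close>

definition markov_step ::
    "'a measure \<Rightarrow> ('a \<Rightarrow> 'a measure) \<Rightarrow> nat \<Rightarrow> (nat \<Rightarrow> 'a) \<Rightarrow> 'a measure" where
  "markov_step m P i \<omega> = (case i of 0 \<Rightarrow> m | Suc n \<Rightarrow> P (\<omega> n))"

definition markov_law :: "'a measure \<Rightarrow> ('a \<Rightarrow> 'a measure) \<Rightarrow> (nat \<Rightarrow> 'a) measure" where
  "markov_law m P =
     projective_family.lim UNIV (Ionescu_Tulcea.CI (markov_step m P) (\<lambda>_. m)) (\<lambda>_. m)"

definition markov_ergodic :: "'a measure \<Rightarrow> ('a \<Rightarrow> 'a measure) \<Rightarrow> bool" where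
  "markov_ergodic m P \<longleftrightarrow>
     (\<forall>A\<in>sets (PiM UNIV (\<lambda>_::nat. m)).
        (\<lambda>\<omega> n. \<omega> (Suc n)) -` A \<inter> space (PiM UNIV (\<lambda>_::nat. m)) = A \<longrightarrow>
        measure (markov_law m P) A \<in> {0, 1})"

primrec cocycle :: "('a \<Rightarrow> real^2^2) \<Rightarrow> nat \<Rightarrow> (nat \<Rightarrow> 'a) \<Rightarrow> real^2^2" where
  "cocycle A 0 \<omega> = mat 1"
| "cocycle A (Suc n) \<omega> = A (\<omega> n) ** cocycle A n \<omega>"

text \<open>The completion makes the integrals insensitive to the values of the integrands on
  null sets, where the derivative is undefined. The integral of a non-integrable function is \<open>0\<close>
  by convention, so integrability is required explicitly.\<close>

definition lyapunov_exponents ::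
    "'a measure \<Rightarrow> ('a \<Rightarrow> 'a measure) \<Rightarrow> ('a \<Rightarrow> real^2^2) \<Rightarrow> real \<Rightarrow> real \<Rightarrow> bool" where
  "lyapunov_exponents m P A l1 l2 \<longleftrightarrow>
     (\<forall>n\<ge>1. integrable (completion (markov_law m P)) (\<lambda>\<omega>. ln (onorm ((*v) (cocycle A n \<omega>)))) \<and>
            integrable (completion (markov_law m P)) (\<lambda>\<omega>. ln \<bar>det (cocycle A n \<omega>)\<bar>)) \<and>
     (\<lambda>n. (\<integral>\<omega>. ln (onorm ((*v) (cocycle A n \<omega>))) \<partial>completion (markov_law m P)) / real n)
        \<longlonglongrightarrow> l1 \<and>
     (\<lambda>n. (\<integral>\<omega>. ln \<bar>det (cocycle A n \<omega>)\<bar> \<partial>completion (markov_law m P)) / real n)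
        \<longlonglongrightarrow> l1 + l2 \<and>
     l2 \<le> l1"

definition markov_hyperbolic ::
    "'a measure \<Rightarrow> ('a \<Rightarrow> 'a measure) \<Rightarrow> ('a \<Rightarrow> real^2^2) \<Rightarrow> bool" where
  "markov_hyperbolic m P A \<longleftrightarrow> (\<exists>l1 l2. lyapunov_exponents m P A l1 l2 \<and> 0 < l1)"

end

theory Submission
  imports Defs
begin

text \<open>Noise with a density that is positive near the origin gives the transition operator a spectral
  gap: the loss of \<open>L\<^sup>2\<close> norm under averaging over the noise bounds the oscillation of a function
  between points at small distance, hence, by doubling, over the whole torus. Here it is used that
  the billiard map preserves the measure, being given piecewise by compositions of shears. The gap
  yields ergodicity.

  For the exponent, consider the operator \<open>f \<mapsto> \<integral> f (y, A x v) P(x, dy)\<close> on \<open>L\<^sup>2(M \<times> \<real>\<^sup>2)\<close>, where \<open>A\<close> is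
  the derivative of the billiard map. If its square does not contract, the gap provides a function of
  \<open>v\<close> that is almost invariant under all matrices \<open>A x\<inverse> A y\<close>. This is impossible: nearly tangential
  collisions that stay on one arc give arbitrarily strong shears in a common direction, collisions
  that change the arc do not preserve that direction, and together they play ping-pong on the plane.
  The contraction makes the expected area of the vectors of the unit disc that remain in it decay
  exponentially, and this area is at least \<open>\<pi> / \<parallel>A\<^bsup>(n)\<^esup>\<parallel>\<^sup>2\<close>. Jensen's inequality gives linear growth
  of the expected logarithm of the norm.\<close>

section \<open>The law of a Markov process\<close>

text \<open>The square of the operator is needed because the gap sees only the oscillation in the
  first variable. One application contracts unless \<open>f\<close> hardly depends on the collision.
  In that case \<open>T_op f\<close> is close to \<open>mean f (A x *v v)\<close>, and the second
  application fails to contract only if this, too, hardly depends on \<open>x\<close>. Functions on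
  the plane can be treated in \<open>L^2\<close> because matrices of determinant \<plusminus>1
  preserve area. Three obstacles shape the development. The derivative is unbounded near tangential
  collisions, so integrability of the logarithm of its norm has to be established. The map, its
  derivative and the kernel are specified only up to null sets, hence everywhere defined measurable
  versions are used and exchanged at the end. The exponents are limits of expectations, so Fekete's
  lemma on subadditive sequences takes the place of a pathwise limit theorem.\<close>

locale markov_process =
  fixes m :: "'a measure" and P :: "'a \<Rightarrow> 'a measure"
  assumes prob_m: "prob_space m"
    and kernel[measurable]: "P \<in> m \<rightarrow>\<^sub>M prob_algebra m"
begin

abbreviation "paths \<equiv> PiM UNIV (\<lambda>_::nat. m)"
abbreviation "law \<equiv> markov_law m P"

sublocale m: prob_space m by (rule prob_m)

lemma kernel_sub[measurable]: "P \<in> m \<rightarrow>\<^sub>M subprob_algebra m"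
  by (rule measurable_prob_algebraD[OF kernel])

lemma kernel_prob: "x \<in> space m \<Longrightarrow> prob_space (P x)"
  and sets_kernel: "x \<in> space m \<Longrightarrow> sets (P x) = sets m"
  using measurable_space[OF kernel, of x] by (auto simp: space_prob_algebra dest: sets_eq_imp_space_eq)

sublocale IT: Ionescu_Tulcea "markov_step m P" "\<lambda>_. m"
proof (rule Ionescu_Tulcea.intro)
  show "markov_step m P i \<in> Pi\<^sub>M {0..<i} (\<lambda>_. m) \<rightarrow>\<^sub>M subprob_algebra m" for i
  proof (cases i)
    case 0
    then show ?thesis by (simp add: markov_step_def[abs_def])
  next
    case (Suc n)
    then have [measurable]: "(\<lambda>\<omega>. \<omega> n) \<in> Pi\<^sub>M {0..<i} (\<lambda>_. m) \<rightarrow>\<^sub>M m"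
      by (intro measurable_component_singleton) auto
    from Suc show ?thesis by (simp add: markov_step_def[abs_def])
  qed
  show "prob_space (markov_step m P i x)" if "x \<in> space (Pi\<^sub>M {0..<i} (\<lambda>_. m))" for i x
    using that by (cases i) (auto simp: markov_step_def prob_m space_PiM PiE_iff intro!: kernel_prob)
qed

lemma law_eq: "law = IT.PF.lim"
  by (simp add: markov_law_def)

lemma sets_law[measurable_cong]: "sets law = sets paths"
  by (simp add: law_eq)

lemma space_law: "space law = space paths"
  by (rule sets_eq_imp_space_eq[OF sets_law])

lemma up_to_ivl: "IT.up_to {0..<n} = n"
  unfolding IT.up_to_def by (rule Least_equality) (auto simp: not_le[symmetric])

text \<open>Identities for \<open>law\<close> are first proved for finite-dimensional marginals,
  where the law is the explicit iterated kernel \<open>IT.C\<close>.\<close>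

lemma distr_law: "distr law (PiM {0..<n} (\<lambda>_. m)) (\<lambda>x. restrict x {0..<n}) = IT.C 0 n (\<lambda>_. undefined)"
proof -
  have "IT.C 0 n (\<lambda>_. undefined) = distr (IT.C 0 n (\<lambda>_. undefined)) (PiM {0..<n} (\<lambda>_. m)) (\<lambda>f. restrict f {0..<n})"
    using IT.distr_C[of n n "\<lambda>_. undefined" 0] by simp
  then show ?thesis
    by (simp add: law_eq IT.distr_lim IT.CI_def up_to_ivl)
qed

lemma nn_integral_law_restrict:
  assumes [measurable]: "g \<in> borel_measurable (PiM {0..<n} (\<lambda>_. m))"
  shows "(\<integral>\<^sup>+\<omega>. g (restrict \<omega> {0..<n}) \<partial>law) = (\<integral>\<^sup>+x. g x \<partial>IT.C 0 n (\<lambda>_. undefined))"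
  by (subst distr_law[symmetric], subst nn_integral_distr)
     (auto intro!: measurable_restrict measurable_component_singleton simp: measurable_cong_sets[OF sets_law refl])

sublocale law: prob_space law
proof
  have "emeasure law (space law) = (\<integral>\<^sup>+\<omega>. 1 \<partial>law)" by simp
  also have "\<dots> = (\<integral>\<^sup>+x. 1 \<partial>IT.C 0 0 (\<lambda>_. undefined))"
    by (rule nn_integral_law_restrict) simp
  also have "\<dots> = 1"
    using prob_space.emeasure_space_1[OF IT.prob_space_C[of "\<lambda>_. undefined" 0 0]] by (simp add: space_PiM)
  finally show "emeasure law (space law) = 1" .
qed

lemma nn_integral_law_0:
  assumes [measurable]: "f \<in> borel_measurable m"
  shows "(\<integral>\<^sup>+\<omega>. f (\<omega> 0) \<partial>law) = (\<integral>\<^sup>+x. f x \<partial>m)"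
proof -
  have "(\<integral>\<^sup>+\<omega>. f (\<omega> 0) \<partial>law) = (\<integral>\<^sup>+\<omega>. f (restrict \<omega> {0..<1} 0) \<partial>law)"
    by simp
  also have "\<dots> = (\<integral>\<^sup>+\<omega>. f (\<omega> 0) \<partial>IT.C 0 1 (\<lambda>_. undefined))"
    by (rule nn_integral_law_restrict[where g = "\<lambda>\<omega>. f (\<omega> 0)"]) simp
  also have "\<dots> = (\<integral>\<^sup>+\<omega>. f (\<omega> 0) \<partial>IT.eP 0 (\<lambda>_. undefined))"
    by (simp add: space_PiM bind_return[OF IT.measurable_eP[of 0, simplified]])
  also have "\<dots> = (\<integral>\<^sup>+x. f x \<partial>m)"
    by (subst IT.nn_integral_eP) (auto simp: markov_step_def space_PiM)
  finally show ?thesis .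
qed

text \<open>Markov property for histories of finite length: unfolding the last stage of the
  Ionescu-Tulcea construction as a bind leaves a single integral against
  \<open>P (\<omega> n)\<close>.\<close>

lemma nn_integral_step_restrict:
  assumes G[measurable]: "case_prod G \<in> borel_measurable (PiM {0..<Suc n} (\<lambda>_. m) \<Otimes>\<^sub>M m)"
  shows "(\<integral>\<^sup>+\<omega>. G (restrict \<omega> {0..<Suc n}) (\<omega> (Suc n)) \<partial>law) =
         (\<integral>\<^sup>+\<omega>. (\<integral>\<^sup>+y. G (restrict \<omega> {0..<Suc n}) y \<partial>P (\<omega> n)) \<partial>law)"
proof -
  let ?M = "\<lambda>k. PiM {0..<k} (\<lambda>_. m)"
  have 1[measurable]: "(\<lambda>\<omega>. G (restrict \<omega> {0..<Suc n}) (\<omega> (Suc n))) \<in> borel_measurable (?M (Suc (Suc n)))"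
  proof -
    have "(\<lambda>\<omega>. (restrict \<omega> {0..<Suc n}, \<omega> (Suc n))) \<in> ?M (Suc (Suc n)) \<rightarrow>\<^sub>M ?M (Suc n) \<Otimes>\<^sub>M m"
      by (intro measurable_Pair measurable_restrict_subset measurable_component_singleton) auto
    from measurable_compose[OF this G] show ?thesis by simp
  qed
  have [measurable]: "(\<lambda>\<omega>. \<omega> n) \<in> ?M (Suc n) \<rightarrow>\<^sub>M m"
    by (intro measurable_component_singleton) auto
  have 2[measurable]: "(\<lambda>\<omega>. \<integral>\<^sup>+y. G \<omega> y \<partial>P (\<omega> n)) \<in> borel_measurable (?M (Suc n))"
    by (rule nn_integral_measurable_subprob_algebra2[where N = m]) auto
  have "(\<integral>\<^sup>+\<omega>. G (restrict \<omega> {0..<Suc n}) (\<omega> (Suc n)) \<partial>law)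
      = (\<integral>\<^sup>+\<omega>. G (restrict (restrict \<omega> {0..<Suc (Suc n)}) {0..<Suc n}) (restrict \<omega> {0..<Suc (Suc n)} (Suc n)) \<partial>law)"
    by (simp add: Int_absorb1)
  also have "\<dots> = (\<integral>\<^sup>+\<omega>. G (restrict \<omega> {0..<Suc n}) (\<omega> (Suc n)) \<partial>IT.C 0 (Suc (Suc n)) (\<lambda>_. undefined))"
    by (rule nn_integral_law_restrict[OF 1])
  also have "\<dots> = (\<integral>\<^sup>+\<omega>. \<integral>\<^sup>+\<omega>'. G (restrict \<omega>' {0..<Suc n}) (\<omega>' (Suc n)) \<partial>IT.eP (Suc n) \<omega> \<partial>IT.C 0 (Suc n) (\<lambda>_. undefined))"
    unfolding IT.C.simps(2)[of 0 "Suc n"] add_0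
  proof (rule nn_integral_bind[OF 1])
    show "IT.eP (Suc n) \<in> IT.C 0 (Suc n) (\<lambda>_. undefined) \<rightarrow>\<^sub>M subprob_algebra (?M (Suc (Suc n)))"
      by (subst measurable_cong_sets[OF IT.sets_C refl])
         (simp_all only: add_0 IT.measurable_eP, simp add: space_PiM)
  qed
  also have "\<dots> = (\<integral>\<^sup>+\<omega>. \<integral>\<^sup>+y. G \<omega> y \<partial>P (\<omega> n) \<partial>IT.C 0 (Suc n) (\<lambda>_. undefined))"
  proof (rule nn_integral_cong)
    fix \<omega> assume "\<omega> \<in> space (IT.C 0 (Suc n) (\<lambda>_. undefined))"
    then have \<omega>: "\<omega> \<in> space (?M (Suc n))" by (simp add: IT.space_C space_PiM del: IT.C.simps)
    then have r: "restrict (fun_upd \<omega> (Suc n) y) {0..<Suc n} = \<omega>" for y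
      by (auto simp: space_PiM PiE_iff extensional_def restrict_def fun_eq_iff)
    show "(\<integral>\<^sup>+\<omega>'. G (restrict \<omega>' {0..<Suc n}) (\<omega>' (Suc n)) \<partial>IT.eP (Suc n) \<omega>) = (\<integral>\<^sup>+y. G \<omega> y \<partial>P (\<omega> n))"
      by (subst IT.nn_integral_eP[OF \<omega> 1]) (simp only: r fun_upd_same, simp add: markov_step_def)
  qed
  also have "\<dots> = (\<integral>\<^sup>+\<omega>. (\<integral>\<^sup>+y. G (restrict \<omega> {0..<Suc n}) y \<partial>P (restrict \<omega> {0..<Suc n} n)) \<partial>law)"
    by (rule nn_integral_law_restrict[OF 2, symmetric])
  finally show ?thesis by simp
qed

text \<open>The Markov property in the form used later: \<open>F\<close> takes the whole path as
  argument while only the coordinates up to \<open>n\<close> matter, which spares restrictions to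
  finite index sets.\<close>

lemma nn_integral_step:
  fixes F :: "(nat \<Rightarrow> 'a) \<Rightarrow> 'a \<Rightarrow> ennreal"
  assumes F[measurable]: "case_prod F \<in> borel_measurable (paths \<Otimes>\<^sub>M m)"
    and adapted: "\<And>\<omega> \<omega>' y. \<omega> \<in> space paths \<Longrightarrow> \<omega>' \<in> space paths \<Longrightarrow>
      (\<And>i. i \<le> n \<Longrightarrow> \<omega> i = \<omega>' i) \<Longrightarrow> F \<omega> y = F \<omega>' y"
  shows "(\<integral>\<^sup>+\<omega>. F \<omega> (\<omega> (Suc n)) \<partial>law) = (\<integral>\<^sup>+\<omega>. (\<integral>\<^sup>+y. F \<omega> y \<partial>P (\<omega> n)) \<partial>law)"
proof -
  obtain x0 where x0: "x0 \<in> space m" using m.not_empty by blast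
  \<comment> \<open>A finite history is padded to a full path with a fixed point; by
    \<open>adapted\<close> the padding does not influence \<open>F\<close>.\<close>
  define ext where "ext \<omega> i = (if i \<le> n then \<omega> i else x0)" for \<omega> i
  have "(\<lambda>\<omega>. ext \<omega>) \<in> PiM {0..<Suc n} (\<lambda>_. m) \<rightarrow>\<^sub>M paths"
  proof (rule measurable_PiM_single')
    show "(\<lambda>\<omega>. ext \<omega> i) \<in> PiM {0..<Suc n} (\<lambda>_. m) \<rightarrow>\<^sub>M m" for i
      using x0 unfolding ext_def
      by (cases "i \<le> n") (auto intro!: measurable_component_singleton)
  qed (auto simp: ext_def x0 space_PiM PiE_iff)
  then have [measurable]: "(\<lambda>(\<omega>, y). F (ext \<omega>) y) \<in> borel_measurable (PiM {0..<Suc n} (\<lambda>_. m) \<Otimes>\<^sub>M m)"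
    by measurable
  have *: "F (ext (restrict \<omega> {0..<Suc n})) y = F \<omega> y" if "\<omega> \<in> space law" for \<omega> y
    using that x0 by (intro adapted) (auto simp: ext_def space_law space_PiM PiE_iff)
  have "(\<integral>\<^sup>+\<omega>. F \<omega> (\<omega> (Suc n)) \<partial>law) = (\<integral>\<^sup>+\<omega>. F (ext (restrict \<omega> {0..<Suc n})) (\<omega> (Suc n)) \<partial>law)"
    by (simp add: * cong: nn_integral_cong_simp)
  also have "\<dots> = (\<integral>\<^sup>+\<omega>. (\<integral>\<^sup>+y. F (ext (restrict \<omega> {0..<Suc n})) y \<partial>P (\<omega> n)) \<partial>law)"
    by (rule nn_integral_step_restrict) simp
  also have "\<dots> = (\<integral>\<^sup>+\<omega>. (\<integral>\<^sup>+y. F \<omega> y \<partial>P (\<omega> n)) \<partial>law)"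
    by (simp add: * cong: nn_integral_cong_simp)
  finally show ?thesis .
qed

end

section \<open>Ergodicity from a spectral gap\<close>

text \<open>Invariance of \<open>m\<close> is assumed for non-negative functions instead of sets,
  the form in which it is applied under integrals.\<close>

locale stationary_markov_process = markov_process +
  assumes nn_integral_kernel:
    "f \<in> borel_measurable m \<Longrightarrow> (\<integral>\<^sup>+x. (\<integral>\<^sup>+y. f y \<partial>P x) \<partial>m) = (\<integral>\<^sup>+x. f x \<partial>m)"
begin

lemma nn_integral_law_component:
  assumes [measurable]: "f \<in> borel_measurable m"
  shows "(\<integral>\<^sup>+\<omega>. f (\<omega> n) \<partial>law) = (\<integral>\<^sup>+x. f x \<partial>m)"
  using assms
proof (induction n arbitrary: f)
  case 0
  then show ?case by (rule nn_integral_law_0)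
next
  case (Suc n)
  note [measurable] = Suc.prems
  have [measurable]: "(\<lambda>x. \<integral>\<^sup>+y. f y \<partial>P x) \<in> borel_measurable m"
    by (rule nn_integral_measurable_subprob_algebra2[where N = m]) auto
  have "(\<integral>\<^sup>+\<omega>. f (\<omega> (Suc n)) \<partial>law) = (\<integral>\<^sup>+\<omega>. (\<integral>\<^sup>+y. f y \<partial>P (\<omega> n)) \<partial>law)"
    by (rule nn_integral_step[where F = "\<lambda>_ y. f y"]) auto
  also have "\<dots> = (\<integral>\<^sup>+x. f x \<partial>m)"
    by (subst Suc.IH) (auto simp: nn_integral_kernel)
  finally show ?case .
qed

lemma measurable_law_component[measurable]: "(\<lambda>\<omega>. \<omega> n) \<in> law \<rightarrow>\<^sub>M m"
  by (subst measurable_cong_sets[OF sets_law refl]) (rule measurable_component_singleton, simp)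

lemma distr_law_component: "distr law m (\<lambda>\<omega>. \<omega> n) = m"
proof (rule measure_eqI)
  fix A assume "A \<in> sets (distr law m (\<lambda>\<omega>. \<omega> n))"
  then have A[measurable]: "A \<in> sets m" by simp
  have "emeasure (distr law m (\<lambda>\<omega>. \<omega> n)) A = (\<integral>\<^sup>+x. indicator A x \<partial>distr law m (\<lambda>\<omega>. \<omega> n))"
    by simp
  also have "\<dots> = (\<integral>\<^sup>+\<omega>. indicator A (\<omega> n) \<partial>law)"
    by (subst nn_integral_distr) auto
  also have "\<dots> = emeasure m A"
    by (subst nn_integral_law_component) auto
  finally show "emeasure (distr law m (\<lambda>\<omega>. \<omega> n)) A = emeasure m A" .
qed simp

text \<open>Every coordinate has law \<open>m\<close>, so null sets of \<open>m\<close> may be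
  discarded at any time.\<close>

lemma AE_law_component:
  assumes "AE x in m. Q x"
  shows "AE \<omega> in law. Q (\<omega> n)"
  by (rule AE_distrD[OF measurable_law_component], subst distr_law_component, rule assms)

lemma sets_lawI: "A \<in> sets paths \<Longrightarrow> A \<in> sets law"
  by (simp add: sets_law)

lemma sets_component: "B \<in> sets m \<Longrightarrow> {\<omega> \<in> space paths. \<omega> n \<in> B} \<in> sets paths"
  using measurable_sets[OF measurable_component_singleton[of n UNIV "\<lambda>_. m"], of B]
  by (simp add: vimage_def Int_def conj_commute)

lemma emeasure_law: "A \<in> sets paths \<Longrightarrow> emeasure law A = (\<integral>\<^sup>+\<omega>. indicator A \<omega> \<partial>law)"
  by (simp add: sets_law)

section \<open>Shifts, adapted events and conditional probabilities\<close>

definition shift :: "nat \<Rightarrow> (nat \<Rightarrow> 'a) \<Rightarrow> nat \<Rightarrow> 'a" where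
  "shift n \<omega> i = \<omega> (n + i)"

lemma shift_measurable[measurable]: "shift n \<in> paths \<rightarrow>\<^sub>M paths"
  by (rule measurable_PiM_single')
     (auto simp: shift_def[abs_def] space_PiM PiE_iff)

lemma shift_Suc: "shift n (\<lambda>i. \<omega> (Suc i)) = shift (Suc n) \<omega>" "shift (Suc n) \<omega> = (\<lambda>i. shift n \<omega> (Suc i))"
  by (auto simp: shift_def fun_eq_iff)

text \<open>A concrete substitute for membership in the sigma-algebra generated by the coordinates
  up to \<open>n\<close>.\<close>

definition adapted :: "nat \<Rightarrow> (nat \<Rightarrow> 'a) set \<Rightarrow> bool" where
  "adapted n C \<longleftrightarrow> C \<in> sets paths \<and>
     (\<forall>\<omega>\<in>space paths. \<forall>\<omega>'\<in>space paths. (\<forall>i\<le>n. \<omega> i = \<omega>' i) \<longrightarrow> (\<omega> \<in> C \<longleftrightarrow> \<omega>' \<in> C))"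

lemma adapted_sets: "adapted n C \<Longrightarrow> C \<in> sets paths"
  by (simp add: adapted_def)

text \<open>\<open>h x\<close> plays the role of the probability of \<open>A\<close> for the process
  started at \<open>x\<close>. Characterising it by integrals avoids constructing a law for each
  starting point. One \<open>h\<close> has to serve all times \<open>n\<close>; this encodes the
  Markov property.\<close>

definition conditional :: "(nat \<Rightarrow> 'a) set \<Rightarrow> ('a \<Rightarrow> ennreal) \<Rightarrow> bool" where
  "conditional A h \<longleftrightarrow> h \<in> borel_measurable m \<and> (\<forall>x. h x \<le> 1) \<and>
     (\<forall>n C. adapted n C \<longrightarrow>
        emeasure law (C \<inter> (shift n -` A \<inter> space paths)) = (\<integral>\<^sup>+\<omega>. indicator C \<omega> * h (\<omega> n) \<partial>law))"

definition path_box :: "nat \<Rightarrow> (nat \<Rightarrow> 'a set) \<Rightarrow> (nat \<Rightarrow> 'a) set" where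
  "path_box k X = {\<omega> \<in> space paths. \<forall>i\<le>k. \<omega> i \<in> X i}"

lemma path_box_sets[measurable]:
  assumes [measurable]: "\<And>i. X i \<in> sets m"
  shows "path_box k X \<in> sets paths"
  unfolding path_box_def by measurable

lemma adapted_path_box: "(\<And>i. X i \<in> sets m) \<Longrightarrow> adapted k (path_box k X)"
  by (auto simp: adapted_def path_box_def)

lemma prod_algebra_path_box:
  assumes "A \<in> prod_algebra UNIV (\<lambda>_::nat. m)"
  obtains k X where "A = path_box k X" "\<And>i. X i \<in> sets m"
proof -
  from assms obtain J E where A: "A = prod_emb UNIV (\<lambda>_. m) J (Pi\<^sub>E J E)" and J: "finite J"
    and E: "\<And>i. i \<in> J \<Longrightarrow> E i \<in> sets m"
    by (elim prod_algebraE) auto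
  obtain k where k: "\<And>i. i \<in> J \<Longrightarrow> i \<le> k"
    using J by (meson finite_nat_set_iff_bounded_le)
  define X where "X i = (if i \<in> J then E i else space m)" for i
  have "A = path_box k X"
    using k by (auto simp: A prod_emb_def path_box_def X_def space_PiM PiE_iff)
  moreover have "X i \<in> sets m" for i using E by (simp add: X_def)
  ultimately show thesis by (rule that)
qed

text \<open>The conditional probability of a box is \<open>indicator (X 0) x\<close> times the
  average under \<open>P x\<close> of that of the shifted box. Restricting \<open>C\<close> by the
  first factor gives an event adapted at time \<open>Suc n\<close>, to which the induction
  hypothesis applies.\<close>

lemma conditional_path_box:
  assumes "\<And>i. X i \<in> sets m"
  shows "\<exists>h. conditional (path_box k X) h"
  using assms
proof (induction k arbitrary: X)
  case (0 X)
  note [measurable] = 0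
  show ?case
  proof (intro exI[of _ "indicator (X 0)"], unfold conditional_def, intro conjI allI impI)
    fix n C assume "adapted n C"
    then have [measurable]: "C \<in> sets paths" by (rule adapted_sets)
    have "emeasure law (C \<inter> (shift n -` path_box 0 X \<inter> space paths)) =
        (\<integral>\<^sup>+\<omega>. indicator (C \<inter> (shift n -` path_box 0 X \<inter> space paths)) \<omega> \<partial>law)"
      by (rule emeasure_law) simp
    also have "\<dots> = (\<integral>\<^sup>+\<omega>. indicator C \<omega> * indicator (X 0) (\<omega> n) \<partial>law)"
      by (rule nn_integral_cong)
         (use measurable_space[OF shift_measurable[of n]] in \<open>auto simp: path_box_def space_law shift_def split: split_indicator\<close>)
    finally show "emeasure law (C \<inter> (shift n -` path_box 0 X \<inter> space paths)) =
        (\<integral>\<^sup>+\<omega>. indicator C \<omega> * indicator (X 0) (\<omega> n) \<partial>law)" .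
  qed (auto simp: indicator_def)
next
  case (Suc k X)
  note [measurable] = Suc.prems
  obtain h where h: "conditional (path_box k (\<lambda>i. X (Suc i))) h"
    using Suc.IH[of "\<lambda>i. X (Suc i)"] Suc.prems by auto
  then have [measurable]: "h \<in> borel_measurable m" and h1: "\<And>x. h x \<le> 1"
    and h2: "\<And>n C. adapted n C \<Longrightarrow>
        emeasure law (C \<inter> (shift n -` path_box k (\<lambda>i. X (Suc i)) \<inter> space paths)) = (\<integral>\<^sup>+\<omega>. indicator C \<omega> * h (\<omega> n) \<partial>law)"
    by (auto simp: conditional_def)
  \<comment> \<open>Outside the space \<open>P x\<close> is arbitrary; the value 0 keeps
    \<open>g\<close> below 1 everywhere.\<close>
  define g where "g x = (if x \<in> space m then indicator (X 0) x * (\<integral>\<^sup>+y. h y \<partial>P x) else 0)" for x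
  have [measurable]: "(\<lambda>x. \<integral>\<^sup>+y. h y \<partial>P x) \<in> borel_measurable m"
    by (rule nn_integral_measurable_subprob_algebra2[where N = m]) auto
  have gm[measurable]: "g \<in> borel_measurable m"
    by (subst measurable_cong[of _ _ "\<lambda>x. indicator (X 0) x * (\<integral>\<^sup>+y. h y \<partial>P x)"]) (auto simp: g_def)
  have "g x \<le> 1" for x
  proof (cases "x \<in> space m")
    case True
    interpret Px: prob_space "P x" by (rule kernel_prob) fact
    have "(\<integral>\<^sup>+y. h y \<partial>P x) \<le> (\<integral>\<^sup>+y. 1 \<partial>P x)" by (intro nn_integral_mono h1)
    then show ?thesis by (auto simp: g_def Px.emeasure_space_1 split: split_indicator)
  qed (simp add: g_def)
  moreover
  have "emeasure law (C \<inter> (shift n -` path_box (Suc k) X \<inter> space paths)) = (\<integral>\<^sup>+\<omega>. indicator C \<omega> * g (\<omega> n) \<partial>law)"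
    if C: "adapted n C" for n C
  proof -
    have [measurable]: "C \<in> sets paths" using C by (rule adapted_sets)
    define C' where "C' = C \<inter> {\<omega> \<in> space paths. \<omega> n \<in> X 0}"
    have [measurable]: "C' \<in> sets paths" unfolding C'_def by (intro sets.Int sets_component Suc.prems) fact
    have Cn: "\<omega> \<in> C \<longleftrightarrow> \<omega>' \<in> C"
      if "\<omega> \<in> space paths" "\<omega>' \<in> space paths" "\<forall>i\<le>n. \<omega> i = \<omega>' i" for \<omega> \<omega>'
      using C that unfolding adapted_def by blast
    have C'': "\<omega> \<in> C' \<longleftrightarrow> \<omega>' \<in> C'"
      if "\<omega> \<in> space paths" "\<omega>' \<in> space paths" "\<And>i. i \<le> n \<Longrightarrow> \<omega> i = \<omega>' i" for \<omega> \<omega>'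
    proof -
      have "\<omega> \<in> C \<longleftrightarrow> \<omega>' \<in> C" using that by (intro Cn) auto
      moreover have "\<omega> n = \<omega>' n" using that(3)[of n] by simp
      ultimately show ?thesis unfolding C'_def using that(1,2) by (simp only: Int_iff mem_Collect_eq)
    qed
    have C': "adapted (Suc n) C'"
      unfolding adapted_def using \<open>C' \<in> sets paths\<close> C'' le_SucI by blast
    have "C \<inter> (shift n -` path_box (Suc k) X \<inter> space paths) =
      C' \<inter> (shift (Suc n) -` path_box k (\<lambda>i. X (Suc i)) \<inter> space paths)"
    proof -
      have "(\<forall>i\<le>Suc k. Q i) \<longleftrightarrow> Q 0 \<and> (\<forall>i\<le>k. Q (Suc i))" for Q :: "nat \<Rightarrow> bool"
        using All_less_Suc2[of "Suc k" Q] by (simp add: less_Suc_eq_le)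
      then show ?thesis
        using measurable_space[OF shift_measurable[of n]] measurable_space[OF shift_measurable[of "Suc n"]]
        unfolding C'_def path_box_def by (auto simp: shift_def)
    qed
    then have "emeasure law (C \<inter> (shift n -` path_box (Suc k) X \<inter> space paths)) = (\<integral>\<^sup>+\<omega>. indicator C' \<omega> * h (\<omega> (Suc n)) \<partial>law)"
      using h2[OF C'] by simp
    also have "\<dots> = (\<integral>\<^sup>+\<omega>. (\<integral>\<^sup>+y. indicator C' \<omega> * h y \<partial>P (\<omega> n)) \<partial>law)"
    proof (rule nn_integral_step[where F = "\<lambda>\<omega> y. indicator C' \<omega> * h y"])
      fix \<omega> \<omega>' and y :: 'a
      assume "\<omega> \<in> space paths" "\<omega>' \<in> space paths" "\<And>i. i \<le> n \<Longrightarrow> \<omega> i = \<omega>' i"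
      then have "\<omega> \<in> C' \<longleftrightarrow> \<omega>' \<in> C'" by (rule C'')
      then show "indicator C' \<omega> * h y = indicator C' \<omega>' * h y" by (simp only: indicator_def)
    qed simp
    also have "\<dots> = (\<integral>\<^sup>+\<omega>. indicator C \<omega> * g (\<omega> n) \<partial>law)"
    proof (rule nn_integral_cong)
      fix \<omega> assume "\<omega> \<in> space law"
      then have \<omega>: "\<omega> \<in> space paths" "\<omega> n \<in> space m" by (auto simp: space_law space_PiM)
      have "h \<in> borel_measurable (P (\<omega> n))"
        by (subst measurable_cong_sets[OF sets_kernel[OF \<omega>(2)] refl]) simp
      then show "(\<integral>\<^sup>+y. indicator C' \<omega> * h y \<partial>P (\<omega> n)) = indicator C \<omega> * g (\<omega> n)"
        using \<omega> by (subst nn_integral_cmult) (auto simp: C'_def g_def split: split_indicator)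
    qed
    finally show ?thesis .
  qed
  ultimately show ?case using gm by (intro exI[of _ g]) (simp add: conditional_def)
qed

text \<open>Boxes form an intersection-stable generator, so complements and disjoint unions remain;
  they turn \<open>h\<close> into \<open>1 - h\<close> and into a sum.\<close>

lemma conditional_exists:
  assumes A: "A \<in> sets paths"
  shows "\<exists>h. conditional A h"
proof -
  have "A \<in> sigma_sets (\<Pi>\<^sub>E i\<in>UNIV. space m) (prod_algebra UNIV (\<lambda>_::nat. m))"
    using A by (simp add: sets_PiM)
  with Int_stable_prod_algebra prod_algebra_sets_into_space show ?thesis
  proof (induction rule: sigma_sets_induct_disjoint)
    case (basic A)
    then show ?case by (elim prod_algebra_path_box) (auto intro: conditional_path_box)
  next
    case empty
    show ?case by (intro exI[of _ "\<lambda>_. 0"]) (simp add: conditional_def)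
  next
    case (compl A)
    then have [measurable]: "A \<in> sets paths" by (simp add: sets_PiM)
    from compl obtain h where h: "conditional A h" by blast
    then have [measurable]: "h \<in> borel_measurable m" and h1: "\<And>x. h x \<le> 1"
      by (auto simp: conditional_def)
    have "emeasure law (C \<inter> (shift n -` (space paths - A) \<inter> space paths)) =
        (\<integral>\<^sup>+\<omega>. indicator C \<omega> * (1 - h (\<omega> n)) \<partial>law)" if C: "adapted n C" for n C
    proof -
      have [measurable]: "C \<in> sets paths" using C by (rule adapted_sets)
      have "C \<inter> (shift n -` (space paths - A) \<inter> space paths) = C - C \<inter> (shift n -` A \<inter> space paths)"
        using sets.sets_into_space[OF \<open>C \<in> sets paths\<close>] measurable_space[OF shift_measurable[of n]] by auto
      then have "emeasure law (C \<inter> (shift n -` (space paths - A) \<inter> space paths)) =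
          emeasure law C - emeasure law (C \<inter> (shift n -` A \<inter> space paths))"
        by (simp add: emeasure_Diff sets_lawI)
      also have "\<dots> = (\<integral>\<^sup>+\<omega>. indicator C \<omega> \<partial>law) - (\<integral>\<^sup>+\<omega>. indicator C \<omega> * h (\<omega> n) \<partial>law)"
        using h C by (simp add: conditional_def sets_lawI)
      also have "\<dots> = (\<integral>\<^sup>+\<omega>. indicator C \<omega> - indicator C \<omega> * h (\<omega> n) \<partial>law)"
      proof (rule nn_integral_diff[symmetric])
        have "(\<integral>\<^sup>+\<omega>. indicator C \<omega> * h (\<omega> n) \<partial>law) \<le> (\<integral>\<^sup>+\<omega>. 1 \<partial>law)"
          by (rule nn_integral_mono) (auto simp: h1 split: split_indicator)
        then show "(\<integral>\<^sup>+\<omega>. indicator C \<omega> * h (\<omega> n) \<partial>law) \<noteq> \<infinity>"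
          by (auto simp: law.emeasure_space_1 top_unique)
      qed (auto simp: h1 split: split_indicator)
      also have "\<dots> = (\<integral>\<^sup>+\<omega>. indicator C \<omega> * (1 - h (\<omega> n)) \<partial>law)"
        by (rule nn_integral_cong) (auto split: split_indicator)
      finally show ?thesis .
    qed
    then show ?case
      by (intro exI[of _ "\<lambda>x. 1 - h x"]) (auto simp: conditional_def space_PiM diff_le_self_ennreal)
  next
    case (union A)
    then have [measurable]: "\<And>i. A i \<in> sets paths" by (auto simp: sets_PiM)
    from union(3) obtain h where h: "\<And>i. conditional (A i) (h i)" by metis
    then have [measurable]: "\<And>i. h i \<in> borel_measurable m" by (auto simp: conditional_def)
    let ?h = "\<lambda>x. \<Sum>i. h i x"
    have *: "emeasure law (C \<inter> (shift n -` (\<Union>i. A i) \<inter> space paths)) =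
        (\<integral>\<^sup>+\<omega>. indicator C \<omega> * ?h (\<omega> n) \<partial>law)" if C: "adapted n C" for n C
    proof -
      have [measurable]: "C \<in> sets paths" using C by (rule adapted_sets)
      have "(\<integral>\<^sup>+\<omega>. indicator C \<omega> * ?h (\<omega> n) \<partial>law) = (\<integral>\<^sup>+\<omega>. (\<Sum>i. indicator C \<omega> * h i (\<omega> n)) \<partial>law)"
        by simp
      also have "\<dots> = (\<Sum>i. \<integral>\<^sup>+\<omega>. indicator C \<omega> * h i (\<omega> n) \<partial>law)"
        by (rule nn_integral_suminf) simp
      also have "\<dots> = (\<Sum>i. emeasure law (C \<inter> (shift n -` A i \<inter> space paths)))"
        using h C by (simp add: conditional_def)
      also have "\<dots> = emeasure law (\<Union>i. C \<inter> (shift n -` A i \<inter> space paths))"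
        using union(1) by (intro suminf_emeasure) (auto simp: disjoint_family_on_def intro!: sets_lawI)
      also have "(\<Union>i. C \<inter> (shift n -` A i \<inter> space paths)) = C \<inter> (shift n -` (\<Union>i. A i) \<inter> space paths)"
        by auto
      finally show ?thesis by simp
    qed
    \<comment> \<open>The sum is bounded by 1 only almost everywhere: on the event that it exceeds 1
      at the start, the conditional probabilities would integrate to more than the probability of
      that event. Truncation at 1 then restores the pointwise bound.\<close>
    have "AE x in m. ?h x \<le> 1"
    proof -
      let ?B = "{x \<in> space m. 1 < ?h x}"
      let ?C = "{\<omega> \<in> space paths. \<omega> 0 \<in> ?B}"
      have "adapted 0 ?C" by (auto simp: adapted_def intro!: sets_component)
      note *[OF this]
      moreover have "emeasure law (?C \<inter> (shift 0 -` (\<Union>i. A i) \<inter> space paths)) \<le> emeasure law ?C"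
        by (intro emeasure_mono) auto
      moreover have "emeasure law ?C = (\<integral>\<^sup>+\<omega>. indicator ?B (\<omega> 0) \<partial>law)"
        by (subst emeasure_law) (measurable, auto intro!: nn_integral_cong simp: space_law space_PiM split: split_indicator)
      moreover have "(\<integral>\<^sup>+\<omega>. indicator ?B (\<omega> 0) \<partial>law) = (\<integral>\<^sup>+x. indicator ?B x \<partial>m)"
        by (subst nn_integral_law_component) auto
      moreover have "(\<integral>\<^sup>+\<omega>. indicator ?C \<omega> * ?h (\<omega> 0) \<partial>law) = (\<integral>\<^sup>+\<omega>. indicator ?B (\<omega> 0) * ?h (\<omega> 0) \<partial>law)"
        by (auto intro!: nn_integral_cong simp: space_law split: split_indicator)
      moreover have "(\<integral>\<^sup>+\<omega>. indicator ?B (\<omega> 0) * ?h (\<omega> 0) \<partial>law) = (\<integral>\<^sup>+x. indicator ?B x * ?h x \<partial>m)"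
        by (subst nn_integral_law_component[where f = "\<lambda>x. indicator ?B x * ?h x"]) auto
      ultimately have le: "(\<integral>\<^sup>+x. indicator ?B x * ?h x \<partial>m) \<le> (\<integral>\<^sup>+x. indicator ?B x \<partial>m)"
        by simp
      have "AE x in m. \<not> (indicator ?B x < indicator ?B x * ?h x)"
      proof (rule ccontr)
        assume "\<not> (AE x in m. \<not> (indicator ?B x < indicator ?B x * ?h x))"
        then have "(\<integral>\<^sup>+x. indicator ?B x \<partial>m) < (\<integral>\<^sup>+x. indicator ?B x * ?h x \<partial>m)"
          by (intro nn_integral_less)
             (auto split: split_indicator simp: m.emeasure_eq_measure not_less)
        with le show False by simp
      qed
      then show ?thesis using AE_space by eventually_elim (auto split: split_indicator_asm)
    qed
    note ae = AE_law_component[OF this]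
    have "emeasure law (C \<inter> (shift n -` (\<Union>i. A i) \<inter> space paths)) =
        (\<integral>\<^sup>+\<omega>. indicator C \<omega> * min 1 (?h (\<omega> n)) \<partial>law)" if C: "adapted n C" for n C
      unfolding *[OF C] using ae[of n] by (intro nn_integral_cong_AE) (auto simp: min_absorb2)
    then show ?case
      by (intro exI[of _ "\<lambda>x. min 1 (?h x)"]) (auto simp: conditional_def)
  qed
qed

text \<open>The probability that the shifted path lies in \<open>A\<close> is the integral of
  \<open>h\<close> for every shift, hence the same as without a shift.\<close>

lemma distr_law_shift: "distr law paths (shift n) = law"
proof (rule measure_eqI)
  fix A assume "A \<in> sets (distr law paths (shift n))"
  then have [measurable]: "A \<in> sets paths" by simp
  obtain h where h: "conditional A h" using conditional_exists[OF \<open>A \<in> sets paths\<close>] by blast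
  then have [measurable]: "h \<in> borel_measurable m" by (simp add: conditional_def)
  have *: "emeasure law (shift k -` A \<inter> space paths) = (\<integral>\<^sup>+x. h x \<partial>m)" for k
  proof -
    have "adapted k (space paths)" by (auto simp: adapted_def)
    then have "emeasure law (space paths \<inter> (shift k -` A \<inter> space paths)) = (\<integral>\<^sup>+\<omega>. indicator (space paths) \<omega> * h (\<omega> k) \<partial>law)"
      using h unfolding conditional_def by blast
    also have "\<dots> = (\<integral>\<^sup>+\<omega>. h (\<omega> k) \<partial>law)"
      by (rule nn_integral_cong) (auto simp: space_law)
    finally show ?thesis by (simp add: nn_integral_law_component Int_absorb1)
  qed
  have "emeasure (distr law paths (shift n)) A = emeasure law (shift n -` A \<inter> space paths)"
    by (subst emeasure_distr) (auto simp: space_law)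
  also have "\<dots> = emeasure law (shift 0 -` A \<inter> space paths)"
    by (simp only: *)
  also have "shift 0 -` A \<inter> space paths = A"
    using sets.sets_into_space[OF \<open>A \<in> sets paths\<close>] by (auto simp: shift_def[abs_def])
  finally show "emeasure (distr law paths (shift n)) A = emeasure law A" .
qed (simp add: sets_law)

end

text \<open>The double integral is twice the variance of \<open>h\<close>, so \<open>gap\<close>
  says that the transition operator decreases the squared norm by at least a multiple of the
  variance. Functions between 0 and 1 keep all integrals finite.\<close>

locale spectral_gap = stationary_markov_process +
  fixes \<kappa> :: real
  assumes gap_pos: "0 < \<kappa>"
    and gap: "\<And>h. h \<in> borel_measurable m \<Longrightarrow> (\<And>x. 0 \<le> h x) \<Longrightarrow> (\<And>x. h x \<le> (1::real)) \<Longrightarrow>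
      (\<integral>x. (\<integral>y. h y \<partial>P x)\<^sup>2 \<partial>m) + \<kappa> * (\<integral>x. (\<integral>y. (h x - h y)\<^sup>2 \<partial>m) \<partial>m) \<le> (\<integral>x. (h x)\<^sup>2 \<partial>m)"
begin

lemma kernel_measurable:
  assumes "f \<in> m \<rightarrow>\<^sub>M N" "x \<in> space m"
  shows "f \<in> P x \<rightarrow>\<^sub>M N"
  using assms measurable_cong_sets[OF sets_kernel refl] by blast

text \<open>For a harmonic \<open>h\<close> the two squared norms in \<open>gap\<close> agree, so
  the variance term vanishes; a point \<open>x\<close> at which the inner integral is 0 supplies the
  constant.\<close>

lemma harmonic_const:
  fixes h :: "'a \<Rightarrow> real"
  assumes [measurable]: "h \<in> borel_measurable m" and h: "\<And>x. 0 \<le> h x" "\<And>x. h x \<le> 1"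
    and harm: "AE x in m. (\<integral>y. h y \<partial>P x) = h x"
  obtains c where "AE x in m. h x = c"
proof -
  have [measurable]: "(\<lambda>x. \<integral>y. h y \<partial>P x) \<in> borel_measurable m"
    by (rule measurable_compose[OF kernel_sub integral_measurable_subprob_algebra]) simp
  have bd: "(h x - h y)\<^sup>2 \<le> 1" for x y
    using h[of x] h[of y] by (intro power_le_one_iff[THEN iffD2] abs_square_le_1[THEN iffD2]) auto
  have int: "integrable m (\<lambda>y. (h x - h y)\<^sup>2)" for x
    using bd by (intro m.integrable_const_bound[where B = 1]) auto
  have "(\<integral>y. (h x - h y)\<^sup>2 \<partial>m) \<le> 1" for x
    using integral_mono[OF int[of x], of "\<lambda>_. 1"] bd by (simp add: m.prob_space)
  then have int2: "integrable m (\<lambda>x. \<integral>y. (h x - h y)\<^sup>2 \<partial>m)"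
    by (intro m.integrable_const_bound[where B = 1]) auto
  have "(\<integral>x. (\<integral>y. h y \<partial>P x)\<^sup>2 \<partial>m) = (\<integral>x. (h x)\<^sup>2 \<partial>m)"
    using harm by (intro integral_cong_AE) auto
  with gap[OF assms(1) h] have "\<kappa> * (\<integral>x. (\<integral>y. (h x - h y)\<^sup>2 \<partial>m) \<partial>m) \<le> 0" by simp
  then have "(\<integral>x. (\<integral>y. (h x - h y)\<^sup>2 \<partial>m) \<partial>m) \<le> 0"
    using gap_pos by (simp add: mult_le_0_iff)
  moreover have "0 \<le> (\<integral>x. (\<integral>y. (h x - h y)\<^sup>2 \<partial>m) \<partial>m)" by simp
  ultimately have "(\<integral>x. (\<integral>y. (h x - h y)\<^sup>2 \<partial>m) \<partial>m) = 0" by simp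
  then have "AE x in m. (\<integral>y. (h x - h y)\<^sup>2 \<partial>m) = 0"
    using integral_nonneg_eq_0_iff_AE[OF int2] by simp
  then have "\<exists>x. (\<integral>y. (h x - h y)\<^sup>2 \<partial>m) = 0"
    using m.AE_contr[of "\<lambda>x. (\<integral>y. (h x - h y)\<^sup>2 \<partial>m) = 0"] by (cases "\<exists>x. (\<integral>y. (h x - h y)\<^sup>2 \<partial>m) = 0") auto
  then obtain x where "(\<integral>y. (h x - h y)\<^sup>2 \<partial>m) = 0" ..
  then have "AE y in m. (h x - h y)\<^sup>2 = 0"
    using integral_nonneg_eq_0_iff_AE[OF int] by simp
  then have "AE y in m. h y = h x" by eventually_elim simp
  then show thesis by (rule that)
qed

text \<open>The conditional probability of an invariant event is harmonic, hence constant. The event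
  is therefore independent of every box, and so of itself.\<close>

lemma ergodic: "markov_ergodic m P"
  unfolding markov_ergodic_def
proof (intro ballI impI)
  fix A assume A[measurable]: "A \<in> sets paths"
    and inv: "(\<lambda>\<omega> n. \<omega> (Suc n)) -` A \<inter> space paths = A"
  have inv_n: "shift n -` A \<inter> space paths = A" for n
  proof (induction n)
    case 0
    then show ?case using sets.sets_into_space[OF A] by (auto simp: shift_def[abs_def])
  next
    case (Suc n)
    have "shift (Suc n) \<omega> \<in> A \<longleftrightarrow> \<omega> \<in> A" if \<omega>: "\<omega> \<in> space paths" for \<omega>
    proof -
      have "shift n \<omega> \<in> space paths" using measurable_space[OF shift_measurable \<omega>] .
      then have "shift (Suc n) \<omega> \<in> A \<longleftrightarrow> shift n \<omega> \<in> A"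
        unfolding shift_Suc(2) using inv by auto
      then show ?thesis using Suc.IH \<omega> by auto
    qed
    then show ?case using sets.sets_into_space[OF A] by auto
  qed
  obtain g where g: "conditional A g" using conditional_exists[OF A] by blast
  then have gm[measurable]: "g \<in> borel_measurable m" and g1: "\<And>x. g x \<le> 1" by (auto simp: conditional_def)
  \<comment> \<open>By invariance the shift disappears: the same \<open>g\<close> gives the mass of
    \<open>A\<close> on events adapted at any time.\<close>
  have PA: "emeasure law (C \<inter> A) = (\<integral>\<^sup>+\<omega>. indicator C \<omega> * g (\<omega> n) \<partial>law)" if "adapted n C" for n C
    using g that unfolding conditional_def inv_n by blast
  have [measurable]: "(\<lambda>x. \<integral>\<^sup>+y. g y \<partial>P x) \<in> borel_measurable m"
    by (rule nn_integral_measurable_subprob_algebra2[where N = m]) auto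
  have "AE x in m. (\<integral>\<^sup>+y. g y \<partial>P x) = g x"
  proof (rule m.density_unique_finite_measure)
    fix B assume [measurable]: "B \<in> sets m"
    let ?C = "{\<omega> \<in> space paths. \<omega> 0 \<in> B}"
    \<comment> \<open>The same event, read at time 0 and at time 1, yields two expressions for its
      mass in \<open>A\<close>; comparing them shows that \<open>g\<close> is harmonic.\<close>
    have C: "adapted 0 ?C" "adapted (Suc 0) ?C" by (auto simp: adapted_def intro!: sets_component)
    have "(\<integral>\<^sup>+x. (\<integral>\<^sup>+y. g y \<partial>P x) * indicator B x \<partial>m) = (\<integral>\<^sup>+\<omega>. (\<integral>\<^sup>+y. g y \<partial>P (\<omega> 0)) * indicator B (\<omega> 0) \<partial>law)"
      by (rule nn_integral_law_0[symmetric]) simp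
    also have "\<dots> = (\<integral>\<^sup>+\<omega>. (\<integral>\<^sup>+y. g y * indicator B (\<omega> 0) \<partial>P (\<omega> 0)) \<partial>law)"
      by (rule nn_integral_cong)
         (auto intro!: nn_integral_multc[symmetric] kernel_measurable gm simp: space_law space_PiM)
    also have "\<dots> = (\<integral>\<^sup>+\<omega>. g (\<omega> (Suc 0)) * indicator B (\<omega> 0) \<partial>law)"
      by (rule nn_integral_step[symmetric, where F = "\<lambda>\<omega> y. g y * indicator B (\<omega> 0)"]) auto
    also have "\<dots> = (\<integral>\<^sup>+\<omega>. indicator ?C \<omega> * g (\<omega> (Suc 0)) \<partial>law)"
      by (rule nn_integral_cong) (auto simp: space_law split: split_indicator)
    also have "\<dots> = (\<integral>\<^sup>+\<omega>. indicator ?C \<omega> * g (\<omega> 0) \<partial>law)"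
      using PA[OF C(1)] PA[OF C(2)] by simp
    also have "\<dots> = (\<integral>\<^sup>+\<omega>. g (\<omega> 0) * indicator B (\<omega> 0) \<partial>law)"
      by (rule nn_integral_cong) (auto simp: space_law split: split_indicator)
    also have "\<dots> = (\<integral>\<^sup>+x. g x * indicator B x \<partial>m)"
      by (rule nn_integral_law_0) simp
    finally show "(\<integral>\<^sup>+x. (\<integral>\<^sup>+y. g y \<partial>P x) * indicator B x \<partial>m) = (\<integral>\<^sup>+x. g x * indicator B x \<partial>m)" .
  qed auto
  define h where "h x = enn2real (g x)" for x
  have [measurable]: "h \<in> borel_measurable m" unfolding h_def[abs_def] by measurable
  have gh: "g x = ennreal (h x)" for x
    unfolding h_def using g1[of x] le_less_trans[OF _ ennreal_one_less_top, of "g x"] by simp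
  have h01: "0 \<le> h x" "h x \<le> 1" for x
    using g1[of x] unfolding gh by (simp add: h_def, simp)
  have "AE x in m. (\<integral>y. h y \<partial>P x) = h x"
    using \<open>AE x in m. (\<integral>\<^sup>+y. g y \<partial>P x) = g x\<close> AE_space
  proof eventually_elim
    case (elim x)
    have "h \<in> borel_measurable (P x)" by (rule kernel_measurable) (use elim in simp_all)
    with elim show ?case
      by (subst integral_eq_nn_integral) (auto simp: h01 gh)
  qed
  then obtain c where c: "AE x in m. h x = c"
    using harmonic_const[OF \<open>h \<in> borel_measurable m\<close> h01] by blast
  have PC: "emeasure law (C \<inter> A) = ennreal c * emeasure law C" if C: "adapted n C" for n C
  proof -
    have [measurable]: "C \<in> sets paths" using C by (rule adapted_sets)
    have "emeasure law (C \<inter> A) = (\<integral>\<^sup>+\<omega>. indicator C \<omega> * ennreal c \<partial>law)"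
      unfolding PA[OF C] using AE_law_component[OF c, of n]
      by (intro nn_integral_cong_AE) (auto simp: gh)
    also have "\<dots> = ennreal c * emeasure law C"
      by (subst nn_integral_multc) (auto simp: mult.commute sets_lawI)
    finally show ?thesis .
  qed
  have *: "density law (indicator A) = density law (\<lambda>_. ennreal c)"
  proof (rule measure_eqI_generator_eq[OF Int_stable_prod_algebra[of UNIV "\<lambda>_. m"] prod_algebra_sets_into_space])
    fix X assume X: "X \<in> prod_algebra UNIV (\<lambda>_::nat. m)"
    from prod_algebra_path_box[OF X] obtain k Y where X_eq: "X = path_box k Y" and Y: "\<And>i. Y i \<in> sets m"
      by metis
    have "X \<in> sets paths" using X by (auto simp: sets_PiM)
    then have "X \<in> sets law" by (simp add: sets_law)
    moreover have "A \<in> sets law" using A by (simp add: sets_law)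
    ultimately show "emeasure (density law (indicator A)) X = emeasure (density law (\<lambda>_. ennreal c)) X"
      using PC[OF adapted_path_box[OF Y, of k]]
      by (simp add: X_eq emeasure_density nn_integral_cmult_indicator Int_commute flip: indicator_inter_arith)
  next
    show "range (\<lambda>_. space paths) \<subseteq> prod_algebra UNIV (\<lambda>_::nat. m)"
      using space_in_prod_algebra[of UNIV "\<lambda>_. m"] by (auto simp: space_PiM)
    have "A \<in> sets law" using A by (simp add: sets_law)
    then show "emeasure (density law (indicator A)) (space paths) \<noteq> \<infinity>"
      by (simp add: emeasure_density space_law[symmetric] flip: indicator_inter_arith)
  qed (auto simp: sets_law sets_PiM space_PiM)
  \<comment> \<open>The two measures agree on all events; evaluation at \<open>A\<close> and at the
    whole space gives p = c p and p = c for p the probability of \<open>A\<close>.\<close>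
  have "A \<in> sets law" using A by (simp add: sets_law)
  with arg_cong[OF *, of "\<lambda>M. emeasure M A"] arg_cong[OF *, of "\<lambda>M. emeasure M (space law)"]
  have "emeasure law A = ennreal c * emeasure law A" "emeasure law A = ennreal c"
    by (simp_all add: emeasure_density nn_integral_cmult_indicator law.emeasure_space_1 flip: indicator_inter_arith)
  then have "emeasure law A = emeasure law A * emeasure law A" by simp
  then have "measure law A = measure law A * measure law A"
    by (simp add: law.emeasure_eq_measure flip: ennreal_mult)
  then show "measure law A \<in> {0, 1}" by simp
qed

end

section \<open>Ping-pong in the plane\<close>

lemma distr_lborel_matrix:
  fixes A :: "real^2^2"
  assumes "\<bar>det A\<bar> = 1"
  shows "distr lborel borel ((*v) A) = lborel"
proof (rule lborel_eqI[symmetric])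
  fix l u :: "real^2" assume le: "\<And>b. b \<in> Basis \<Longrightarrow> l \<bullet> b \<le> u \<bullet> b"
  have "det A \<noteq> 0" using assms by auto
  then obtain B where B: "A ** B = mat 1" "B ** A = mat 1"
    using invertible_det_nz invertible_def by blast
  have "det A * det B = 1" using B(1) det_mul[of A B] by (simp add: det_I)
  with assms have detB: "\<bar>det B\<bar> = 1" by (metis abs_mult abs_one mult_1)
  have eq: "(*v) A -` box l u = (*v) B ` box l u"
  proof (intro set_eqI iffI)
    fix x assume "x \<in> (*v) A -` box l u"
    moreover have "x = B *v (A *v x)" by (simp add: matrix_vector_mul_assoc B)
    ultimately show "x \<in> (*v) B ` box l u" by blast
  next
    fix x assume "x \<in> (*v) B ` box l u"
    then show "x \<in> (*v) A -` box l u" by (auto simp: matrix_vector_mul_assoc B)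
  qed
  have m[measurable]: "(*v) A \<in> borel_measurable borel"
    by (intro borel_measurable_continuous_onI linear_continuous_on matrix_vector_mul_bounded_linear)
  have meas: "(*v) A -` box l u \<in> sets borel"
    using measurable_sets[OF m, of "box l u"] by simp
  have lm: "(*v) B ` box l u \<in> lmeasurable"
    by (intro measurable_linear_image) auto
  have "emeasure (distr lborel borel ((*v) A)) (box l u) = emeasure lborel ((*v) A -` box l u)"
    by (subst emeasure_distr) auto
  also have "\<dots> = emeasure lebesgue ((*v) B ` box l u)"
    using meas eq by simp
  also have "\<dots> = ennreal (measure lebesgue ((*v) B ` box l u))"
    using lm by (simp add: emeasure_eq_measure2)
  also have "\<dots> = ennreal (measure lebesgue (box l u))"
    by (subst measure_linear_image) (auto simp: detB)
  also have "\<dots> = (\<Prod>b\<in>Basis. (u - l) \<bullet> b)"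
    using le by (simp add: measure_lborel_box_eq)
  finally show "emeasure (distr lborel borel ((*v) A)) (box l u) = (\<Prod>b\<in>Basis. (u - l) \<bullet> b)" .
qed simp

lemma borel_measurable_matrix_vector[measurable]:
  fixes A :: "real^'n^'m"
  shows "(*v) A \<in> borel_measurable borel"
  by (intro borel_measurable_continuous_onI linear_continuous_on matrix_vector_mul_bounded_linear)

lemma nn_integral_lborel_matrix:
  fixes A :: "real^2^2"
  assumes "\<bar>det A\<bar> = 1" and [measurable]: "f \<in> borel_measurable borel"
  shows "(\<integral>\<^sup>+v. f (A *v v) \<partial>lborel) = (\<integral>\<^sup>+v. f v \<partial>lborel)"
  by (subst (2) distr_lborel_matrix[OF assms(1), symmetric], subst nn_integral_distr) auto

lemma nn_integral_lborel_matrix_set: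
  fixes A :: "real^2^2"
  assumes "\<bar>det A\<bar> = 1" and [measurable]: "f \<in> borel_measurable borel" "S \<in> sets borel"
  shows "(\<integral>\<^sup>+v. indicator S v * f (A *v v) \<partial>lborel) = (\<integral>\<^sup>+v. indicator ((*v) A ` S) v * f v \<partial>lborel)"
    and "(*v) A ` S \<in> sets borel"
proof -
  have "det A \<noteq> 0" using assms by auto
  then obtain B where B: "A ** B = mat 1" "B ** A = mat 1"
    using invertible_det_nz invertible_def by blast
  have eq: "(*v) A ` S = (*v) B -` S"
  proof (intro set_eqI iffI)
    fix x assume "x \<in> (*v) B -` S"
    moreover have "x = A *v (B *v x)" by (simp add: matrix_vector_mul_assoc B)
    ultimately show "x \<in> (*v) A ` S" by blast
  next
    fix x assume "x \<in> (*v) A ` S"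
    then show "x \<in> (*v) B -` S" by (auto simp: matrix_vector_mul_assoc B)
  qed
  show im[measurable]: "(*v) A ` S \<in> sets borel"
    unfolding eq using measurable_sets[OF borel_measurable_matrix_vector assms(3), of B] by simp
  have "indicator S v = (indicator ((*v) A ` S) (A *v v) :: ennreal)" for v
    unfolding eq by (auto simp: indicator_def matrix_vector_mul_assoc B)
  then have "(\<integral>\<^sup>+v. indicator S v * f (A *v v) \<partial>lborel) =
      (\<integral>\<^sup>+v. indicator ((*v) A ` S) (A *v v) * f (A *v v) \<partial>lborel)"
    by simp
  also have "\<dots> = (\<integral>\<^sup>+v. indicator ((*v) A ` S) v * f v \<partial>lborel)"
    by (rule nn_integral_lborel_matrix[OF assms(1), where f = "\<lambda>v. indicator ((*v) A ` S) v * f v"]) simp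
  finally show "(\<integral>\<^sup>+v. indicator S v * f (A *v v) \<partial>lborel) = (\<integral>\<^sup>+v. indicator ((*v) A ` S) v * f v \<partial>lborel)" .
qed

text \<open>The first two hypotheses give p2 + p3 \<le> q. Adding the two bounds for
  \<open>q\<close> yields 2 q \<le> (3/2) q + 3 (d2 + d3), which is conclusive because 3/2 is below
  2.\<close>

lemma pingpong_arith:
  fixes N p1 p2 p3 q d1 d2 d3 :: real
  assumes "p1 + p2 + p3 \<le> N" "N \<le> p1 + q" "q \<le> 3/2 * p2 + 3 * d2" "q \<le> 3/2 * p3 + 3 * d3"
    "p1 \<le> 3/2 * q + 3 * d1" "0 \<le> d1" "0 \<le> d2" "0 \<le> d3" 
  shows "N \<le> 18 * (d1 + d2 + d3)"
proof -
  have "p2 + p3 \<le> q" using assms(1,2) by linarith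
  then have "q \<le> 6 * (d2 + d3)" using assms(3,4) by (simp add: field_simps)
  then show ?thesis using assms(2,5-8) by (simp add: field_simps)
qed

text \<open>The factor of the first square must stay below 2 for \<open>pingpong_arith\<close>; the
  value 3/2 costs the factor 3 in front of the difference.\<close>

lemma square_le_shift: "(a::real)\<^sup>2 \<le> 3/2 * b\<^sup>2 + 3 * (a - b)\<^sup>2"
proof -
  have "3/2 * b\<^sup>2 + 3 * (a - b)\<^sup>2 - a\<^sup>2 = 1/2 * (2 * a - 3 * b)\<^sup>2"
    by (simp add: power2_eq_square field_simps)
  moreover have "0 \<le> 1/2 * (2 * a - 3 * b)\<^sup>2" by simp
  ultimately show ?thesis by linarith
qed

text \<open>The square of the distance in \<open>L^2\<close> of the plane, extended-valued so that
  it is meaningful for every measurable \<open>h\<close>.\<close>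

definition L2dist :: "(real^2 \<Rightarrow> real) \<Rightarrow> real^2^2 \<Rightarrow> real^2^2 \<Rightarrow> ennreal" where
  "L2dist h A B = (\<integral>\<^sup>+v. ennreal ((h (A *v v) - h (B *v v))\<^sup>2) \<partial>lborel)"

lemma L2dist_commute: "L2dist h A B = L2dist h B A"
  by (simp add: L2dist_def power2_commute)

text \<open>A ping-pong configuration: three of the matrices move \<open>S\<close> to disjoint sets, which forces the
  mass of \<open>h\<^sup>2\<close> on one image of \<open>S\<close> to be small, whereas two images cover the plane.\<close>

definition pingpong :: "(real^2) set \<Rightarrow> real^2^2 \<Rightarrow> real^2^2 \<Rightarrow> real^2^2 \<Rightarrow> real^2^2 \<Rightarrow> bool" where
  "pingpong S A1 A2 A3 B \<longleftrightarrow>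
     (*v) A1 ` S \<inter> (*v) A2 ` S = {} \<and> (*v) A1 ` S \<inter> (*v) A3 ` S = {} \<and> (*v) A2 ` S \<inter> (*v) A3 ` S = {} \<and>
     - {0} \<subseteq> (*v) A1 ` S \<union> (*v) B ` S"

text \<open>If \<open>h\<close> were exactly invariant, its mass \<mu> would be the same on all four
  images, and 3 \<mu> \<le> N \<le> 2 \<mu> with finite total mass N would force N = 0. The
  inequality is the quantitative version.\<close>

lemma pingpong_mass:
  assumes det: "\<bar>det A1\<bar> = 1" "\<bar>det A2\<bar> = 1" "\<bar>det A3\<bar> = 1" "\<bar>det B\<bar> = 1"
    and S[measurable]: "S \<in> sets borel" and pp: "pingpong S A1 A2 A3 B"
    and h[measurable]: "h \<in> borel_measurable borel" and fin: "(\<integral>\<^sup>+v. ennreal ((h v)\<^sup>2) \<partial>lborel) < \<infinity>"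
  shows "(\<integral>\<^sup>+v. ennreal ((h v)\<^sup>2) \<partial>lborel) \<le> 18 * (L2dist h A1 B + L2dist h A2 B + L2dist h A3 B)"
proof -
  define N where "N = (\<integral>\<^sup>+v. ennreal ((h v)\<^sup>2) \<partial>lborel)"
  define p where "p A = (\<integral>\<^sup>+v. indicator S v * ennreal ((h (A *v v))\<^sup>2) \<partial>lborel)" for A
  have p_eq: "p A = (\<integral>\<^sup>+v. indicator ((*v) A ` S) v * ennreal ((h v)\<^sup>2) \<partial>lborel)" if "\<bar>det A\<bar> = 1" for A
    unfolding p_def by (rule nn_integral_lborel_matrix_set[OF that]) auto
  note [measurable] = nn_integral_lborel_matrix_set(2)[OF det(1) borel_measurable_const S]
    nn_integral_lborel_matrix_set(2)[OF det(2) borel_measurable_const S] nn_integral_lborel_matrix_set(2)[OF det(3) borel_measurable_const S]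
    nn_integral_lborel_matrix_set(2)[OF det(4) borel_measurable_const S]
  have pN: "p A \<le> N" if "\<bar>det A\<bar> = 1" for A
    unfolding p_eq[OF that] N_def by (intro nn_integral_mono) (auto split: split_indicator)
  have 1: "p A1 + p A2 + p A3 \<le> N"
  proof -
    have "p A1 + p A2 + p A3 = (\<integral>\<^sup>+v. indicator ((*v) A1 ` S) v * ennreal ((h v)\<^sup>2) +
        indicator ((*v) A2 ` S) v * ennreal ((h v)\<^sup>2) + indicator ((*v) A3 ` S) v * ennreal ((h v)\<^sup>2) \<partial>lborel)"
      unfolding p_eq[OF det(1)] p_eq[OF det(2)] p_eq[OF det(3)] by (simp add: nn_integral_add)
    also have "\<dots> \<le> N"
      unfolding N_def
    proof (intro nn_integral_mono)
      fix v
      consider "v \<in> (*v) A1 ` S" "v \<notin> (*v) A2 ` S" "v \<notin> (*v) A3 ` S"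
        | "v \<notin> (*v) A1 ` S" "v \<in> (*v) A2 ` S" "v \<notin> (*v) A3 ` S"
        | "v \<notin> (*v) A1 ` S" "v \<notin> (*v) A2 ` S" "v \<in> (*v) A3 ` S"
        | "v \<notin> (*v) A1 ` S" "v \<notin> (*v) A2 ` S" "v \<notin> (*v) A3 ` S"
        using pp unfolding pingpong_def by blast
      then show "indicator ((*v) A1 ` S) v * ennreal ((h v)\<^sup>2) + indicator ((*v) A2 ` S) v * ennreal ((h v)\<^sup>2)
        + indicator ((*v) A3 ` S) v * ennreal ((h v)\<^sup>2) \<le> ennreal ((h v)\<^sup>2)"
        by cases (simp_all only: indicator_def of_bool_def if_True if_False mult_zero_left mult_1_left add_0 add_0_right order_refl zero_le)
    qed
    finally show ?thesis .
  qed
  have 2: "N \<le> p A1 + p B"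
  proof -
    have "N \<le> (\<integral>\<^sup>+v. indicator ((*v) A1 ` S) v * ennreal ((h v)\<^sup>2) + indicator ((*v) B ` S) v * ennreal ((h v)\<^sup>2) \<partial>lborel)"
      unfolding N_def
    \<comment> \<open>The origin may be left uncovered, but it is a null set.\<close>
    proof (intro nn_integral_mono_AE eventually_mono[OF AE_lborel_singleton[of 0]])
      fix v :: "real^2" assume "v \<noteq> 0"
      then have "v \<in> (*v) A1 ` S \<or> v \<in> (*v) B ` S" using pp unfolding pingpong_def by blast
      then show "ennreal ((h v)\<^sup>2) \<le> indicator ((*v) A1 ` S) v * ennreal ((h v)\<^sup>2) + indicator ((*v) B ` S) v * ennreal ((h v)\<^sup>2)"
        by (elim disjE) (simp_all only: indicator_simps mult_1_left le_add1 le_add2 le_iff_add, auto simp: add.commute)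
    qed
    also have "\<dots> = p A1 + p B"
      unfolding p_eq[OF det(1)] p_eq[OF det(4)] by (simp add: nn_integral_add)
    finally show ?thesis .
  qed
  have 3: "p A \<le> ennreal (3/2) * p C + ennreal 3 * L2dist h A C" for A C
  proof -
    have "p A \<le> (\<integral>\<^sup>+v. ennreal (3/2) * (indicator S v * ennreal ((h (C *v v))\<^sup>2)) + ennreal 3 * ennreal ((h (A *v v) - h (C *v v))\<^sup>2) \<partial>lborel)"
      unfolding p_def
    proof (intro nn_integral_mono)
      fix v
      have "ennreal ((h (A *v v))\<^sup>2) \<le> ennreal (3/2 * (h (C *v v))\<^sup>2 + 3 * (h (A *v v) - h (C *v v))\<^sup>2)"
        by (intro ennreal_leI square_le_shift)
      also have "\<dots> = ennreal (3/2) * ennreal ((h (C *v v))\<^sup>2) + ennreal 3 * ennreal ((h (A *v v) - h (C *v v))\<^sup>2)"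
        by (subst ennreal_plus, simp, simp, intro arg_cong2[where f = "(+)"] ennreal_mult') simp_all
      finally show "indicator S v * ennreal ((h (A *v v))\<^sup>2) \<le> ennreal (3/2) * (indicator S v * ennreal ((h (C *v v))\<^sup>2)) + ennreal 3 * ennreal ((h (A *v v) - h (C *v v))\<^sup>2)"
        by (cases "v \<in> S") (simp_all only: indicator_def of_bool_def if_True if_False mult_1_left mult_zero_left mult_zero_right zero_le)
    qed
    also have "\<dots> = ennreal (3/2) * p C + ennreal 3 * L2dist h A C"
      unfolding p_def L2dist_def by (simp add: nn_integral_add nn_integral_cmult)
    finally show ?thesis .
  qed
  show ?thesis
  \<comment> \<open>An infinite distance makes the bound trivial; otherwise all quantities are
    finite and the estimate is one between real numbers.\<close>
  proof (cases "L2dist h A1 B = \<top> \<or> L2dist h A2 B = \<top> \<or> L2dist h A3 B = \<top>")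
    case True
    then have "L2dist h A1 B + L2dist h A2 B + L2dist h A3 B = \<top>" by auto
    then have "18 * (L2dist h A1 B + L2dist h A2 B + L2dist h A3 B) = \<top>"
      by (simp only: ennreal_mult_eq_top_iff) simp
    then show ?thesis by (simp only: top_greatest)
  next
    case False
    then obtain d1 d2 d3 where d: "L2dist h A1 B = ennreal d1" "L2dist h A2 B = ennreal d2" "L2dist h A3 B = ennreal d3"
      "0 \<le> d1" "0 \<le> d2" "0 \<le> d3"
      by (metis ennreal_cases)
    have Nfin: "N < \<top>" using fin by (simp add: N_def)
    then have "p A1 < \<top>" "p A2 < \<top>" "p A3 < \<top>" "p B < \<top>"
      using pN det by (meson le_less_trans)+
    then obtain p1 p2 p3 q where p: "p A1 = ennreal p1" "p A2 = ennreal p2" "p A3 = ennreal p3" "p B = ennreal q"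
      "0 \<le> p1" "0 \<le> p2" "0 \<le> p3" "0 \<le> q"
      by (metis ennreal_cases less_irrefl)
    obtain n where n: "N = ennreal n" "0 \<le> n" using Nfin by (metis ennreal_cases less_irrefl)
    have "p1 + p2 + p3 \<le> n" "n \<le> p1 + q"
      using 1 2 n p by (simp_all flip: ennreal_plus)
    moreover have "q \<le> 3/2 * p2 + 3 * d2" "q \<le> 3/2 * p3 + 3 * d3" "p1 \<le> 3/2 * q + 3 * d1"
      using 3[of B A2] 3[of B A3] 3[of A1 B] p d
      by (simp_all add: L2dist_commute[of h B] flip: ennreal_plus ennreal_mult ennreal_numeral)
    ultimately have "n \<le> 18 * (d1 + d2 + d3)"
      using d by (intro pingpong_arith) auto
    then have "ennreal n \<le> ennreal (18 * (d1 + d2 + d3))" by (rule ennreal_leI)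
    also have "\<dots> = 18 * (ennreal d1 + ennreal d2 + ennreal d3)"
      using d(4-6) ennreal_mult[of 18 "d1 + d2 + d3"]
      by (simp only: ennreal_plus[symmetric] add_nonneg_nonneg ennreal_numeral zero_le_numeral)
    finally show ?thesis unfolding d(1-3) n(1)[symmetric] by (simp only: N_def)
  qed
qed

text \<open>The disc of radius 1 / n, with n the norm, lies in the unit disc and is mapped into it;
  in the plane its area is 1 / n^2 times that of the unit disc.\<close>

lemma area_lower_bound:
  fixes A :: "real^2^2"
  assumes "1 \<le> onorm ((*v) A)"
  shows "emeasure lborel (cball 0 1 :: (real^2) set) * ennreal (1 / (onorm ((*v) A))\<^sup>2)
    \<le> (\<integral>\<^sup>+v. indicator (cball 0 1) v * indicator (cball 0 1) (A *v v) \<partial>lborel)"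
proof -
  let ?n = "onorm ((*v) A)"
  have n0: "0 < ?n" using assms by simp
  have bl: "bounded_linear ((*v) A)" by (rule matrix_vector_mul_bounded_linear)
  have sub: "v \<in> cball 0 1 \<and> A *v v \<in> cball 0 1" if "v \<in> cball 0 (1 / ?n)" for v
  proof -
    have v: "norm v \<le> 1 / ?n" using that by simp
    also have "\<dots> \<le> 1" using assms by simp
    finally have 1: "norm v \<le> 1" .
    have "norm (A *v v) \<le> ?n * norm v" by (rule onorm[OF bl])
    also have "\<dots> \<le> ?n * (1 / ?n)" using v n0 by (intro mult_left_mono) auto
    finally show ?thesis using 1 n0 by simp
  qed
  have "emeasure lborel (cball 0 1 :: (real^2) set) * ennreal (1 / ?n\<^sup>2) = emeasure lborel (cball 0 (1 / ?n) :: (real^2) set)"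
    using n0 by (simp add: emeasure_cball power_divide ennreal_mult[symmetric] unit_ball_vol_nonneg)
  also have "\<dots> = (\<integral>\<^sup>+v. indicator (cball 0 (1 / ?n) :: (real^2) set) v \<partial>lborel)"
    by simp
  also have "\<dots> \<le> (\<integral>\<^sup>+v. indicator (cball 0 1) v * indicator (cball 0 1) (A *v v) \<partial>lborel)"
    using sub by (intro nn_integral_mono) (auto split: split_indicator simp del: mem_cball)
  finally show ?thesis .
qed

text \<open>A matrix of norm below 1 would map the unit disc into a smaller one, contradicting
  preservation of area.\<close>

lemma onorm_ge_1:
  fixes A :: "real^2^2"
  assumes "\<bar>det A\<bar> = 1"
  shows "1 \<le> onorm ((*v) A)"
proof (rule ccontr)
  let ?n = "onorm ((*v) A)"
  have bl: "bounded_linear ((*v) A)" by (rule matrix_vector_mul_bounded_linear)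
  assume "\<not> 1 \<le> ?n"
  then have n1: "?n < 1" by simp
  have n0: "0 \<le> ?n" by (rule onorm_pos_le[OF bl])
  have e: "norm (A *v v) \<le> ?n * norm v" for v by (rule onorm[OF bl])
  have "(*v) A ` cball 0 1 \<subseteq> cball 0 ?n"
  proof
    fix w assume "w \<in> (*v) A ` cball 0 1"
    then obtain v where "w = A *v v" "norm v \<le> 1" by auto
    then show "w \<in> cball 0 ?n" using e[of v] n0 mult_left_le[of "norm v" ?n] by simp
  qed
  then have "measure lebesgue ((*v) A ` cball 0 1) \<le> measure lebesgue (cball 0 ?n :: (real^2) set)"
    by (intro measure_mono_fmeasurable) (auto intro!: fmeasurableD measurable_linear_image)
  moreover have "measure lebesgue ((*v) A ` cball 0 1) = measure lebesgue (cball 0 1 :: (real^2) set)"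
    using assms by (subst measure_linear_image) auto
  moreover have "measure lebesgue (cball 0 ?n :: (real^2) set) = unit_ball_vol 2 * ?n\<^sup>2"
    "measure lebesgue (cball 0 1 :: (real^2) set) = unit_ball_vol 2"
    using n0 content_cball[of ?n "0::real^2"] content_cball[of 1 "0::real^2"] by simp_all
  moreover have "unit_ball_vol 2 * ?n\<^sup>2 < unit_ball_vol 2 * 1"
    using n1 n0 by (intro mult_strict_left_mono) (use power_strict_mono[of ?n 1 2] in auto)
  ultimately show False by simp
qed

text \<open>If the inequality failed on all of \<open>X\<close>, integrating over \<open>X\<close>
  would exceed the full integral. In this way averaged estimates produce concrete points of
  \<open>X\<close>.\<close>

lemma ex_average_le:
  fixes f :: "'a \<Rightarrow> ennreal"
  assumes [measurable]: "f \<in> borel_measurable M" "X \<in> sets M" and X: "0 < emeasure M X" "emeasure M X < \<infinity>"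
  shows "\<exists>x\<in>X. f x * emeasure M X \<le> (\<integral>\<^sup>+x. f x \<partial>M)"
proof (rule ccontr)
  assume "\<not> ?thesis"
  then have gt: "\<And>x. x \<in> X \<Longrightarrow> (\<integral>\<^sup>+x. f x \<partial>M) < f x * emeasure M X" by (auto simp: not_le)
  let ?I = "\<integral>\<^sup>+x. f x \<partial>M"
  have "X \<noteq> {}" using X by auto
  then obtain x where "x \<in> X" by auto
  from gt[OF this] have I: "?I < \<infinity>" by (auto simp: less_top[symmetric] top_unique dest: order.strict_implies_not_eq)
  have "(\<integral>\<^sup>+x. ?I * indicator X x \<partial>M) < (\<integral>\<^sup>+x. f x * emeasure M X * indicator X x \<partial>M)"
  proof (rule nn_integral_less)
    show "(\<integral>\<^sup>+x. ?I * indicator X x \<partial>M) \<noteq> \<infinity>"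
      using I X by (auto simp: nn_integral_cmult_indicator ennreal_mult_eq_top_iff)
    show "AE x in M. ?I * indicator X x \<le> f x * emeasure M X * indicator X x"
      using gt by (intro AE_I2) (auto split: split_indicator intro: less_imp_le)
    show "\<not> (AE x in M. f x * emeasure M X * indicator X x \<le> ?I * indicator X x)"
    proof
      assume "AE x in M. f x * emeasure M X * indicator X x \<le> ?I * indicator X x"
      then have "AE x in M. x \<notin> X"
        by eventually_elim (use gt in \<open>auto simp: not_le[symmetric] split: split_indicator_asm\<close>)
      then have "emeasure M X = 0" by (subst (asm) AE_iff_null) (auto simp: null_sets_def Collect_conj_eq Int_absorb1 dest: sets.sets_into_space[OF assms(2), THEN subsetD] cong: conj_cong)
      with X show False by simp
    qed
  qed auto
  also have "\<dots> \<le> (\<integral>\<^sup>+x. f x * emeasure M X \<partial>M)"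
    by (intro nn_integral_mono) (auto split: split_indicator)
  also have "\<dots> = ?I * emeasure M X" by (simp add: nn_integral_multc)
  finally show False by (simp add: nn_integral_cmult_indicator)
qed

section \<open>Subadditive sequences and operator norms\<close>

text \<open>The limit is the infimum of \<open>a n / n\<close>: after division of \<open>n\<close>
  by a nearly optimal \<open>N\<close>, the remainder contributes at most one of the finitely many
  values below \<open>N\<close>. Non-negativity bounds the infimum from below.\<close>

lemma fekete_subadditive:
  fixes a :: "nat \<Rightarrow> real"
  assumes sub: "\<And>n k. a (n + k) \<le> a n + a k" and nonneg: "\<And>n. 0 \<le> a n"
  obtains l where "(\<lambda>n. a n / real n) \<longlonglongrightarrow> l"
proof -
  define L where "L = (INF n\<in>{1..}. a n / real n)"
  have bdd: "bdd_below ((\<lambda>n. a n / real n) ` {1..})"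
    by (rule bdd_belowI[of _ 0]) (auto simp: nonneg)
  have L_le: "L \<le> a n / real n" if "1 \<le> n" for n
    unfolding L_def using that by (intro cINF_lower bdd) auto
  have mult: "a (q * N + r) \<le> real q * a N + a r" for q N r
  proof (induction q)
    case (Suc q)
    have "a (Suc q * N + r) = a (N + (q * N + r))" by (simp add: add.assoc)
    also have "\<dots> \<le> a N + a (q * N + r)" by (rule sub)
    also have "\<dots> \<le> a N + (real q * a N + a r)" using Suc by simp
    finally show ?case by (simp add: algebra_simps)
  qed simp
  have "(\<lambda>n. a n / real n) \<longlonglongrightarrow> L"
  proof (rule LIMSEQ_I)
    fix e :: real assume e: "0 < e"
    obtain N where N: "1 \<le> N" "a N / real N < L + e / 2"
    proof -
      have "(INF n\<in>{1..}. a n / real n) < L + e / 2" using e by (simp add: L_def)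
      then have "\<exists>n\<in>{1..}. a n / real n < L + e / 2"
        by (subst (asm) cINF_less_iff[OF _ bdd]) auto
      then show thesis using that by auto
    qed
    define M where "M = (\<Sum>r<N. a r)"
    have M: "a r \<le> M" if "r < N" for r
      unfolding M_def using that by (intro member_le_sum) (auto simp: nonneg)
    have M0: "0 \<le> M" unfolding M_def by (intro sum_nonneg) (simp add: nonneg)
    \<comment> \<open>Large enough for the remainder term \<open>M / n\<close> to fall below e /
      2.\<close>
    obtain n0 where n0: "real n0 > 2 * M / e + 1" using reals_Archimedean2 by blast
    show "\<exists>n0. \<forall>n\<ge>n0. norm (a n / real n - L) < e"
    proof (intro exI[of _ n0] allI impI)
      fix n assume n: "n0 \<le> n"
      have n1: "2 * M / e + 1 < real n" using n n0 by linarith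
      moreover have "0 \<le> 2 * M / e" using M0 e by simp
      ultimately have n_pos: "0 < real n" by linarith
      then have "1 \<le> n" by simp
      have "a n \<le> real (n div N) * a N + a (n mod N)" using mult[of "n div N" N "n mod N"] by simp
      also have "\<dots> \<le> real (n div N) * a N + M" using M[of "n mod N"] N by simp
      also have "real (n div N) * a N \<le> (real n / real N) * a N"
      proof (intro mult_right_mono nonneg)
        have "real (n div N) * real N \<le> real n"
          unfolding of_nat_mult[symmetric] of_nat_le_iff by (rule div_times_less_eq_dividend)
        then show "real (n div N) \<le> real n / real N" using N by (simp add: pos_le_divide_eq)
      qed
      finally have "a n / real n \<le> ((real n / real N) * a N + M) / real n"
        using n_pos by (intro divide_right_mono) auto
      also have "\<dots> = a N / real N + M / real n" using n_pos N by (simp add: field_simps)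
      also have "M / real n < e / 2"
      proof -
        have "2 * M / e < real n" using n1 by linarith
        then have "2 * M < real n * e" using e by (simp add: field_simps)
        then show ?thesis using n_pos by (simp add: field_simps)
      qed
      finally have "a n / real n < L + e" using N(2) by linarith
      then show "norm (a n / real n - L) < e" using L_le[OF \<open>1 \<le> n\<close>] by simp
    qed
  qed
  then show thesis by (rule that)
qed

section \<open>Measurability of matrix operations and inequalities for squares\<close>

lemma continuous_on_matrix_vector_pair:
  "continuous_on UNIV (\<lambda>x::(real^'n^'m) \<times> (real^'n). fst x *v snd x)"
  unfolding matrix_vector_mult_def by (intro continuous_intros)

lemma continuous_on_matrix_matrix_pair:
  "continuous_on UNIV (\<lambda>x::(real^'n^'m) \<times> (real^'k^'n). fst x ** snd x)"
  unfolding matrix_matrix_mult_def by (intro continuous_intros)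

lemma borel_measurable_matrix_vector_mult[measurable (raw)]:
  fixes f :: "'a \<Rightarrow> real^'n^'m"
  assumes "f \<in> borel_measurable M" "g \<in> borel_measurable M"
  shows "(\<lambda>x. f x *v g x) \<in> borel_measurable M"
  using borel_measurable_continuous_Pair[OF assms continuous_on_matrix_vector_pair] .

lemma borel_measurable_matrix_matrix_mult[measurable (raw)]:
  fixes f :: "'a \<Rightarrow> real^'n^'m" and g :: "'a \<Rightarrow> real^'k^'n"
  assumes "f \<in> borel_measurable M" "g \<in> borel_measurable M"
  shows "(\<lambda>x. f x ** g x) \<in> borel_measurable M"
  using borel_measurable_continuous_Pair[OF assms continuous_on_matrix_matrix_pair] .

text \<open>The operator norm satisfies the triangle inequality and is dominated by a multiple of
  the Euclidean norm, hence it is Lipschitz.\<close>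

lemma continuous_on_onorm_matrix:
  "continuous_on UNIV (\<lambda>A::real^'n^'m. onorm ((*v) A))"
proof -
  have sub: "onorm ((*v) M) \<le> onorm ((*v) N) + onorm ((*v) (M - N))" for M N :: "real^'n^'m"
  proof -
    have "(*v) M = (\<lambda>x. N *v x + (M - N) *v x)"
      by (simp add: fun_eq_iff matrix_vector_mult_diff_rdistrib)
    then show ?thesis
      by (metis onorm_triangle matrix_vector_mul_bounded_linear)
  qed
  let ?C = "real CARD('m) * real CARD('n)"
  have le: "onorm ((*v) M) \<le> ?C * norm M" for M :: "real^'n^'m"
  proof (rule onorm_le_matrix_component)
    fix i j
    have "\<bar>M $ i $ j\<bar> \<le> norm (M $ i)" by (rule component_le_norm_cart)
    also have "\<dots> \<le> norm M" by (rule Finite_Cartesian_Product.norm_nth_le)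
    finally show "\<bar>M $ i $ j\<bar> \<le> norm M" .
  qed
  have "?C-lipschitz_on UNIV (\<lambda>A::real^'n^'m. onorm ((*v) A))"
  proof (rule lipschitz_onI)
    fix M N :: "real^'n^'m"
    show "dist (onorm ((*v) M)) (onorm ((*v) N)) \<le> ?C * dist M N"
      using sub[of M N] sub[of N M] le[of "M - N"] le[of "N - M"]
      by (simp add: dist_norm norm_minus_commute)
  qed simp
  then show ?thesis by (rule lipschitz_on_continuous_on)
qed

lemma borel_measurable_onorm[measurable (raw)]:
  fixes f :: "'a \<Rightarrow> real^'n^'m"
  assumes "f \<in> borel_measurable M"
  shows "(\<lambda>x. onorm ((*v) (f x))) \<in> borel_measurable M"
  using borel_measurable_continuous_on[OF continuous_on_onorm_matrix assms] .

lemma onorm_matrix_mult: "onorm ((*v) (A ** B)) \<le> onorm ((*v) A) * onorm ((*v) B)"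
  for A :: "real^'n^'m" and B :: "real^'k^'n"
proof -
  have "(*v) (A ** B) = (*v) A \<circ> (*v) B" by (auto simp: fun_eq_iff matrix_vector_mul_assoc)
  then show ?thesis by (simp add: onorm_compose)
qed

text \<open>Non-negativity of the variance, with an extended-valued right-hand side that can be
  integrated further.\<close>

lemma (in prob_space) square_expectation_le:
  assumes [measurable]: "g \<in> borel_measurable M" and B: "\<And>x. \<bar>g x\<bar> \<le> (B::real)"
  shows "ennreal ((expectation g)\<^sup>2) \<le> (\<integral>\<^sup>+x. ennreal ((g x)\<^sup>2) \<partial>M)"
proof -
  have i1: "integrable M g" by (rule integrable_const_bound[where B = B]) (auto simp: B)
  have "\<bar>(g x)\<^sup>2\<bar> \<le> B\<^sup>2" for x
    using B[of x] by (simp add: power2_le_iff_abs_le abs_le_square_iff[symmetric])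
  then have i2: "integrable M (\<lambda>x. (g x)\<^sup>2)" by (intro integrable_const_bound[where B = "B\<^sup>2"]) auto
  have "(expectation g)\<^sup>2 \<le> expectation (\<lambda>x. (g x)\<^sup>2)"
    using variance_positive[of g] variance_eq[OF i1 i2] by simp
  then have "ennreal ((expectation g)\<^sup>2) \<le> ennreal (expectation (\<lambda>x. (g x)\<^sup>2))" by (rule ennreal_leI)
  also have "\<dots> = (\<integral>\<^sup>+x. ennreal ((g x)\<^sup>2) \<partial>M)" by (rule nn_integral_eq_integral[symmetric]) (auto simp: i2)
  finally show ?thesis .
qed

lemma sum3_square_le: "(a + b + c)\<^sup>2 \<le> 3 * (a\<^sup>2 + b\<^sup>2 + c\<^sup>2)" for a b c :: real
proof -
  have "3 * (a\<^sup>2 + b\<^sup>2 + c\<^sup>2) - (a + b + c)\<^sup>2 = (a - b)\<^sup>2 + (b - c)\<^sup>2 + (a - c)\<^sup>2"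
    by (simp add: power2_eq_square algebra_simps)
  moreover have "0 \<le> (a - b)\<^sup>2 + (b - c)\<^sup>2 + (a - c)\<^sup>2" by simp
  ultimately show ?thesis by linarith
qed

lemma sum2_square_le: "(a + b)\<^sup>2 \<le> 2 * a\<^sup>2 + 2 * b\<^sup>2" for a b :: real
proof -
  have "2 * a\<^sup>2 + 2 * b\<^sup>2 - (a + b)\<^sup>2 = (a - b)\<^sup>2" by (simp add: power2_eq_square algebra_simps)
  then show ?thesis by (smt (verit) zero_le_power2)
qed

section \<open>Positivity of the Lyapunov exponent\<close>

text \<open>Determinants are prescribed at every point, so \<open>A\<close> is meant as a chosen
  version of the derivative; \<open>log_A\<close> controls its unboundedness. The ping-pong sets
  have positive measure so that averaged estimates can be evaluated at some of their points.\<close>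

locale hyperbolic_cocycle = spectral_gap +
  fixes A :: "'a \<Rightarrow> real^2^2" and S :: "(real^2) set" and X1 X2 X3 Y :: "'a set"
  assumes A_meas[measurable]: "A \<in> borel_measurable m"
    and det_A: "\<And>x. x \<in> space m \<Longrightarrow> \<bar>det (A x)\<bar> = 1"
    and log_A: "integrable m (\<lambda>x. ln (onorm ((*v) (A x))))"
    and S_sets[measurable]: "S \<in> sets borel"
    and X_sets[measurable]: "X1 \<in> sets m" "X2 \<in> sets m" "X3 \<in> sets m" "Y \<in> sets m"
    and X_pos: "0 < measure m X1" "0 < measure m X2" "0 < measure m X3" "0 < measure m Y"
    and pp: "\<And>x1 x2 x3 y. x1 \<in> X1 \<Longrightarrow> x2 \<in> X2 \<Longrightarrow> x3 \<in> X3 \<Longrightarrow> y \<in> Y \<Longrightarrow>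
      pingpong S (A x1) (A x2) (A x3) (A y)"
begin

interpretation L: pair_sigma_finite m "lborel :: (real^2) measure" ..

text \<open>The default 0 off the space keeps the result between 0 and 1 at every point, although
  \<open>P x\<close> is arbitrary there.\<close>

definition Pi_op :: "('a \<Rightarrow> real^2 \<Rightarrow> real) \<Rightarrow> 'a \<Rightarrow> real^2 \<Rightarrow> real" where
  "Pi_op f x v = (if x \<in> space m then \<integral>y. f y v \<partial>P x else 0)"

definition T_op :: "('a \<Rightarrow> real^2 \<Rightarrow> real) \<Rightarrow> 'a \<Rightarrow> real^2 \<Rightarrow> real" where
  "T_op f x v = Pi_op f x (A x *v v)"

text \<open>A class closed under both operators and containing the indicator of the unit disc; the
  pointwise bounds make every section integrable.\<close>

definition good :: "('a \<Rightarrow> real^2 \<Rightarrow> real) \<Rightarrow> bool" where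
  "good f \<longleftrightarrow> case_prod f \<in> borel_measurable (m \<Otimes>\<^sub>M borel) \<and> (\<forall>x v. 0 \<le> f x v \<and> f x v \<le> 1)"

lemma good_measurable:
  assumes "good f" "a \<in> N \<rightarrow>\<^sub>M m" "b \<in> N \<rightarrow>\<^sub>M borel"
  shows "(\<lambda>p. f (a p) (b p)) \<in> borel_measurable N"
proof -
  have "case_prod f \<in> borel_measurable (m \<Otimes>\<^sub>M borel)" using assms(1) by (simp add: good_def)
  from measurable_compose[OF measurable_Pair[OF assms(2,3)] this] show ?thesis by simp
qed

lemma goodD: "good f \<Longrightarrow> 0 \<le> f x v" "good f \<Longrightarrow> f x v \<le> 1"
  by (auto simp: good_def)

lemma good_section: "good f \<Longrightarrow> (\<lambda>y. f y v) \<in> borel_measurable m"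
  by (erule good_measurable) auto

lemma good_diff_bound: "good f \<Longrightarrow> \<bar>f x v - f y w\<bar> \<le> 1"
  using goodD[of f x v] goodD[of f y w] by simp

lemma kernel_param_measurable:
  assumes g: "(\<lambda>(x, v). g x v) \<in> borel_measurable (m \<Otimes>\<^sub>M borel)"
  shows "(\<lambda>(x, v). \<integral>\<^sup>+y. g y v \<partial>P x) \<in> borel_measurable (m \<Otimes>\<^sub>M (borel :: (real^2) measure))"
proof -
  have "(\<lambda>(p, y). g y (snd p)) \<in> borel_measurable ((m \<Otimes>\<^sub>M borel) \<Otimes>\<^sub>M m)"
    using measurable_compose[OF measurable_Pair[OF measurable_snd measurable_compose[OF measurable_fst measurable_snd]] g]
    by (simp add: split_beta')
  moreover have "(\<lambda>p. P (fst p)) \<in> m \<Otimes>\<^sub>M (borel :: (real^2) measure) \<rightarrow>\<^sub>M subprob_algebra m"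
    by measurable
  ultimately have "(\<lambda>p. \<integral>\<^sup>+y. g y (snd p) \<partial>P (fst p)) \<in> borel_measurable (m \<Otimes>\<^sub>M borel)"
    by (rule nn_integral_measurable_subprob_algebra2)
  then show ?thesis by (simp add: split_beta')
qed

lemma ennreal_Pi_op:
  assumes f: "good f" and x: "x \<in> space m"
  shows "ennreal (Pi_op f x v) = (\<integral>\<^sup>+y. ennreal (f y v) \<partial>P x)" and "Pi_op f x v \<le> 1" "0 \<le> Pi_op f x v"
proof -
  interpret Px: prob_space "P x" by (rule kernel_prob) fact
  have meas: "(\<lambda>y. f y v) \<in> borel_measurable (P x)"
    by (rule kernel_measurable[OF good_section[OF f] x])
  have int: "integrable (P x) (\<lambda>y. f y v)"
    using meas f by (intro Px.integrable_const_bound[where B = 1]) (auto simp: goodD)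
  show "ennreal (Pi_op f x v) = (\<integral>\<^sup>+y. ennreal (f y v) \<partial>P x)"
    using x by (simp add: Pi_op_def nn_integral_eq_integral[OF int] goodD[OF f])
  show "0 \<le> Pi_op f x v" by (simp add: Pi_op_def goodD[OF f])
  have "(\<integral>y. f y v \<partial>P x) \<le> (\<integral>y. 1 \<partial>P x)"
    by (rule integral_mono[OF int]) (auto simp: goodD[OF f])
  then show "Pi_op f x v \<le> 1" by (simp add: Pi_op_def Px.prob_space)
qed

lemma good_Pi_op:
  assumes f: "good f"
  shows "good (Pi_op f)"
proof -
  have fm: "(\<lambda>(x, v). ennreal (f x v)) \<in> borel_measurable (m \<Otimes>\<^sub>M borel)"
    using f by (auto simp: good_def split_beta')
  have "(\<lambda>(x, v). enn2real (\<integral>\<^sup>+y. ennreal (f y v) \<partial>P x)) \<in> borel_measurable (m \<Otimes>\<^sub>M borel)"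
    using kernel_param_measurable[OF fm] unfolding split_beta' by measurable
  moreover have "case_prod (Pi_op f) p = (case p of (x, v) \<Rightarrow> enn2real (\<integral>\<^sup>+y. ennreal (f y v) \<partial>P x))"
    if "p \<in> space (m \<Otimes>\<^sub>M (borel :: (real^2) measure))" for p
    using that ennreal_Pi_op[OF f, of "fst p" "snd p"]
    by (auto simp: space_pair_measure split_beta' simp flip: ennreal_Pi_op(1)[OF f])
  ultimately have "case_prod (Pi_op f) \<in> borel_measurable (m \<Otimes>\<^sub>M borel)"
    by (simp cong: measurable_cong)
  moreover have "0 \<le> Pi_op f x v \<and> Pi_op f x v \<le> 1" for x v
    using ennreal_Pi_op[OF f, of x v] by (cases "x \<in> space m") (auto simp: Pi_op_def)
  ultimately show ?thesis by (simp add: good_def)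
qed

lemma good_T_op:
  assumes f: "good f"
  shows "good (T_op f)"
proof -
  have "(\<lambda>p. Pi_op f (fst p) (A (fst p) *v snd p)) \<in> borel_measurable (m \<Otimes>\<^sub>M borel)"
    by (rule good_measurable[OF good_Pi_op[OF f]]) measurable
  then show ?thesis
    using goodD[OF good_Pi_op[OF f]] by (simp add: good_def T_op_def split_beta')
qed

definition sqn :: "('a \<Rightarrow> real^2 \<Rightarrow> real) \<Rightarrow> ennreal" where
  "sqn f = (\<integral>\<^sup>+x. (\<integral>\<^sup>+v. ennreal ((f x v)\<^sup>2) \<partial>lborel) \<partial>m)"

text \<open>Twice the variance in the first variable, integrated over the plane; extended values
  allow Tonelli's theorem without integrability conditions.\<close>

definition osc :: "('a \<Rightarrow> real^2 \<Rightarrow> real) \<Rightarrow> ennreal" where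
  "osc f = (\<integral>\<^sup>+x. (\<integral>\<^sup>+y. (\<integral>\<^sup>+v. ennreal ((f x v - f y v)\<^sup>2) \<partial>lborel) \<partial>m) \<partial>m)"

lemma swap:
  fixes g :: "'a \<Rightarrow> real^2 \<Rightarrow> ennreal"
  assumes "case_prod g \<in> borel_measurable (m \<Otimes>\<^sub>M borel)"
  shows "(\<integral>\<^sup>+x. (\<integral>\<^sup>+v. g x v \<partial>lborel) \<partial>m) = (\<integral>\<^sup>+v. (\<integral>\<^sup>+x. g x v \<partial>m) \<partial>lborel)"
proof -
  have "case_prod g \<in> borel_measurable (m \<Otimes>\<^sub>M lborel)"
    using assms by (simp cong: measurable_cong_sets)
  from L.Fubini'[of g, OF this] show ?thesis by simp
qed

lemma sqn_swap: "good f \<Longrightarrow> sqn f = (\<integral>\<^sup>+v. (\<integral>\<^sup>+x. ennreal ((f x v)\<^sup>2) \<partial>m) \<partial>lborel)"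
  unfolding sqn_def good_def by (intro swap) (auto simp: split_beta')

lemma osc_swap:
  assumes f: "good f"
  shows "osc f = (\<integral>\<^sup>+v. (\<integral>\<^sup>+x. (\<integral>\<^sup>+y. ennreal ((f x v - f y v)\<^sup>2) \<partial>m) \<partial>m) \<partial>lborel)"
proof -
  note [measurable (raw)] = good_measurable[OF f]
  have "osc f = (\<integral>\<^sup>+x. (\<integral>\<^sup>+v. (\<integral>\<^sup>+y. ennreal ((f x v - f y v)\<^sup>2) \<partial>m) \<partial>lborel) \<partial>m)"
    unfolding osc_def by (intro nn_integral_cong swap) measurable
  also have "\<dots> = (\<integral>\<^sup>+v. (\<integral>\<^sup>+x. (\<integral>\<^sup>+y. ennreal ((f x v - f y v)\<^sup>2) \<partial>m) \<partial>m) \<partial>lborel)"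
    by (intro swap) measurable
  finally show ?thesis .
qed

text \<open>For fixed \<open>v\<close> this is the spectral gap of the kernel, translated into
  extended integrals.\<close>

lemma gap_section:
  assumes f: "good f"
  shows "(\<integral>\<^sup>+x. ennreal ((Pi_op f x v)\<^sup>2) \<partial>m) + ennreal \<kappa> * (\<integral>\<^sup>+x. (\<integral>\<^sup>+y. ennreal ((f x v - f y v)\<^sup>2) \<partial>m) \<partial>m)
    \<le> (\<integral>\<^sup>+x. ennreal ((f x v)\<^sup>2) \<partial>m)"
proof -
  note [measurable (raw)] = good_measurable[OF f] good_measurable[OF good_Pi_op[OF f]]
  have sq1: "(f x v - f y v)\<^sup>2 \<le> 1" for x y
    using good_diff_bound[OF f] by (simp add: abs_square_le_1)
  have i1: "integrable m (\<lambda>y. (f x v - f y v)\<^sup>2)" if "x \<in> space m" for x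
    using sq1 that by (intro m.integrable_const_bound[where B = 1]) auto
  have i1_le: "(\<integral>y. (f x v - f y v)\<^sup>2 \<partial>m) \<le> 1" if "x \<in> space m" for x
    using integral_mono[OF i1[OF that], of "\<lambda>_. 1"] sq1 by (simp add: m.prob_space)
  have i2: "integrable m (\<lambda>x. \<integral>y. (f x v - f y v)\<^sup>2 \<partial>m)"
    using i1_le by (intro m.integrable_const_bound[where B = 1]) auto
  have i3: "integrable m (\<lambda>x. (f x v)\<^sup>2)"
    using goodD[OF f] by (intro m.integrable_const_bound[where B = 1]) (auto simp: abs_square_le_1)
  have i4: "integrable m (\<lambda>x. (Pi_op f x v)\<^sup>2)"
    using goodD[OF good_Pi_op[OF f]] by (intro m.integrable_const_bound[where B = 1]) (auto simp: abs_square_le_1)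
  have "(\<integral>x. (\<integral>y. f y v \<partial>P x)\<^sup>2 \<partial>m) + \<kappa> * (\<integral>x. (\<integral>y. (f x v - f y v)\<^sup>2 \<partial>m) \<partial>m) \<le> (\<integral>x. (f x v)\<^sup>2 \<partial>m)"
    by (rule gap) (auto simp: goodD[OF f] good_section[OF f])
  moreover have "(\<integral>x. (\<integral>y. f y v \<partial>P x)\<^sup>2 \<partial>m) = (\<integral>x. (Pi_op f x v)\<^sup>2 \<partial>m)"
    by (rule Bochner_Integration.integral_cong) (auto simp: Pi_op_def)
  ultimately have "ennreal ((\<integral>x. (Pi_op f x v)\<^sup>2 \<partial>m) + \<kappa> * (\<integral>x. (\<integral>y. (f x v - f y v)\<^sup>2 \<partial>m) \<partial>m)) \<le> ennreal (\<integral>x. (f x v)\<^sup>2 \<partial>m)"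
    by (intro ennreal_leI) simp
  moreover have "(\<integral>\<^sup>+x. (\<integral>\<^sup>+y. ennreal ((f x v - f y v)\<^sup>2) \<partial>m) \<partial>m) = ennreal (\<integral>x. (\<integral>y. (f x v - f y v)\<^sup>2 \<partial>m) \<partial>m)"
  proof -
    have "(\<integral>\<^sup>+x. (\<integral>\<^sup>+y. ennreal ((f x v - f y v)\<^sup>2) \<partial>m) \<partial>m) = (\<integral>\<^sup>+x. ennreal (\<integral>y. (f x v - f y v)\<^sup>2 \<partial>m) \<partial>m)"
      by (intro nn_integral_cong nn_integral_eq_integral i1) auto
    then show ?thesis using nn_integral_eq_integral[OF i2] by simp
  qed
  ultimately show ?thesis
    using gap_pos by (simp add: nn_integral_eq_integral[OF i3] nn_integral_eq_integral[OF i4] ennreal_mult)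
qed

lemma sqn_Pi_op:
  assumes f: "good f"
  shows "sqn (Pi_op f) + ennreal \<kappa> * osc f \<le> sqn f"
proof -
  note [measurable (raw)] = good_measurable[OF f] good_measurable[OF good_Pi_op[OF f]]
  have "sqn (Pi_op f) + ennreal \<kappa> * osc f = (\<integral>\<^sup>+v. (\<integral>\<^sup>+x. ennreal ((Pi_op f x v)\<^sup>2) \<partial>m) +
      ennreal \<kappa> * (\<integral>\<^sup>+x. (\<integral>\<^sup>+y. ennreal ((f x v - f y v)\<^sup>2) \<partial>m) \<partial>m) \<partial>lborel)"
    unfolding sqn_swap[OF good_Pi_op[OF f]] osc_swap[OF f]
    by (subst nn_integral_add) (simp_all add: nn_integral_cmult)
  also have "\<dots> \<le> sqn f"
    unfolding sqn_swap[OF f] by (intro nn_integral_mono gap_section[OF f])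
  finally show ?thesis .
qed

text \<open>Each \<open>A x\<close> preserves area, so composing with it does not change the
  integral over the vectors.\<close>

lemma sqn_T_op:
  assumes f: "good f"
  shows "sqn (T_op f) = sqn (Pi_op f)"
  unfolding sqn_def T_op_def
proof (rule nn_integral_cong)
  fix x assume x: "x \<in> space m"
  note [measurable (raw)] = good_measurable[OF good_Pi_op[OF f]]
  show "(\<integral>\<^sup>+v. ennreal ((Pi_op f x (A x *v v))\<^sup>2) \<partial>lborel) = (\<integral>\<^sup>+v. ennreal ((Pi_op f x v)\<^sup>2) \<partial>lborel)"
    by (rule nn_integral_lborel_matrix[OF det_A[OF x], where f = "\<lambda>v. ennreal ((Pi_op f x v)\<^sup>2)"])
       (use x in measurable)
qed

definition mean :: "('a \<Rightarrow> real^2 \<Rightarrow> real) \<Rightarrow> real^2 \<Rightarrow> real" where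
  "mean f v = (\<integral>y. f y v \<partial>m)"

lemma integrable_section: "good f \<Longrightarrow> integrable m (\<lambda>y. f y v)"
  using good_section[of f v] by (intro m.integrable_const_bound[where B = 1]) (auto simp: goodD)

lemma mean_measurable[measurable]:
  assumes f: "good f"
  shows "mean f \<in> borel_measurable borel"
proof -
  note [measurable (raw)] = good_measurable[OF f]
  show ?thesis unfolding mean_def by measurable
qed

lemma mean_bounds:
  assumes f: "good f"
  shows "0 \<le> mean f v" "mean f v \<le> 1"
  using integral_mono[OF integrable_section[OF f, of v], of "\<lambda>_. 1"]
  by (auto simp: mean_def goodD[OF f] m.prob_space)

text \<open>Jensen's inequality for the square, applied to \<open>f x v - f y v\<close> as a
  function of \<open>y\<close>.\<close>

lemma dist_mean_le:
  assumes f: "good f"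
  shows "(\<integral>\<^sup>+x. (\<integral>\<^sup>+v. ennreal ((f x v - mean f v)\<^sup>2) \<partial>lborel) \<partial>m) \<le> osc f"
proof -
  note [measurable (raw)] = good_measurable[OF f] measurable_compose[OF _ mean_measurable[OF f]]
  have "(\<integral>\<^sup>+x. (\<integral>\<^sup>+v. ennreal ((f x v - mean f v)\<^sup>2) \<partial>lborel) \<partial>m) = (\<integral>\<^sup>+v. (\<integral>\<^sup>+x. ennreal ((f x v - mean f v)\<^sup>2) \<partial>m) \<partial>lborel)"
    by (intro swap) measurable
  also have "\<dots> \<le> osc f"
    unfolding osc_swap[OF f]
  proof (intro nn_integral_mono)
    fix v x assume x: "x \<in> space m"
    have "f x v - mean f v = (\<integral>y. f x v - f y v \<partial>m)"
      by (simp add: mean_def integrable_section[OF f] m.prob_space)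
    then show "ennreal ((f x v - mean f v)\<^sup>2) \<le> (\<integral>\<^sup>+y. ennreal ((f x v - f y v)\<^sup>2) \<partial>m)"
      using m.square_expectation_le[of "\<lambda>y. f x v - f y v" 1] x good_diff_bound[OF f] by simp
  qed
  finally show ?thesis .
qed

text \<open>Preservation of area removes \<open>A x\<close>; Jensen's inequality under
  \<open>P x\<close> and the invariance of \<open>m\<close> then reduce the claim to
  \<open>dist_mean_le\<close>.\<close>

lemma T_op_mean_le:
  assumes f: "good f"
  shows "(\<integral>\<^sup>+x. (\<integral>\<^sup>+v. ennreal ((T_op f x v - mean f (A x *v v))\<^sup>2) \<partial>lborel) \<partial>m) \<le> osc f"
proof -
  note [measurable (raw)] = good_measurable[OF f] measurable_compose[OF _ mean_measurable[OF f]]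
    good_measurable[OF good_Pi_op[OF f]]
  define g where "g x v = ennreal ((f x v - mean f v)\<^sup>2)" for x v
  have g[measurable]: "(\<lambda>(x, v). g x v) \<in> borel_measurable (m \<Otimes>\<^sub>M borel)"
    unfolding g_def by measurable
  have "(\<integral>\<^sup>+x. (\<integral>\<^sup>+v. ennreal ((T_op f x v - mean f (A x *v v))\<^sup>2) \<partial>lborel) \<partial>m)
      \<le> (\<integral>\<^sup>+x. (\<integral>\<^sup>+v. (\<integral>\<^sup>+y. g y v \<partial>P x) \<partial>lborel) \<partial>m)"
  proof (rule nn_integral_mono)
    fix x assume x: "x \<in> space m"
    have "(\<integral>\<^sup>+v. ennreal ((T_op f x v - mean f (A x *v v))\<^sup>2) \<partial>lborel) = (\<integral>\<^sup>+v. ennreal ((Pi_op f x v - mean f v)\<^sup>2) \<partial>lborel)"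
      unfolding T_op_def
      by (rule nn_integral_lborel_matrix[OF det_A[OF x], where f = "\<lambda>v. ennreal ((Pi_op f x v - mean f v)\<^sup>2)"])
         (use x in measurable)
    also have "\<dots> \<le> (\<integral>\<^sup>+v. (\<integral>\<^sup>+y. g y v \<partial>P x) \<partial>lborel)"
    proof (intro nn_integral_mono)
      fix v
      interpret Px: prob_space "P x" by (rule kernel_prob) fact
      have m1: "(\<lambda>y. f y v) \<in> borel_measurable (P x)"
        by (rule kernel_measurable[OF good_section[OF f] x])
      have "integrable (P x) (\<lambda>y. f y v)"
        using m1 f by (intro Px.integrable_const_bound[where B = 1]) (auto simp: goodD)
      then have "Pi_op f x v - mean f v = (\<integral>y. f y v - mean f v \<partial>P x)"
        using x by (simp add: Pi_op_def Px.prob_space)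
      moreover have "\<bar>f y v - mean f v\<bar> \<le> 1" for y
        using goodD[OF f, of y v] mean_bounds[OF f, of v] by simp
      ultimately show "ennreal ((Pi_op f x v - mean f v)\<^sup>2) \<le> (\<integral>\<^sup>+y. g y v \<partial>P x)"
        using Px.square_expectation_le[of "\<lambda>y. f y v - mean f v" 1] m1 by (simp add: g_def)
    qed
    finally show "(\<integral>\<^sup>+v. ennreal ((T_op f x v - mean f (A x *v v))\<^sup>2) \<partial>lborel) \<le> (\<integral>\<^sup>+v. (\<integral>\<^sup>+y. g y v \<partial>P x) \<partial>lborel)" .
  qed
  also have "\<dots> = (\<integral>\<^sup>+v. (\<integral>\<^sup>+x. (\<integral>\<^sup>+y. g y v \<partial>P x) \<partial>m) \<partial>lborel)"
    by (intro swap kernel_param_measurable g)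
  also have "\<dots> = (\<integral>\<^sup>+v. (\<integral>\<^sup>+x. g x v \<partial>m) \<partial>lborel)"
    by (intro nn_integral_cong nn_integral_kernel) measurable
  also have "\<dots> = (\<integral>\<^sup>+x. (\<integral>\<^sup>+v. g x v \<partial>lborel) \<partial>m)"
    by (intro swap[symmetric] g)
  also have "\<dots> \<le> osc f" unfolding g_def by (rule dist_mean_le[OF f])
  finally show ?thesis .
qed

text \<open>Measures, on average over two collisions, how far \<open>h\<close> is from being
  invariant under the quotients of two values of \<open>A\<close>.\<close>

definition spread :: "(real^2 \<Rightarrow> real) \<Rightarrow> ennreal" where
  "spread h = (\<integral>\<^sup>+x. (\<integral>\<^sup>+y. L2dist h (A x) (A y) \<partial>m) \<partial>m)"

text \<open>Triangle inequality along \<open>mean f (A x *v v)\<close>, \<open>T_op f x v\<close>,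
  \<open>T_op f y v\<close>, \<open>mean f (A y *v v)\<close>. Squaring three terms costs the factor
  3, and 3 (2 osc f + osc (T_op f)) is rounded up.\<close>

lemma spread_mean_le:
  assumes f: "good f"
  shows "spread (mean f) \<le> 6 * (osc f + osc (T_op f))"
proof -
  note [measurable (raw)] = good_measurable[OF f] measurable_compose[OF _ mean_measurable[OF f]]
    good_measurable[OF good_T_op[OF f]]
  let ?a = "\<lambda>x v. ennreal ((T_op f x v - mean f (A x *v v))\<^sup>2)"
  let ?a' = "\<lambda>x. \<integral>\<^sup>+v. ?a x v \<partial>lborel"
  let ?b = "\<lambda>x y. \<integral>\<^sup>+v. ennreal ((T_op f x v - T_op f y v)\<^sup>2) \<partial>lborel"
  have ptw: "L2dist (mean f) (A x) (A y) \<le> 3 * (?a' x + ?b x y + ?a' y)" if xy[measurable]: "x \<in> space m" "y \<in> space m" for x y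
  proof -
    have "ennreal ((mean f (A x *v v) - mean f (A y *v v))\<^sup>2) \<le> 3 * (?a x v + ennreal ((T_op f x v - T_op f y v)\<^sup>2) + ?a y v)" for v
    proof -
      have "(mean f (A x *v v) - mean f (A y *v v))\<^sup>2 \<le>
        3 * ((T_op f x v - mean f (A x *v v))\<^sup>2 + (T_op f x v - T_op f y v)\<^sup>2 + (T_op f y v - mean f (A y *v v))\<^sup>2)"
        using sum3_square_le[of "mean f (A x *v v) - T_op f x v" "T_op f x v - T_op f y v" "T_op f y v - mean f (A y *v v)"]
        by (simp add: power2_commute[of "mean f (A x *v v)" "T_op f x v"])
      then have "ennreal ((mean f (A x *v v) - mean f (A y *v v))\<^sup>2) \<le>
        ennreal (3 * ((T_op f x v - mean f (A x *v v))\<^sup>2 + (T_op f x v - T_op f y v)\<^sup>2 + (T_op f y v - mean f (A y *v v))\<^sup>2))"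
        by (rule ennreal_leI)
      also have "\<dots> = 3 * (?a x v + ennreal ((T_op f x v - T_op f y v)\<^sup>2) + ?a y v)"
        by (simp only: ennreal_mult' ennreal_plus add_nonneg_nonneg zero_le_power2 zero_le_numeral ennreal_numeral)
      finally show ?thesis .
    qed
    then have "L2dist (mean f) (A x) (A y) \<le> (\<integral>\<^sup>+v. 3 * (?a x v + ennreal ((T_op f x v - T_op f y v)\<^sup>2) + ?a y v) \<partial>lborel)"
      unfolding L2dist_def by (rule nn_integral_mono)
    also have "\<dots> = 3 * (?a' x + ?b x y + ?a' y)"
      by (simp add: nn_integral_cmult nn_integral_add)
    finally show ?thesis .
  qed
  have am[measurable]: "?a' \<in> borel_measurable m" by measurable
  have bm[measurable]: "(\<lambda>(x, y). ?b x y) \<in> borel_measurable (m \<Otimes>\<^sub>M m)" by measurable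
  have a: "(\<integral>\<^sup>+x. ?a' x \<partial>m) \<le> osc f" by (rule T_op_mean_le[OF f])
  have "spread (mean f) \<le> (\<integral>\<^sup>+x. (\<integral>\<^sup>+y. 3 * (?a' x + ?b x y + ?a' y) \<partial>m) \<partial>m)"
    unfolding spread_def by (intro nn_integral_mono ptw)
  also have "\<dots> = (\<integral>\<^sup>+x. 3 * (?a' x + (\<integral>\<^sup>+y. ?b x y \<partial>m) + (\<integral>\<^sup>+y. ?a' y \<partial>m)) \<partial>m)"
  proof (rule nn_integral_cong)
    fix x assume x[measurable]: "x \<in> space m"
    have [measurable]: "(\<lambda>y. ?b x y) \<in> borel_measurable m" by measurable
    show "(\<integral>\<^sup>+y. 3 * (?a' x + ?b x y + ?a' y) \<partial>m) = 3 * (?a' x + (\<integral>\<^sup>+y. ?b x y \<partial>m) + (\<integral>\<^sup>+y. ?a' y \<partial>m))"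
      by (subst nn_integral_cmult, measurable, subst nn_integral_add, measurable, subst nn_integral_add, measurable)
         (simp add: m.emeasure_space_1)
  qed
  also have "\<dots> = 3 * ((\<integral>\<^sup>+x. ?a' x \<partial>m) + (\<integral>\<^sup>+x. (\<integral>\<^sup>+y. ?b x y \<partial>m) \<partial>m) + (\<integral>\<^sup>+y. ?a' y \<partial>m))"
    by (subst nn_integral_cmult, measurable, subst nn_integral_add, measurable, subst nn_integral_add, measurable)
       (simp add: m.emeasure_space_1)
  also have "\<dots> \<le> 3 * (osc f + osc (T_op f) + osc f)"
    unfolding osc_def[of "T_op f"] by (intro mult_left_mono add_mono a order_refl) auto
  also have "\<dots> \<le> 6 * (osc f + osc (T_op f))"
  proof -
    have "3 * (osc f + osc (T_op f) + osc f) \<le> 3 * ((osc f + osc (T_op f)) + (osc f + osc (T_op f)))"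
      by (intro mult_left_mono add_mono) auto
    also have "\<dots> = 6 * (osc f + osc (T_op f))" by (simp add: mult_2[symmetric] mult.assoc[symmetric])
    finally show ?thesis .
  qed
  finally show ?thesis .
qed

end

section \<open>Contraction of the squared operator and decay of areas\<close>

context hyperbolic_cocycle
begin

lemma mean_sq_le:
  assumes f: "good f" and fin: "sqn f < \<infinity>"
  shows "(\<integral>\<^sup>+v. ennreal ((mean f v)\<^sup>2) \<partial>lborel) \<le> sqn f"
proof -
  note [measurable (raw)] = good_measurable[OF f]
  show ?thesis
    unfolding sqn_swap[OF f]
  proof (rule nn_integral_mono)
    fix v
    show "ennreal ((mean f v)\<^sup>2) \<le> (\<integral>\<^sup>+x. ennreal ((f x v)\<^sup>2) \<partial>m)"
      unfolding mean_def
      by (rule m.square_expectation_le[where B = 1]) (auto simp: good_section[OF f] goodD[OF f])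
  qed
qed

text \<open>For fixed \<open>y\<close>, each of the three \<open>X\<close>-sets has a point at which
  the distance is at most the average over all collisions divided by the mass of that set. The
  ping-pong bound at these points has three terms with factor 18, hence 54. Choosing
  \<open>y\<close> in \<open>Y\<close> in the same way contributes the second factor of the
  constant.\<close>

lemma mean_le_spread:
  obtains c :: real where "0 < c" "c \<le> 1"
    "\<And>f. good f \<Longrightarrow> sqn f < \<infinity> \<Longrightarrow>
       ennreal c * (\<integral>\<^sup>+v. ennreal ((mean f v)\<^sup>2) \<partial>lborel) \<le> 54 * spread (mean f)"
proof -
  define c where "c = Min {measure m X1, measure m X2, measure m X3}"
  have c: "0 < c" "c \<le> measure m X1" "c \<le> measure m X2" "c \<le> measure m X3"
    using X_pos by (auto simp: c_def)
  define \<nu> where "\<nu> = measure m Y"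
  have \<nu>: "0 < \<nu>" "\<nu> \<le> 1" using X_pos m.prob_le_1[of Y] by (auto simp: \<nu>_def)
  have c1: "c \<le> 1" using c m.prob_le_1[of X1] by linarith
  show thesis
  proof (rule that)
    show "0 < c * \<nu>" using c \<nu> by simp
    show "c * \<nu> \<le> 1" using c1 c(1) \<nu> by (intro mult_le_one) auto
    fix f assume f: "good f" and fin: "sqn f < \<infinity>"
    note [measurable] = mean_measurable[OF f]
    let ?N = "\<integral>\<^sup>+v. ennreal ((mean f v)\<^sup>2) \<partial>lborel"
    let ?E = "\<lambda>x y. L2dist (mean f) (A x) (A y)"
    let ?G = "\<lambda>y. \<integral>\<^sup>+x. ?E x y \<partial>m"
    have Nfin: "?N < \<infinity>" using mean_sq_le[OF f fin] fin by (rule le_less_trans)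
    have E[measurable]: "(\<lambda>(x, y). ?E x y) \<in> borel_measurable (m \<Otimes>\<^sub>M m)"
      unfolding L2dist_def by measurable
    have avg: "\<exists>x\<in>X. ?E x y * ennreal c \<le> ?G y"
      if X: "X \<in> sets m" "c \<le> measure m X" and y[measurable]: "y \<in> space m" for X y
    proof -
      have [measurable]: "(\<lambda>x. ?E x y) \<in> borel_measurable m" by measurable
      have "\<exists>x\<in>X. ?E x y * emeasure m X \<le> ?G y"
        using X c(1) by (intro ex_average_le) (auto simp: m.emeasure_eq_measure)
      then obtain x where "x \<in> X" "?E x y * emeasure m X \<le> ?G y" by blast
      moreover have "?E x y * ennreal c \<le> ?E x y * emeasure m X"
        using X(2) by (intro mult_left_mono) (auto simp: m.emeasure_eq_measure intro: ennreal_leI)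
      ultimately show ?thesis by (meson order_trans)
    qed
    have NG: "ennreal c * ?N \<le> 54 * ?G y" if y: "y \<in> Y" for y
    proof -
      have ys: "y \<in> space m" using y sets.sets_into_space[OF X_sets(4)] by auto
      obtain x1 where x1: "x1 \<in> X1" "?E x1 y * ennreal c \<le> ?G y" using avg[OF X_sets(1) c(2) ys] by blast
      obtain x2 where x2: "x2 \<in> X2" "?E x2 y * ennreal c \<le> ?G y" using avg[OF X_sets(2) c(3) ys] by blast
      obtain x3 where x3: "x3 \<in> X3" "?E x3 y * ennreal c \<le> ?G y" using avg[OF X_sets(3) c(4) ys] by blast
      have sp: "x1 \<in> space m" "x2 \<in> space m" "x3 \<in> space m"
        using x1 x2 x3 sets.sets_into_space[OF X_sets(1)] sets.sets_into_space[OF X_sets(2)] sets.sets_into_space[OF X_sets(3)] by auto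
      have "?N \<le> 18 * (?E x1 y + ?E x2 y + ?E x3 y)"
        by (rule pingpong_mass[OF det_A det_A det_A det_A S_sets pp mean_measurable[OF f] Nfin])
           (use sp ys x1 x2 x3 y in auto)
      then have "ennreal c * ?N \<le> ennreal c * (18 * (?E x1 y + ?E x2 y + ?E x3 y))"
        by (rule mult_left_mono) simp
      also have "\<dots> = 18 * (?E x1 y * ennreal c + ?E x2 y * ennreal c + ?E x3 y * ennreal c)"
        by (simp add: algebra_simps)
      also have "\<dots> \<le> 18 * (?G y + ?G y + ?G y)"
        by (intro mult_left_mono add_mono x1 x2 x3) simp
      also have "\<dots> = 54 * ?G y"
        by (simp add: mult_2[symmetric] mult.assoc[symmetric] distrib_right[symmetric] distrib_left)
      finally show ?thesis .
    qed
    have [measurable]: "?G \<in> borel_measurable m"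
      by measurable
    have "\<exists>y\<in>Y. ?G y * emeasure m Y \<le> (\<integral>\<^sup>+y. ?G y \<partial>m)"
      using X_pos by (intro ex_average_le) (auto simp: m.emeasure_eq_measure)
    then obtain y where y: "y \<in> Y" "?G y * emeasure m Y \<le> (\<integral>\<^sup>+y. ?G y \<partial>m)" by blast
    have "(\<integral>\<^sup>+y. ?G y \<partial>m) = spread (mean f)"
      unfolding spread_def by (intro nn_integral_cong) (simp add: L2dist_commute)
    with y have Gy: "?G y * ennreal \<nu> \<le> spread (mean f)" by (simp add: \<nu>_def m.emeasure_eq_measure)
    have "ennreal (c * \<nu>) * ?N = (ennreal c * ?N) * ennreal \<nu>"
      using c \<nu> by (simp add: ennreal_mult algebra_simps)
    also have "\<dots> \<le> (54 * ?G y) * ennreal \<nu>" by (intro mult_right_mono NG y) simp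
    also have "\<dots> = 54 * (?G y * ennreal \<nu>)" by (simp add: mult.assoc)
    also have "\<dots> \<le> 54 * spread (mean f)" by (intro mult_left_mono Gy) simp
    finally show "ennreal (c * \<nu>) * ?N \<le> 54 * spread (mean f)" .
  qed
qed

text \<open>\<open>f\<close> is split into its mean over the first variable and the deviation from
  it.\<close>

lemma sqn_le_mean_osc:
  assumes f: "good f"
  shows "sqn f \<le> 2 * (\<integral>\<^sup>+v. ennreal ((mean f v)\<^sup>2) \<partial>lborel) + 2 * osc f"
proof -
  note [measurable (raw)] = good_measurable[OF f] measurable_compose[OF _ mean_measurable[OF f]]
  let ?N = "\<integral>\<^sup>+v. ennreal ((mean f v)\<^sup>2) \<partial>lborel"
  let ?d = "\<lambda>x. \<integral>\<^sup>+v. ennreal ((f x v - mean f v)\<^sup>2) \<partial>lborel"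
  have "sqn f \<le> (\<integral>\<^sup>+x. 2 * ?N + 2 * ?d x \<partial>m)"
    unfolding sqn_def
  proof (rule nn_integral_mono)
    fix x assume x[measurable]: "x \<in> space m"
    have "(\<integral>\<^sup>+v. ennreal ((f x v)\<^sup>2) \<partial>lborel) \<le> (\<integral>\<^sup>+v. 2 * ennreal ((mean f v)\<^sup>2) + 2 * ennreal ((f x v - mean f v)\<^sup>2) \<partial>lborel)"
    proof (rule nn_integral_mono)
      fix v
      have "ennreal ((f x v)\<^sup>2) \<le> ennreal (2 * (mean f v)\<^sup>2 + 2 * (f x v - mean f v)\<^sup>2)"
        using sum2_square_le[of "mean f v" "f x v - mean f v"] by (intro ennreal_leI) simp
      also have "\<dots> = 2 * ennreal ((mean f v)\<^sup>2) + 2 * ennreal ((f x v - mean f v)\<^sup>2)"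
        by (simp only: ennreal_mult' ennreal_plus mult_nonneg_nonneg zero_le_power2 zero_le_numeral ennreal_numeral)
      finally show "ennreal ((f x v)\<^sup>2) \<le> 2 * ennreal ((mean f v)\<^sup>2) + 2 * ennreal ((f x v - mean f v)\<^sup>2)" .
    qed
    also have "\<dots> = 2 * ?N + 2 * ?d x"
      by (simp add: nn_integral_add nn_integral_cmult)
    finally show "(\<integral>\<^sup>+v. ennreal ((f x v)\<^sup>2) \<partial>lborel) \<le> 2 * ?N + 2 * ?d x" .
  qed
  also have "\<dots> = 2 * ?N + 2 * (\<integral>\<^sup>+x. ?d x \<partial>m)"
    by (simp add: nn_integral_add nn_integral_cmult m.emeasure_space_1)
  also have "\<dots> \<le> 2 * ?N + 2 * osc f"
    by (intro add_mono mult_left_mono dist_mean_le[OF f]) auto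
  finally show ?thesis .
qed

text \<open>If neither \<open>f\<close> nor its image under the operator oscillates in the first variable, then the
  mean of \<open>f\<close> is almost invariant under all pairs of matrices, which the ping-pong sets forbid.\<close>

lemma osc_lower_bound:
  obtains \<delta> :: real where "0 < \<delta>"
    "\<And>f. good f \<Longrightarrow> sqn f < \<infinity> \<Longrightarrow> ennreal \<delta> * sqn f \<le> osc f + osc (T_op f)"
proof -
  obtain c where c: "0 < c" "c \<le> 1" and mean: "\<And>f. good f \<Longrightarrow> sqn f < \<infinity> \<Longrightarrow>
       ennreal c * (\<integral>\<^sup>+v. ennreal ((mean f v)\<^sup>2) \<partial>lborel) \<le> 54 * spread (mean f)"
    using mean_le_spread by blast
  show thesis
  proof (rule that)
    \<comment> \<open>650 = 2 * 54 * 6 + 2: the 54 and the 6 come from the two estimates for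
      \<open>spread\<close>, the factors 2 from \<open>sqn_le_mean_osc\<close>.\<close>
    show "0 < c / 650" using c by simp
    fix f assume f: "good f" and fin: "sqn f < \<infinity>"
    let ?N = "\<integral>\<^sup>+v. ennreal ((mean f v)\<^sup>2) \<partial>lborel"
    let ?o = "osc f + osc (T_op f)"
    have "ennreal c * sqn f \<le> ennreal c * (2 * ?N + 2 * osc f)"
      by (intro mult_left_mono sqn_le_mean_osc[OF f]) simp
    also have "\<dots> = 2 * (ennreal c * ?N) + 2 * (ennreal c * osc f)"
      by (simp add: algebra_simps)
    also have "\<dots> \<le> 2 * (54 * (6 * ?o)) + 2 * (1 * ?o)"
    proof -
      have h1: "ennreal c * ?N \<le> 54 * (6 * ?o)"
        using mean[OF f fin] spread_mean_le[OF f] by (meson mult_left_mono order_trans zero_le)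
      have h2: "ennreal c * osc f \<le> 1 * ?o" using c(2) by (intro mult_mono) (auto simp: ennreal_le_1)
      show ?thesis by (intro add_mono mult_left_mono h1 h2) auto
    qed
    also have "\<dots> = (2 * (54 * 6) + 2) * ?o" by (simp only: distrib_right mult.assoc mult_1_left)
    also have "(2 * (54 * 6) + 2 :: ennreal) = 650" by simp
    finally have "ennreal c * sqn f \<le> 650 * ?o" .
    then have "ennreal (1/650) * (ennreal c * sqn f) \<le> ennreal (1/650) * (650 * ?o)"
      by (rule mult_left_mono) simp
    moreover have "ennreal (1/650) * (ennreal c * sqn f) = ennreal (c / 650) * sqn f"
      using c by (simp add: ennreal_mult[symmetric] mult.assoc[symmetric])
    moreover have "ennreal (1/650) * 650 = 1"
      by (simp add: ennreal_mult[symmetric] flip: ennreal_numeral ennreal_1)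
    then have "ennreal (1/650) * (650 * ?o) = ?o"
      by (simp only: mult.assoc[symmetric] mult_1_left)
    ultimately show "ennreal (c / 650) * sqn f \<le> ?o" by simp
  qed
qed

text \<open>The losses of two consecutive applications add up to \<kappa> times the sum of the two
  oscillations, which is bounded below by \<open>osc_lower_bound\<close>.\<close>

lemma sqn_contraction:
  obtains q :: real where "0 < q" "q < 1"
    "\<And>f. good f \<Longrightarrow> sqn f < \<infinity> \<Longrightarrow> sqn (T_op (T_op f)) \<le> ennreal q * sqn f"
proof -
  obtain \<delta> where \<delta>: "0 < \<delta>" and low: "\<And>f. good f \<Longrightarrow> sqn f < \<infinity> \<Longrightarrow> ennreal \<delta> * sqn f \<le> osc f + osc (T_op f)"
    using osc_lower_bound by blast
  \<comment> \<open>The maximum with 1/2 keeps \<open>q\<close> positive even if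
    \<open>\<kappa> * \<delta>\<close> is 1 or more.\<close>
  define q where "q = max (1/2) (1 - \<kappa> * \<delta>)"
  show thesis
  proof (rule that)
    show "0 < q" "q < 1" using \<delta> gap_pos by (auto simp: q_def)
    fix f assume f: "good f" and fin: "sqn f < \<infinity>"
    have 1: "sqn (T_op f) + ennreal \<kappa> * osc f \<le> sqn f"
      using sqn_Pi_op[OF f] sqn_T_op[OF f] by simp
    have 2: "sqn (T_op (T_op f)) + ennreal \<kappa> * osc (T_op f) \<le> sqn (T_op f)"
      using sqn_Pi_op[OF good_T_op[OF f]] sqn_T_op[OF good_T_op[OF f]] by simp
    have "sqn (T_op (T_op f)) + ennreal \<kappa> * (ennreal \<delta> * sqn f) \<le> sqn (T_op (T_op f)) + ennreal \<kappa> * (osc f + osc (T_op f))"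
      by (intro add_mono mult_left_mono low f fin) auto
    also have "\<dots> = (sqn (T_op (T_op f)) + ennreal \<kappa> * osc (T_op f)) + ennreal \<kappa> * osc f"
      by (simp add: algebra_simps)
    also have "\<dots> \<le> sqn (T_op f) + ennreal \<kappa> * osc f" by (intro add_mono 2) simp
    also have "\<dots> \<le> sqn f" by (rule 1)
    finally have le: "sqn (T_op (T_op f)) + ennreal \<kappa> * (ennreal \<delta> * sqn f) \<le> sqn f" .
    obtain s where s: "sqn f = ennreal s" "0 \<le> s" using fin by (metis ennreal_cases less_irrefl infinity_ennreal_def)
    have "sqn (T_op (T_op f)) \<le> sqn f"
      using le order_trans[OF _ le, of "sqn (T_op (T_op f))"] by (simp add: le_iff_add) 
    then have "sqn (T_op (T_op f)) < \<infinity>" using fin by (rule le_less_trans)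
    then obtain t where t: "sqn (T_op (T_op f)) = ennreal t" "0 \<le> t" by (metis ennreal_cases less_irrefl infinity_ennreal_def)
    have "t + \<kappa> * (\<delta> * s) \<le> s"
      using le s t \<delta> gap_pos by (simp flip: ennreal_mult ennreal_plus)
    then have "t \<le> (1 - \<kappa> * \<delta>) * s" by (simp add: algebra_simps)
    also have "\<dots> \<le> q * s" using s by (intro mult_right_mono) (auto simp: q_def)
    finally show "sqn (T_op (T_op f)) \<le> ennreal q * sqn f"
      using s t \<open>0 < q\<close> by (simp add: ennreal_leI flip: ennreal_mult)
  qed
qed

text \<open>\<open>Fn n x v\<close> is the probability that the process started at \<open>x\<close>
  carries the vector \<open>v\<close> into the unit disc after \<open>n\<close> steps;
  \<open>Fn_law\<close> is the averaged form of this.\<close>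

definition Fn :: "nat \<Rightarrow> 'a \<Rightarrow> real^2 \<Rightarrow> real" where
  "Fn n = (T_op ^^ n) (\<lambda>x v. indicator (cball 0 1) v)"

definition vol :: real where "vol = measure lborel (cball 0 1 :: (real^2) set)"

lemma vol: "emeasure lborel (cball 0 1 :: (real^2) set) = ennreal vol" "0 < vol"
proof -
  show "emeasure lborel (cball 0 1 :: (real^2) set) = ennreal vol"
    unfolding vol_def using emeasure_lborel_cball_finite[of "0::real^2" 1]
    by (intro emeasure_eq_ennreal_measure) (simp add: less_top)
qed (simp add: vol_def content_cball_pos)

lemma good_Fn: "good (Fn n)"
proof (induction n)
  case 0
  show ?case by (simp add: Fn_def good_def indicator_def)
next
  case (Suc n)
  then show ?case using good_T_op by (simp add: Fn_def)
qed

lemma sqn_Fn_0: "sqn (Fn 0) = ennreal vol"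
proof -
  have "sqn (Fn 0) = (\<integral>\<^sup>+x. (\<integral>\<^sup>+v. indicator (cball 0 1 :: (real^2) set) v \<partial>lborel) \<partial>m)"
    unfolding sqn_def Fn_def by (intro nn_integral_cong) (auto split: split_indicator)
  then show ?thesis by (simp add: m.emeasure_space_1 vol)
qed

text \<open>The contraction is available for two applications at a time, hence the even
  indices.\<close>

lemma sqn_Fn_even:
  assumes q: "0 < q" and contr: "\<And>f. good f \<Longrightarrow> sqn f < \<infinity> \<Longrightarrow> sqn (T_op (T_op f)) \<le> ennreal q * sqn f"
  shows "sqn (Fn (2 * n)) \<le> ennreal (q ^ n * vol)"
proof (induction n)
  case 0
  show ?case using sqn_Fn_0 by simp
next
  case (Suc n)
  have "sqn (Fn (2 * Suc n)) = sqn (T_op (T_op (Fn (2 * n))))"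
    by (simp add: Fn_def)
  also have "\<dots> \<le> ennreal q * sqn (Fn (2 * n))"
    by (rule contr[OF good_Fn]) (use Suc in \<open>auto intro: le_less_trans\<close>)
  also have "\<dots> \<le> ennreal q * ennreal (q ^ n * vol)" by (intro mult_left_mono Suc) simp
  also have "\<dots> = ennreal (q ^ Suc n * vol)" using q vol(2) by (simp add: ennreal_mult[symmetric] mult.assoc)
  finally show ?case .
qed

lemma cocycle_measurable[measurable]: "cocycle A n \<in> borel_measurable paths"
  by (induction n) (simp_all, measurable)

lemma cocycle_cong: "(\<And>i. i < n \<Longrightarrow> \<omega> i = \<omega>' i) \<Longrightarrow> cocycle A n \<omega> = cocycle A n \<omega>'"
proof (induction n)
  case (Suc n)
  have "cocycle A n \<omega> = cocycle A n \<omega>'" by (rule Suc.IH) (simp add: Suc.prems)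
  then show ?case using Suc.prems[of n] by simp
qed simp

lemma det_cocycle: "\<omega> \<in> space paths \<Longrightarrow> \<bar>det (cocycle A n \<omega>)\<bar> = 1"
  by (induction n) (auto simp: det_mul abs_mult det_A space_PiM PiE_iff det_I)

text \<open>One application of the operator is exchanged for one step of the process: the kernel
  integral in \<open>T_op\<close> is the conditional expectation given the first
  \<open>n + 1\<close> collisions, which determine \<open>cocycle A (Suc n)\<close>.\<close>

lemma Fn_step:
  "(\<integral>\<^sup>+\<omega>. ennreal (Fn (Suc k) (\<omega> n) (cocycle A n \<omega> *v v)) \<partial>law) =
   (\<integral>\<^sup>+\<omega>. ennreal (Fn k (\<omega> (Suc n)) (cocycle A (Suc n) \<omega> *v v)) \<partial>law)"
proof -
  note [measurable (raw)] = good_measurable[OF good_Fn]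
  have "(\<integral>\<^sup>+\<omega>. ennreal (Fn k (\<omega> (Suc n)) (cocycle A (Suc n) \<omega> *v v)) \<partial>law) =
    (\<integral>\<^sup>+\<omega>. (\<integral>\<^sup>+y. ennreal (Fn k y (cocycle A (Suc n) \<omega> *v v)) \<partial>P (\<omega> n)) \<partial>law)"
  proof (rule nn_integral_step[where F = "\<lambda>\<omega> y. ennreal (Fn k y (cocycle A (Suc n) \<omega> *v v))"])
    show "(\<lambda>(\<omega>, y). ennreal (Fn k y (cocycle A (Suc n) \<omega> *v v))) \<in> borel_measurable (paths \<Otimes>\<^sub>M m)"
      by measurable
    fix \<omega> \<omega>' :: "nat \<Rightarrow> 'a" and y assume "\<And>i. i \<le> n \<Longrightarrow> \<omega> i = \<omega>' i"
    then have "cocycle A (Suc n) \<omega> = cocycle A (Suc n) \<omega>'" by (intro cocycle_cong) simp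
    then show "ennreal (Fn k y (cocycle A (Suc n) \<omega> *v v)) = ennreal (Fn k y (cocycle A (Suc n) \<omega>' *v v))"
      by (simp only:)
  qed
  also have "\<dots> = (\<integral>\<^sup>+\<omega>. ennreal (Fn (Suc k) (\<omega> n) (cocycle A n \<omega> *v v)) \<partial>law)"
  proof (rule nn_integral_cong)
    fix \<omega> assume "\<omega> \<in> space law"
    then have "\<omega> n \<in> space m" by (simp add: space_law space_PiM PiE_iff)
    from ennreal_Pi_op(1)[OF good_Fn this, of k "cocycle A (Suc n) \<omega> *v v"]
    show "(\<integral>\<^sup>+y. ennreal (Fn k y (cocycle A (Suc n) \<omega> *v v)) \<partial>P (\<omega> n)) = ennreal (Fn (Suc k) (\<omega> n) (cocycle A n \<omega> *v v))"
      by (simp add: Fn_def T_op_def matrix_vector_mul_assoc)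
  qed
  finally show ?thesis by simp
qed

lemma Fn_law:
  "(\<integral>\<^sup>+x. ennreal (Fn n x v) \<partial>m) = (\<integral>\<^sup>+\<omega>. indicator (cball 0 1) (cocycle A n \<omega> *v v) \<partial>law)"
proof -
  note [measurable (raw)] = good_measurable[OF good_Fn]
  have "(\<integral>\<^sup>+\<omega>. ennreal (Fn n (\<omega> k) (cocycle A k \<omega> *v v)) \<partial>law) =
     (\<integral>\<^sup>+\<omega>. ennreal (Fn 0 (\<omega> (n + k)) (cocycle A (n + k) \<omega> *v v)) \<partial>law)" for k
  proof (induction n arbitrary: k)
    case (Suc n)
    show ?case using Fn_step[of n k v] Suc[of "Suc k"] by (simp del: cocycle.simps)
  qed simp
  from this[of 0] have "(\<integral>\<^sup>+\<omega>. ennreal (Fn n (\<omega> 0) v) \<partial>law) = (\<integral>\<^sup>+\<omega>. ennreal (Fn 0 (\<omega> n) (cocycle A n \<omega> *v v)) \<partial>law)"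
    by simp
  moreover have "(\<integral>\<^sup>+\<omega>. ennreal (Fn n (\<omega> 0) v) \<partial>law) = (\<integral>\<^sup>+x. ennreal (Fn n x v) \<partial>m)"
    by (rule nn_integral_law_0) measurable
  moreover have "ennreal (Fn 0 x w) = indicator (cball 0 1) w" for x w
    by (simp add: Fn_def split: split_indicator)
  ultimately show ?thesis by simp
qed

lemma law_swap:
  fixes g :: "(nat \<Rightarrow> 'a) \<Rightarrow> real^2 \<Rightarrow> ennreal"
  assumes "case_prod g \<in> borel_measurable (paths \<Otimes>\<^sub>M borel)"
  shows "(\<integral>\<^sup>+\<omega>. (\<integral>\<^sup>+v. g \<omega> v \<partial>lborel) \<partial>law) = (\<integral>\<^sup>+v. (\<integral>\<^sup>+\<omega>. g \<omega> v \<partial>law) \<partial>lborel)"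
proof -
  interpret LL: pair_sigma_finite law "lborel :: (real^2) measure" ..
  have "case_prod g \<in> borel_measurable (law \<Otimes>\<^sub>M lborel)"
    using assms by (simp cong: measurable_cong_sets)
  from LL.Fubini'[of g, OF this] show ?thesis by simp
qed

text \<open>A matrix of determinant \<open>\<plusminus>1\<close> and norm \<open>N\<close> keeps a part of the unit disc of relative area
  at least \<open>1 / N\<^sup>2\<close> inside the unit disc, and the expected area is the scalar product of \<open>Fn 0\<close>
  and \<open>Fn n\<close>.\<close>

lemma inverse_square_norm_le:
  assumes t: "0 < t" and sq: "sqn (Fn n) \<le> ennreal (t\<^sup>2 * vol)"
  shows "(\<integral>\<^sup>+\<omega>. ennreal (1 / (onorm ((*v) (cocycle A n \<omega>)))\<^sup>2) \<partial>law) \<le> ennreal t"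
proof -
  note [measurable (raw)] = good_measurable[OF good_Fn]
  let ?I = "\<integral>\<^sup>+\<omega>. ennreal (1 / (onorm ((*v) (cocycle A n \<omega>)))\<^sup>2) \<partial>law"
  let ?B = "cball 0 1 :: (real^2) set"
  have [measurable]: "?B \<in> sets borel" by simp
  have "ennreal vol * ?I = (\<integral>\<^sup>+\<omega>. ennreal vol * ennreal (1 / (onorm ((*v) (cocycle A n \<omega>)))\<^sup>2) \<partial>law)"
    by (rule nn_integral_cmult[symmetric]) measurable
  also have "\<dots> \<le> (\<integral>\<^sup>+\<omega>. (\<integral>\<^sup>+v. indicator ?B v * indicator ?B (cocycle A n \<omega> *v v) \<partial>lborel) \<partial>law)"
  proof (rule nn_integral_mono)
    fix \<omega> assume "\<omega> \<in> space law"
    then have "1 \<le> onorm ((*v) (cocycle A n \<omega>))"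
      by (intro onorm_ge_1 det_cocycle) (simp add: space_law)
    from area_lower_bound[OF this]
    show "ennreal vol * ennreal (1 / (onorm ((*v) (cocycle A n \<omega>)))\<^sup>2) \<le>
      (\<integral>\<^sup>+v. indicator ?B v * indicator ?B (cocycle A n \<omega> *v v) \<partial>lborel)" by (simp add: vol)
  qed
  also have "\<dots> = (\<integral>\<^sup>+v. (\<integral>\<^sup>+\<omega>. indicator ?B v * indicator ?B (cocycle A n \<omega> *v v) \<partial>law) \<partial>lborel)"
    by (rule law_swap) measurable
  also have "\<dots> = (\<integral>\<^sup>+v. indicator ?B v * (\<integral>\<^sup>+x. ennreal (Fn n x v) \<partial>m) \<partial>lborel)"
    unfolding Fn_law by (intro nn_integral_cong nn_integral_cmult) measurable
  also have "\<dots> = (\<integral>\<^sup>+v. (\<integral>\<^sup>+x. indicator ?B v * ennreal (Fn n x v) \<partial>m) \<partial>lborel)"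
    by (intro nn_integral_cong nn_integral_cmult[symmetric]) measurable
  also have "\<dots> = (\<integral>\<^sup>+x. (\<integral>\<^sup>+v. indicator ?B v * ennreal (Fn n x v) \<partial>lborel) \<partial>m)"
    by (rule swap[symmetric]) measurable
  finally have le: "ennreal vol * ?I \<le> (\<integral>\<^sup>+x. (\<integral>\<^sup>+v. indicator ?B v * ennreal (Fn n x v) \<partial>lborel) \<partial>m)" .
  have "2 * (\<integral>\<^sup>+x. (\<integral>\<^sup>+v. indicator ?B v * ennreal (Fn n x v) \<partial>lborel) \<partial>m) =
     (\<integral>\<^sup>+x. (\<integral>\<^sup>+v. 2 * (indicator ?B v * ennreal (Fn n x v)) \<partial>lborel) \<partial>m)"
  proof -
    have "2 * (\<integral>\<^sup>+x. (\<integral>\<^sup>+v. indicator ?B v * ennreal (Fn n x v) \<partial>lborel) \<partial>m) =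
       (\<integral>\<^sup>+x. 2 * (\<integral>\<^sup>+v. indicator ?B v * ennreal (Fn n x v) \<partial>lborel) \<partial>m)"
      by (rule nn_integral_cmult[symmetric]) measurable
    also have "\<dots> = (\<integral>\<^sup>+x. (\<integral>\<^sup>+v. 2 * (indicator ?B v * ennreal (Fn n x v)) \<partial>lborel) \<partial>m)"
    proof (rule nn_integral_cong)
      fix x assume [measurable]: "x \<in> space m"
      show "2 * (\<integral>\<^sup>+v. indicator ?B v * ennreal (Fn n x v) \<partial>lborel) = (\<integral>\<^sup>+v. 2 * (indicator ?B v * ennreal (Fn n x v)) \<partial>lborel)"
        by (rule nn_integral_cmult[symmetric]) measurable
    qed
    finally show ?thesis .
  qed
  \<comment> \<open>Young's inequality 2 y \<le> t + y^2 / t takes the place of the Cauchy-Schwarz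
    inequality; by the assumed bound on \<open>sqn (Fn n)\<close> both terms contribute at most
    \<open>t * vol\<close>.\<close>
  also have "\<dots> \<le> (\<integral>\<^sup>+x. (\<integral>\<^sup>+v. ennreal t * indicator ?B v + ennreal (1 / t) * ennreal ((Fn n x v)\<^sup>2) \<partial>lborel) \<partial>m)"
  proof (intro nn_integral_mono)
    fix x v
    show "2 * (indicator ?B v * ennreal (Fn n x v)) \<le> ennreal t * indicator ?B v + ennreal (1 / t) * ennreal ((Fn n x v)\<^sup>2)"
    proof (cases "v \<in> ?B")
      case True
      let ?y = "Fn n x v"
      have "0 \<le> (t - ?y)\<^sup>2 / t" using t by simp
      also have "(t - ?y)\<^sup>2 / t = t + 1 / t * ?y\<^sup>2 - 2 * ?y"
        using t by (simp add: power2_eq_square field_simps)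
      finally have "2 * ?y \<le> t + 1 / t * ?y\<^sup>2" by simp
      then have "ennreal (2 * ?y) \<le> ennreal (t + 1 / t * ?y\<^sup>2)" by (rule ennreal_leI)
      also have "\<dots> = ennreal t + ennreal (1 / t) * ennreal (?y\<^sup>2)"
        using t by (subst ennreal_plus) (auto simp: ennreal_mult'[symmetric])
      finally show ?thesis using True goodD(1)[OF good_Fn, of n x v] by (simp add: ennreal_mult')
    qed simp
  qed
  also have "\<dots> = ennreal t * ennreal vol + ennreal (1 / t) * sqn (Fn n)"
  proof -
    have "(\<integral>\<^sup>+x. (\<integral>\<^sup>+v. ennreal t * indicator ?B v + ennreal (1 / t) * ennreal ((Fn n x v)\<^sup>2) \<partial>lborel) \<partial>m) =
        (\<integral>\<^sup>+x. ennreal t * ennreal vol + ennreal (1 / t) * (\<integral>\<^sup>+v. ennreal ((Fn n x v)\<^sup>2) \<partial>lborel) \<partial>m)"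
    proof (rule nn_integral_cong)
      fix x assume [measurable]: "x \<in> space m"
      have [measurable]: "(\<lambda>v. ennreal ((Fn n x v)\<^sup>2)) \<in> borel_measurable lborel" by measurable
      show "(\<integral>\<^sup>+v. ennreal t * indicator ?B v + ennreal (1 / t) * ennreal ((Fn n x v)\<^sup>2) \<partial>lborel) =
          ennreal t * ennreal vol + ennreal (1 / t) * (\<integral>\<^sup>+v. ennreal ((Fn n x v)\<^sup>2) \<partial>lborel)"
        by (simp add: nn_integral_add nn_integral_cmult vol)
    qed
    also have "\<dots> = ennreal t * ennreal vol + ennreal (1 / t) * sqn (Fn n)"
      unfolding sqn_def by (simp add: nn_integral_add nn_integral_cmult m.emeasure_space_1)
    finally show ?thesis .
  qed
  also have "\<dots> \<le> ennreal t * ennreal vol + ennreal (1 / t) * ennreal (t\<^sup>2 * vol)"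
    by (intro add_mono mult_left_mono sq) auto
  also have "\<dots> = ennreal (2 * (t * vol))"
    using t vol(2) by (simp add: power2_eq_square flip: ennreal_mult ennreal_plus)
  finally have "2 * (\<integral>\<^sup>+x. (\<integral>\<^sup>+v. indicator ?B v * ennreal (Fn n x v) \<partial>lborel) \<partial>m) \<le> ennreal (2 * (t * vol))" .
  moreover have "2 * (ennreal vol * ?I) \<le> 2 * (\<integral>\<^sup>+x. (\<integral>\<^sup>+v. indicator ?B v * ennreal (Fn n x v) \<partial>lborel) \<partial>m)"
    by (intro mult_left_mono le) simp
  ultimately have 1: "2 * (ennreal vol * ?I) \<le> ennreal (2 * (t * vol))"
    by (rule order_trans[rotated])
  have "ennreal (2 * vol) * ?I = 2 * (ennreal vol * ?I)"
    by (simp only: ennreal_mult' zero_le_numeral ennreal_numeral mult.assoc)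
  also note 1
  also have "ennreal (2 * (t * vol)) = ennreal (2 * vol) * ennreal t"
    using t vol(2) by (subst ennreal_mult[symmetric]) (auto simp: mult_ac)
  finally show ?thesis
    using vol(2) by (subst (asm) ennreal_mult_le_mult_iff) auto
qed

end

section \<open>Integrands known only almost everywhere, and the completed measure\<close>

lemma measurable_completion_AE:
  assumes g: "g \<in> M \<rightarrow>\<^sub>M N" and eq: "AE x in M. f x = g x" and f: "f \<in> space M \<rightarrow> space N"
  shows "f \<in> completion M \<rightarrow>\<^sub>M N"
proof (rule measurableI)
  fix A assume A: "A \<in> sets N"
  obtain Z where Z: "Z \<in> null_sets M" "{x \<in> space M. f x \<noteq> g x} \<subseteq> Z"
    using eq unfolding eventually_ae_filter by blast
  show "f -` A \<inter> space (completion M) \<in> sets (completion M)"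
  proof (rule sets_completionI)
    show "f -` A \<inter> space (completion M) = ((g -` A \<inter> space M) - Z) \<union> (f -` A \<inter> space M \<inter> Z)"
      using Z(2) by auto
    show "f -` A \<inter> space M \<inter> Z \<subseteq> Z" by auto
    show "(g -` A \<inter> space M) - Z \<in> sets M"
      using measurable_sets[OF g A] Z(1) by auto
  qed fact
qed (use f in auto)

text \<open>Transfers expectations to integrands that are changed on a null set and may fail to be
  measurable before completion.\<close>

lemma integral_completion_AE:
  fixes f g :: "'a \<Rightarrow> real"
  assumes g: "integrable M g" and eq: "AE x in M. f x = g x"
  shows "integrable (completion M) f" "(\<integral>x. f x \<partial>completion M) = (\<integral>x. g x \<partial>M)"
proof -
  have gm[measurable]: "g \<in> borel_measurable M" using g by simp
  have fm: "f \<in> borel_measurable (completion M)"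
    by (rule measurable_completion_AE[OF gm eq]) auto
  have gc: "g \<in> borel_measurable (completion M)" by (rule measurable_completion[OF gm])
  have eq': "AE x in completion M. f x = g x" by (rule AE_completion[OF eq])
  show "integrable (completion M) f"
    using integrable_cong_AE[OF fm gc eq'] g by (simp add: integrable_completion)
  show "(\<integral>x. f x \<partial>completion M) = (\<integral>x. g x \<partial>M)"
    using integral_cong_AE[OF fm gc eq'] by (simp add: integral_completion)
qed

section \<open>The largest exponent as a limit of expectations\<close>

context hyperbolic_cocycle
begin

definition logn :: "nat \<Rightarrow> (nat \<Rightarrow> 'a) \<Rightarrow> real" where
  "logn n \<omega> = ln (onorm ((*v) (cocycle A n \<omega>)))"

lemma logn_measurable[measurable]: "logn n \<in> borel_measurable law"
proof -
  have "logn n \<in> borel_measurable paths" unfolding logn_def by measurable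
  then show ?thesis by (simp cong: measurable_cong_sets)
qed

lemma onorm_cocycle_ge_1: "\<omega> \<in> space paths \<Longrightarrow> 1 \<le> onorm ((*v) (cocycle A n \<omega>))"
  by (intro onorm_ge_1 det_cocycle)

lemma logn_nonneg: "\<omega> \<in> space paths \<Longrightarrow> 0 \<le> logn n \<omega>"
  using onorm_cocycle_ge_1[of \<omega> n] by (simp add: logn_def)

lemma cocycle_add: "cocycle A (n + k) \<omega> = cocycle A k (shift n \<omega>) ** cocycle A n \<omega>"
  by (induction k) (auto simp: shift_def matrix_mul_assoc)

lemma logn_add:
  assumes \<omega>: "\<omega> \<in> space paths"
  shows "logn (n + k) \<omega> \<le> logn n \<omega> + logn k (shift n \<omega>)"
proof -
  have s: "shift n \<omega> \<in> space paths" using measurable_space[OF shift_measurable \<omega>] .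
  have "onorm ((*v) (cocycle A (n + k) \<omega>)) \<le> onorm ((*v) (cocycle A k (shift n \<omega>))) * onorm ((*v) (cocycle A n \<omega>))"
    unfolding cocycle_add by (rule onorm_matrix_mult)
  then have "logn (n + k) \<omega> \<le> ln (onorm ((*v) (cocycle A k (shift n \<omega>))) * onorm ((*v) (cocycle A n \<omega>)))"
    unfolding logn_def using onorm_cocycle_ge_1[OF \<omega>, of "n + k"] by (intro ln_mono) auto
  also have "\<dots> = logn n \<omega> + logn k (shift n \<omega>)"
    unfolding logn_def using onorm_cocycle_ge_1[OF \<omega>, of n] onorm_cocycle_ge_1[OF s, of k]
    by (subst ln_mult) auto
  finally show ?thesis .
qed

lemma logn_1: "logn (Suc 0) \<omega> = ln (onorm ((*v) (A (\<omega> 0))))"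
  by (simp add: logn_def)

lemma integrable_shift: "integrable law f \<Longrightarrow> integrable law (\<lambda>\<omega>. f (shift n \<omega>))"
  and integral_shift: "f \<in> borel_measurable law \<Longrightarrow> (\<integral>\<omega>. f (shift n \<omega>) \<partial>law) = (\<integral>\<omega>. f \<omega> \<partial>law)" for f :: "_ \<Rightarrow> real"
proof -
  have sh: "shift n \<in> law \<rightarrow>\<^sub>M paths" by (simp cong: measurable_cong_sets)
  have c: "f \<in> borel_measurable law \<longleftrightarrow> f \<in> borel_measurable paths"
    by (simp only: measurable_cong_sets[OF sets_law refl])
  show "integrable law f \<Longrightarrow> integrable law (\<lambda>\<omega>. f (shift n \<omega>))"
    using integrable_distr_eq[OF sh, of f] c by (auto simp: distr_law_shift)
  show "f \<in> borel_measurable law \<Longrightarrow> (\<integral>\<omega>. f (shift n \<omega>) \<partial>law) = (\<integral>\<omega>. f \<omega> \<partial>law)"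
    using integral_distr[OF sh, of f] c by (auto simp: distr_law_shift)
qed

text \<open>Subadditivity along the path dominates the next logarithm by the previous one plus a
  shifted copy of the first, and stationarity makes shifted copies integrable.\<close>

lemma logn_integrable: "integrable law (logn n)"
proof (induction n)
  case 0
  have "(*v) (mat 1 :: real^2^2) = (\<lambda>x. x)" by (simp add: fun_eq_iff)
  then have "logn 0 = (\<lambda>\<omega>. 0)" by (simp only: logn_def[abs_def] cocycle.simps onorm_id ln_one)
  then show ?case by simp
next
  case (Suc n)
  have 1: "integrable law (logn (Suc 0))"
    unfolding logn_1
    using integrable_distr_eq[OF measurable_law_component[of 0], of "\<lambda>x. ln (onorm ((*v) (A x)))"] log_A
    by (simp add: distr_law_component)
  show ?case
  proof (rule Bochner_Integration.integrable_bound)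
    show "integrable law (\<lambda>\<omega>. logn n \<omega> + logn (Suc 0) (shift n \<omega>))"
      by (intro Bochner_Integration.integrable_add Suc integrable_shift 1)
    show "AE \<omega> in law. norm (logn (Suc n) \<omega>) \<le> norm (logn n \<omega> + logn (Suc 0) (shift n \<omega>))"
    proof (rule AE_I2)
      fix \<omega> assume "\<omega> \<in> space law"
      then have \<omega>: "\<omega> \<in> space paths" by (simp add: space_law)
      show "norm (logn (Suc n) \<omega>) \<le> norm (logn n \<omega> + logn (Suc 0) (shift n \<omega>))"
        using logn_add[OF \<omega>, of n "Suc 0"] logn_nonneg[OF \<omega>, of "Suc n"] by simp
    qed
  qed simp
qed

text \<open>Jensen's inequality for the logarithm in tangent form: ln (z / t) \<le> z / t - 1, where
  z is the inverse squared norm and its expectation is at most t.\<close>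

lemma logn_lower:
  obtains b :: real where "0 < b" "\<And>n. real n * b \<le> (\<integral>\<omega>. logn (2 * n) \<omega> \<partial>law)"
proof -
  obtain q where q: "0 < q" "q < 1" and contr: "\<And>f. good f \<Longrightarrow> sqn f < \<infinity> \<Longrightarrow> sqn (T_op (T_op f)) \<le> ennreal q * sqn f"
    using sqn_contraction by blast
  show thesis
  proof (rule that)
    show "0 < - ln (sqrt q) / 2" using q by simp
    fix n
    \<comment> \<open>Chosen so that the bound of \<open>sqn_Fn_even\<close> reads
      \<open>t\<^sup>2 * vol\<close>.\<close>
    define t where "t = sqrt q ^ n"
    have t: "0 < t" "t\<^sup>2 = q ^ n" using q by (auto simp: t_def power_mult[symmetric] mult.commute[of n] power_mult)
    let ?o = "\<lambda>\<omega>. onorm ((*v) (cocycle A (2 * n) \<omega>))"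
    have o1: "1 \<le> ?o \<omega>" if "\<omega> \<in> space law" for \<omega>
      using onorm_cocycle_ge_1 that by (simp add: space_law)
    have "?o \<in> borel_measurable paths" by measurable
    then have om[measurable]: "?o \<in> borel_measurable law" by (simp cong: measurable_cong_sets)
    have I: "(\<integral>\<^sup>+\<omega>. ennreal (1 / (?o \<omega>)\<^sup>2) \<partial>law) \<le> ennreal t"
      using sqn_Fn_even[OF q(1) contr, of n] t by (intro inverse_square_norm_le) auto
    have int: "integrable law (\<lambda>\<omega>. 1 / (?o \<omega>)\<^sup>2)"
      using I by (intro integrableI_nonneg) (auto intro: le_less_trans)
    have "ennreal (\<integral>\<omega>. 1 / (?o \<omega>)\<^sup>2 \<partial>law) \<le> ennreal t"
      using I by (subst (asm) nn_integral_eq_integral[OF int]) auto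
    then have le: "(\<integral>\<omega>. 1 / (?o \<omega>)\<^sup>2 \<partial>law) \<le> t" using t by simp
    have "(\<integral>\<omega>. - 2 * logn (2 * n) \<omega> \<partial>law) \<le> (\<integral>\<omega>. (1 / (?o \<omega>)\<^sup>2) / t - 1 + ln t \<partial>law)"
    proof (rule integral_mono)
      show "integrable law (\<lambda>\<omega>. - 2 * logn (2 * n) \<omega>)" by (intro integrable_mult_right logn_integrable)
      show "integrable law (\<lambda>\<omega>. (1 / (?o \<omega>)\<^sup>2) / t - 1 + ln t)"
        by (intro Bochner_Integration.integrable_add Bochner_Integration.integrable_diff integrable_divide int) auto
      fix \<omega> assume "\<omega> \<in> space law"
      then have o: "0 < ?o \<omega>" using o1[of \<omega>] by simp
      have "ln ((1 / (?o \<omega>)\<^sup>2) / t) \<le> (1 / (?o \<omega>)\<^sup>2) / t - 1"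
        using o t by (intro ln_le_minus_one) simp
      moreover have "ln ((1 / (?o \<omega>)\<^sup>2) / t) = - 2 * logn (2 * n) \<omega> - ln t"
        using o t by (simp add: ln_div ln_mult ln_realpow logn_def)
      ultimately show "- 2 * logn (2 * n) \<omega> \<le> (1 / (?o \<omega>)\<^sup>2) / t - 1 + ln t" by linarith
    qed
    also have "\<dots> = (\<integral>\<omega>. 1 / (?o \<omega>)\<^sup>2 \<partial>law) / t - 1 + ln t"
    proof -
      define g where "g \<omega> = 1 / (?o \<omega>)\<^sup>2" for \<omega>
      have g: "integrable law g" using int by (simp add: g_def[abs_def])
      have "(\<integral>\<omega>. g \<omega> / t - 1 + ln t \<partial>law) = (\<integral>\<omega>. g \<omega> \<partial>law) / t - 1 + ln t"
        using g by (simp add: law.prob_space)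
      then show ?thesis by (simp only: g_def)
    qed
    also have "\<dots> \<le> ln t" using le t by simp
    finally have "- 2 * (\<integral>\<omega>. logn (2 * n) \<omega> \<partial>law) \<le> real n * ln (sqrt q)"
      using q by (simp add: t_def ln_realpow)
    then show "real n * (- ln (sqrt q) / 2) \<le> (\<integral>\<omega>. logn (2 * n) \<omega> \<partial>law)" by simp
  qed
qed

text \<open>A null set of collisions is visited, at any of the countably many times, only by a null
  set of paths. This admits the derivative itself, about which nothing is known on a null
  set.\<close>

theorem hyperbolic:
  assumes B: "AE x in m. B x = A x"
  shows "markov_hyperbolic m P B"
proof -
  define a where "a n = (\<integral>\<omega>. logn n \<omega> \<partial>law)" for n
  have a_nonneg: "0 \<le> a n" for n
    unfolding a_def by (intro integral_nonneg_AE AE_I2 logn_nonneg) (simp add: space_law)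
  have a_sub: "a (n + k) \<le> a n + a k" for n k
  proof -
    have "a (n + k) \<le> (\<integral>\<omega>. logn n \<omega> + logn k (shift n \<omega>) \<partial>law)"
      unfolding a_def
      by (intro integral_mono logn_integrable Bochner_Integration.integrable_add integrable_shift logn_add)
         (simp add: space_law)
    also have "\<dots> = a n + a k"
      unfolding a_def
      by (subst Bochner_Integration.integral_add)
         (auto intro!: logn_integrable integrable_shift simp: integral_shift)
    finally show ?thesis .
  qed
  obtain l where l: "(\<lambda>n. a n / real n) \<longlonglongrightarrow> l"
    using fekete_subadditive[of a] a_sub a_nonneg by blast
  obtain b where b: "0 < b" "\<And>n. real n * b \<le> a (2 * n)"
    using logn_lower unfolding a_def by blast
  \<comment> \<open>The lower bound concerns even times; since the limit exists by subadditivity,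
    this subsequence determines it.\<close>
  have "(\<lambda>n. a (2 * n) / real (2 * n)) \<longlonglongrightarrow> l"
    using LIMSEQ_subseq_LIMSEQ[OF l, of "\<lambda>n. 2 * n"] by (simp add: strict_mono_def comp_def)
  moreover have "\<forall>\<^sub>F n in sequentially. b / 2 \<le> a (2 * n) / real (2 * n)"
  proof (rule eventually_sequentiallyI[of 1])
    fix n :: nat assume "1 \<le> n"
    then show "b / 2 \<le> a (2 * n) / real (2 * n)" using b(2)[of n] by (simp add: field_simps)
  qed
  ultimately have "b / 2 \<le> l" by (rule tendsto_lowerbound) simp
  then have l_pos: "0 < l" using b(1) by simp
  have "AE \<omega> in law. \<forall>i. B (\<omega> i) = A (\<omega> i)"
    unfolding AE_all_countable using AE_law_component[OF B] by blast
  then have eq: "AE \<omega> in law. cocycle B n \<omega> = cocycle A n \<omega>" for n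
  proof eventually_elim
    case (elim \<omega>)
    then show ?case by (induction n) auto
  qed
  have eq_log: "AE \<omega> in law. ln (onorm ((*v) (cocycle B n \<omega>))) = logn n \<omega>" for n
    using eq[of n] by eventually_elim (simp add: logn_def)
  have eq_det: "AE \<omega> in law. ln \<bar>det (cocycle B n \<omega>)\<bar> = 0" for n
    using eq[of n] AE_space by eventually_elim (simp add: det_cocycle space_law)
  have int0: "integrable law (\<lambda>_. 0 :: real)" by simp
  note log = integral_completion_AE[OF logn_integrable eq_log]
  note det = integral_completion_AE[OF int0 eq_det]
  \<comment> \<open>All determinants are \<plusminus>1, so the exponents add up to 0 and the smaller
    one is \<open>- l\<close>.\<close>
  have "lyapunov_exponents m P B l (- l)"
    unfolding lyapunov_exponents_def log(2) det(2)
    using log(1) det(1) l l_pos by (simp add: a_def)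
  then show ?thesis using l_pos unfolding markov_hyperbolic_def by blast
qed

end

section \<open>Noise on the torus\<close>

text \<open>The representative of \<open>t\<close> modulo \<open>p\<close> in the half-open interval
  from \<open>a\<close> to \<open>a + p\<close>.\<close>

definition wrap1 :: "real \<Rightarrow> real \<Rightarrow> real \<Rightarrow> real" where
  "wrap1 p a t = t - p * of_int \<lfloor>(t - a) / p\<rfloor>"

lemma wrap1_measurable[measurable]: "wrap1 p a \<in> borel_measurable borel"
  unfolding wrap1_def[abs_def] by measurable

lemma wrap1_mem:
  assumes "0 < p"
  shows "a \<le> wrap1 p a t" "wrap1 p a t < a + p"
proof -
  have "of_int \<lfloor>(t - a) / p\<rfloor> \<le> (t - a) / p" "(t - a) / p < of_int \<lfloor>(t - a) / p\<rfloor> + 1" by linarith+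
  then have "of_int \<lfloor>(t - a) / p\<rfloor> * p \<le> t - a" "t - a < (of_int \<lfloor>(t - a) / p\<rfloor> + 1) * p"
    using assms by (simp_all only: pos_le_divide_eq pos_divide_less_eq)
  then show "a \<le> wrap1 p a t" "wrap1 p a t < a + p"
    by (simp_all add: wrap1_def algebra_simps)
qed

lemma wrap1_periodic:
  assumes "0 < p"
  shows "wrap1 p a (t + p * of_int k) = wrap1 p a t"
proof -
  have "(t + p * of_int k - a) / p = (t - a) / p + of_int k" using assms by (simp add: field_simps)
  then have "\<lfloor>(t + p * of_int k - a) / p\<rfloor> = \<lfloor>(t - a) / p\<rfloor> + k" by (simp only: floor_add_int)
  then show ?thesis by (simp add: wrap1_def algebra_simps)
qed

lemma wrap1_periodic': "0 < p \<Longrightarrow> wrap1 p a (t + p) = wrap1 p a t"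
  using wrap1_periodic[of p a t 1] by simp

lemma wrap1_ident: "0 < p \<Longrightarrow> a \<le> t \<Longrightarrow> t < a + p \<Longrightarrow> wrap1 p a t = t"
proof -
  assume "0 < p" "a \<le> t" "t < a + p"
  then have "\<lfloor>(t - a) / p\<rfloor> = 0" by (intro floor_unique) (auto simp: field_simps)
  then show ?thesis by (simp add: wrap1_def)
qed

lemma wrap1_add: "0 < p \<Longrightarrow> wrap1 p a (wrap1 p a s + t) = wrap1 p a (s + t)"
  using wrap1_periodic[of p a "s + t" "- \<lfloor>(s - a) / p\<rfloor>"] by (simp add: wrap1_def[of p a s] algebra_simps)

text \<open>A shift by at most one period cuts off a piece of the window that reappears one period
  later. Iteration covers all positive shifts, and a negative shift is undone by a positive
  one.\<close>

lemma nn_integral_periodic_shift: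
  fixes g :: "real \<Rightarrow> ennreal"
  assumes [measurable]: "g \<in> borel_measurable borel" and per: "\<And>x. g (x + p) = g x" and p: "0 < p"
  shows "(\<integral>\<^sup>+x. indicator {a..<a+p} x * g (x + t) \<partial>lborel) = (\<integral>\<^sup>+x. indicator {a..<a+p} x * g x \<partial>lborel)"
proof -
  define \<Phi> where "\<Phi> b = (\<integral>\<^sup>+x. indicator {b..<b+p} x * g x \<partial>lborel)" for b
  have step: "\<Phi> (b + s) = \<Phi> b" if s: "0 \<le> s" "s \<le> p" for b s
  proof -
    have "\<Phi> (b + s) = (\<integral>\<^sup>+x. indicator {b+s..<b+p} x * g x + indicator {b+p..<b+p+s} x * g x \<partial>lborel)"
      unfolding \<Phi>_def using s by (intro nn_integral_cong) (auto split: split_indicator)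
    also have "\<dots> = (\<integral>\<^sup>+x. indicator {b+s..<b+p} x * g x \<partial>lborel) + (\<integral>\<^sup>+x. indicator {b+p..<b+p+s} x * g x \<partial>lborel)"
      by (rule nn_integral_add) auto
    also have "(\<integral>\<^sup>+x. indicator {b+p..<b+p+s} x * g x \<partial>lborel) = (\<integral>\<^sup>+x. indicator {b+p..<b+p+s} (p + 1 * x) * g (p + 1 * x) \<partial>lborel)"
      by (subst nn_integral_real_affine[where c = 1 and t = p]) auto
    also have "\<dots> = (\<integral>\<^sup>+x. indicator {b..<b+s} x * g x \<partial>lborel)"
      by (intro nn_integral_cong) (auto simp: per add.commute[of p] split: split_indicator)
    also have "(\<integral>\<^sup>+x. indicator {b+s..<b+p} x * g x \<partial>lborel) + (\<integral>\<^sup>+x. indicator {b..<b+s} x * g x \<partial>lborel)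
      = (\<integral>\<^sup>+x. indicator {b+s..<b+p} x * g x + indicator {b..<b+s} x * g x \<partial>lborel)"
      by (rule nn_integral_add[symmetric]) auto
    also have "\<dots> = \<Phi> b"
      unfolding \<Phi>_def using s by (intro nn_integral_cong) (auto split: split_indicator)
    finally show ?thesis .
  qed
  have multi: "\<Phi> (b + real n * p) = \<Phi> b" for b n
  proof (induction n)
    case (Suc n)
    have "b + real (Suc n) * p = (b + real n * p) + p" by (simp add: algebra_simps)
    then show ?case using step[of p "b + real n * p"] p Suc by (simp only:)
  qed simp
  have pos: "\<Phi> (b + s) = \<Phi> b" if s: "0 \<le> s" for b s
  proof -
    define n where "n = nat \<lfloor>s / p\<rfloor>"
    have n: "real n = of_int \<lfloor>s / p\<rfloor>" using s p by (simp add: n_def)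
    have "real n \<le> s / p" "s / p < real n + 1" unfolding n by linarith+
    then have r: "0 \<le> s - real n * p" "s - real n * p \<le> p" using p by (auto simp: field_simps)
    have "\<Phi> (b + s) = \<Phi> ((b + real n * p) + (s - real n * p))" by simp
    also have "\<dots> = \<Phi> (b + real n * p)" by (rule step[OF r])
    also have "\<dots> = \<Phi> b" by (rule multi)
    finally show ?thesis .
  qed
  have all: "\<Phi> (a + t) = \<Phi> a"
  proof (cases "0 \<le> t")
    case False
    then show ?thesis using pos[of "- t" "a + t"] by simp
  qed (rule pos)
  have "(\<integral>\<^sup>+x. indicator {a..<a+p} x * g (x + t) \<partial>lborel) = (\<integral>\<^sup>+x. indicator {a..<a+p} (- t + 1 * x) * g ((- t + 1 * x) + t) \<partial>lborel)"
    by (subst nn_integral_real_affine[where c = 1 and t = "- t"]) auto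
  also have "\<dots> = \<Phi> (a + t)"
    unfolding \<Phi>_def by (intro nn_integral_cong) (auto split: split_indicator)
  finally show ?thesis using all by (simp add: \<Phi>_def)
qed

lemma nn_integral_lborel_pair:
  fixes f :: "real \<times> real \<Rightarrow> ennreal"
  assumes [measurable]: "f \<in> borel_measurable borel"
  shows "(\<integral>\<^sup>+u. f u \<partial>lborel) = (\<integral>\<^sup>+x. (\<integral>\<^sup>+y. f (x, y) \<partial>lborel) \<partial>lborel)"
  unfolding lborel_prod[symmetric] by (rule lborel.nn_integral_fst[symmetric]) (simp add: lborel_prod)

lemma AE_lborel_snd_notin:
  assumes "countable C"
  shows "AE u in (lborel :: (real \<times> real) measure). snd u \<notin> C"
proof -
  have [measurable]: "C \<in> sets borel" using assms by (intro sets.countable[of C borel]) auto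
  have "AE x in lborel :: real measure. AE y in lborel. snd (x, y) \<notin> C"
    using countable_imp_null_set_lborel[OF assms] by (auto intro: AE_not_in)
  then have "AE u in (lborel :: real measure) \<Otimes>\<^sub>M (lborel :: real measure). snd u \<notin> C"
  proof (intro lborel_pair.AE_pair_measure)
    show "{u \<in> space ((lborel :: real measure) \<Otimes>\<^sub>M (lborel :: real measure)). snd u \<notin> C} \<in> sets (lborel \<Otimes>\<^sub>M lborel)"
      by measurable
  qed
  then show ?thesis unfolding lborel_prod .
qed

section \<open>The collision space as a torus\<close>

locale collision_torus =
  fixes L :: real
  assumes L_pos: "0 < L"
begin

abbreviation "m \<equiv> collision_measure L"

lemma space_m: "space m = collision_space L"
  by (simp add: collision_measure_def space_restrict_space)

lemma cs_borel[measurable]: "collision_space L \<in> sets borel"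
  unfolding collision_space_def by (intro borel_Times) auto

lemma sets_m: "sets m = sets (restrict_space borel (collision_space L))"
  unfolding collision_measure_def by (simp cong: sets_restrict_space_cong)

lemma measurable_m_iff: "measurable m N = measurable (restrict_space borel (collision_space L)) N"
  by (rule measurable_cong_sets[OF sets_m refl])

lemma sets_m_iff: "B \<in> sets m \<longleftrightarrow> B \<in> sets borel \<and> B \<subseteq> collision_space L"
  unfolding sets_m by (subst sets_restrict_space_iff) auto

lemma into_m: "f \<in> N \<rightarrow>\<^sub>M m \<longleftrightarrow> f \<in> N \<rightarrow>\<^sub>M borel \<and> f \<in> space N \<rightarrow> collision_space L"
  by (subst measurable_cong_sets[OF refl sets_m], subst measurable_restrict_space2_iff) auto

lemma m_imp_borel: "f \<in> N \<rightarrow>\<^sub>M m \<Longrightarrow> f \<in> N \<rightarrow>\<^sub>M borel"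
  by (simp add: into_m)

lemma nn_integral_m:
  assumes "f \<in> borel_measurable m"
  shows "(\<integral>\<^sup>+x. f x \<partial>m) = ennreal (1 / (2 * L)) * (\<integral>\<^sup>+u. f u * indicator (collision_space L) u \<partial>lborel)"
proof -
  have f: "f \<in> borel_measurable (restrict_space lborel (collision_space L))"
    using assms unfolding measurable_m_iff by (simp cong: measurable_cong_sets sets_restrict_space_cong)
  have "(\<integral>\<^sup>+x. f x \<partial>m) = (\<integral>\<^sup>+x. ennreal (1 / (2 * L)) * f x \<partial>restrict_space lborel (collision_space L))"
    unfolding collision_measure_def using f by (subst nn_integral_density) auto
  also have "\<dots> = ennreal (1 / (2 * L)) * (\<integral>\<^sup>+x. f x \<partial>restrict_space lborel (collision_space L))"
    using f by (rule nn_integral_cmult)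
  finally show ?thesis by (simp add: nn_integral_restrict_space)
qed

lemma emeasure_lborel_cs: "emeasure lborel (collision_space L) = ennreal (2 * L)"
proof -
  have "emeasure lborel (collision_space L) = emeasure (lborel \<Otimes>\<^sub>M lborel) ({0..<L} \<times> {-1..1::real})"
    by (simp add: collision_space_def lborel_prod)
  also have "\<dots> = ennreal L * ennreal 2"
    using L_pos by (subst lborel.emeasure_pair_measure_Times) auto
  finally show ?thesis using L_pos by (simp add: ennreal_mult' mult.commute)
qed

lemma prob_space_m: "prob_space m"
proof
  have "emeasure m (space m) = (\<integral>\<^sup>+x. 1 \<partial>m)" by simp
  also have "\<dots> = ennreal (1 / (2 * L)) * (\<integral>\<^sup>+u. 1 * indicator (collision_space L) u \<partial>lborel)"
    by (rule nn_integral_m) simp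
  also have "\<dots> = 1" using L_pos by (simp add: emeasure_lborel_cs ennreal_mult[symmetric])
  finally show "emeasure m (space m) = 1" .
qed

sublocale m: prob_space m by (rule prob_space_m)

text \<open>The noise lattice also identifies \<open>s = -1\<close> with \<open>s = 1\<close>, so
  the cylinder becomes a torus. The representative has second coordinate below 1, hence points with
  \<open>s = 1\<close> are moved; they form a null set.\<close>

definition wrap :: "real \<times> real \<Rightarrow> real \<times> real" where
  "wrap u = (wrap1 L 0 (fst u), wrap1 2 (-1) (snd u))"

lemma wrap_borel[measurable]: "wrap \<in> borel_measurable borel"
  unfolding wrap_def[abs_def] by (subst borel_prod[symmetric]) measurable

lemma wrap_mem: "wrap u \<in> collision_space L" "snd (wrap u) < 1"
  using wrap1_mem[OF L_pos, of 0 "fst u"] wrap1_mem[of 2 "-1" "snd u"] by (auto simp: wrap_def collision_space_def)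

lemma wrap_m[measurable (raw)]: "f \<in> N \<rightarrow>\<^sub>M borel \<Longrightarrow> (\<lambda>x. wrap (f x)) \<in> N \<rightarrow>\<^sub>M m"
  using measurable_compose[OF _ wrap_borel] by (auto simp: into_m wrap_mem)

lemma wrap_add: "wrap (wrap u + v) = wrap (u + v)" "wrap (u + wrap v) = wrap (u + v)"
  using wrap1_add[OF L_pos, of 0] wrap1_add[of 2 "-1"]
  by (auto simp: wrap_def add.commute[of "fst u"] add.commute[of "snd u"])

lemma wrap_ident: "u \<in> collision_space L \<Longrightarrow> snd u \<noteq> 1 \<Longrightarrow> wrap u = u"
  by (auto simp: wrap_def collision_space_def wrap1_ident[OF L_pos, of 0] wrap1_ident[of 2 "-1"] prod_eq_iff)

text \<open>Discarding the null edge \<open>s = 1\<close> leaves one half-open period in each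
  coordinate, so that periodicity can be used.\<close>

lemma nn_integral_m_wrap:
  assumes f: "f \<in> borel_measurable m"
  shows "(\<integral>\<^sup>+x. f x \<partial>m) = ennreal (1 / (2 * L)) *
    (\<integral>\<^sup>+x. indicator {0..<0+L} x * (\<integral>\<^sup>+y. indicator {-1..<-1+2} y * f (wrap (x, y)) \<partial>lborel) \<partial>lborel)"
proof -
  have fw[measurable]: "(\<lambda>u. f (wrap u)) \<in> borel_measurable borel"
    by (rule measurable_compose[OF wrap_m[OF measurable_ident] f, simplified])
  have [measurable]: "({0..<L} \<times> {-1..<1}) \<in> sets (borel :: (real \<times> real) measure)"
    by (intro borel_Times) auto
  have "(\<integral>\<^sup>+u. f u * indicator (collision_space L) u \<partial>lborel) =
      (\<integral>\<^sup>+u. indicator ({0..<L} \<times> {-1..<1}) u * f (wrap u) \<partial>lborel)"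
  proof (rule nn_integral_cong_AE)
    show "AE u in lborel. f u * indicator (collision_space L) u = indicator ({0..<L} \<times> {-1..<1}) u * f (wrap u)"
      using AE_lborel_snd_notin[of "{1}", simplified]
    proof eventually_elim
      case (elim u)
      then show ?case using wrap_ident[of u]
        by (cases "u \<in> collision_space L") (auto simp: collision_space_def split: split_indicator)
    qed
  qed
  also have "\<dots> = (\<integral>\<^sup>+x. (\<integral>\<^sup>+y. indicator ({0..<L} \<times> {-1..<1}) (x, y) * f (wrap (x, y)) \<partial>lborel) \<partial>lborel)"
    by (rule nn_integral_lborel_pair) measurable
  also have "\<dots> = (\<integral>\<^sup>+x. indicator {0..<0+L} x * (\<integral>\<^sup>+y. indicator {-1..<-1+2} y * f (wrap (x, y)) \<partial>lborel) \<partial>lborel)"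
    by (intro nn_integral_cong) (auto split: split_indicator intro!: nn_integral_cong)
  finally show ?thesis by (simp add: nn_integral_m[OF f])
qed

text \<open>Translation invariance on the torus, obtained from periodicity in each coordinate
  separately.\<close>

lemma nn_integral_wrap_shift:
  assumes f: "f \<in> borel_measurable m"
  shows "(\<integral>\<^sup>+x. f (wrap (x + u)) \<partial>m) = (\<integral>\<^sup>+x. f x \<partial>m)"
proof -
  have fw: "(\<lambda>u. f (wrap u)) \<in> borel_measurable borel"
    by (rule measurable_compose[OF wrap_m[OF measurable_ident] f, simplified])
  have fw2[measurable]: "(\<lambda>(x, y). f (wrap (x, y))) \<in> borel_measurable (borel \<Otimes>\<^sub>M borel)"
    using fw unfolding borel_prod by (simp add: split_beta')
  have id_m: "(\<lambda>x. x) \<in> m \<rightarrow>\<^sub>M borel" by (rule m_imp_borel) (rule measurable_ident_sets[OF refl])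
  have fu: "(\<lambda>x. f (wrap (x + u))) \<in> borel_measurable m"
    by (rule measurable_compose[OF wrap_m f]) (intro borel_measurable_add id_m measurable_const, simp)
  define G where "G x = (\<integral>\<^sup>+y. indicator {-1..<-1+2} y * f (wrap (x, y)) \<partial>lborel)" for x
  have G[measurable]: "G \<in> borel_measurable borel" unfolding G_def by measurable
  have per1: "wrap (x + L, y) = wrap (x, y)" and per2: "wrap (x, y + 2) = wrap (x, y)" for x y
    by (simp_all add: wrap_def wrap1_periodic'[OF L_pos] wrap1_periodic')
  have inner: "(\<integral>\<^sup>+y. indicator {-1..<-1+2} y * f (wrap (x + fst u, y + snd u)) \<partial>lborel) = G (x + fst u)" for x
    unfolding G_def
    by (rule nn_integral_periodic_shift[where g = "\<lambda>y. f (wrap (x + fst u, y))"]) (auto simp: per2)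
  have "(\<integral>\<^sup>+x. f (wrap (x + u)) \<partial>m) = ennreal (1 / (2 * L)) *
    (\<integral>\<^sup>+x. indicator {0..<0+L} x * (\<integral>\<^sup>+y. indicator {-1..<-1+2} y * f (wrap (wrap (x, y) + u)) \<partial>lborel) \<partial>lborel)"
    by (rule nn_integral_m_wrap[OF fu])
  also have "\<dots> = ennreal (1 / (2 * L)) * (\<integral>\<^sup>+x. indicator {0..<0+L} x * G (x + fst u) \<partial>lborel)"
  proof -
    have "wrap (wrap (x, y) + u) = wrap (x + fst u, y + snd u)" for x y
      unfolding wrap_add by (simp add: plus_prod_def)
    then show ?thesis by (simp only: inner)
  qed
  also have "(\<integral>\<^sup>+x. indicator {0..<0+L} x * G (x + fst u) \<partial>lborel) = (\<integral>\<^sup>+x. indicator {0..<0+L} x * G x \<partial>lborel)"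
    by (rule nn_integral_periodic_shift[OF G _ L_pos]) (simp add: G_def per1)
  also have "ennreal (1 / (2 * L)) * \<dots> = (\<integral>\<^sup>+x. f x \<partial>m)"
    by (simp only: nn_integral_m_wrap[OF f] G_def)
  finally show ?thesis .
qed

end

text \<open>Expressing the variance through independent pairs is what brings differences of two
  noise values into play.\<close>

lemma (in prob_space) two_point_variance:
  fixes a :: "'a \<Rightarrow> real"
  assumes [measurable]: "a \<in> borel_measurable M" and a: "\<And>u. 0 \<le> a u" "\<And>u. a u \<le> 1"
  shows "(\<integral>\<^sup>+u. (\<integral>\<^sup>+w. ennreal ((a u - a w)\<^sup>2) \<partial>M) \<partial>M) =
    ennreal (2 * ((\<integral>u. (a u)\<^sup>2 \<partial>M) - (\<integral>u. a u \<partial>M)\<^sup>2))"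
proof -
  let ?e = "\<integral>u. a u \<partial>M" and ?s = "\<integral>u. (a u)\<^sup>2 \<partial>M"
  have ia: "integrable M a" using a by (intro integrable_const_bound[where B = 1]) auto
  have i2: "integrable M (\<lambda>u. (a u)\<^sup>2)" using a by (intro integrable_const_bound[where B = 1]) (auto simp: abs_square_le_1)
  have id: "integrable M (\<lambda>w. (a u - a w)\<^sup>2)" for u
  proof (rule integrable_const_bound[where B = 1])
    have "(a u - a w)\<^sup>2 \<le> 1" for w using a[of u] a[of w] by (simp add: abs_square_le_1)
    then show "AE w in M. norm ((a u - a w)\<^sup>2) \<le> 1" by simp
  qed simp
  have inner: "(\<integral>w. (a u - a w)\<^sup>2 \<partial>M) = (a u)\<^sup>2 - 2 * ?e * a u + ?s" for u
    unfolding power2_diff using ia i2 by (simp add: prob_space mult_ac)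
  have "(\<integral>\<^sup>+u. (\<integral>\<^sup>+w. ennreal ((a u - a w)\<^sup>2) \<partial>M) \<partial>M) = (\<integral>\<^sup>+u. ennreal ((a u)\<^sup>2 - 2 * ?e * a u + ?s) \<partial>M)"
    by (intro nn_integral_cong) (subst nn_integral_eq_integral[OF id], auto simp: inner)
  also have "\<dots> = ennreal (\<integral>u. (a u)\<^sup>2 - 2 * ?e * a u + ?s \<partial>M)"
  proof (rule nn_integral_eq_integral)
    show "AE u in M. 0 \<le> (a u)\<^sup>2 - 2 * ?e * a u + ?s"
      unfolding inner[symmetric] by simp
  qed (use ia i2 in simp)
  also have "(\<integral>u. (a u)\<^sup>2 - 2 * ?e * a u + ?s \<partial>M) = 2 * (?s - ?e\<^sup>2)"
    using ia i2 by (simp add: prob_space power2_eq_square)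
  finally show ?thesis .
qed

lemma nn_integral_lborel_translate:
  fixes f :: "real \<times> real \<Rightarrow> ennreal"
  assumes [measurable]: "f \<in> borel_measurable borel"
  shows "(\<integral>\<^sup>+u. f (u + t) \<partial>lborel) = (\<integral>\<^sup>+u. f u \<partial>lborel)"
proof -
  have "(\<integral>\<^sup>+u. f u \<partial>lborel) = (\<integral>\<^sup>+u. f u \<partial>distr lborel borel ((+) t))"
    by (simp add: lborel_distr_plus)
  also have "\<dots> = (\<integral>\<^sup>+u. f (t + u) \<partial>lborel)" by (rule nn_integral_distr) auto
  finally show ?thesis by (simp add: add.commute)
qed

lemma nn_integral_lborel_double:
  fixes f :: "real \<times> real \<Rightarrow> ennreal"
  assumes [measurable]: "f \<in> borel_measurable borel"
  shows "(\<integral>\<^sup>+u. f u \<partial>lborel) = 4 * (\<integral>\<^sup>+u. f (2 *\<^sub>R u) \<partial>lborel)"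
proof -
  have "(\<integral>\<^sup>+u. f u \<partial>lborel) = (\<integral>\<^sup>+u. f u \<partial>density (distr lborel borel (\<lambda>x::real\<times>real. 0 + 2 *\<^sub>R x)) (\<lambda>_. \<bar>2\<bar>^DIM(real \<times> real)))"
    by (subst lborel_affine[of 2 0]) simp_all
  also have "\<dots> = 4 * (\<integral>\<^sup>+u. f (2 *\<^sub>R u) \<partial>lborel)"
    by (subst nn_integral_density) (auto simp: nn_integral_distr nn_integral_cmult)
  finally show ?thesis .
qed

definition box2 :: "real \<Rightarrow> (real \<times> real) set" where
  "box2 r = {-r<..<r} \<times> {-r<..<r}"

lemma box2_borel[measurable]: "box2 r \<in> sets borel"
  unfolding box2_def by (intro borel_Times) auto

lemma emeasure_box2: "0 \<le> r \<Longrightarrow> emeasure lborel (box2 r) = ennreal ((2 * r)\<^sup>2)"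
proof -
  assume r: "0 \<le> r"
  have "emeasure lborel (box2 r) = emeasure (lborel \<Otimes>\<^sub>M lborel) ({-r<..<r} \<times> {-r<..<r})"
    by (simp add: box2_def lborel_prod)
  also have "\<dots> = ennreal (2 * r) * ennreal (2 * r)"
    using r by (subst lborel.emeasure_pair_measure_Times) auto
  finally show ?thesis using r by (simp add: ennreal_mult[symmetric] power2_eq_square)
qed

section \<open>Lower bound for the autocorrelation of the noise\<close>

locale torus_noise = collision_torus +
  fixes \<epsilon> :: real and \<rho> :: "real \<times> real \<Rightarrow> real"
  assumes eps_pos: "0 < \<epsilon>" and noise: "noise_density \<epsilon> \<rho>"
begin

lemma rho_measurable[measurable]: "\<rho> \<in> borel_measurable borel"
  and rho_nonneg: "0 \<le> \<rho> u"
  and rho_pos: "u \<in> ball 0 \<epsilon> \<Longrightarrow> 0 < \<rho> u"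
  using noise unfolding noise_density_def by blast+

definition noise_measure :: "(real \<times> real) measure" where
  "noise_measure = density lborel (\<lambda>u. ennreal (\<rho> u))"

sublocale noise: prob_space noise_measure
  using noise by (simp add: noise_density_def noise_measure_def)

lemma sets_noise[measurable_cong, simp]: "sets noise_measure = sets borel"
  by (simp add: noise_measure_def)

lemma space_noise[simp]: "space noise_measure = UNIV"
  by (simp add: noise_measure_def)

text \<open>The autocorrelation of \<open>\<rho>\<close> is bounded below near the origin, although \<open>\<rho>\<close> itself need not be
  bounded below on any ball.\<close>

lemma noise_density_lower_bound:
  obtains c r :: real where "0 < c" "0 < r"
    "\<And>f. f \<in> borel_measurable borel \<Longrightarrow>
      ennreal c * (\<integral>\<^sup>+z. indicator (box2 r) z * f z \<partial>lborel) \<le> (\<integral>\<^sup>+w. (\<integral>\<^sup>+u. f (u - w) \<partial>noise_measure) \<partial>noise_measure)"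
proof -
  define a where "a = \<epsilon> / 2"
  have a: "0 < a" using eps_pos by (simp add: a_def)
  have sub: "box2 a \<subseteq> ball 0 \<epsilon>"
  proof
    fix u assume "u \<in> box2 a"
    then have "\<bar>fst u\<bar> < a" "\<bar>snd u\<bar> < a" by (auto simp: box2_def)
    then have "norm u < 2 * a" using norm_Pair_le[of "fst u" "snd u"] by simp
    then show "u \<in> ball 0 \<epsilon>" by (simp add: a_def)
  qed
  \<comment> \<open>These sets exhaust the box because \<rho> is positive there, so one of them
    fills more than nine tenths of it.\<close>
  define S where "S n = {u \<in> box2 a. 1 / real (Suc n) < \<rho> u}" for n
  have S[measurable]: "S n \<in> sets borel" for n
    unfolding S_def by measurable
  have "incseq S"
    unfolding incseq_def S_def
    by (auto simp: field_simps intro: less_le_trans) (smt (verit) of_nat_mono rho_nonneg mult_left_mono mult.commute)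
  moreover have "(\<Union>n. S n) = box2 a"
  proof (intro equalityI subsetI)
    fix u assume u: "u \<in> box2 a"
    then have "0 < \<rho> u" using sub rho_pos by blast
    then obtain n where "inverse (real (Suc n)) < \<rho> u" using reals_Archimedean by blast
    then show "u \<in> (\<Union>n. S n)" using u by (auto simp: S_def inverse_eq_divide)
  qed (auto simp: S_def)
  ultimately have "(\<lambda>n. emeasure lborel (S n)) \<longlonglongrightarrow> emeasure lborel (box2 a)"
    using Lim_emeasure_incseq[of S lborel] by (auto simp: image_subset_iff)
  moreover have "ennreal (9/10 * (2 * a)\<^sup>2) < emeasure lborel (box2 a)"
    using a by (simp add: emeasure_box2 ennreal_less_iff)
  ultimately have "eventually (\<lambda>n. ennreal (9/10 * (2 * a)\<^sup>2) < emeasure lborel (S n)) sequentially"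
    by (rule order_tendstoD)
  then obtain n where n: "ennreal (9/10 * (2 * a)\<^sup>2) < emeasure lborel (S n)"
    by (auto simp: eventually_sequentially)
  define T where "T = S n"
  have T[measurable]: "T \<in> sets borel" by (simp add: T_def)
  \<comment> \<open>\<open>T\<close> and its translate lie in a box enlarged by the factor 9/8.
    Their total relative area of at least 9/5 exceeds 81/64 by more than 1/2, and this excess is
    overlap.\<close>
  define r where "r = a / 8"
  have r: "0 < r" using a by (simp add: r_def)
  have overlap: "ennreal (1/2 * (2 * a)\<^sup>2) \<le> (\<integral>\<^sup>+w. indicator T w * indicator T (w + z) \<partial>lborel)" if z: "z \<in> box2 r" for z
  proof -
    have [measurable]: "(\<lambda>w. indicator T (w + z) :: ennreal) \<in> borel_measurable borel" by measurable
    have "ennreal (9/10 * (2 * a)\<^sup>2) + ennreal (9/10 * (2 * a)\<^sup>2) \<le> emeasure lborel T + emeasure lborel T"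
      using n by (intro add_mono) (auto simp: T_def)
    also have "\<dots> = (\<integral>\<^sup>+w. indicator T w \<partial>lborel) + (\<integral>\<^sup>+w. indicator T (w + z) \<partial>lborel)"
      using nn_integral_lborel_translate[of "indicator T" z] by simp
    also have "\<dots> = (\<integral>\<^sup>+w. indicator T w + indicator T (w + z) \<partial>lborel)"
      by (rule nn_integral_add[symmetric]) auto
    also have "\<dots> \<le> (\<integral>\<^sup>+w. indicator (box2 (a + r)) w + indicator T w * indicator T (w + z) \<partial>lborel)"
    proof (rule nn_integral_mono)
      fix w
      have "w \<in> T \<Longrightarrow> w \<in> box2 (a + r)" "w + z \<in> T \<Longrightarrow> w \<in> box2 (a + r)"
        using z r by (auto simp: T_def S_def box2_def plus_prod_def mem_Times_iff)
      then show "indicator T w + indicator T (w + z) \<le> indicator (box2 (a + r)) w + (indicator T w * indicator T (w + z) :: ennreal)"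
        by (auto simp: indicator_def)
    qed
    also have "\<dots> = emeasure lborel (box2 (a + r)) + (\<integral>\<^sup>+w. indicator T w * indicator T (w + z) \<partial>lborel)"
      by (subst nn_integral_add) auto
    also have "emeasure lborel (box2 (a + r)) = ennreal ((2 * (a + r))\<^sup>2)"
      using a r by (intro emeasure_box2) simp
    finally have *: "ennreal (9/10 * (2 * a)\<^sup>2) + ennreal (9/10 * (2 * a)\<^sup>2) \<le>
      ennreal ((2 * (a + r))\<^sup>2) + (\<integral>\<^sup>+w. indicator T w * indicator T (w + z) \<partial>lborel)" .
    have "ennreal ((2 * (a + r))\<^sup>2) + ennreal (1/2 * (2 * a)\<^sup>2) \<le> ennreal (9/10 * (2 * a)\<^sup>2) + ennreal (9/10 * (2 * a)\<^sup>2)"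
      using a by (simp add: r_def power2_eq_square field_simps flip: ennreal_plus) 
    from order_trans[OF this *] show ?thesis by (simp add: ennreal_add_left_cancel_le)
  qed
  \<comment> \<open>Both densities are at least \<open>1 / real (Suc n)\<close> on \<open>T\<close>,
    and the overlap covers at least half of the area of the box.\<close>
  define c where "c = (1 / real (Suc n))\<^sup>2 * (1/2 * (2 * a)\<^sup>2)"
  have c: "0 < c" using a by (simp add: c_def)
  show thesis
  proof (rule that[OF c r])
    fix f :: "real \<times> real \<Rightarrow> ennreal" assume [measurable]: "f \<in> borel_measurable borel"
    let ?q = "1 / real (Suc n)"
    have rho_T: "ennreal ?q * indicator T u \<le> ennreal (\<rho> u)" for u
      by (auto simp: T_def S_def split: split_indicator intro!: ennreal_leI)
    have "ennreal c * (\<integral>\<^sup>+z. indicator (box2 r) z * f z \<partial>lborel) =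
        (ennreal ?q * ennreal ?q) * (\<integral>\<^sup>+z. ennreal (1/2 * (2 * a)\<^sup>2) * (indicator (box2 r) z * f z) \<partial>lborel)"
    proof -
      have "ennreal c = ennreal ?q * ennreal ?q * ennreal (1/2 * (2 * a)\<^sup>2)"
        by (simp only: c_def power2_eq_square[of ?q] ennreal_mult' zero_le_divide_1_iff of_nat_0_le_iff mult_nonneg_nonneg)
      moreover have "(\<lambda>z. indicator (box2 r) z * f z) \<in> borel_measurable lborel" by measurable
      ultimately show ?thesis by (simp only: mult.assoc nn_integral_cmult)
    qed
    also have "\<dots> \<le> (ennreal ?q * ennreal ?q) * (\<integral>\<^sup>+z. (\<integral>\<^sup>+w. indicator T w * indicator T (w + z) \<partial>lborel) * f z \<partial>lborel)"
    proof (intro mult_left_mono nn_integral_mono)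
      fix z
      show "ennreal (1/2 * (2 * a)\<^sup>2) * (indicator (box2 r) z * f z) \<le> (\<integral>\<^sup>+w. indicator T w * indicator T (w + z) \<partial>lborel) * f z"
      proof (cases "z \<in> box2 r")
        case True
        then show ?thesis using mult_right_mono[OF overlap[OF True], of "f z"] by simp
      qed simp
    qed simp
    also have "\<dots> = (ennreal ?q * ennreal ?q) * (\<integral>\<^sup>+z. (\<integral>\<^sup>+w. indicator T w * indicator T (w + z) * f z \<partial>lborel) \<partial>lborel)"
      by (simp add: nn_integral_multc)
    also have "\<dots> = (ennreal ?q * ennreal ?q) * (\<integral>\<^sup>+w. (\<integral>\<^sup>+z. indicator T w * indicator T (w + z) * f z \<partial>lborel) \<partial>lborel)"
      by (subst lborel_pair.Fubini') simp_all
    also have "\<dots> = (ennreal ?q * ennreal ?q) * (\<integral>\<^sup>+w. (\<integral>\<^sup>+u. indicator T w * indicator T u * f (u - w) \<partial>lborel) \<partial>lborel)"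
    proof -
      have "(\<integral>\<^sup>+z. indicator T w * indicator T (w + z) * f z \<partial>lborel) = (\<integral>\<^sup>+u. indicator T w * indicator T u * f (u - w) \<partial>lborel)" for w
        by (subst nn_integral_lborel_translate[of "\<lambda>u. indicator T w * indicator T u * f (u - w)" w, symmetric])
           (auto simp: add.commute)
      then show ?thesis by simp
    qed
    also have "\<dots> = (\<integral>\<^sup>+w. (\<integral>\<^sup>+u. (ennreal ?q * indicator T w) * ((ennreal ?q * indicator T u) * f (u - w)) \<partial>lborel) \<partial>lborel)"
      by (simp add: nn_integral_cmult[symmetric] mult_ac)
    also have "\<dots> \<le> (\<integral>\<^sup>+w. (\<integral>\<^sup>+u. ennreal (\<rho> w) * (ennreal (\<rho> u) * f (u - w)) \<partial>lborel) \<partial>lborel)"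
      by (intro nn_integral_mono mult_mono rho_T mult_right_mono) auto
    also have "\<dots> = (\<integral>\<^sup>+w. (\<integral>\<^sup>+u. f (u - w) \<partial>noise_measure) \<partial>noise_measure)"
      unfolding noise_measure_def by (simp add: nn_integral_density nn_integral_cmult)
    finally show "ennreal c * (\<integral>\<^sup>+z. indicator (box2 r) z * f z \<partial>lborel) \<le> (\<integral>\<^sup>+w. (\<integral>\<^sup>+u. f (u - w) \<partial>noise_measure) \<partial>noise_measure)" .
  qed
qed

end

section \<open>Oscillation under translations and the gap of the noise\<close>

context torus_noise
begin

text \<open>The squared \<open>L^2\<close> modulus of continuity of \<open>h\<close> for the
  translation by \<open>z\<close>.\<close>

definition osc1 :: "(real \<times> real \<Rightarrow> real) \<Rightarrow> real \<times> real \<Rightarrow> ennreal" where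
  "osc1 h z = (\<integral>\<^sup>+x. ennreal ((h (wrap (x + z)) - h x)\<^sup>2) \<partial>m)"

lemma id_m_borel[measurable]: "(\<lambda>x. x) \<in> m \<rightarrow>\<^sub>M borel"
  by (rule m_imp_borel) (rule measurable_ident_sets[OF refl])

lemma id_noise[simp, measurable]: "(\<lambda>x. x) \<in> noise_measure \<rightarrow>\<^sub>M borel"
  by (rule measurable_ident_sets) simp

lemma wrap_add_measurable[measurable (raw)]:
  "f \<in> N \<rightarrow>\<^sub>M m \<Longrightarrow> g \<in> borel_measurable N \<Longrightarrow> (\<lambda>x. wrap (f x + g x)) \<in> N \<rightarrow>\<^sub>M m"
  by (rule wrap_m) (rule borel_measurable_add[OF m_imp_borel])

lemma wrap_diff_measurable:
  assumes h: "h \<in> borel_measurable m" and "a \<in> borel_measurable N" "b \<in> borel_measurable N"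
  shows "(\<lambda>p. ennreal ((h (wrap (a p)) - h (wrap (b p)))\<^sup>2)) \<in> borel_measurable N"
  using measurable_compose[OF wrap_m[OF assms(2)] h] measurable_compose[OF wrap_m[OF assms(3)] h]
  by measurable

lemma osc1_measurable[measurable]:
  assumes [measurable]: "h \<in> borel_measurable m"
  shows "osc1 h \<in> borel_measurable borel"
  unfolding osc1_def by measurable

text \<open>The intermediate point \<open>x + z\<close> splits the increment; translation invariance
  turns the second part into an increment starting at \<open>x\<close>.\<close>

lemma osc1_add:
  assumes [measurable]: "h \<in> borel_measurable m"
  shows "osc1 h (z + w) \<le> 2 * osc1 h z + 2 * osc1 h w"
proof -
  have "osc1 h (z + w) \<le> (\<integral>\<^sup>+x. 2 * ennreal ((h (wrap (x + z)) - h x)\<^sup>2) +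
      2 * ennreal ((h (wrap (wrap (x + z) + w)) - h (wrap (x + z)))\<^sup>2) \<partial>m)"
    unfolding osc1_def
  proof (rule nn_integral_mono)
    fix x
    let ?a = "h (wrap (x + z)) - h x" and ?b = "h (wrap (wrap (x + z) + w)) - h (wrap (x + z))"
    have "(?a + ?b)\<^sup>2 \<le> 2 * ?a\<^sup>2 + 2 * ?b\<^sup>2"
      using sum_squares_ge_zero[of "?a - ?b" 0] by (simp add: power2_eq_square algebra_simps)
    then have "ennreal ((?a + ?b)\<^sup>2) \<le> ennreal (2 * ?a\<^sup>2 + 2 * ?b\<^sup>2)" by (rule ennreal_leI)
    also have "\<dots> = 2 * ennreal (?a\<^sup>2) + 2 * ennreal (?b\<^sup>2)"
      by (simp only: ennreal_mult' ennreal_plus mult_nonneg_nonneg zero_le_power2 zero_le_numeral ennreal_numeral)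
    finally show "ennreal ((h (wrap (x + (z + w))) - h x)\<^sup>2) \<le> 2 * ennreal (?a\<^sup>2) + 2 * ennreal (?b\<^sup>2)"
      by (simp add: wrap_add add.assoc)
  qed
  also have "\<dots> = 2 * osc1 h z + 2 * (\<integral>\<^sup>+x. ennreal ((h (wrap (wrap (x + z) + w)) - h (wrap (x + z)))\<^sup>2) \<partial>m)"
    unfolding osc1_def by (simp add: nn_integral_add nn_integral_cmult)
  also have "(\<integral>\<^sup>+x. ennreal ((h (wrap (wrap (x + z) + w)) - h (wrap (x + z)))\<^sup>2) \<partial>m) = osc1 h w"
    unfolding osc1_def
    by (rule nn_integral_wrap_shift[where f = "\<lambda>y. ennreal ((h (wrap (y + w)) - h y)\<^sup>2)"]) measurable
  finally show ?thesis .
qed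

lemma osc1_double:
  assumes h: "h \<in> borel_measurable m"
  shows "osc1 h (2 *\<^sub>R z) \<le> 4 * osc1 h z"
proof -
  have "osc1 h (z + z) \<le> 2 * osc1 h z + 2 * osc1 h z" by (rule osc1_add[OF h])
  also have "\<dots> = (2 + 2) * osc1 h z" by (simp only: distrib_right)
  finally show ?thesis by (simp add: scaleR_2)
qed

text \<open>Doubling lets the oscillations over a small box control those over the whole torus.\<close>

lemma osc1_box_double:
  assumes h[measurable]: "h \<in> borel_measurable m"
  shows "(\<integral>\<^sup>+z. indicator (box2 (2 ^ k * r)) z * osc1 h z \<partial>lborel) \<le> 16 ^ k * (\<integral>\<^sup>+z. indicator (box2 r) z * osc1 h z \<partial>lborel)"
proof (induction k)
  case (Suc k)
  let ?I = "\<lambda>r. \<integral>\<^sup>+z. indicator (box2 r) z * osc1 h z \<partial>lborel"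
  have bm: "(\<lambda>z. indicator (box2 s) z * osc1 h z) \<in> borel_measurable borel" for s
    by (intro borel_measurable_times_ennreal borel_measurable_indicator box2_borel osc1_measurable[OF h])
  \<comment> \<open>Rescaling the plane by 2 contributes one factor 4 and \<open>osc1_double\<close>
    another, together 16.\<close>
  have "?I (2 ^ Suc k * r) = 4 * (\<integral>\<^sup>+z. indicator (box2 (2 ^ Suc k * r)) (2 *\<^sub>R z) * osc1 h (2 *\<^sub>R z) \<partial>lborel)"
    using nn_integral_lborel_double[OF bm[of "2 ^ Suc k * r"]] .
  also have "\<dots> \<le> 4 * (\<integral>\<^sup>+z. 4 * (indicator (box2 (2 ^ k * r)) z * osc1 h z) \<partial>lborel)"
  proof (rule mult_left_mono, rule nn_integral_mono)
    fix z :: "real \<times> real"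
    have "2 *\<^sub>R z \<in> box2 (2 * s) \<longleftrightarrow> z \<in> box2 s" for s :: real
      unfolding box2_def mem_Times_iff greaterThanLessThan_iff fst_scaleR snd_scaleR real_scaleR_def by linarith
    from this[of "2 ^ k * r"] have "2 *\<^sub>R z \<in> box2 (2 ^ Suc k * r) \<longleftrightarrow> z \<in> box2 (2 ^ k * r)"
      by (simp only: power_Suc mult.assoc)
    then have ind: "(indicator (box2 (2 ^ Suc k * r)) (2 *\<^sub>R z) :: ennreal) = indicator (box2 (2 ^ k * r)) z"
      by (simp only: indicator_def)
    show "indicator (box2 (2 ^ Suc k * r)) (2 *\<^sub>R z) * osc1 h (2 *\<^sub>R z) \<le> 4 * (indicator (box2 (2 ^ k * r)) z * osc1 h z)"
      unfolding ind using mult_left_mono[OF osc1_double[OF h, of z], of "indicator (box2 (2 ^ k * r)) z"]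
      by (simp only: mult.left_commute zero_le)
  qed simp
  also have "\<dots> = 16 * ?I (2 ^ k * r)" 
  proof -
    have "(\<integral>\<^sup>+z. 4 * (indicator (box2 (2 ^ k * r)) z * osc1 h z) \<partial>lborel) = 4 * ?I (2 ^ k * r)"
      by (rule nn_integral_cmult) (use bm[of "2 ^ k * r"] in simp)
    then show ?thesis by (simp add: mult.assoc[symmetric])
  qed
  also have "\<dots> \<le> 16 * (16 ^ k * ?I r)" by (intro mult_left_mono Suc) simp
  finally show ?case by (simp add: mult.assoc)
qed simp

text \<open>Writing the second point as a translate of the first turns an average over pairs into an
  average of \<open>osc1\<close> over the torus.\<close>

lemma osc1_total:
  assumes [measurable]: "h \<in> borel_measurable m"
  shows "(\<integral>\<^sup>+x. (\<integral>\<^sup>+y. ennreal ((h x - h y)\<^sup>2) \<partial>m) \<partial>m) =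
    ennreal (1 / (2 * L)) * (\<integral>\<^sup>+z. osc1 h z * indicator (collision_space L) z \<partial>lborel)"
proof -
  have "(\<integral>\<^sup>+x. (\<integral>\<^sup>+y. ennreal ((h x - h y)\<^sup>2) \<partial>m) \<partial>m) = (\<integral>\<^sup>+x. (\<integral>\<^sup>+y. ennreal ((h y - h x)\<^sup>2) \<partial>m) \<partial>m)"
    by (simp add: power2_commute)
  also have "\<dots> = (\<integral>\<^sup>+x. (\<integral>\<^sup>+z. ennreal ((h (wrap (z + x)) - h x)\<^sup>2) \<partial>m) \<partial>m)"
  proof (rule nn_integral_cong)
    fix x assume [measurable]: "x \<in> space m"
    show "(\<integral>\<^sup>+y. ennreal ((h y - h x)\<^sup>2) \<partial>m) = (\<integral>\<^sup>+z. ennreal ((h (wrap (z + x)) - h x)\<^sup>2) \<partial>m)"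
      by (rule nn_integral_wrap_shift[where f = "\<lambda>y. ennreal ((h y - h x)\<^sup>2)", symmetric]) measurable
  qed
  also have "\<dots> = (\<integral>\<^sup>+z. (\<integral>\<^sup>+x. ennreal ((h (wrap (z + x)) - h x)\<^sup>2) \<partial>m) \<partial>m)"
  proof -
    interpret mm: pair_sigma_finite m m ..
    have "(\<lambda>(z, x). ennreal ((h (wrap (z + x)) - h x)\<^sup>2)) \<in> borel_measurable (m \<Otimes>\<^sub>M m)"
      unfolding split_beta'
      by (intro measurable_compose[OF _ measurable_ennreal] borel_measurable_power borel_measurable_diff
          measurable_compose[OF _ assms] wrap_add_measurable m_imp_borel measurable_snd measurable_fst)
    from mm.Fubini'[OF this] show ?thesis by simp
  qed
  also have "\<dots> = (\<integral>\<^sup>+z. osc1 h z \<partial>m)"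
    by (simp add: osc1_def add.commute)
  also have "\<dots> = ennreal (1 / (2 * L)) * (\<integral>\<^sup>+z. osc1 h z * indicator (collision_space L) z \<partial>lborel)"
    by (rule nn_integral_m) (rule measurable_compose[OF id_m_borel osc1_measurable[OF assms]])
  finally show ?thesis .
qed

lemma noise_osc_lower_bound:
  obtains c :: real where "0 < c"
    "\<And>h. h \<in> borel_measurable m \<Longrightarrow>
      ennreal c * (\<integral>\<^sup>+x. (\<integral>\<^sup>+y. ennreal ((h x - h y)\<^sup>2) \<partial>m) \<partial>m) \<le> (\<integral>\<^sup>+w. (\<integral>\<^sup>+u. osc1 h (u - w) \<partial>noise_measure) \<partial>noise_measure)"
proof -
  obtain c r where c: "0 < c" and r: "0 < r" and low: "\<And>f. f \<in> borel_measurable borel \<Longrightarrow>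
      ennreal c * (\<integral>\<^sup>+z. indicator (box2 r) z * f z \<partial>lborel) \<le> (\<integral>\<^sup>+w. (\<integral>\<^sup>+u. f (u - w) \<partial>noise_measure) \<partial>noise_measure)"
    using noise_density_lower_bound by blast
  \<comment> \<open>Enough doublings for the box to contain the whole fundamental domain.\<close>
  obtain k where k: "(L + 2) / r < 2 ^ k" using real_arch_pow[of 2 "(L + 2) / r"] by auto
  have big: "L + 2 < 2 ^ k * r" using k r by (simp add: pos_divide_less_eq)
  show thesis
  proof (rule that)
    \<comment> \<open>The factor 2 L undoes the normalisation of the measure; the power of 16 is the
      price of the doublings.\<close>
    show "0 < c * (2 * L) / 16 ^ k" using c L_pos by simp
    fix h :: "real \<times> real \<Rightarrow> real" assume h[measurable]: "h \<in> borel_measurable m"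
    let ?I = "\<integral>\<^sup>+z. indicator (box2 r) z * osc1 h z \<partial>lborel"
    have "(\<integral>\<^sup>+z. osc1 h z * indicator (collision_space L) z \<partial>lborel) \<le> (\<integral>\<^sup>+z. indicator (box2 (2 ^ k * r)) z * osc1 h z \<partial>lborel)"
    proof (rule nn_integral_mono)
      fix z
      have "z \<in> collision_space L \<Longrightarrow> z \<in> box2 (2 ^ k * r)"
        using big L_pos by (auto simp: collision_space_def box2_def)
      then show "osc1 h z * indicator (collision_space L) z \<le> indicator (box2 (2 ^ k * r)) z * osc1 h z"
        by (auto simp: indicator_def)
    qed
    also have "\<dots> \<le> 16 ^ k * ?I" by (rule osc1_box_double[OF h])
    finally have 1: "(\<integral>\<^sup>+z. osc1 h z * indicator (collision_space L) z \<partial>lborel) \<le> 16 ^ k * ?I" .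
    have "ennreal (c * (2 * L) / 16 ^ k) * (\<integral>\<^sup>+x. (\<integral>\<^sup>+y. ennreal ((h x - h y)\<^sup>2) \<partial>m) \<partial>m) \<le>
        ennreal (c * (2 * L) / 16 ^ k) * (ennreal (1 / (2 * L)) * (16 ^ k * ?I))"
      unfolding osc1_total[OF h] by (intro mult_left_mono 1) auto
    also have "\<dots> = (ennreal (c * (2 * L) / 16 ^ k) * ennreal (1 / (2 * L)) * ennreal (16 ^ k)) * ?I"
    proof -
      have "(16 :: ennreal) ^ k = ennreal (16 ^ k)"
        by (metis ennreal_numeral ennreal_power zero_le_numeral)
      then show ?thesis by (simp only: mult.assoc)
    qed
    also have "ennreal (c * (2 * L) / 16 ^ k) * ennreal (1 / (2 * L)) * ennreal (16 ^ k) = ennreal c"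
      using c L_pos by (simp add: ennreal_mult[symmetric])
    also have "ennreal c * ?I \<le> (\<integral>\<^sup>+w. (\<integral>\<^sup>+u. osc1 h (u - w) \<partial>noise_measure) \<partial>noise_measure)"
      by (rule low) (rule osc1_measurable[OF h])
    finally show "ennreal (c * (2 * L) / 16 ^ k) * (\<integral>\<^sup>+x. (\<integral>\<^sup>+y. ennreal ((h x - h y)\<^sup>2) \<partial>m) \<partial>m) \<le>
      (\<integral>\<^sup>+w. (\<integral>\<^sup>+u. osc1 h (u - w) \<partial>noise_measure) \<partial>noise_measure)" .
  qed
qed

definition smooth :: "(real \<times> real \<Rightarrow> real) \<Rightarrow> real \<times> real \<Rightarrow> real" where
  "smooth h z = (\<integral>u. h (wrap (u + z)) \<partial>noise_measure)"

text \<open>The loss of squared norm under averaging is the integral over \<open>x\<close> of the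
  variance of \<open>h\<close> under the noise, which is half of the double noise integral of
  \<open>osc1\<close>.\<close>

lemma smooth_gap:
  obtains \<kappa> :: real where "0 < \<kappa>"
    "\<And>h. h \<in> borel_measurable m \<Longrightarrow> (\<And>x. 0 \<le> h x) \<Longrightarrow> (\<And>x. h x \<le> (1::real)) \<Longrightarrow>
      (\<integral>x. (smooth h x)\<^sup>2 \<partial>m) + \<kappa> * (\<integral>x. (\<integral>y. (h x - h y)\<^sup>2 \<partial>m) \<partial>m) \<le> (\<integral>x. (h x)\<^sup>2 \<partial>m)"
proof -
  obtain c where c: "0 < c" and low: "\<And>h. h \<in> borel_measurable m \<Longrightarrow>
      ennreal c * (\<integral>\<^sup>+x. (\<integral>\<^sup>+y. ennreal ((h x - h y)\<^sup>2) \<partial>m) \<partial>m) \<le> (\<integral>\<^sup>+w. (\<integral>\<^sup>+u. osc1 h (u - w) \<partial>noise_measure) \<partial>noise_measure)"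
    using noise_osc_lower_bound by blast
  interpret mn: pair_sigma_finite m noise_measure ..
  show thesis
  proof (rule that)
    show "0 < c / 2" using c by simp
    fix h :: "real \<times> real \<Rightarrow> real"
    assume h[measurable]: "h \<in> borel_measurable m" and h0: "\<And>x. 0 \<le> h x" and h1: "\<And>x. h x \<le> 1"
    have hw[measurable]: "(\<lambda>(x, u). h (wrap (u + x))) \<in> borel_measurable (m \<Otimes>\<^sub>M noise_measure)"
      unfolding split_beta'
      by (rule measurable_compose[OF _ h], rule wrap_m, rule borel_measurable_add)
         (simp, rule m_imp_borel[OF measurable_fst])
    have hwu: "(\<lambda>u. h (wrap (u + x))) \<in> borel_measurable noise_measure" for x
      by (rule measurable_compose[OF _ h], rule wrap_m, rule borel_measurable_add) simp_all
    have hwx: "(\<lambda>x. h (wrap (x + u))) \<in> borel_measurable m" for u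
      by (rule measurable_compose[OF _ h], rule wrap_add_measurable) auto
    define s2 where "s2 x = (\<integral>u. (h (wrap (u + x)))\<^sup>2 \<partial>noise_measure)" for x
    have i2: "integrable noise_measure (\<lambda>u. (h (wrap (u + x)))\<^sup>2)" for x
      using h0 h1 hwu by (intro noise.integrable_const_bound[where B = 1]) (auto simp: abs_square_le_1)
    have i1: "integrable noise_measure (\<lambda>u. h (wrap (u + x)))" for x
      using h0 h1 hwu by (intro noise.integrable_const_bound[where B = 1]) auto
    have s2m[measurable]: "s2 \<in> borel_measurable m" unfolding s2_def by measurable
    have sm[measurable]: "smooth h \<in> borel_measurable m" unfolding smooth_def[abs_def] by measurable
    have s01: "0 \<le> smooth h x" "smooth h x \<le> 1" "0 \<le> s2 x" "s2 x \<le> 1" for x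
      using integral_mono[OF i1[of x], of "\<lambda>_. 1"] integral_mono[OF i2[of x], of "\<lambda>_. 1"] h0 h1
      by (auto simp: smooth_def s2_def noise.prob_space[unfolded space_noise] abs_square_le_1)
    have is2: "integrable m s2" using s01 by (intro m.integrable_const_bound[where B = 1]) auto
    have ism: "integrable m (\<lambda>x. (smooth h x)\<^sup>2)"
      using s01 by (intro m.integrable_const_bound[where B = 1]) (auto simp: abs_square_le_1)
    have ih2: "integrable m (\<lambda>x. (h x)\<^sup>2)"
      using h0 h1 by (intro m.integrable_const_bound[where B = 1]) (auto simp: abs_square_le_1)
    \<comment> \<open>Translation by each single noise value preserves the integral of the square of
      \<open>h\<close>, hence so does the average over the noise.\<close>
    have s2_int: "(\<integral>x. s2 x \<partial>m) = (\<integral>x. (h x)\<^sup>2 \<partial>m)"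
    proof -
      have "ennreal (\<integral>x. s2 x \<partial>m) = (\<integral>\<^sup>+x. ennreal (s2 x) \<partial>m)"
        using s01 by (intro nn_integral_eq_integral[symmetric] is2) auto
      also have "\<dots> = (\<integral>\<^sup>+x. (\<integral>\<^sup>+u. ennreal ((h (wrap (u + x)))\<^sup>2) \<partial>noise_measure) \<partial>m)"
        unfolding s2_def by (intro nn_integral_cong nn_integral_eq_integral[symmetric] i2) auto
      also have "\<dots> = (\<integral>\<^sup>+u. (\<integral>\<^sup>+x. ennreal ((h (wrap (u + x)))\<^sup>2) \<partial>m) \<partial>noise_measure)"
        by (rule mn.Fubini'[symmetric]) measurable
      also have "\<dots> = (\<integral>\<^sup>+u. (\<integral>\<^sup>+x. ennreal ((h x)\<^sup>2) \<partial>m) \<partial>noise_measure)"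
      proof (rule nn_integral_cong)
        fix u
        have "(\<integral>\<^sup>+x. ennreal ((h (wrap (x + u)))\<^sup>2) \<partial>m) = (\<integral>\<^sup>+x. ennreal ((h x)\<^sup>2) \<partial>m)"
          by (rule nn_integral_wrap_shift[where f = "\<lambda>x. ennreal ((h x)\<^sup>2)"]) simp
        then show "(\<integral>\<^sup>+x. ennreal ((h (wrap (u + x)))\<^sup>2) \<partial>m) = (\<integral>\<^sup>+x. ennreal ((h x)\<^sup>2) \<partial>m)"
          by (simp only: add.commute)
      qed
      also have "\<dots> = ennreal (\<integral>x. (h x)\<^sup>2 \<partial>m)"
        using noise.emeasure_space_1 by (simp add: nn_integral_eq_integral[OF ih2])
      finally show ?thesis
        by (subst (asm) ennreal_inj) (auto intro!: integral_nonneg_AE simp: s01)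
    qed
    \<comment> \<open>Shifting \<open>x\<close> by \<open>w\<close> replaces the increment over
      \<open>u - w\<close> by the comparison of \<open>u + x\<close> with \<open>w + x\<close>, in
      which the variance at \<open>x\<close> is visible.\<close>
    have J: "(\<integral>\<^sup>+w. (\<integral>\<^sup>+u. osc1 h (u - w) \<partial>noise_measure) \<partial>noise_measure) =
        (\<integral>\<^sup>+x. (\<integral>\<^sup>+w. (\<integral>\<^sup>+u. ennreal ((h (wrap (u + x)) - h (wrap (w + x)))\<^sup>2) \<partial>noise_measure) \<partial>noise_measure) \<partial>m)"
    proof -
      have shift: "osc1 h (u - w) = (\<integral>\<^sup>+x. ennreal ((h (wrap (u + x)) - h (wrap (w + x)))\<^sup>2) \<partial>m)" for u w
      proof -
        have "osc1 h (u - w) = (\<integral>\<^sup>+x. ennreal ((h (wrap (wrap (x + w) + (u - w))) - h (wrap (x + w)))\<^sup>2) \<partial>m)"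
          unfolding osc1_def
          by (rule nn_integral_wrap_shift[where f = "\<lambda>y. ennreal ((h (wrap (y + (u - w))) - h y)\<^sup>2)", symmetric]) measurable
        then show ?thesis by (simp add: wrap_add add.commute)
      qed
      have f1: "fst \<in> borel_measurable (m \<Otimes>\<^sub>M noise_measure)" by (rule m_imp_borel[OF measurable_fst])
      have f2: "(\<lambda>p. fst (fst p)) \<in> borel_measurable ((m \<Otimes>\<^sub>M noise_measure) \<Otimes>\<^sub>M noise_measure)"
        by (rule measurable_compose[OF measurable_fst f1])
      have "(\<lambda>p. ennreal ((h (wrap (snd p + fst (fst p))) - h (wrap (snd (fst p) + fst (fst p))))\<^sup>2))
          \<in> borel_measurable ((m \<Otimes>\<^sub>M noise_measure) \<Otimes>\<^sub>M noise_measure)"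
        by (intro wrap_diff_measurable[OF h] borel_measurable_add f2) measurable
      then have m1: "(\<lambda>(x, w). \<integral>\<^sup>+u. ennreal ((h (wrap (u + x)) - h (wrap (w + x)))\<^sup>2) \<partial>noise_measure) \<in> borel_measurable (m \<Otimes>\<^sub>M noise_measure)"
        unfolding split_beta' by (intro noise.borel_measurable_nn_integral) (simp add: split_beta')
      have m2: "(\<lambda>(x, u). ennreal ((h (wrap (u + x)) - h (wrap (w + x)))\<^sup>2)) \<in> borel_measurable (m \<Otimes>\<^sub>M noise_measure)" for w
        unfolding split_beta' by (intro wrap_diff_measurable[OF h] borel_measurable_add f1) measurable
      have "(\<integral>\<^sup>+w. (\<integral>\<^sup>+u. osc1 h (u - w) \<partial>noise_measure) \<partial>noise_measure) =
         (\<integral>\<^sup>+w. (\<integral>\<^sup>+x. (\<integral>\<^sup>+u. ennreal ((h (wrap (u + x)) - h (wrap (w + x)))\<^sup>2) \<partial>noise_measure) \<partial>m) \<partial>noise_measure)"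
        unfolding shift by (intro nn_integral_cong) (use mn.Fubini'[OF m2] in simp)
      also have "\<dots> = (\<integral>\<^sup>+x. (\<integral>\<^sup>+w. (\<integral>\<^sup>+u. ennreal ((h (wrap (u + x)) - h (wrap (w + x)))\<^sup>2) \<partial>noise_measure) \<partial>noise_measure) \<partial>m)"
        using mn.Fubini'[OF m1] by simp
      finally show ?thesis .
    qed
    also have "\<dots> = (\<integral>\<^sup>+x. ennreal (2 * (s2 x - (smooth h x)\<^sup>2)) \<partial>m)"
    proof (rule nn_integral_cong)
      fix x
      have "(\<integral>\<^sup>+w. (\<integral>\<^sup>+u. ennreal ((h (wrap (w + x)) - h (wrap (u + x)))\<^sup>2) \<partial>noise_measure) \<partial>noise_measure)
        = ennreal (2 * (s2 x - (smooth h x)\<^sup>2))"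
        unfolding s2_def smooth_def by (rule noise.two_point_variance) (use hwu h0 h1 in auto)
      then show "(\<integral>\<^sup>+w. (\<integral>\<^sup>+u. ennreal ((h (wrap (u + x)) - h (wrap (w + x)))\<^sup>2) \<partial>noise_measure) \<partial>noise_measure)
        = ennreal (2 * (s2 x - (smooth h x)\<^sup>2))" by (simp add: power2_commute)
    qed
    also have "\<dots> = ennreal (\<integral>x. 2 * (s2 x - (smooth h x)\<^sup>2) \<partial>m)"
    proof (rule nn_integral_eq_integral)
      show "integrable m (\<lambda>x. 2 * (s2 x - (smooth h x)\<^sup>2))" using is2 ism by simp
      have "(smooth h x)\<^sup>2 \<le> s2 x" for x
        using noise.variance_positive[of "\<lambda>u. h (wrap (u + x))"] noise.variance_eq[OF i1 i2, of x]
        by (simp add: smooth_def s2_def)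
      then show "AE x in m. 0 \<le> 2 * (s2 x - (smooth h x)\<^sup>2)" by simp
    qed
    also have "(\<integral>x. 2 * (s2 x - (smooth h x)\<^sup>2) \<partial>m) = 2 * ((\<integral>x. (h x)\<^sup>2 \<partial>m) - (\<integral>x. (smooth h x)\<^sup>2 \<partial>m))"
      using is2 ism by (simp add: s2_int)
    finally have JJ: "(\<integral>\<^sup>+w. (\<integral>\<^sup>+u. osc1 h (u - w) \<partial>noise_measure) \<partial>noise_measure) =
      ennreal (2 * ((\<integral>x. (h x)\<^sup>2 \<partial>m) - (\<integral>x. (smooth h x)\<^sup>2 \<partial>m)))" .
    let ?D = "\<integral>x. (\<integral>y. (h x - h y)\<^sup>2 \<partial>m) \<partial>m"
    have "(h x - h y)\<^sup>2 \<le> 1" for x y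
      using h0[of x] h0[of y] h1[of x] h1[of y] by (simp add: abs_square_le_1)
    note le1 = this
    have id: "integrable m (\<lambda>y. (h x - h y)\<^sup>2)" for x
      using le1 by (intro m.integrable_const_bound[where B = 1]) auto
    have "(\<integral>y. (h x - h y)\<^sup>2 \<partial>m) \<le> 1" for x
      using integral_mono[OF id[of x], of "\<lambda>_. 1"] le1 by (simp add: m.prob_space)
    then have id2: "integrable m (\<lambda>x. \<integral>y. (h x - h y)\<^sup>2 \<partial>m)"
      by (intro m.integrable_const_bound[where B = 1]) auto
    have "(\<integral>\<^sup>+x. (\<integral>\<^sup>+y. ennreal ((h x - h y)\<^sup>2) \<partial>m) \<partial>m) = ennreal ?D"
    proof -
      have "(\<integral>\<^sup>+x. (\<integral>\<^sup>+y. ennreal ((h x - h y)\<^sup>2) \<partial>m) \<partial>m) = (\<integral>\<^sup>+x. ennreal (\<integral>y. (h x - h y)\<^sup>2 \<partial>m) \<partial>m)"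
        by (intro nn_integral_cong nn_integral_eq_integral id) auto
      then show ?thesis using nn_integral_eq_integral[OF id2] by simp
    qed
    with low[OF h] have "ennreal c * ennreal ?D \<le> ennreal (2 * ((\<integral>x. (h x)\<^sup>2 \<partial>m) - (\<integral>x. (smooth h x)\<^sup>2 \<partial>m)))"
      by (simp add: JJ)
    then have "ennreal (c * ?D) \<le> ennreal (2 * ((\<integral>x. (h x)\<^sup>2 \<partial>m) - (\<integral>x. (smooth h x)\<^sup>2 \<partial>m)))"
      using c by (simp add: ennreal_mult')
    moreover have "(\<integral>x. (smooth h x)\<^sup>2 \<partial>m) \<le> (\<integral>x. (h x)\<^sup>2 \<partial>m)"
      unfolding s2_int[symmetric]
    proof (rule integral_mono[OF ism is2])
      fix x
      show "(smooth h x)\<^sup>2 \<le> s2 x"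
        using noise.variance_positive[of "\<lambda>u. h (wrap (u + x))"] noise.variance_eq[OF i1 i2, of x]
        by (simp add: smooth_def s2_def)
    qed
    ultimately have "c * ?D \<le> 2 * ((\<integral>x. (h x)\<^sup>2 \<partial>m) - (\<integral>x. (smooth h x)\<^sup>2 \<partial>m))"
      by (subst (asm) ennreal_le_iff) auto
    then show "(\<integral>x. (smooth h x)\<^sup>2 \<partial>m) + c / 2 * ?D \<le> (\<integral>x. (h x)\<^sup>2 \<partial>m)" by simp
  qed
qed

end

section \<open>The transition kernel of the noisy map\<close>

context torus_noise
begin

text \<open>The left-hand side asks for some lattice translate in \<open>B\<close>, the right-hand
  side for the canonical representative. They differ only if a translate has second coordinate
  exactly 1, because \<open>wrap\<close> sends it to -1.\<close>

lemma emeasure_perturbed: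
  assumes B: "B \<in> sets m"
  shows "perturbed L \<rho> z B = emeasure (distr noise_measure m (\<lambda>u. wrap (u + z))) B"
proof -
  let ?\<Lambda> = "noise_lattice L"
  have B': "B \<in> sets borel" "B \<subseteq> collision_space L" using B by (auto simp: sets_m_iff)
  have "?\<Lambda> = (\<lambda>(j, k). (L * of_int j, 2 * of_int k)) ` (UNIV :: (int \<times> int) set)"
    by (auto simp: noise_lattice_def)
  then have count: "countable ?\<Lambda>" by simp
  have pre: "(\<lambda>u. u + z + w) -` B \<in> sets borel" for w
    using measurable_sets[OF _ B'(1), of "\<lambda>u. u + z + w" borel] by simp
  have "{u. \<exists>w\<in>?\<Lambda>. u + z + w \<in> B} = (\<Union>w\<in>?\<Lambda>. (\<lambda>u. u + z + w) -` B)" by blast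
  then have m1: "{u. \<exists>w\<in>?\<Lambda>. u + z + w \<in> B} \<in> sets borel"
    by (simp only:) (rule sets.countable_UN'[OF count], use pre in auto)
  have wm: "(\<lambda>u. wrap (u + z)) \<in> noise_measure \<rightarrow>\<^sub>M m"
    by (rule wrap_m, rule borel_measurable_add) simp_all
  have m2: "{u. wrap (u + z) \<in> B} \<in> sets borel"
    using measurable_sets[OF wm B] by (simp add: vimage_def)
  have wrap_eq: "\<exists>w\<in>?\<Lambda>. wrap y = y + w" for y
  proof
    let ?j = "- \<lfloor>(fst y - 0) / L\<rfloor>" and ?k = "- \<lfloor>(snd y - (-1)) / 2\<rfloor>"
    show "wrap y = y + (L * of_int ?j, 2 * of_int ?k)"
      by (auto simp: wrap_def wrap1_def plus_prod_def)
    show "(L * of_int ?j, 2 * of_int ?k) \<in> ?\<Lambda>" unfolding noise_lattice_def by blast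
  qed
  have wrap_lat: "wrap (y + w) = wrap y" if "w \<in> ?\<Lambda>" for y w
    using that by (auto simp: noise_lattice_def wrap_def wrap1_periodic[OF L_pos] wrap1_periodic)
  \<comment> \<open>The second coordinates of those noise values for which some translate lands on
    the edge \<open>s = 1\<close>.\<close>
  define C where "C = range (\<lambda>k::int. 2 * of_int k + 1 - snd z)"
  have "AE u in (lborel :: (real \<times> real) measure). snd u \<notin> C" by (rule AE_lborel_snd_notin) (simp add: C_def)
  then have "AE u in noise_measure. snd u \<notin> C"
    unfolding noise_measure_def by (subst AE_density) auto
  then have "AE u in noise_measure. u \<in> {u. \<exists>w\<in>?\<Lambda>. u + z + w \<in> B} \<longleftrightarrow> u \<in> {u. wrap (u + z) \<in> B}"
  proof eventually_elim
    case (elim u)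
    show ?case
    proof
      assume "u \<in> {u. \<exists>w\<in>?\<Lambda>. u + z + w \<in> B}"
      then obtain w where w: "w \<in> ?\<Lambda>" "u + z + w \<in> B" by auto
      obtain k where k: "snd w = 2 * of_int k" using w(1) by (auto simp: noise_lattice_def)
      have "snd (u + z + w) \<noteq> 1"
      proof
        assume "snd (u + z + w) = 1"
        then have "snd u = 2 * of_int (- k) + 1 - snd z" using k by simp
        then show False using elim unfolding C_def by blast
      qed
      then have "wrap (u + z + w) = u + z + w" using w(2) B'(2) by (intro wrap_ident) auto
      then show "u \<in> {u. wrap (u + z) \<in> B}" using w wrap_lat[OF w(1), of "u + z"] by simp
    next
      assume "u \<in> {u. wrap (u + z) \<in> B}"
      then show "u \<in> {u. \<exists>w\<in>?\<Lambda>. u + z + w \<in> B}" using wrap_eq[of "u + z"] by auto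
    qed
  qed
  then have "emeasure noise_measure {u. \<exists>w\<in>?\<Lambda>. u + z + w \<in> B} = emeasure noise_measure {u. wrap (u + z) \<in> B}"
    by (rule emeasure_eq_AE) (use m1 m2 in simp_all)
  then show ?thesis
    using wm B by (simp add: perturbed_def emeasure_distr noise_measure_def[symmetric] vimage_def)
qed

end

text \<open>\<open>F'\<close> is an everywhere defined measurable version of the map
  \<open>F\<close>, which is controlled only up to a null set, as is the kernel.\<close>

locale noisy_map = torus_noise +
  fixes F F' :: "real \<times> real \<Rightarrow> real \<times> real" and P :: "real \<times> real \<Rightarrow> (real \<times> real) measure"
  assumes F'_meas[measurable]: "F' \<in> m \<rightarrow>\<^sub>M m"
    and F'_preserves: "distr m m F' = m"
    and F_eq: "AE x in m. F x = F' x"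
    and P_kernel: "P \<in> m \<rightarrow>\<^sub>M prob_algebra m"
    and P_eq: "AE x in m. \<forall>B\<in>sets m. emeasure (P x) B = perturbed L \<rho> (F x) B"
begin

lemma P_distr: "AE x in m. P x = distr noise_measure m (\<lambda>u. wrap (u + F' x))"
  using F_eq P_eq AE_space
proof eventually_elim
  case (elim x)
  have "sets (P x) = sets m"
    using measurable_space[OF P_kernel elim(3)] by (auto simp: space_prob_algebra)
  then show ?case using elim by (intro measure_eqI) (auto simp: emeasure_perturbed)
qed

lemma wrap_noise_meas: "(\<lambda>u. wrap (u + z)) \<in> noise_measure \<rightarrow>\<^sub>M m"
  by (rule wrap_m, rule borel_measurable_add) simp_all

text \<open>The kernel average of \<open>h\<close> at \<open>x\<close> is
  \<open>smooth h (F' x)\<close>. Composition with \<open>F'\<close> preserves integrals, so the gap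
  of the noise and the invariance of \<open>m\<close> are inherited.\<close>

lemma spectral_gap_exists: "\<exists>\<kappa>. spectral_gap m P \<kappa>"
proof -
  obtain \<kappa> where \<kappa>: "0 < \<kappa>" and gap: "\<And>h. h \<in> borel_measurable m \<Longrightarrow> (\<And>x. 0 \<le> h x) \<Longrightarrow> (\<And>x. h x \<le> (1::real)) \<Longrightarrow>
      (\<integral>x. (smooth h x)\<^sup>2 \<partial>m) + \<kappa> * (\<integral>x. (\<integral>y. (h x - h y)\<^sup>2 \<partial>m) \<partial>m) \<le> (\<integral>x. (h x)\<^sup>2 \<partial>m)"
    using smooth_gap by blast
  interpret mn: pair_sigma_finite m noise_measure ..
  interpret mp: markov_process m P
    by unfold_locales (rule P_kernel)
  have fst_b: "fst \<in> borel_measurable (m \<Otimes>\<^sub>M noise_measure)" by (rule m_imp_borel[OF measurable_fst])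
  have hw: "(\<lambda>p. h (wrap (snd p + fst p))) \<in> borel_measurable (m \<Otimes>\<^sub>M noise_measure)"
    if "h \<in> borel_measurable m" for h :: "_ \<Rightarrow> 'b :: topological_space"
    by (rule measurable_compose[OF _ that], rule wrap_m) (intro borel_measurable_add fst_b, simp)
  have "(\<integral>\<^sup>+x. (\<integral>\<^sup>+y. f y \<partial>P x) \<partial>m) = (\<integral>\<^sup>+x. f x \<partial>m)" if f[measurable]: "f \<in> borel_measurable m" for f
  proof -
    define G where "G x = (\<integral>\<^sup>+u. f (wrap (u + x)) \<partial>noise_measure)" for x
    have G[measurable]: "G \<in> borel_measurable m"
      unfolding G_def by (rule noise.borel_measurable_nn_integral) (use hw[OF f] in \<open>simp add: split_beta'\<close>)
    have "(\<integral>\<^sup>+x. (\<integral>\<^sup>+y. f y \<partial>P x) \<partial>m) = (\<integral>\<^sup>+x. G (F' x) \<partial>m)"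
    proof (rule nn_integral_cong_AE)
      show "AE x in m. (\<integral>\<^sup>+y. f y \<partial>P x) = G (F' x)"
        using P_distr by eventually_elim (simp add: G_def nn_integral_distr[OF wrap_noise_meas])
    qed
    also have "\<dots> = (\<integral>\<^sup>+x. G x \<partial>distr m m F')" by (rule nn_integral_distr[symmetric]) auto
    also have "\<dots> = (\<integral>\<^sup>+x. G x \<partial>m)" by (simp add: F'_preserves)
    also have "\<dots> = (\<integral>\<^sup>+u. (\<integral>\<^sup>+x. f (wrap (u + x)) \<partial>m) \<partial>noise_measure)"
      unfolding G_def by (rule mn.Fubini'[symmetric]) (use hw[OF f] in \<open>simp add: split_beta'\<close>)
    also have "\<dots> = (\<integral>\<^sup>+u. (\<integral>\<^sup>+x. f x \<partial>m) \<partial>noise_measure)"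
    proof (rule nn_integral_cong)
      fix u
      show "(\<integral>\<^sup>+x. f (wrap (u + x)) \<partial>m) = (\<integral>\<^sup>+x. f x \<partial>m)"
        using nn_integral_wrap_shift[OF f, of u] by (simp only: add.commute)
    qed
    also have "\<dots> = (\<integral>\<^sup>+x. f x \<partial>m)" using noise.emeasure_space_1 by simp
    finally show ?thesis .
  qed
  then interpret smp: stationary_markov_process m P by unfold_locales
  have "spectral_gap m P \<kappa>"
  proof unfold_locales
    fix h :: "real \<times> real \<Rightarrow> real"
    assume h[measurable]: "h \<in> borel_measurable m" and h01: "\<And>x. 0 \<le> h x" "\<And>x. h x \<le> 1"
    have sm[measurable]: "smooth h \<in> borel_measurable m"
      unfolding smooth_def[abs_def] by (rule noise.borel_measurable_lebesgue_integral) (use hw[OF h] in \<open>simp add: split_beta'\<close>)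
    have [measurable]: "(\<lambda>x. \<integral>y. h y \<partial>P x) \<in> borel_measurable m"
      by (rule measurable_compose[OF mp.kernel_sub integral_measurable_subprob_algebra]) simp
    have "(\<integral>x. (\<integral>y. h y \<partial>P x)\<^sup>2 \<partial>m) = (\<integral>x. (smooth h (F' x))\<^sup>2 \<partial>m)"
    proof (rule integral_cong_AE)
      show "AE x in m. (\<integral>y. h y \<partial>P x)\<^sup>2 = (smooth h (F' x))\<^sup>2"
        using P_distr by eventually_elim (simp add: smooth_def integral_distr[OF wrap_noise_meas h])
    qed measurable
    also have "\<dots> = (\<integral>x. (smooth h x)\<^sup>2 \<partial>distr m m F')"
      by (rule integral_distr[symmetric]) auto
    also have "\<dots> = (\<integral>x. (smooth h x)\<^sup>2 \<partial>m)" by (simp add: F'_preserves)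
    finally show "(\<integral>x. (\<integral>y. h y \<partial>P x)\<^sup>2 \<partial>m) + \<kappa> * (\<integral>x. (\<integral>y. (h x - h y)\<^sup>2 \<partial>m) \<partial>m) \<le> (\<integral>x. (h x)\<^sup>2 \<partial>m)"
      using gap[OF h h01] by simp
  qed (rule \<kappa>)
  then show ?thesis by blast
qed

end

section \<open>Lemon tables\<close>

text \<open>Strict convexity of the disc: the squared norm of a convex combination is the convex
  combination of the squared norms minus
  \<open>\<tau> * (1 - \<tau>) * (cmod (p - q))\<^sup>2\<close>.\<close>

lemma open_segment_in_ball:
  fixes p q c :: complex
  assumes "cmod (p - c) \<le> R" "cmod (q - c) \<le> R" "p \<noteq> q" "0 < \<tau>" "\<tau> < 1"
  shows "cmod ((1 - of_real \<tau>) * p + of_real \<tau> * q - c) < R"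
proof -
  let ?u = "p - c" and ?w = "q - c"
  have R: "0 \<le> R" using assms(1) norm_ge_zero order_trans by blast
  have eq: "(1 - of_real \<tau>) * p + of_real \<tau> * q - c = (1 - \<tau>) *\<^sub>R ?u + \<tau> *\<^sub>R ?w"
    by (simp add: scaleR_conv_of_real algebra_simps)
  have "(cmod ((1 - \<tau>) *\<^sub>R ?u + \<tau> *\<^sub>R ?w))\<^sup>2 =
     (1 - \<tau>) * (cmod ?u)\<^sup>2 + \<tau> * (cmod ?w)\<^sup>2 - \<tau> * (1 - \<tau>) * (cmod (?u - ?w))\<^sup>2"
    unfolding cmod_power2 by (simp add: power2_eq_square algebra_simps)
  moreover have "(1 - \<tau>) * (cmod ?u)\<^sup>2 \<le> (1 - \<tau>) * R\<^sup>2" "\<tau> * (cmod ?w)\<^sup>2 \<le> \<tau> * R\<^sup>2"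
    using assms by (auto intro!: mult_left_mono power_mono)
  moreover have "0 < \<tau> * (1 - \<tau>) * (cmod (?u - ?w))\<^sup>2"
    using assms by simp
  ultimately have "(cmod ((1 - \<tau>) *\<^sub>R ?u + \<tau> *\<^sub>R ?w))\<^sup>2 < (1 - \<tau>) * R\<^sup>2 + \<tau> * R\<^sup>2" by linarith
  also have "\<dots> = R\<^sup>2" by (simp add: algebra_simps)
  finally have "cmod ((1 - \<tau>) *\<^sub>R ?u + \<tau> *\<^sub>R ?w) < R" using R by (rule power2_less_imp_less)
  then show ?thesis unfolding eq .
qed

text \<open>Orthogonality makes \<open>cnj w * d\<close> purely imaginary, and its modulus is
  \<open>R\<close>; the two signs give the two tangents.\<close>

lemma tangent_unit_cases:
  fixes w d :: complex
  assumes "Re w * Re d + Im w * Im d = 0" "cmod w = R" "cmod d = 1" "0 < R"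
  shows "d = \<i> * w / of_real R \<or> d = - \<i> * w / of_real R"
proof -
  define k where "k = cnj w * d"
  have "Re k = 0" using assms(1) by (simp add: k_def)
  moreover have "cmod k = R" using assms by (simp add: k_def norm_mult)
  ultimately have Im: "\<bar>Im k\<bar> = R" by (simp only: cmod_eq_Im)
  have "k = \<i> * of_real R \<or> k = - \<i> * of_real R"
  proof (cases "0 \<le> Im k")
    case True
    then have "k = \<i> * of_real R" using Im \<open>Re k = 0\<close> by (intro complex_eqI) simp_all
    then show ?thesis ..
  next
    case False
    then have "k = - \<i> * of_real R" using Im \<open>Re k = 0\<close> by (intro complex_eqI) simp_all
    then show ?thesis ..
  qed
  moreover have wk: "w * k = of_real R * (of_real R * d)"
    using assms(2) complex_norm_square[of w] by (simp add: k_def mult.assoc[symmetric] power2_eq_square)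
  moreover have R: "of_real R \<noteq> (0 :: complex)" using assms(4) by simp
  ultimately consider "of_real R * (of_real R * d) = of_real R * (\<i> * w)" | "of_real R * (of_real R * d) = of_real R * (- \<i> * w)"
    by (elim disjE) (simp_all add: mult_ac)
  then show ?thesis
  proof cases
    case 1
    then have "of_real R * d = \<i> * w" using R by (simp only: mult_cancel_left) simp
    then show ?thesis using nonzero_mult_div_cancel_left[OF R, of d] by metis
  next
    case 2
    then have "of_real R * d = - \<i> * w" using R by (simp only: mult_cancel_left) simp
    then show ?thesis using nonzero_mult_div_cancel_left[OF R, of d] by metis
  qed
qed

lemma has_vector_derivative_cis_compose:
  assumes "(g has_vector_derivative g') (at x)"
  shows "((\<lambda>t. cis (g t)) has_vector_derivative g' *\<^sub>R (\<i> * cis (g x))) (at x)"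
proof -
  have "((\<lambda>t. cis (g t)) has_derivative (\<lambda>t. (t *\<^sub>R g') *\<^sub>R (\<i> * cis (g x)))) (at x)"
    using assms unfolding has_vector_derivative_def by (rule has_derivative_cis)
  then show ?thesis by (simp add: has_vector_derivative_def)
qed

text \<open>The discs are indexed by truth values, so that \<open>\<not> j\<close> denotes the other
  one and statements about the two arcs are proved once.\<close>

locale lemon_billiard =
  fixes c :: "bool \<Rightarrow> complex" and R :: "bool \<Rightarrow> real" and D :: "complex set" and L :: real
    and \<gamma> :: "real \<Rightarrow> complex"
  assumes D_eq: "D = cball (c True) (R True) \<inter> cball (c False) (R False)"
    and card2: "card (sphere (c True) (R True) \<inter> sphere (c False) (R False)) = 2"
    and boundary: "arclength_boundary D L \<gamma>"
begin

lemma L_pos: "0 < L" and inj_gamma: "inj_on \<gamma> {0..<L}" and gamma_image: "\<gamma> ` {0..<L} = frontier D"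
  and gamma_pw: "\<gamma> piecewise_C1_differentiable_on {0..L}"
  and gamma_unit: "\<gamma> differentiable (at r) \<Longrightarrow> norm (vector_derivative \<gamma> (at r)) = 1"
  and gamma_inward: "\<gamma> differentiable (at r) \<Longrightarrow>
        \<exists>\<delta>>0. \<forall>t\<in>{0<..<\<delta>}. \<gamma> r + of_real t * (\<i> * vector_derivative \<gamma> (at r)) \<in> interior D"
  using boundary unfolding arclength_boundary_def by blast+

definition corners :: "complex set" where
  "corners = sphere (c True) (R True) \<inter> sphere (c False) (R False)"

definition arc :: "bool \<Rightarrow> complex set" where
  "arc j = sphere (c j) (R j) \<inter> ball (c (\<not> j)) (R (\<not> j))"

lemma finite_corners: "finite corners"
  using card2 by (auto simp: corners_def intro: card_ge_0_finite)

lemma two_corners: obtains a b where "a \<noteq> b" "corners = {a, b}"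
  using card2 unfolding corners_def card_2_iff by auto

lemma R_pos: "0 < R j"
proof -
  obtain a b where ab: "a \<noteq> b" "corners = {a, b}" by (rule two_corners)
  then have "dist (c j) a = R j" "dist (c j) b = R j" by (cases j; auto simp: corners_def)+
  then show ?thesis using ab(1) by (metis dist_eq_0_iff dist_pos_lt zero_le_dist order_le_less)
qed

text \<open>Concentric circles with a common point coincide, and a circle is infinite.\<close>

lemma c_distinct: "c True \<noteq> c False"
proof
  assume eq: "c True = c False"
  obtain a b where ab: "a \<noteq> b" "corners = {a, b}" by (rule two_corners)
  then have "dist (c True) a = R True" "dist (c False) a = R False" by (auto simp: corners_def)
  then have "corners = sphere (c True) (R True)" using eq by (simp add: corners_def)
  moreover have "infinite (sphere (c True) (R True))"
  proof -
    have "(\<lambda>t. c True + of_real (R True) * cis t) ` {0..1} \<subseteq> sphere (c True) (R True)"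
      using R_pos[of True] by (auto simp: dist_norm norm_mult)
    moreover have "inj_on (\<lambda>t. c True + of_real (R True) * cis t) {0..1}"
    proof (rule inj_onI)
      fix x y :: real assume xy: "x \<in> {0..1}" "y \<in> {0..1}" "c True + of_real (R True) * cis x = c True + of_real (R True) * cis y"
      then have "cis x = cis y" using R_pos[of True] by simp
      then have "cos x = cos y" by (metis cis.simps(1))
      then show "x = y" using xy cos_inj_pi[of x y] pi_gt3 by auto
    qed
    moreover have "infinite {0..1::real}" by (simp add: infinite_Icc)
    ultimately show ?thesis by (meson finite_imageD finite_subset)
  qed
  ultimately show False using finite_corners by simp
qed

lemma interior_D: "interior D = ball (c True) (R True) \<inter> ball (c False) (R False)"
  by (simp add: D_eq)

lemma interior_D_iff: "z \<in> interior D \<longleftrightarrow> (\<forall>j. cmod (z - c j) < R j)"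
  unfolding interior_D by (auto simp: dist_norm norm_minus_commute all_bool_eq)

lemma D_iff: "z \<in> D \<longleftrightarrow> (\<forall>j. cmod (z - c j) \<le> R j)"
  unfolding D_eq by (auto simp: dist_norm norm_minus_commute all_bool_eq)

lemma frontier_D: "frontier D = D - interior D"
  unfolding frontier_def D_eq by (simp add: closed_Int closure_closed)

lemma frontier_cases:
  "z \<in> frontier D \<longleftrightarrow> z \<in> corners \<or> z \<in> arc True \<or> z \<in> arc False"
  unfolding frontier_D Diff_iff D_iff interior_D_iff corners_def arc_def
  by (auto simp: all_bool_eq dist_norm norm_minus_commute)

lemma arc_iff: "z \<in> arc j \<longleftrightarrow> cmod (z - c j) = R j \<and> cmod (z - c (\<not> j)) < R (\<not> j)"
  by (auto simp: arc_def dist_norm norm_minus_commute)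

lemma arc_frontier: "z \<in> arc j \<Longrightarrow> z \<in> frontier D"
  by (cases j) (auto simp: frontier_cases)

lemma arc_disjoint: "z \<in> arc j \<Longrightarrow> z \<in> arc k \<Longrightarrow> j = k"
  unfolding arc_iff by (cases j; cases k) auto

lemma continuous_gamma: "continuous_on {0..L} \<gamma>"
  using gamma_pw by (simp add: piecewise_C1_differentiable_on_def)

lemma gamma_frontier: "0 \<le> r \<Longrightarrow> r < L \<Longrightarrow> \<gamma> r \<in> frontier D"
  using gamma_image by auto

text \<open>The orientation of the boundary selects the sign of the tangent.\<close>

lemma gamma_derivative:
  assumes r: "0 < r" "r < L" and arc: "\<gamma> r \<in> arc j" and near: "\<forall>\<^sub>F t in at r. \<gamma> t \<in> arc j"
    and d: "(\<gamma> has_vector_derivative d) (at r)"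
  shows "d = \<i> * (\<gamma> r - c j) / of_real (R j)"
proof -
  have diff: "\<gamma> differentiable (at r)" using d by (rule differentiableI_vector)
  have vd: "vector_derivative \<gamma> (at r) = d" using d by (rule vector_derivative_at)
  let ?w = "\<gamma> r - c j"
  have w: "cmod ?w = R j" using arc by (simp add: arc_iff)
  have "((\<lambda>t. (\<gamma> t - c j) \<bullet> (\<gamma> t - c j)) has_derivative (\<lambda>h. 2 * (?w \<bullet> (h *\<^sub>R d)))) (at r)"
    using d unfolding has_vector_derivative_def
    by (auto intro!: derivative_eq_intros simp: inner_commute)
  moreover have "((\<lambda>t. (\<gamma> t - c j) \<bullet> (\<gamma> t - c j)) has_derivative (\<lambda>h. 0)) (at r)"
  proof (rule has_derivative_transform_eventually)
    show "((\<lambda>t. (R j)\<^sup>2) has_derivative (\<lambda>h. 0)) (at r)" by simp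
    show "\<forall>\<^sub>F t in at r. (R j)\<^sup>2 = (\<gamma> t - c j) \<bullet> (\<gamma> t - c j)"
      using near by eventually_elim (simp add: arc_iff dot_square_norm)
    show "(R j)\<^sup>2 = ?w \<bullet> ?w" using w by (simp add: dot_square_norm)
  qed simp
  ultimately have "(\<lambda>h. 2 * (?w \<bullet> (h *\<^sub>R d))) = (\<lambda>h. 0)" by (rule has_derivative_unique)
  then have "2 * (?w \<bullet> (1 *\<^sub>R d)) = 0" by metis
  then have orth: "Re ?w * Re d + Im ?w * Im d = 0" by (simp add: inner_complex_def)
  have "cmod d = 1" using gamma_unit[OF diff] vd by simp
  from tangent_unit_cases[OF orth w this R_pos]
  have cases: "d = \<i> * ?w / of_real (R j) \<or> d = - \<i> * ?w / of_real (R j)" .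
  show ?thesis
  proof (rule ccontr)
    assume "d \<noteq> \<i> * ?w / of_real (R j)"
    then have d': "d = - \<i> * ?w / of_real (R j)" using cases by blast
    obtain \<delta> where \<delta>: "0 < \<delta>" "\<And>t. 0 < t \<Longrightarrow> t < \<delta> \<Longrightarrow> \<gamma> r + of_real t * (\<i> * d) \<in> interior D"
      using gamma_inward[OF diff] vd by auto
    \<comment> \<open>With the opposite sign \<open>\<i> * d\<close> is the outward unit normal, so
      a small step along it leaves disc \<open>j\<close>.\<close>
    have "\<gamma> r + of_real (\<delta>/2) * (\<i> * d) \<in> interior D" using \<delta>(1) by (intro \<delta>(2)) simp_all
    then have "cmod (\<gamma> r + of_real (\<delta>/2) * (\<i> * d) - c j) < R j" by (simp add: interior_D_iff)
    moreover have "\<gamma> r + of_real (\<delta>/2) * (\<i> * d) - c j = of_real (1 + \<delta> / (2 * R j)) * ?w"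
      using R_pos[of j] by (simp add: d' field_simps)
    ultimately have "(1 + \<delta> / (2 * R j)) * R j < R j"
      using \<delta>(1) R_pos[of j] w by (simp only: norm_mult norm_of_real) simp
    moreover have "(1 + \<delta> / (2 * R j)) * R j = R j + \<delta> / 2"
      using R_pos[of j] by (simp add: distrib_right)
    ultimately show False using \<delta>(1) by linarith
  qed
qed

text \<open>Away from the corners the inequality for the other disc is strict; by continuity it
  persists, and the curve stays on the same arc.\<close>

lemma arc_near:
  assumes r: "0 < r" "r < L" and not_corner: "\<gamma> r \<notin> corners"
  obtains j \<delta> where "0 < \<delta>" "\<And>t. \<bar>t - r\<bar> \<le> \<delta> \<Longrightarrow> 0 < t \<and> t < L \<and> \<gamma> t \<in> arc j"
proof -
  obtain j where j: "\<gamma> r \<in> arc j"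
    using gamma_frontier[of r] r not_corner by (auto simp: frontier_cases)
  have ct: "isCont \<gamma> r"
    using continuous_gamma r continuous_on_interior[of "{0..L}" \<gamma> r] by simp
  have "(\<lambda>t. cmod (\<gamma> t - c (\<not> j))) \<midarrow>r\<rightarrow> cmod (\<gamma> r - c (\<not> j))"
    using ct unfolding isCont_def by (intro tendsto_intros)
  moreover have "cmod (\<gamma> r - c (\<not> j)) < R (\<not> j)" using j by (simp add: arc_iff)
  ultimately have "\<forall>\<^sub>F t in at r. cmod (\<gamma> t - c (\<not> j)) < R (\<not> j)" by (rule order_tendstoD)
  moreover have "\<forall>\<^sub>F t in at r. t \<in> {0<..<L}" using r by (intro eventually_at_in_open') auto
  ultimately have "\<forall>\<^sub>F t in at r. t \<in> {0<..<L} \<and> \<gamma> t \<in> arc j"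
  proof eventually_elim
    case (elim t)
    then have "\<gamma> t \<in> frontier D" by (intro gamma_frontier) auto
    then show ?case using elim by (cases j) (auto simp: frontier_cases arc_iff corners_def dist_norm norm_minus_commute)
  qed
  then obtain d where d: "0 < d" "\<And>t. t \<noteq> r \<Longrightarrow> dist t r < d \<Longrightarrow> t \<in> {0<..<L} \<and> \<gamma> t \<in> arc j"
    unfolding eventually_at by auto
  show thesis
  proof (rule that[of "d / 2" j])
    show "0 < d / 2" using d by simp
    fix t assume "\<bar>t - r\<bar> \<le> d / 2"
    then show "0 < t \<and> t < L \<and> \<gamma> t \<in> arc j"
      using d r j by (cases "t = r") (auto simp: dist_real_def)
  qed
qed

text \<open>The counterclockwise unit-speed parametrization of circle \<open>j\<close> with phase
  \<beta>.\<close>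

definition arc_param :: "bool \<Rightarrow> real \<Rightarrow> real \<Rightarrow> complex" where
  "arc_param j \<beta> t = c j + of_real (R j) * cis (\<beta> + t / R j)"

end

context lemon_billiard
begin

text \<open>Turning \<open>\<gamma> t - c j\<close> back by the angle \<open>t / R j\<close> gives a
  continuous curve whose derivative vanishes off a finite set, hence a constant, whose argument is
  \<beta>. So the curve is smooth near \<open>r\<close> even if \<open>r\<close> is an exceptional
  point of its piecewise differentiability.\<close>

lemma local_arc:
  assumes r: "0 < r" "r < L" and not_corner: "\<gamma> r \<notin> corners"
  obtains j \<delta> \<beta> where "0 < \<delta>"
    "\<And>t. \<bar>t - r\<bar> \<le> \<delta> \<Longrightarrow> 0 < t \<and> t < L \<and> \<gamma> t \<in> arc j \<and> \<gamma> t = arc_param j \<beta> t"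
proof -
  obtain j \<delta> where \<delta>: "0 < \<delta>" "\<And>t. \<bar>t - r\<bar> \<le> \<delta> \<Longrightarrow> 0 < t \<and> t < L \<and> \<gamma> t \<in> arc j"
    using arc_near[OF r not_corner] by blast
  define a b where "a = r - \<delta>" and "b = r + \<delta>"
  have ab: "a < r" "r < b" using \<delta> by (auto simp: a_def b_def)
  have in_ab: "0 < t \<and> t < L \<and> \<gamma> t \<in> arc j" if "a \<le> t" "t \<le> b" for t
    using that by (intro \<delta>(2)) (auto simp: a_def b_def abs_le_iff)
  define e where "e t = (\<gamma> t - c j) / of_real (R j) * cis (- (t / R j))" for t
  obtain S where S: "finite S" "\<gamma> C1_differentiable_on ({0..L} - S)"
    using gamma_pw unfolding piecewise_C1_differentiable_on_def by auto
  then obtain d where d: "\<And>t. t \<in> {0..L} - S \<Longrightarrow> (\<gamma> has_vector_derivative d t) (at t)"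
    unfolding C1_differentiable_on_def by blast
  have e_const: "e t = e a" if t: "t \<in> {a..b}" for t
  proof (rule has_derivative_zero_unique_strong_interval[of "S \<union> {a, b}" a b e "e a" t])
    show "continuous_on {a..b} e"
      unfolding e_def using R_pos[of j] in_ab
      by (intro continuous_intros continuous_on_subset[OF continuous_gamma]) (auto simp: less_imp_le)
    fix x assume x: "x \<in> {a..b} - (S \<union> {a, b})"
    then have x': "a < x" "x < b" "x \<notin> S" by auto
    have dx: "(\<gamma> has_vector_derivative d x) (at x)" using in_ab[of x] x' by (intro d) auto
    have near: "\<forall>\<^sub>F t in at x. \<gamma> t \<in> arc j"
    proof -
      have "\<forall>\<^sub>F t in at x. t \<in> {a<..<b}" using x' by (intro eventually_at_in_open') auto
      then show ?thesis by eventually_elim (use in_ab in auto)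
    qed
    have dx_eq: "d x = \<i> * (\<gamma> x - c j) / of_real (R j)"
      using in_ab[of x] x' by (intro gamma_derivative[OF _ _ _ near dx]) auto
    have cis_d: "((\<lambda>t. cis (- (t / R j))) has_vector_derivative (- (1 / R j)) *\<^sub>R (\<i> * cis (- (x / R j)))) (at x)"
    proof -
      have "((\<lambda>t. - (t / R j)) has_vector_derivative - (1 / R j)) (at x)"
        unfolding has_real_derivative_iff_has_vector_derivative[symmetric]
        using R_pos[of j] by (auto intro!: derivative_eq_intros)
      then show ?thesis by (rule has_vector_derivative_cis_compose)
    qed
    have "(e has_vector_derivative ((\<gamma> x - c j) / of_real (R j)) * ((- (1 / R j)) *\<^sub>R (\<i> * cis (- (x / R j)))) + (d x / of_real (R j)) * cis (- (x / R j))) (at x)"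
      unfolding e_def
      by (rule has_vector_derivative_mult[OF _ cis_d])
         (use dx in \<open>auto intro!: has_vector_derivative_divide derivative_eq_intros\<close>)
    moreover have "((\<gamma> x - c j) / of_real (R j)) * ((- (1 / R j)) *\<^sub>R (\<i> * cis (- (x / R j)))) + (d x / of_real (R j)) * cis (- (x / R j)) = 0"
      using R_pos[of j] by (simp add: dx_eq scaleR_conv_of_real field_simps)
    ultimately have "(e has_vector_derivative 0) (at x)" by simp
    then show "(e has_derivative (\<lambda>h. 0)) (at x within {a..b})"
      unfolding has_vector_derivative_def by (simp add: has_derivative_at_withinI)
  qed (use S t in \<open>auto intro: countable_finite\<close>)
  have "cmod (e a) = 1"
    using in_ab[of a] ab R_pos[of j] by (simp add: e_def norm_mult norm_divide arc_iff)
  then obtain \<beta> where \<beta>: "e a = cis \<beta>"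
    using complex_unimodular_polar[of "e a"] by (metis cis_conv_exp cis.ctr)
  have form: "\<gamma> t = arc_param j \<beta> t" if t: "t \<in> {a..b}" for t
  proof -
    have "e t * cis (t / R j) = cis \<beta> * cis (t / R j)" using e_const[OF t] \<beta> by simp
    moreover have "e t * cis (t / R j) = (\<gamma> t - c j) / of_real (R j)"
      by (simp add: e_def mult.assoc cis_mult)
    ultimately have "(\<gamma> t - c j) / of_real (R j) = cis (\<beta> + t / R j)" by (simp add: cis_mult)
    then show ?thesis using R_pos[of j] by (simp add: arc_param_def field_simps)
  qed
  show thesis
  proof (rule that[OF \<delta>(1)])
    fix t assume "\<bar>t - r\<bar> \<le> \<delta>"
    then show "0 < t \<and> t < L \<and> \<gamma> t \<in> arc j \<and> \<gamma> t = arc_param j \<beta> t"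
      using \<delta>(2)[of t] form[of t] by (auto simp: a_def b_def abs_le_iff)
  qed
qed

end

section \<open>Branches of the billiard map\<close>

text \<open>The arcsine is clipped so that the maps built from it are defined on the whole plane.\<close>

definition asin_clip :: "real \<Rightarrow> real" where
  "asin_clip s = arcsin (max (- 1) (min 1 s))"

lemma asin_clip_eq: "\<bar>s\<bar> \<le> 1 \<Longrightarrow> asin_clip s = arcsin s"
  by (simp add: asin_clip_def abs_le_iff)

lemma continuous_on_asin_clip: "continuous_on UNIV asin_clip"
  unfolding asin_clip_def[abs_def] by (intro continuous_on_arcsin' continuous_intros) auto

lemma borel_measurable_asin_clip[measurable]: "asin_clip \<in> borel_measurable borel"
  by (rule borel_measurable_continuous_onI[OF continuous_on_asin_clip])

lemma cis_add_2pi_int: "cis (x + 2 * pi * of_int n) = cis x"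
  using sin_cos_eq_iff[of "x + 2 * pi * of_int n" x] by (auto simp: complex_eq_iff)

lemma cis_eqD: "cis x = cis y \<Longrightarrow> \<exists>n::int. x = y + 2 * pi * of_int n"
  using sin_cos_eq_iff[of x y] by (auto simp: complex_eq_iff)

lemma cos_arcsin_pos: "\<bar>s\<bar> < 1 \<Longrightarrow> 0 < cos (arcsin s)"
  using arcsin_lt_bounded[of s] cos_gt_zero_pi[of "arcsin s"] by (simp add: abs_less_iff)

text \<open>Along the line, \<open>(cmod (p + of_real t * v - c))\<^sup>2 - R\<^sup>2\<close> is a
  quadratic polynomial in \<open>t\<close> with value at most 0 at the start. The exit time is its
  larger root \<open>w - b\<close>, where the position relative to \<open>c\<close> has component
  \<open>w > 0\<close> along \<open>v\<close>.\<close>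

lemma exit_time:
  fixes p v c :: complex
  assumes p: "cmod (p - c) \<le> R" and v: "cmod v = 1" and R: "0 < R"
    and into: "cmod (p - c) < R \<or> Re (cnj v * (p - c)) < 0"
  obtains t where "0 < t" "cmod (p + of_real t * v - c) = R" "0 < Re (cnj v * (p + of_real t * v - c))"
    "\<And>\<tau>. 0 \<le> \<tau> \<Longrightarrow> \<tau> \<le> t \<Longrightarrow> cmod (p + of_real \<tau> * v - c) \<le> R"
proof -
  define b where "b = Re (cnj v * (p - c))"
  define e where "e = (cmod (p - c))\<^sup>2 - R\<^sup>2"
  have vv: "(Re v)\<^sup>2 + (Im v)\<^sup>2 = 1" using v by (simp add: cmod_power2[symmetric])
  have quad: "(cmod (p + of_real t * v - c))\<^sup>2 - R\<^sup>2 = t\<^sup>2 + 2 * b * t + e" for t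
  proof -
    have "(cmod (p + of_real t * v - c))\<^sup>2 = (cmod (p - c))\<^sup>2 + 2 * t * b + t\<^sup>2 * ((Re v)\<^sup>2 + (Im v)\<^sup>2)"
      unfolding cmod_power2 b_def by (simp add: power2_eq_square algebra_simps)
    then show ?thesis unfolding vv e_def by simp
  qed
  have e0: "e \<le> 0" using p by (simp add: e_def power_mono)
  have into': "e < 0 \<or> b < 0"
    using into R by (auto simp: e_def b_def intro: power_strict_mono)
  define w where "w = sqrt (b\<^sup>2 - e)"
  have be: "0 \<le> b\<^sup>2 - e" using e0 zero_le_power2[of b] by linarith
  have w2: "w\<^sup>2 = b\<^sup>2 - e" unfolding w_def by (rule real_sqrt_pow2[OF be])
  have w0: "0 \<le> w" unfolding w_def using be by (rule real_sqrt_ge_zero)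
  have wb: "b < w"
  proof (cases "b < 0")
    case False
    then have "b\<^sup>2 < w\<^sup>2" using into' w2 by simp
    then show ?thesis using w0 by (rule power2_less_imp_less)
  qed (use w0 in simp)
  have wb': "- b \<le> w"
  proof -
    have "(- b)\<^sup>2 \<le> w\<^sup>2" using w2 e0 by simp
    then show ?thesis using w0 by (rule power2_le_imp_le)
  qed
  have w_pos: "0 < w"
  proof (rule ccontr)
    assume "\<not> 0 < w"
    then have "w = 0" using w0 by simp
    then show False using wb wb' by simp
  qed
  define t where "t = w - b"
  show thesis
  proof (rule that)
    show t: "0 < t" using wb by (simp add: t_def)
    have "(cmod (p + of_real t * v - c))\<^sup>2 = R\<^sup>2"
    proof -
      have "t\<^sup>2 + 2 * b * t + e = w\<^sup>2 - b\<^sup>2 + e" by (simp add: t_def power2_eq_square algebra_simps)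
      then show ?thesis using quad[of t] w2 by linarith
    qed
    from this norm_ge_zero less_imp_le[OF R] show "cmod (p + of_real t * v - c) = R" by (rule power2_eq_imp_eq)
    have "v * cnj v = 1" using complex_norm_square[of v] v by simp
    then have "cnj v * (p + of_real t * v - c) = cnj v * (p - c) + of_real t"
      by (simp add: distrib_left right_diff_distrib mult.left_commute mult.commute[of v])
    then have "Re (cnj v * (p + of_real t * v - c)) = b + t" by (simp only: b_def plus_complex.sel Re_complex_of_real)
    also have "\<dots> = w" unfolding t_def by simp
    finally show "0 < Re (cnj v * (p + of_real t * v - c))" using w_pos by (simp only:)
    fix \<tau> assume \<tau>: "0 \<le> \<tau>" "\<tau> \<le> t"
    have "\<tau>\<^sup>2 + 2 * b * \<tau> + e = (\<tau> - t) * (\<tau> + b + w)"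
    proof -
      have "(\<tau> - t) * (\<tau> + b + w) = \<tau>\<^sup>2 + 2 * b * \<tau> + b\<^sup>2 - w\<^sup>2" by (simp add: t_def power2_eq_square algebra_simps)
      then show ?thesis using w2 by linarith
    qed
    also have "\<dots> \<le> 0" using \<tau> wb' by (intro mult_nonpos_nonneg) auto
    finally have "(cmod (p + of_real \<tau> * v - c))\<^sup>2 \<le> R\<^sup>2" using quad[of \<tau>] by linarith
    from this less_imp_le[OF R] show "cmod (p + of_real \<tau> * v - c) \<le> R" by (rule power2_le_imp_le)
  qed
qed

section \<open>The next collision in explicit form\<close>

context lemon_billiard
begin

text \<open>The interval stays inside the open period and on one open arc, so it avoids the base
  point and the corners, and one phase serves all of it.\<close>

definition piece :: "bool \<Rightarrow> real \<Rightarrow> real \<Rightarrow> real \<Rightarrow> bool" where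
  "piece j \<beta> a b \<longleftrightarrow> (\<forall>t. a < t \<and> t < b \<longrightarrow> 0 < t \<and> t < L \<and> \<gamma> t \<in> arc j \<and> \<gamma> t = arc_param j \<beta> t)"

lemma pieceD:
  assumes "piece j \<beta> a b" "a < t" "t < b"
  shows "0 < t" "t < L" "\<gamma> t \<in> arc j" "\<gamma> t = c j + of_real (R j) * cis (\<beta> + t / R j)"
  using assms by (auto simp: piece_def arc_param_def)

lemma piece_derivative:
  assumes p: "piece j \<beta> a b" and t: "a < t" "t < b"
  shows "\<gamma> differentiable (at t)" "inward_normal \<gamma> t = - cis (\<beta> + t / R j)"
proof -
  have "((\<lambda>t. \<beta> + t / R j) has_vector_derivative 1 / R j) (at t)"
    unfolding has_real_derivative_iff_has_vector_derivative[symmetric]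
    using R_pos[of j] by (auto intro!: derivative_eq_intros)
  from has_vector_derivative_cis_compose[OF this]
  have "((\<lambda>t. c j + of_real (R j) * cis (\<beta> + t / R j)) has_vector_derivative
      0 + of_real (R j) * ((1 / R j) *\<^sub>R (\<i> * cis (\<beta> + t / R j)))) (at t)"
    by (intro has_vector_derivative_add has_vector_derivative_const has_vector_derivative_mult_right)
  also have "0 + of_real (R j) * ((1 / R j) *\<^sub>R (\<i> * cis (\<beta> + t / R j))) = \<i> * cis (\<beta> + t / R j)"
    using R_pos[of j] by (simp add: scaleR_conv_of_real)
  finally have "(\<gamma> has_vector_derivative \<i> * cis (\<beta> + t / R j)) (at t)"
    by (rule has_vector_derivative_transform_within_open[of _ _ _ "{a<..<b}"])
       (use t pieceD(4)[OF p] in auto)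
  then show "\<gamma> differentiable (at t)" "inward_normal \<gamma> t = - cis (\<beta> + t / R j)"
    by (auto simp: inward_normal_def vector_derivative_at intro: differentiableI_vector)
qed

text \<open>The argument of the outgoing velocity: the inward normal has argument
  \<open>\<beta> + r / R j + pi\<close> and is turned by \<open>- arcsin s\<close>.\<close>

definition direction :: "bool \<Rightarrow> real \<Rightarrow> real \<times> real \<Rightarrow> real" where
  "direction j \<beta> x = \<beta> + fst x / R j - asin_clip (snd x) + pi"

text \<open>\<open>R j * s\<close> is a signed distance of \<open>c j\<close> from the line of the
  trajectory. Passing to the centre \<open>c k\<close> changes it by the component of
  \<open>c k - c j\<close> perpendicular to the direction.\<close>

definition next_s :: "bool \<Rightarrow> bool \<Rightarrow> real \<Rightarrow> real \<Rightarrow> real" where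
  "next_s j k \<theta> s = (R j * s + Im (cis (- \<theta>) * (c k - c j))) / R k"

text \<open>The point of arrival has polar angle \<open>\<theta> - arcsin s1\<close> about
  \<open>c k\<close>; \<open>n\<close> selects its representative in the parameter range of the
  piece.\<close>

definition branch :: "bool \<Rightarrow> real \<Rightarrow> bool \<Rightarrow> real \<Rightarrow> int \<Rightarrow> real \<times> real \<Rightarrow> real \<times> real" where
  "branch j \<beta> k \<beta>' n x = (let \<theta> = direction j \<beta> x; s1 = next_s j k \<theta> (snd x)
     in (R k * (\<theta> - asin_clip s1 - \<beta>' + 2 * pi * of_int n), s1))"

lemma piece_velocity:
  assumes p: "piece j \<beta> a b" and r: "a < r" "r < b" and s: "\<bar>s\<bar> \<le> 1"
  shows "post_velocity \<gamma> (r, s) = cis (direction j \<beta> (r, s))"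
    "\<gamma> r = c j - of_real (R j) * (cis (direction j \<beta> (r, s)) * cis (arcsin s))"
proof -
  have "cis (direction j \<beta> (r, s)) = - (cis (\<beta> + r / R j) * cis (- arcsin s))"
    using s by (simp add: direction_def asin_clip_eq cis_mult minus_cis)
  then show "post_velocity \<gamma> (r, s) = cis (direction j \<beta> (r, s))"
    by (simp add: post_velocity_def piece_derivative(2)[OF p r])
  have "cis (\<beta> + r / R j) = - (cis (direction j \<beta> (r, s)) * cis (arcsin s))"
    using s by (simp add: direction_def asin_clip_eq cis_mult minus_cis')
  then show "\<gamma> r = c j - of_real (R j) * (cis (direction j \<beta> (r, s)) * cis (arcsin s))"
    using pieceD(4)[OF p r] by simp
qed

text \<open>The equation for \<open>s1\<close> puts the candidate point of arrival on the line of
  departure. Transversality at both ends excludes times \<le> 0, and strict convexity puts the open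
  segment into the interior.\<close>

lemma branch_collision:
  assumes p: "piece j \<beta> a b" and r: "a < r" "r < b" and s: "\<bar>s\<bar> < 1"
    and p': "piece k \<beta>' a' b'" and r1: "a' < r1" "r1 < b'" and s1: "\<bar>s1\<bar> < 1"
    and br: "branch j \<beta> k \<beta>' n (r, s) = (r1, s1)"
  shows "next_collision D L \<gamma> (r, s) (r1, s1)"
proof -
  define \<theta> where "\<theta> = direction j \<beta> (r, s)"
  define \<phi> where "\<phi> = arcsin s"
  define \<psi> where "\<psi> = arcsin s1"
  have s1_eq: "s1 = next_s j k \<theta> s" and r1_eq: "r1 = R k * (\<theta> - \<psi> - \<beta>' + 2 * pi * of_int n)"
    using br s1 by (auto simp: branch_def Let_def \<theta>_def \<psi>_def asin_clip_eq)
  have sin: "sin \<phi> = s" "sin \<psi> = s1" using s s1 by (auto simp: \<phi>_def \<psi>_def)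
  have cos: "0 < cos \<phi>" "0 < cos \<psi>" using s s1 by (auto simp: \<phi>_def \<psi>_def cos_arcsin_pos)
  let ?p = "\<gamma> r" and ?q = "\<gamma> r1" and ?v = "cis \<theta>"
  have v: "post_velocity \<gamma> (r, s) = ?v" and p_eq: "?p = c j - of_real (R j) * (?v * cis \<phi>)"
    using piece_velocity[OF p r, of s] s by (auto simp: \<theta>_def \<phi>_def)
  have "\<beta>' + r1 / R k = (\<theta> - \<psi>) + 2 * pi * of_int n" using R_pos[of k] by (simp add: r1_eq)
  then have cis1: "cis (\<beta>' + r1 / R k) = cis (\<theta> - \<psi>)" by (simp only: cis_add_2pi_int)
  have q_eq: "?q = c k + of_real (R k) * (?v * cis (- \<psi>))"
    using pieceD(4)[OF p' r1] cis1 by (simp add: cis_mult)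
  define T where "T = Re (cis (- \<theta>) * (?q - ?p))"
  have uv: "cis (- \<theta>) * ?v = 1" by (simp add: cis_mult)
  have diff: "cis (- \<theta>) * (?q - ?p) = cis (- \<theta>) * (c k - c j) + of_real (R k) * cis (- \<psi>) + of_real (R j) * cis \<phi>"
  proof -
    have "cis (- \<theta>) * (?q - ?p) = cis (- \<theta>) * (c k - c j) + (cis (- \<theta>) * ?v) * (of_real (R k) * cis (- \<psi>) + of_real (R j) * cis \<phi>)"
      unfolding p_eq q_eq by algebra
    then show ?thesis by (simp only: uv mult_1_left add.assoc)
  qed
  have "R k * s1 = R j * s + Im (cis (- \<theta>) * (c k - c j))"
    using R_pos[of k] by (simp add: s1_eq next_s_def)
  moreover have "Im (of_real (R k) * cis (- \<psi>) + of_real (R j) * cis \<phi>) = R j * s - R k * s1" by (simp add: sin)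
  ultimately have "Im (cis (- \<theta>) * (?q - ?p)) = 0"
    unfolding diff plus_complex.sel by linarith
  then have uT: "cis (- \<theta>) * (?q - ?p) = of_real T"
    unfolding T_def by (simp only: complex_eq_iff Re_complex_of_real Im_complex_of_real simp_thms)
  then have "(?q - ?p) = of_real T * ?v"
    using uv by (metis mult.assoc mult.commute mult_1_left)
  then have qp: "?q = ?p + of_real T * ?v" by (metis add.commute diff_add_cancel)
  have pD: "cmod (?p - c i) \<le> R i" for i
    using arc_frontier[OF pieceD(3)[OF p r]] by (simp add: frontier_D D_iff)
  have qD: "cmod (?q - c i) \<le> R i" for i
    using arc_frontier[OF pieceD(3)[OF p' r1]] by (simp add: frontier_D D_iff)
  have T_pos: "0 < T"
  proof (rule ccontr)
    assume "\<not> 0 < T"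
    \<comment> \<open>Coinciding points lie on the same arc; then
      \<open>cis (- \<psi>) + cis \<phi>\<close> would vanish although both cosines are
      positive.\<close>
    moreover have "T \<noteq> 0"
    proof
      assume "T = 0"
      then have pq: "?p = ?q" using qp by simp
      then have "j = k" using arc_disjoint pieceD(3)[OF p r] pieceD(3)[OF p' r1] by simp
      then have "of_real (R k) * cis (- \<psi>) + of_real (R k) * cis \<phi> = 0" using diff pq by simp
      then have "of_real (R k) * (cis (- \<psi>) + cis \<phi>) = 0" by (simp add: distrib_left)
      then have "cis (- \<psi>) + cis \<phi> = 0" using R_pos[of k] by simp
      then have "Re (cis (- \<psi>) + cis \<phi>) = 0" by simp
      then show False using cos by simp
    qed
    ultimately have T: "T < 0" by simp
    \<comment> \<open>The line leaves disc \<open>k\<close> at \<open>?q\<close>, so a starting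
      point further along it would lie outside that disc.\<close>
    have "?p - c k = ?v * (of_real (R k) * cis (- \<psi>) - of_real T)"
      using qp q_eq by algebra
    then have "(cmod (?p - c k))\<^sup>2 = (cmod (of_real (R k) * cis (- \<psi>) - of_real T))\<^sup>2"
      by (simp add: norm_mult)
    also have "\<dots> = (R k * cos \<psi> - T)\<^sup>2 + (R k * sin \<psi>)\<^sup>2"
      unfolding cmod_power2 by simp
    also have "\<dots> = (R k)\<^sup>2 * ((cos \<psi>)\<^sup>2 + (sin \<psi>)\<^sup>2) - 2 * T * R k * cos \<psi> + T\<^sup>2"
      by algebra
    also have "\<dots> = (R k)\<^sup>2 + (- T) * (2 * R k * cos \<psi> - T)"
      unfolding sin_cos_squared_add2 by (simp add: power2_eq_square algebra_simps)
    also have "\<dots> > (R k)\<^sup>2"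
    proof -
      have "0 < 2 * R k * cos \<psi>" using R_pos[of k] cos(2) by simp
      then have "0 < 2 * R k * cos \<psi> - T" using T by linarith
      then have "0 < (- T) * (2 * R k * cos \<psi> - T)" using T by (intro mult_pos_pos) auto
      then show ?thesis by linarith
    qed
    finally have "(R k)\<^sup>2 < (cmod (?p - c k))\<^sup>2" .
    moreover have "(cmod (?p - c k))\<^sup>2 \<le> (R k)\<^sup>2" using pD[of k] by (intro power_mono) auto
    ultimately show False by simp
  qed
  have pq: "?p \<noteq> ?q" using qp T_pos by simp
  have inside: "?p + of_real t * ?v \<in> interior D" if t: "0 < t" "t < T" for t
    unfolding interior_D_iff
  proof
    fix i
    have "cmod ((1 - of_real (t / T)) * ?p + of_real (t / T) * ?q - c i) < R i"
      using t T_pos by (intro open_segment_in_ball pD qD pq) auto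
    moreover have "(1 - of_real (t / T)) * ?p + of_real (t / T) * ?q = ?p + of_real t * ?v"
      using T_pos by (simp add: qp algebra_simps)
    ultimately show "cmod (?p + of_real t * ?v - c i) < R i" by simp
  qed
  have n: "inward_normal \<gamma> r1 = - cis (\<theta> - \<psi>)" using piece_derivative(2)[OF p' r1] cis1 by simp
  have refl: "post_velocity \<gamma> (r1, s1) = ?v - (2 * (?v \<bullet> inward_normal \<gamma> r1)) *\<^sub>R inward_normal \<gamma> r1"
  proof -
    have "?v \<bullet> inward_normal \<gamma> r1 = - cos \<psi>"
      unfolding n using cos_diff[of \<theta> "\<theta> - \<psi>"] by (simp add: inner_complex_def)
    moreover have "cis (\<theta> - \<psi>) * (cis \<psi> - of_real (2 * cos \<psi>) + cis (- \<psi>)) = 0"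
      by (simp add: complex_eq_iff)
    then have "?v - of_real (2 * cos \<psi>) * cis (\<theta> - \<psi>) = - (cis (\<theta> - \<psi>) * cis (- \<psi>))"
      using cis_mult[of "\<theta> - \<psi>" \<psi>] by (simp add: distrib_left right_diff_distrib add_eq_0_iff mult.commute)
    ultimately show ?thesis
      by (simp add: post_velocity_def n \<psi>_def[symmetric] scaleR_conv_of_real)
  qed
  show ?thesis
    unfolding next_collision_def fst_conv v Let_def
    using pieceD(1,2)[OF p r] pieceD(1,2)[OF p' r1] s s1 piece_derivative(1)[OF p r] piece_derivative(1)[OF p' r1]
      refl T_pos inside qp
    by (auto simp: collision_space_def intro!: exI[of _ T])
qed

text \<open>The trajectory ends at the earlier of its exits from the two discs. There it moves
  outwards with positive speed, so the arrival is not tangential, and \<open>s1\<close> and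
  \<open>n\<close> can be read off.\<close>

lemma branch_exists:
  assumes p: "piece j \<beta> a b" and r: "a < r" "r < b" and s: "\<bar>s\<bar> < 1"
  obtains T q where "0 < T" "q = \<gamma> r + of_real T * post_velocity \<gamma> (r, s)" "q \<in> frontier D"
    "\<And>k \<beta>' a' b' r1. piece k \<beta>' a' b' \<Longrightarrow> a' < r1 \<Longrightarrow> r1 < b' \<Longrightarrow> \<gamma> r1 = q \<Longrightarrow>
       \<exists>n s1. \<bar>s1\<bar> < 1 \<and> branch j \<beta> k \<beta>' n (r, s) = (r1, s1)"
proof -
  define \<theta> where "\<theta> = direction j \<beta> (r, s)"
  define \<phi> where "\<phi> = arcsin s"
  have sin: "sin \<phi> = s" using s by (simp add: \<phi>_def)
  have cos: "0 < cos \<phi>" using s by (simp add: \<phi>_def cos_arcsin_pos)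
  let ?p = "\<gamma> r" and ?v = "cis \<theta>"
  have v: "post_velocity \<gamma> (r, s) = ?v" and p_eq: "?p = c j - of_real (R j) * (?v * cis \<phi>)"
    using piece_velocity[OF p r, of s] s by (auto simp: \<theta>_def \<phi>_def)
  have uv: "cis (- \<theta>) * ?v = 1" by (simp add: cis_mult)
  have cnj: "cnj ?v = cis (- \<theta>)" by (simp add: cis_cnj)
  have arc: "?p \<in> arc j" by (rule pieceD(3)[OF p r])
  have "cnj ?v * (?p - c j) = - (cis (- \<theta>) * ?v) * (of_real (R j) * cis \<phi>)"
    unfolding p_eq cnj by algebra
  then have "Re (cnj ?v * (?p - c j)) = - R j * cos \<phi>" by (simp only: uv) simp
  then have into: "Re (cnj ?v * (?p - c j)) < 0" using R_pos[of j] cos by simp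
  have pj: "cmod (?p - c j) = R j" "cmod (?p - c (\<not> j)) < R (\<not> j)" using arc by (auto simp: arc_iff)
  \<comment> \<open>The start lies on circle \<open>j\<close>, but the velocity points into that
    disc; the other disc contains the start in its interior. Either way \<open>exit_time\<close>
    applies.\<close>
  obtain t1 where t1: "0 < t1" "cmod (?p + of_real t1 * ?v - c j) = R j" "0 < Re (cnj ?v * (?p + of_real t1 * ?v - c j))"
    "\<And>\<tau>. 0 \<le> \<tau> \<Longrightarrow> \<tau> \<le> t1 \<Longrightarrow> cmod (?p + of_real \<tau> * ?v - c j) \<le> R j"
    by (rule exit_time[of ?p "c j" "R j" ?v]) (use pj into R_pos[of j] in auto)
  obtain t2 where t2: "0 < t2" "cmod (?p + of_real t2 * ?v - c (\<not> j)) = R (\<not> j)" "0 < Re (cnj ?v * (?p + of_real t2 * ?v - c (\<not> j)))"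
    "\<And>\<tau>. 0 \<le> \<tau> \<Longrightarrow> \<tau> \<le> t2 \<Longrightarrow> cmod (?p + of_real \<tau> * ?v - c (\<not> j)) \<le> R (\<not> j)"
    by (rule exit_time[of ?p "c (\<not> j)" "R (\<not> j)" ?v]) (use pj R_pos[of "\<not> j"] in auto)
  define T where "T = min t1 t2"
  define q where "q = ?p + of_real T * ?v"
  have T: "0 < T" using t1(1) t2(1) by (simp add: T_def)
  have inD: "cmod (q - c i) \<le> R i" for i
    using t1(4)[of T] t2(4)[of T] T by (cases "i = j") (auto simp: q_def T_def)
  obtain k where k: "cmod (q - c k) = R k" "0 < Re (cnj ?v * (q - c k))"
  proof (cases "t1 \<le> t2")
    case True
    then show thesis using t1 that[of j] by (simp add: q_def T_def min_def)
  next
    case False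
    then show thesis using t2 that[of "\<not> j"] by (simp add: q_def T_def min_def)
  qed
  have qf: "q \<in> frontier D"
    using inD k(1) by (auto simp: frontier_D D_iff interior_D_iff) (metis less_irrefl)
  show thesis
  proof (rule that[OF T _ qf])
    show "q = ?p + of_real T * post_velocity \<gamma> (r, s)" by (simp add: q_def v)
    fix k' \<beta>' a' b' r1
    assume p': "piece k' \<beta>' a' b'" and r1: "a' < r1" "r1 < b'" and q: "\<gamma> r1 = q"
    \<comment> \<open>The end point lies on circle \<open>k\<close>, whereas the points of the other
      arc lie strictly inside it.\<close>
    have "k' = k"
    proof (rule ccontr)
      assume "k' \<noteq> k"
      then have "cmod (q - c k) < R k" using pieceD(3)[OF p' r1] q by (cases k; cases k') (auto simp: arc_iff)
      then show False using k by simp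
    qed
    note p' = p'[unfolded this]
    define \<zeta> where "\<zeta> = cis (- \<theta>) * (q - c k) / of_real (R k)"
    have z1: "cmod \<zeta> = 1" using k(1) R_pos[of k] by (simp add: \<zeta>_def norm_mult norm_divide)
    have z2: "0 < Re \<zeta>" using k(2) R_pos[of k] by (simp add: \<zeta>_def cnj)
    define s1 where "s1 = - Im \<zeta>"
    have zz: "(Re \<zeta>)\<^sup>2 + s1\<^sup>2 = 1" using z1 cmod_power2[of \<zeta>] by (simp add: s1_def)
    have s1: "\<bar>s1\<bar> < 1"
    proof -
      have "0 < (Re \<zeta>)\<^sup>2" using z2 by simp
      then have "s1\<^sup>2 < 1" using zz by linarith
      then show ?thesis by (simp add: abs_square_less_1)
    qed
    define \<psi> where "\<psi> = arcsin s1"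
    have "cos \<psi> = Re \<zeta>"
    proof -
      have "cos \<psi> = sqrt (1 - s1\<^sup>2)" using s1 by (simp add: \<psi>_def cos_arcsin abs_less_iff)
      also have "1 - s1\<^sup>2 = (Re \<zeta>)\<^sup>2" using zz by linarith
      finally show ?thesis using z2 by simp
    qed
    moreover have "sin \<psi> = s1" using s1 by (simp add: \<psi>_def abs_less_iff)
    ultimately have z: "\<zeta> = cis (- \<psi>)" by (simp add: complex_eq_iff s1_def)
    have q_eq: "q = c k + of_real (R k) * (?v * cis (- \<psi>))"
    proof -
      have "?v * \<zeta> = (cis (- \<theta>) * ?v) * ((q - c k) / of_real (R k))" by (simp add: \<zeta>_def)
      then have "of_real (R k) * (?v * \<zeta>) = q - c k" using R_pos[of k] by (simp only: uv) simp
      then show ?thesis by (simp add: z algebra_simps)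
    qed
    have "of_real (R k) * cis (\<beta>' + r1 / R k) = of_real (R k) * (?v * cis (- \<psi>))"
    proof -
      have "c k + of_real (R k) * cis (\<beta>' + r1 / R k) = c k + of_real (R k) * (?v * cis (- \<psi>))"
        by (simp only: pieceD(4)[OF p' r1, symmetric] q q_eq[symmetric])
      then show ?thesis by (simp only: add_left_cancel)
    qed
    then have "cis (\<beta>' + r1 / R k) = ?v * cis (- \<psi>)" using R_pos[of k] by simp
    then have "cis (\<beta>' + r1 / R k) = cis (\<theta> - \<psi>)" by (simp add: cis_mult)
    then obtain n :: int where n: "\<beta>' + r1 / R k = \<theta> - \<psi> + 2 * pi * of_int n" using cis_eqD by blast
    have "cis (- \<theta>) * (q - ?p) = cis (- \<theta>) * (c k - c j) + of_real (R k) * cis (- \<psi>) + of_real (R j) * cis \<phi>"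
    proof -
      have "cis (- \<theta>) * (q - ?p) = cis (- \<theta>) * (c k - c j) + (cis (- \<theta>) * ?v) * (of_real (R k) * cis (- \<psi>) + of_real (R j) * cis \<phi>)"
        unfolding p_eq q_eq by algebra
      then show ?thesis by (simp only: uv mult_1_left add.assoc)
    qed
    moreover have "cis (- \<theta>) * (q - ?p) = of_real T"
      unfolding q_def using uv by algebra
    ultimately have "Im (cis (- \<theta>) * (c k - c j)) + Im (of_real (R k) * cis (- \<psi>) + of_real (R j) * cis \<phi>) = 0"
      by (metis Im_complex_of_real add.assoc plus_complex.sel(2))
    moreover have "Im (of_real (R k) * cis (- \<psi>) + of_real (R j) * cis \<phi>) = R j * s - R k * s1"
      by (simp add: sin \<open>sin \<psi> = s1\<close>)
    ultimately have "R k * s1 = R j * s + Im (cis (- \<theta>) * (c k - c j))" by linarith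
    then have "s1 = next_s j k \<theta> s" using R_pos[of k] by (simp add: next_s_def field_simps)
    moreover have "r1 = R k * (\<theta> - \<psi> - \<beta>' + 2 * pi * of_int n)"
    proof -
      have "r1 / R k = \<theta> - \<psi> - \<beta>' + 2 * pi * of_int n" using n by linarith
      then show ?thesis using R_pos[of k] by (simp add: field_simps)
    qed
    ultimately have "branch j \<beta> k \<beta>' n (r, s) = (r1, s1)"
      using s1 by (simp add: branch_def Let_def \<theta>_def[symmetric] asin_clip_eq \<psi>_def)
    then show "\<exists>n s1. \<bar>s1\<bar> < 1 \<and> branch j \<beta> k' \<beta>' n (r, s) = (r1, s1)"
      using s1 \<open>k' = k\<close> by blast
  qed
qed

end

section \<open>Uniqueness, injectivity and almost everywhere existence of the next collision\<close>

context lemon_billiard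
begin

lemma normal_unit: "\<gamma> differentiable (at r) \<Longrightarrow> cmod (inward_normal \<gamma> r) = 1"
  using gamma_unit by (simp add: inward_normal_def norm_mult)

text \<open>Dividing the velocity by the normal leaves \<open>cis (- arcsin s)\<close>, so position
  and velocity determine the collision.\<close>

lemma velocity_s:
  assumes "\<gamma> differentiable (at r)" "\<bar>s\<bar> \<le> 1"
  shows "s = - Im (post_velocity \<gamma> (r, s) * cnj (inward_normal \<gamma> r))"
proof -
  let ?n = "inward_normal \<gamma> r"
  have nn: "?n * cnj ?n = 1" using normal_unit[OF assms(1)] complex_norm_square[of ?n] by simp
  have "post_velocity \<gamma> (r, s) * cnj ?n = (?n * cnj ?n) * cis (- arcsin s)"
    unfolding post_velocity_def prod.case by (simp only: mult_ac)
  also have "\<dots> = cis (- arcsin s)" by (simp only: nn mult_1_left)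
  finally have "Im (post_velocity \<gamma> (r, s) * cnj ?n) = Im (cis (- arcsin s))" by (rule arg_cong)
  also have "\<dots> = - s" using assms(2) by (simp add: abs_le_iff)
  finally show ?thesis by (simp only: minus_minus)
qed

lemma next_collisionE:
  assumes "next_collision D L \<gamma> x y"
  obtains T where "0 < T" "\<forall>t. 0 < t \<and> t < T \<longrightarrow> \<gamma> (fst x) + of_real t * post_velocity \<gamma> x \<in> interior D"
    "\<gamma> (fst y) = \<gamma> (fst x) + of_real T * post_velocity \<gamma> x"
    "x \<in> collision_space L" "y \<in> collision_space L" "\<gamma> differentiable (at (fst x))" "\<gamma> differentiable (at (fst y))"
    "post_velocity \<gamma> y = post_velocity \<gamma> x - (2 * (post_velocity \<gamma> x \<bullet> inward_normal \<gamma> (fst y))) *\<^sub>R inward_normal \<gamma> (fst y)"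
  using assms unfolding next_collision_def Let_def by auto

lemma collision_frontier: "x \<in> collision_space L \<Longrightarrow> \<gamma> (fst x) \<in> frontier D"
  by (auto simp: collision_space_def gamma_frontier)

lemma collision_eqI:
  assumes x: "x \<in> collision_space L" "y \<in> collision_space L" and d: "\<gamma> differentiable (at (fst x))"
    and g: "\<gamma> (fst x) = \<gamma> (fst y)" and v: "post_velocity \<gamma> x = post_velocity \<gamma> y"
  shows "x = y"
proof -
  have f: "fst x = fst y"
    using inj_onD[OF inj_gamma g] x by (auto simp: collision_space_def)
  have b: "\<bar>snd x\<bar> \<le> 1" "\<bar>snd y\<bar> \<le> 1" using x by (auto simp: collision_space_def)
  have "snd x = - Im (post_velocity \<gamma> x * cnj (inward_normal \<gamma> (fst x)))"
    using velocity_s[OF d b(1)] by (simp only: prod.collapse)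
  moreover have "snd y = - Im (post_velocity \<gamma> y * cnj (inward_normal \<gamma> (fst y)))"
    using velocity_s[OF d[unfolded f] b(2)] by (simp only: prod.collapse)
  ultimately have "snd x = snd y" by (simp only: f v)
  with f show ?thesis by (rule prod_eqI)
qed

text \<open>Of two different arrival times, the earlier would be a time in the interior by the
  condition for the later one, although the point reached then lies on the boundary.\<close>

lemma next_collision_unique:
  assumes 1: "next_collision D L \<gamma> x y" and 2: "next_collision D L \<gamma> x z"
  shows "y = z"
proof -
  from 1 obtain T where T: "0 < T" "\<forall>t. 0 < t \<and> t < T \<longrightarrow> \<gamma> (fst x) + of_real t * post_velocity \<gamma> x \<in> interior D"
    "\<gamma> (fst y) = \<gamma> (fst x) + of_real T * post_velocity \<gamma> x"
    "x \<in> collision_space L" "y \<in> collision_space L" "\<gamma> differentiable (at (fst x))" "\<gamma> differentiable (at (fst y))"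
    "post_velocity \<gamma> y = post_velocity \<gamma> x - (2 * (post_velocity \<gamma> x \<bullet> inward_normal \<gamma> (fst y))) *\<^sub>R inward_normal \<gamma> (fst y)"
    by (rule next_collisionE)
  from 2 obtain T' where T': "0 < T'" "\<forall>t. 0 < t \<and> t < T' \<longrightarrow> \<gamma> (fst x) + of_real t * post_velocity \<gamma> x \<in> interior D"
    "\<gamma> (fst z) = \<gamma> (fst x) + of_real T' * post_velocity \<gamma> x"
    "x \<in> collision_space L" "z \<in> collision_space L" "\<gamma> differentiable (at (fst x))" "\<gamma> differentiable (at (fst z))"
    "post_velocity \<gamma> z = post_velocity \<gamma> x - (2 * (post_velocity \<gamma> x \<bullet> inward_normal \<gamma> (fst z))) *\<^sub>R inward_normal \<gamma> (fst z)"
    by (rule next_collisionE)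
  have fy: "\<gamma> (fst y) \<notin> interior D" and fz: "\<gamma> (fst z) \<notin> interior D"
    using collision_frontier[OF T(5)] collision_frontier[OF T'(5)] by (auto simp: frontier_D)
  have "T = T'"
    using T(2)[rule_format, of T'] T'(2)[rule_format, of T] T(1,3) T'(1,3) fy fz by (cases T T' rule: linorder_cases) auto
  then have g: "\<gamma> (fst y) = \<gamma> (fst z)" using T(3) T'(3) by simp
  then have "fst y = fst z"
    using inj_onD[OF inj_gamma] T(5) T'(5) by (auto simp: collision_space_def)
  then have "post_velocity \<gamma> y = post_velocity \<gamma> z" using T(8) T'(8) by simp
  then show ?thesis by (intro collision_eqI[OF T(5) T'(5) T(7) g])
qed

lemma reflect_involution:
  fixes v n w :: complex
  assumes n: "cmod n = 1" and w: "w = v - (2 * (v \<bullet> n)) *\<^sub>R n"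
  shows "v = w - (2 * (w \<bullet> n)) *\<^sub>R n"
proof -
  have "n \<bullet> n = 1" using n by (simp add: dot_square_norm)
  then have "w \<bullet> n = - (v \<bullet> n)" unfolding w by (simp add: inner_diff_left)
  then show ?thesis unfolding w by simp
qed

text \<open>Time reversal: reflection is an involution, so the arrival determines the incoming
  velocity. Of two departures on the same line, the later would lie inside the open segment of the
  earlier and hence in the interior.\<close>

lemma next_collision_inj:
  assumes 1: "next_collision D L \<gamma> x z" and 2: "next_collision D L \<gamma> y z"
  shows "x = y"
proof -
  from 1 obtain T where T: "0 < T" "\<forall>t. 0 < t \<and> t < T \<longrightarrow> \<gamma> (fst x) + of_real t * post_velocity \<gamma> x \<in> interior D"
    "\<gamma> (fst z) = \<gamma> (fst x) + of_real T * post_velocity \<gamma> x"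
    "x \<in> collision_space L" "z \<in> collision_space L" "\<gamma> differentiable (at (fst x))" "\<gamma> differentiable (at (fst z))"
    "post_velocity \<gamma> z = post_velocity \<gamma> x - (2 * (post_velocity \<gamma> x \<bullet> inward_normal \<gamma> (fst z))) *\<^sub>R inward_normal \<gamma> (fst z)"
    by (rule next_collisionE)
  from 2 obtain T' where T': "0 < T'" "\<forall>t. 0 < t \<and> t < T' \<longrightarrow> \<gamma> (fst y) + of_real t * post_velocity \<gamma> y \<in> interior D"
    "\<gamma> (fst z) = \<gamma> (fst y) + of_real T' * post_velocity \<gamma> y"
    "y \<in> collision_space L" "z \<in> collision_space L" "\<gamma> differentiable (at (fst y))" "\<gamma> differentiable (at (fst z))"
    "post_velocity \<gamma> z = post_velocity \<gamma> y - (2 * (post_velocity \<gamma> y \<bullet> inward_normal \<gamma> (fst z))) *\<^sub>R inward_normal \<gamma> (fst z)"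
    by (rule next_collisionE)
  have v: "post_velocity \<gamma> x = post_velocity \<gamma> y"
    using reflect_involution[OF normal_unit[OF T(7)] T(8)] reflect_involution[OF normal_unit[OF T(7)] T'(8)] by simp
  have fx: "\<gamma> (fst x) \<notin> interior D" and fy: "\<gamma> (fst y) \<notin> interior D"
    using collision_frontier[OF T(4)] collision_frontier[OF T'(4)] by (auto simp: frontier_D)
  have xy: "\<gamma> (fst x) = \<gamma> (fst y) + of_real (T' - T) * post_velocity \<gamma> y"
    and yx: "\<gamma> (fst y) = \<gamma> (fst x) + of_real (T - T') * post_velocity \<gamma> x"
  proof -
    have e: "\<gamma> (fst x) + of_real T * post_velocity \<gamma> y = \<gamma> (fst y) + of_real T' * post_velocity \<gamma> y"
      using T(3) T'(3) by (simp only: v)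
    have "a = b + (t' - t) * w" "b = a + (t - t') * w" if "a + t * w = b + t' * w" for a b t t' w :: complex
      using that by algebra+
    from this[OF e] show "\<gamma> (fst x) = \<gamma> (fst y) + of_real (T' - T) * post_velocity \<gamma> y"
      "\<gamma> (fst y) = \<gamma> (fst x) + of_real (T - T') * post_velocity \<gamma> x"
      by (simp_all only: of_real_diff v)
  qed
  have "T = T'"
  proof (cases T T' rule: linorder_cases)
    case less
    then have "\<gamma> (fst x) \<in> interior D" unfolding xy using T(1) by (intro T'(2)[rule_format]) auto
    then show ?thesis using fx by simp
  next
    case greater
    then have "\<gamma> (fst y) \<in> interior D" unfolding yx using T'(1) by (intro T(2)[rule_format]) auto
    then show ?thesis using fy by simp
  qed
  then have "\<gamma> (fst x) = \<gamma> (fst y)" using xy by simp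
  then show ?thesis by (intro collision_eqI[OF T(4) T'(4) T(6) _ v])
qed

lemma billiard_map_eq: "next_collision D L \<gamma> x y \<Longrightarrow> billiard_map D L \<gamma> x = y"
  unfolding billiard_map_def using next_collision_unique by blast

text \<open>Rational end points make the family of pieces countable; one phase for each piece is
  fixed by choice.\<close>

definition beta :: "bool \<times> rat \<times> rat \<Rightarrow> real" where
  "beta p = (SOME \<beta>. piece (fst p) \<beta> (of_rat (fst (snd p))) (of_rat (snd (snd p))))"

definition valid :: "bool \<times> rat \<times> rat \<Rightarrow> bool" where
  "valid p \<longleftrightarrow> (\<exists>\<beta>. piece (fst p) \<beta> (of_rat (fst (snd p))) (of_rat (snd (snd p))))"

lemma valid_piece:
  assumes "valid (j, a, b)"
  shows "piece j (beta (j, a, b)) (of_rat a) (of_rat b)"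
proof -
  have e: "\<exists>\<beta>. piece j \<beta> (of_rat a) (of_rat b)" using assms unfolding valid_def fst_conv snd_conv .
  have "piece j (SOME \<beta>. piece j \<beta> (of_rat a) (of_rat b)) (of_rat a) (of_rat b)" by (rule someI_ex[OF e])
  then show ?thesis unfolding beta_def fst_conv snd_conv .
qed

lemma valid_exists:
  assumes "0 < r" "r < L" "\<gamma> r \<notin> corners"
  obtains j a b where "valid (j, a, b)" "of_rat a < r" "r < of_rat b"
proof (rule local_arc[OF assms])
  fix j \<delta> \<beta>
  assume \<delta>: "0 < \<delta>" "\<And>t. \<bar>t - r\<bar> \<le> \<delta> \<Longrightarrow> 0 < t \<and> t < L \<and> \<gamma> t \<in> arc j \<and> \<gamma> t = arc_param j \<beta> t"
  obtain a where a: "r - \<delta> < of_rat a" "of_rat a < r" using of_rat_dense[of "r - \<delta>" r] \<delta>(1) by auto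
  obtain b where b: "r < of_rat b" "of_rat b < r + \<delta>" using of_rat_dense[of r "r + \<delta>"] \<delta>(1) by auto
  have "piece j \<beta> (of_rat a) (of_rat b)"
    unfolding piece_def using a b by (intro allI impI \<delta>(2)) auto
  then have "valid (j, a, b)" by (auto simp: valid_def)
  then show thesis using a(2) b(1) by (rule that)
qed

text \<open>An index consists of a piece of departure, a piece of arrival, and the number of full turns
  that brings the arrival angle into the parameter range.\<close>

type_synonym index = "(bool \<times> rat \<times> rat) \<times> (bool \<times> rat \<times> rat) \<times> int"

definition br :: "index \<Rightarrow> real \<times> real \<Rightarrow> real \<times> real" where
  "br = (\<lambda>((j, a, b), (k, a', b'), n). branch j (beta (j, a, b)) k (beta (k, a', b')) n)"

definition strip :: "bool \<times> rat \<times> rat \<Rightarrow> (real \<times> real) set" where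
  "strip = (\<lambda>(j, a, b). if valid (j, a, b) then {of_rat a<..<of_rat b} \<times> {-1<..<1} else {})"

text \<open>Departure and arrival both have to be non-tangential and inside open pieces, which makes
  the domain open.\<close>

definition dom :: "index \<Rightarrow> (real \<times> real) set" where
  "dom i = strip (fst i) \<inter> br i -` strip (fst (snd i))"

definition regular :: "(real \<times> real) set" where
  "regular = (\<Union>i. dom i)"

lemma continuous_asin_clip[continuous_intros]:
  "continuous_on S f \<Longrightarrow> continuous_on S (\<lambda>x. asin_clip (f x))"
  by (rule continuous_on_compose2[OF continuous_on_asin_clip]) auto

lemma continuous_branch: "continuous_on UNIV (branch j \<beta> k \<beta>' n)"
  unfolding branch_def[abs_def] Let_def next_s_def direction_def
  using R_pos[of j] R_pos[of k] by (intro continuous_intros) auto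

lemma continuous_br: "continuous_on UNIV (br i)"
  by (cases i) (auto simp: br_def continuous_branch)

lemma br_measurable[measurable]: "br i \<in> borel_measurable borel"
  by (rule borel_measurable_continuous_onI[OF continuous_br])

lemma open_strip: "open (strip p)"
  by (cases p) (auto simp: strip_def intro: open_Times)

lemma open_dom: "open (dom i)"
  unfolding dom_def by (intro open_Int open_strip open_vimage continuous_br)

lemma open_regular: "open regular"
  unfolding regular_def by (intro open_UN ballI open_dom)

lemma dom_collision:
  assumes "x \<in> dom i"
  shows "next_collision D L \<gamma> x (br i x)" "billiard_map D L \<gamma> x = br i x"
proof -
  obtain j a b k a' b' n where i: "i = ((j, a, b), (k, a', b'), n)" by (metis prod.collapse)
  obtain r s where x: "x = (r, s)" by (cases x)
  obtain r1 s1 where y: "br i x = (r1, s1)" by (cases "br i x")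
  have v: "valid (j, a, b)" "valid (k, a', b')"
    and "of_rat a < r" "r < of_rat b" "\<bar>s\<bar> < 1" "of_rat a' < r1" "r1 < of_rat b'" "\<bar>s1\<bar> < 1"
    using assms y by (auto simp: dom_def strip_def i x split: if_splits)
  moreover have "branch j (beta (j, a, b)) k (beta (k, a', b')) n (r, s) = (r1, s1)"
    using y by (simp add: i x br_def)
  ultimately have "next_collision D L \<gamma> (r, s) (r1, s1)"
    using branch_collision[OF valid_piece[OF v(1)] _ _ _ valid_piece[OF v(2)]] by blast
  then show "next_collision D L \<gamma> x (br i x)" using x y by simp
  then show "billiard_map D L \<gamma> x = br i x" by (rule billiard_map_eq)
qed

lemma dom_subset: "dom i \<subseteq> collision_space L" and br_dom: "x \<in> dom i \<Longrightarrow> br i x \<in> collision_space L"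
  using dom_collision(1) unfolding next_collision_def by blast+

text \<open>For such \<open>r\<close>, a non-tangential trajectory is exceptional only if it runs
  into a corner or into the base point, which lies in no piece. The direction towards each of these
  finitely many points determines \<open>s\<close>.\<close>

lemma regular_sections:
  assumes r: "0 < r" "r < L" "\<gamma> r \<notin> corners"
  shows "finite {s. (r, s) \<notin> regular \<and> \<bar>s\<bar> < 1}"
proof (rule finite_subset)
  obtain j a b where v: "valid (j, a, b)" "of_rat a < r" "r < of_rat b" using valid_exists[OF r] by blast
  note p = valid_piece[OF v(1)]
  have d: "\<gamma> differentiable (at r)" by (rule piece_derivative[OF p v(2,3)])
  show "finite ((\<lambda>z. - Im (sgn (z - \<gamma> r) * cnj (inward_normal \<gamma> r))) ` (insert (\<gamma> 0) corners))"
    using finite_corners by simp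
  show "{s. (r, s) \<notin> regular \<and> \<bar>s\<bar> < 1} \<subseteq> (\<lambda>z. - Im (sgn (z - \<gamma> r) * cnj (inward_normal \<gamma> r))) ` (insert (\<gamma> 0) corners)"
  proof
    fix s assume "s \<in> {s. (r, s) \<notin> regular \<and> \<bar>s\<bar> < 1}"
    then have s: "(r, s) \<notin> regular" "\<bar>s\<bar> < 1" by auto
    obtain T q where T: "0 < T" and q: "q = \<gamma> r + of_real T * post_velocity \<gamma> (r, s)" "q \<in> frontier D"
      and ex: "\<And>k \<beta>' a' b' r1. piece k \<beta>' a' b' \<Longrightarrow> a' < r1 \<Longrightarrow> r1 < b' \<Longrightarrow> \<gamma> r1 = q \<Longrightarrow>
       \<exists>n s1. \<bar>s1\<bar> < 1 \<and> branch j (beta (j, a, b)) k \<beta>' n (r, s) = (r1, s1)"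
      using branch_exists[OF p v(2,3) s(2)] by blast
    have "q \<in> insert (\<gamma> 0) corners"
    proof (rule ccontr)
      assume nq: "q \<notin> insert (\<gamma> 0) corners"
      obtain r1 where r1: "0 \<le> r1" "r1 < L" "\<gamma> r1 = q" using q(2) gamma_image[symmetric] by auto
      have "r1 \<noteq> 0" using nq r1(3) by auto
      then have "0 < r1" using r1 by simp
      then obtain k a' b' where v': "valid (k, a', b')" "of_rat a' < r1" "r1 < of_rat b'"
        using valid_exists[of r1] r1 nq by blast
      obtain n s1 where "\<bar>s1\<bar> < 1" "branch j (beta (j, a, b)) k (beta (k, a', b')) n (r, s) = (r1, s1)"
        using ex[OF valid_piece[OF v'(1)] v'(2,3) r1(3)] by blast
      then have "(r, s) \<in> dom ((j, a, b), (k, a', b'), n)"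
        using v v' s(2) by (auto simp: dom_def strip_def br_def)
      then show False using s(1) by (auto simp: regular_def)
    qed
    moreover have "s = - Im (sgn (q - \<gamma> r) * cnj (inward_normal \<gamma> r))"
    proof -
      let ?v = "post_velocity \<gamma> (r, s)"
      have "cmod ?v = 1" using normal_unit[OF d] by (simp add: post_velocity_def norm_mult)
      then have "sgn (q - \<gamma> r) = ?v" using T by (simp add: q(1) sgn_eq norm_mult)
      then show ?thesis using velocity_s[OF d, of s] s(2) by simp
    qed
    ultimately show "s \<in> (\<lambda>z. - Im (sgn (z - \<gamma> r) * cnj (inward_normal \<gamma> r))) ` (insert (\<gamma> 0) corners)"
      by blast
  qed
qed

text \<open>By Fubini's theorem it is enough that for almost every \<open>r\<close> finitely many
  \<open>s\<close> are exceptional, the tangential values \<plusminus>1 included.\<close>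

lemma AE_regular: "AE x in lborel. x \<in> collision_space L \<longrightarrow> x \<in> regular"
proof -
  have cs: "collision_space L \<in> sets borel"
    unfolding collision_space_def by (intro borel_Times) auto
  have reg: "regular \<in> sets borel" using open_regular by simp
  have set: "{x. x \<in> collision_space L \<longrightarrow> x \<in> regular} \<in> sets borel"
  proof -
    have "{x. x \<in> collision_space L \<longrightarrow> x \<in> regular} = - collision_space L \<union> regular" by auto
    then show ?thesis using cs reg by simp
  qed
  define B where "B = insert 0 {r\<in>{0..<L}. \<gamma> r \<in> corners}"
  have "finite {r\<in>{0..<L}. \<gamma> r \<in> corners}"
  proof (rule inj_on_finite)
    show "inj_on \<gamma> {r\<in>{0..<L}. \<gamma> r \<in> corners}" by (rule inj_on_subset[OF inj_gamma]) auto
  qed (use finite_corners in auto)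
  then have "B \<in> null_sets lborel" unfolding B_def by (intro finite_imp_null_set_lborel) simp
  then have "AE r in lborel. r \<notin> B" by (rule AE_not_in)
  then have "AE r in lborel. AE s in lborel. (r, s) \<in> collision_space L \<longrightarrow> (r, s) \<in> regular"
  proof eventually_elim
    case (elim r)
    show ?case
    proof (cases "0 < r \<and> r < L \<and> \<gamma> r \<notin> corners")
      case True
      then have "finite (insert 1 (insert (-1) {s. (r, s) \<notin> regular \<and> \<bar>s\<bar> < 1}))"
        using regular_sections[of r] by simp
      then have "insert 1 (insert (-1) {s. (r, s) \<notin> regular \<and> \<bar>s\<bar> < 1}) \<in> null_sets lborel"
        by (rule finite_imp_null_set_lborel)
      then have "AE s in lborel. s \<notin> insert 1 (insert (-1) {s. (r, s) \<notin> regular \<and> \<bar>s\<bar> < 1})"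
        by (rule AE_not_in)
      then show ?thesis by eventually_elim (auto simp: collision_space_def)
    next
      case False
      then have "(r, s) \<notin> collision_space L" for s
        using elim by (auto simp: collision_space_def B_def)
      then show ?thesis by simp
    qed
  qed
  then have "AE x in (lborel :: real measure) \<Otimes>\<^sub>M (lborel :: real measure). x \<in> collision_space L \<longrightarrow> x \<in> regular"
  proof (rule lborel_pair.AE_pair_measure[rotated])
    show "{x \<in> space ((lborel :: real measure) \<Otimes>\<^sub>M (lborel :: real measure)). x \<in> collision_space L \<longrightarrow> x \<in> regular}
      \<in> sets ((lborel :: real measure) \<Otimes>\<^sub>M (lborel :: real measure))"
      unfolding lborel_prod using set by simp
  qed
  then show ?thesis unfolding lborel_prod .
qed

text \<open>The arrival determines the direction \<theta>, after which the equation for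
  \<open>s1\<close> is solved for \<open>s\<close>. With the clipped arcsine this inversion is valid
  on the whole plane.\<close>

definition branch_inv :: "bool \<Rightarrow> real \<Rightarrow> bool \<Rightarrow> real \<Rightarrow> int \<Rightarrow> real \<times> real \<Rightarrow> real \<times> real" where
  "branch_inv j \<beta> k \<beta>' n y =
     (let \<theta> = fst y / R k + asin_clip (snd y) + \<beta>' - 2 * pi * of_int n;
          s = (R k * snd y - Im (cis (- \<theta>) * (c k - c j))) / R j
      in (R j * (\<theta> - \<beta> + asin_clip s - pi), s))"

lemma branch_inv_left: "branch_inv j \<beta> k \<beta>' n (branch j \<beta> k \<beta>' n x) = x"
proof -
  let ?\<theta> = "direction j \<beta> x"
  let ?s1 = "next_s j k ?\<theta> (snd x)"
  have 1: "R k * (?\<theta> - asin_clip ?s1 - \<beta>' + 2 * pi * of_int n) / R k + asin_clip ?s1 + \<beta>' - 2 * pi * of_int n = ?\<theta>"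
    using R_pos[of k] by simp
  have 2: "(R k * ?s1 - Im (cis (- ?\<theta>) * (c k - c j))) / R j = snd x"
    using R_pos[of k] R_pos[of j] unfolding next_s_def by simp
  have 3: "R j * (?\<theta> - \<beta> + asin_clip (snd x) - pi) = fst x"
    using R_pos[of j] by (simp add: direction_def)
  show ?thesis unfolding branch_inv_def branch_def Let_def fst_conv snd_conv 1 2 3 by simp
qed

lemma branch_inv_right: "branch j \<beta> k \<beta>' n (branch_inv j \<beta> k \<beta>' n y) = y"
proof -
  define \<theta> where "\<theta> = fst y / R k + asin_clip (snd y) + \<beta>' - 2 * pi * of_int n"
  define s where "s = (R k * snd y - Im (cis (- \<theta>) * (c k - c j))) / R j"
  have inv: "branch_inv j \<beta> k \<beta>' n y = (R j * (\<theta> - \<beta> + asin_clip s - pi), s)"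
    by (simp only: branch_inv_def Let_def \<theta>_def s_def)
  have 1: "direction j \<beta> (R j * (\<theta> - \<beta> + asin_clip s - pi), s) = \<theta>"
    using R_pos[of j] by (simp add: direction_def)
  have 2: "next_s j k \<theta> s = snd y"
    using R_pos[of k] R_pos[of j] unfolding next_s_def s_def by simp
  have 3: "R k * (\<theta> - asin_clip (snd y) - \<beta>' + 2 * pi * of_int n) = fst y"
    using R_pos[of k] by (simp add: \<theta>_def)
  show ?thesis unfolding inv branch_def Let_def snd_conv 1 2 3 by simp
qed

lemma continuous_branch_inv: "continuous_on UNIV (branch_inv j \<beta> k \<beta>' n)"
  unfolding branch_inv_def[abs_def] Let_def
  using R_pos[of j] R_pos[of k] by (intro continuous_intros) auto

end

section \<open>Invariance of the measure\<close>

lemma nn_integral_affine: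
  fixes f :: "real \<Rightarrow> ennreal"
  assumes f[measurable]: "f \<in> borel_measurable borel" and c: "0 < c"
  shows "(\<integral>\<^sup>+x. f (t + c * x) \<partial>lborel) = ennreal (1 / c) * (\<integral>\<^sup>+x. f x \<partial>lborel)"
proof -
  have "ennreal (1 / c) * (\<integral>\<^sup>+x. f x \<partial>lborel) = ennreal (1 / c) * (ennreal c * (\<integral>\<^sup>+x. f (t + c * x) \<partial>lborel))"
    using nn_integral_real_affine[OF f, of c t] c by simp
  also have "\<dots> = ennreal (1 / c * c) * (\<integral>\<^sup>+x. f (t + c * x) \<partial>lborel)"
    using c by (subst ennreal_mult) (simp_all add: mult.assoc)
  finally show ?thesis using c by simp
qed

context lemon_billiard
begin

sublocale collision_torus L
  by unfold_locales (rule L_pos)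

text \<open>Written in terms of the direction \<open>\<theta>\<close> of the trajectory, a branch is a composition of shears
  and of scalings whose factors cancel.\<close>

lemma nn_integral_branch:
  fixes f :: "real \<times> real \<Rightarrow> ennreal"
  assumes f: "f \<in> borel_measurable borel"
  shows "(\<integral>\<^sup>+x. f (branch j \<beta> k \<beta>' n x) \<partial>lborel) = (\<integral>\<^sup>+x. f x \<partial>lborel)"
proof -
  have [measurable]: "f \<in> borel_measurable (borel \<Otimes>\<^sub>M borel)" using f by (simp add: borel_prod)
  define a where "a s = R k * (- asin_clip s - \<beta>' + 2 * pi * of_int n)" for s
  define q where "q \<theta> s = f (a s + R k * \<theta>, s)" for \<theta> s
  define w where "w \<theta> = Im (cis (- \<theta>) * (c k - c j)) / R k" for \<theta>
  define \<tau> where "\<tau> s = \<beta> + pi - asin_clip s" for s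
  have [measurable]: "w \<in> borel_measurable borel"
    unfolding w_def[abs_def] by (intro borel_measurable_continuous_onI continuous_intros) (use R_pos[of k] in auto)
  have [measurable]: "a \<in> borel_measurable borel" "\<tau> \<in> borel_measurable borel"
    unfolding a_def[abs_def] \<tau>_def[abs_def] by measurable
  have [measurable]: "case_prod q \<in> borel_measurable (borel \<Otimes>\<^sub>M borel)"
    unfolding q_def[abs_def] by measurable
  have br: "f (branch j \<beta> k \<beta>' n (r, s)) = q (\<tau> s + (1 / R j) * r) (w (\<tau> s + (1 / R j) * r) + (R j / R k) * s)" for r s
  proof -
    have d: "direction j \<beta> (r, s) = \<tau> s + (1 / R j) * r" by (simp add: direction_def \<tau>_def)
    have s: "next_s j k \<theta> s = w \<theta> + (R j / R k) * s" for \<theta>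
      by (simp add: next_s_def w_def add_divide_distrib)
    show ?thesis unfolding branch_def Let_def snd_conv d s q_def a_def by (simp add: algebra_simps)
  qed
  have "(\<integral>\<^sup>+x. f (branch j \<beta> k \<beta>' n x) \<partial>lborel) = (\<integral>\<^sup>+r. (\<integral>\<^sup>+s. f (branch j \<beta> k \<beta>' n (r, s)) \<partial>lborel) \<partial>lborel)"
    by (rule nn_integral_lborel_pair, rule measurable_compose[OF _ f],
        rule borel_measurable_continuous_onI[OF continuous_branch])
  also have "\<dots> = (\<integral>\<^sup>+r. (\<integral>\<^sup>+s. q (\<tau> s + (1 / R j) * r) (w (\<tau> s + (1 / R j) * r) + (R j / R k) * s) \<partial>lborel) \<partial>lborel)"
    unfolding br ..
  \<comment> \<open>Exchanging the order of integration lets \<open>r\<close> be replaced by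
    \<theta> at fixed \<open>s\<close>; after a second exchange \<open>s\<close> is replaced at
    fixed \<theta>, and finally \<theta> by the new parameter at fixed new \<open>s\<close>.\<close>
  also have "\<dots> = (\<integral>\<^sup>+s. (\<integral>\<^sup>+r. q (\<tau> s + (1 / R j) * r) (w (\<tau> s + (1 / R j) * r) + (R j / R k) * s) \<partial>lborel) \<partial>lborel)"
    by (rule lborel_pair.Fubini'[symmetric]) measurable
  also have "\<dots> = (\<integral>\<^sup>+s. ennreal (R j) * (\<integral>\<^sup>+\<theta>. q \<theta> (w \<theta> + (R j / R k) * s) \<partial>lborel) \<partial>lborel)"
  proof (rule nn_integral_cong)
    fix s
    show "(\<integral>\<^sup>+r. q (\<tau> s + (1 / R j) * r) (w (\<tau> s + (1 / R j) * r) + (R j / R k) * s) \<partial>lborel)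
      = ennreal (R j) * (\<integral>\<^sup>+\<theta>. q \<theta> (w \<theta> + (R j / R k) * s) \<partial>lborel)"
      using nn_integral_affine[of "\<lambda>\<theta>. q \<theta> (w \<theta> + (R j / R k) * s)" "1 / R j" "\<tau> s"] R_pos[of j] by simp
  qed
  also have "\<dots> = ennreal (R j) * (\<integral>\<^sup>+s. (\<integral>\<^sup>+\<theta>. q \<theta> (w \<theta> + (R j / R k) * s) \<partial>lborel) \<partial>lborel)"
    by (rule nn_integral_cmult) measurable
  also have "(\<integral>\<^sup>+s. (\<integral>\<^sup>+\<theta>. q \<theta> (w \<theta> + (R j / R k) * s) \<partial>lborel) \<partial>lborel)
      = (\<integral>\<^sup>+\<theta>. (\<integral>\<^sup>+s. q \<theta> (w \<theta> + (R j / R k) * s) \<partial>lborel) \<partial>lborel)"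
    by (rule lborel_pair.Fubini') measurable
  also have "\<dots> = (\<integral>\<^sup>+\<theta>. ennreal (R k / R j) * (\<integral>\<^sup>+s. q \<theta> s \<partial>lborel) \<partial>lborel)"
  proof (rule nn_integral_cong)
    fix \<theta>
    show "(\<integral>\<^sup>+s. q \<theta> (w \<theta> + (R j / R k) * s) \<partial>lborel) = ennreal (R k / R j) * (\<integral>\<^sup>+s. q \<theta> s \<partial>lborel)"
      using nn_integral_affine[of "\<lambda>s. q \<theta> s" "R j / R k" "w \<theta>"] R_pos[of j] R_pos[of k] by simp
  qed
  also have "\<dots> = ennreal (R k / R j) * (\<integral>\<^sup>+\<theta>. (\<integral>\<^sup>+s. q \<theta> s \<partial>lborel) \<partial>lborel)"
    by (rule nn_integral_cmult) measurable
  also have "(\<integral>\<^sup>+\<theta>. (\<integral>\<^sup>+s. q \<theta> s \<partial>lborel) \<partial>lborel) = (\<integral>\<^sup>+s. (\<integral>\<^sup>+\<theta>. q \<theta> s \<partial>lborel) \<partial>lborel)"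
    by (rule lborel_pair.Fubini'[symmetric]) measurable
  also have "\<dots> = (\<integral>\<^sup>+s. ennreal (1 / R k) * (\<integral>\<^sup>+r. f (r, s) \<partial>lborel) \<partial>lborel)"
  proof (rule nn_integral_cong)
    fix s
    show "(\<integral>\<^sup>+\<theta>. q \<theta> s \<partial>lborel) = ennreal (1 / R k) * (\<integral>\<^sup>+r. f (r, s) \<partial>lborel)"
      unfolding q_def by (rule nn_integral_affine[of "\<lambda>r. f (r, s)"]) (use R_pos[of k] in measurable)
  qed
  also have "\<dots> = ennreal (1 / R k) * (\<integral>\<^sup>+s. (\<integral>\<^sup>+r. f (r, s) \<partial>lborel) \<partial>lborel)"
    by (rule nn_integral_cmult) measurable
  also have "(\<integral>\<^sup>+s. (\<integral>\<^sup>+r. f (r, s) \<partial>lborel) \<partial>lborel) = (\<integral>\<^sup>+r. (\<integral>\<^sup>+s. f (r, s) \<partial>lborel) \<partial>lborel)"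
    by (rule lborel_pair.Fubini') measurable
  also have "\<dots> = (\<integral>\<^sup>+x. f x \<partial>lborel)"
    by (rule nn_integral_lborel_pair[OF f, symmetric])
  also have "ennreal (R j) * (ennreal (R k / R j) * (ennreal (1 / R k) * (\<integral>\<^sup>+x. f x \<partial>lborel))) = (\<integral>\<^sup>+x. f x \<partial>lborel)"
  proof -
    have "ennreal (R j) * (ennreal (R k / R j) * ennreal (1 / R k)) = ennreal (R j * (R k / R j * (1 / R k)))"
      using R_pos[of j] R_pos[of k] by (subst ennreal_mult; (subst ennreal_mult)?; simp)
    also have "R j * (R k / R j * (1 / R k)) = 1" using R_pos[of j] R_pos[of k] by simp
    finally show ?thesis by (simp add: mult.assoc[symmetric])
  qed
  finally show ?thesis .
qed

definition br_inv :: "index \<Rightarrow> real \<times> real \<Rightarrow> real \<times> real" where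
  "br_inv = (\<lambda>((j, a, b), (k, a', b'), n). branch_inv j (beta (j, a, b)) k (beta (k, a', b')) n)"

lemma br_inv_left: "br_inv i (br i x) = x" and br_inv_right: "br i (br_inv i x) = x"
proof -
  obtain j a b k a' b' n where i: "i = ((j, a, b), (k, a', b'), n)" by (metis prod.collapse)
  show "br_inv i (br i x) = x" "br i (br_inv i x) = x"
    unfolding br_inv_def br_def i prod.case by (rule branch_inv_left, rule branch_inv_right)
qed

lemma br_inv_measurable[measurable]: "br_inv i \<in> borel_measurable borel"
proof -
  obtain j a b k a' b' n where i: "i = ((j, a, b), (k, a', b'), n)" by (metis prod.collapse)
  show ?thesis unfolding br_inv_def i prod.case by (rule borel_measurable_continuous_onI[OF continuous_branch_inv])
qed

text \<open>The image of a Borel set under a branch is written as a preimage under the inverse,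
  which makes it Borel.\<close>

lemma emeasure_br_image:
  assumes A: "A \<in> sets borel"
  shows "br_inv i -` A \<in> sets borel" "emeasure lborel (br_inv i -` A) = emeasure lborel A"
proof -
  show V: "br_inv i -` A \<in> sets borel" using measurable_sets[OF br_inv_measurable A] by simp
  have "emeasure lborel (br_inv i -` A) = (\<integral>\<^sup>+x. indicator (br_inv i -` A) x \<partial>lborel)"
    using V by simp
  also have "\<dots> = (\<integral>\<^sup>+x. indicator (br_inv i -` A) (br i x) \<partial>lborel)"
  proof -
    obtain j a b k a' b' n where i: "i = ((j, a, b), (k, a', b'), n)" by (metis prod.collapse)
    have "br i = branch j (beta (j, a, b)) k (beta (k, a', b')) n" unfolding br_def i prod.case ..
    then show ?thesis using V by (simp only: nn_integral_branch borel_measurable_indicator)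
  qed
  also have "\<dots> = (\<integral>\<^sup>+x. indicator A x \<partial>lborel)" by (simp add: indicator_def br_inv_left)
  finally show "emeasure lborel (br_inv i -` A) = emeasure lborel A" using A by simp
qed

text \<open>The identity serves as default off \<open>regular\<close>, so that the map is measurable
  and sends the collision space into itself.\<close>

definition regular_map :: "real \<times> real \<Rightarrow> real \<times> real" where
  "regular_map x = (if x \<in> regular then billiard_map D L \<gamma> x else x)"

lemma regular_map_dom: "x \<in> dom i \<Longrightarrow> regular_map x = br i x"
proof -
  assume x: "x \<in> dom i"
  then have "x \<in> regular" unfolding regular_def by blast
  then show ?thesis by (simp add: regular_map_def dom_collision(2)[OF x])
qed

lemma dom_sets[measurable]: "dom i \<in> sets borel" and regular_sets[measurable]: "regular \<in> sets borel"
  using open_dom open_regular by auto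

lemma measurable_regular_piecewise:
  assumes 1: "\<And>i. \<exists>g. g \<in> borel_measurable borel \<and> (\<forall>x\<in>dom i. f x = g x)"
    and 2: "\<exists>g. g \<in> borel_measurable borel \<and> (\<forall>x\<in>- regular. f x = g x)"
  shows "f \<in> borel_measurable borel"
proof (rule measurable_piecewise_restrict[of "insert (- regular) (range dom)"])
  show "countable (insert (- regular) (range dom))" by simp
  show "\<And>\<Omega>. \<Omega> \<in> insert (- regular) (range dom) \<Longrightarrow> \<Omega> \<inter> space borel \<in> sets borel" by auto
  show "space borel \<subseteq> \<Union> (insert (- regular) (range dom))" by (auto simp: regular_def)
  fix \<Omega> assume "\<Omega> \<in> insert (- regular) (range dom)"
  then obtain g where g: "g \<in> borel_measurable borel" "\<And>x. x \<in> \<Omega> \<Longrightarrow> f x = g x"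
    using 1 2 by blast
  have "g \<in> restrict_space borel \<Omega> \<rightarrow>\<^sub>M borel" by (rule measurable_restrict_space1[OF g(1)])
  then show "f \<in> restrict_space borel \<Omega> \<rightarrow>\<^sub>M borel"
    by (subst measurable_cong[of _ f g]) (auto simp: space_restrict_space g(2))
qed

lemma regular_map_borel[measurable]: "regular_map \<in> borel_measurable borel"
proof (rule measurable_regular_piecewise)
  show "\<exists>g. g \<in> borel_measurable borel \<and> (\<forall>x\<in>dom i. regular_map x = g x)" for i
    by (intro exI[of _ "br i"]) (auto simp: regular_map_dom)
  show "\<exists>g. g \<in> borel_measurable borel \<and> (\<forall>x\<in>- regular. regular_map x = g x)"
    by (intro exI[of _ "\<lambda>x. x"]) (auto simp: regular_map_def)
qed

lemma regular_map_mem: "x \<in> collision_space L \<Longrightarrow> regular_map x \<in> collision_space L"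
proof (cases "x \<in> regular")
  case True
  then obtain i where i: "x \<in> dom i" unfolding regular_def by blast
  show ?thesis unfolding regular_map_dom[OF i] by (rule br_dom[OF i])
qed (simp add: regular_map_def)

lemma regular_map_m[measurable]: "regular_map \<in> m \<rightarrow>\<^sub>M m"
  unfolding into_m space_m using regular_map_mem by (auto simp: measurable_m_iff measurable_restrict_space1)

lemma AE_m_regular: "AE x in m. x \<in> regular"
proof -
  have "AE x in restrict_space lborel (collision_space L). x \<in> regular"
    using AE_regular by (subst AE_restrict_space_iff) auto
  then show ?thesis unfolding collision_measure_def by (subst AE_density) auto
qed

lemma AE_billiard_map: "AE x in m. billiard_map D L \<gamma> x = regular_map x"
  using AE_m_regular by eventually_elim (simp add: regular_map_def)

lemma emeasure_m: "B \<in> sets m \<Longrightarrow> emeasure m B = ennreal (1 / (2 * L)) * emeasure lborel B"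
proof -
  assume B: "B \<in> sets m"
  then have B': "B \<in> sets borel" "B \<subseteq> collision_space L" by (auto simp: sets_m_iff)
  have "emeasure m B = (\<integral>\<^sup>+x. indicator B x \<partial>m)" using B by simp
  also have "\<dots> = ennreal (1 / (2 * L)) * (\<integral>\<^sup>+x. indicator B x * indicator (collision_space L) x \<partial>lborel)"
    by (rule nn_integral_m[OF borel_measurable_indicator[OF B]])
  also have "(\<lambda>x. indicator B x * indicator (collision_space L) x :: ennreal) = indicator B"
    using B' by (auto simp: fun_eq_iff split: split_indicator)
  finally show ?thesis using B' by simp
qed

text \<open>The domains of the branches overlap and are first made disjoint; the images are then disjoint
  because the billiard map is injective.\<close>

lemma emeasure_regular_preimage:
  assumes B: "B \<in> sets borel"
  shows "emeasure lborel {x\<in>regular. regular_map x \<in> B} \<le> emeasure lborel B"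
proof -
  define E where "E = disjointed (\<lambda>n. dom (from_nat n))"
  define A where "A n = E n \<inter> br (from_nat n) -` B" for n
  define V where "V n = br_inv (from_nat n) -` A n" for n
  have Ed: "E n \<subseteq> dom (from_nat n)" for n unfolding E_def by (rule disjointed_subset)
  have Es: "E n \<in> sets borel" for n
  proof -
    have "range E \<subseteq> sets borel" unfolding E_def by (rule sets.range_disjointed_sets) auto
    then show ?thesis by blast
  qed
  have As: "A n \<in> sets borel" for n
    unfolding A_def using measurable_sets[OF br_measurable B, of "from_nat n"] Es by auto
  have AV: "x \<in> V n \<Longrightarrow> \<exists>y. y \<in> A n \<and> next_collision D L \<gamma> y x \<and> x \<in> B" for x n
  proof -
    assume "x \<in> V n"
    then have y: "br_inv (from_nat n) x \<in> A n" by (simp add: V_def)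
    then have d: "br_inv (from_nat n) x \<in> dom (from_nat n)" using Ed by (auto simp: A_def)
    show ?thesis
      using y dom_collision(1)[OF d] by (intro exI[of _ "br_inv (from_nat n) x"]) (simp add: A_def br_inv_right)
  qed
  have dA: "disjoint_family A"
    using disjoint_family_disjointed[of "\<lambda>n. dom (from_nat n)"] by (auto simp: disjoint_family_on_def A_def E_def)
  have dV: "disjoint_family V"
    unfolding disjoint_family_on_def
  proof (intro ballI impI)
    fix n k :: nat assume nk: "n \<noteq> k"
    show "V n \<inter> V k = {}"
    proof (rule ccontr)
      assume "V n \<inter> V k \<noteq> {}"
      then obtain x where x: "x \<in> V n" "x \<in> V k" by auto
      obtain y where y: "y \<in> A n" "next_collision D L \<gamma> y x" using AV[OF x(1)] by blast
      obtain z where z: "z \<in> A k" "next_collision D L \<gamma> z x" using AV[OF x(2)] by blast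
      have "y = z" by (rule next_collision_inj[OF y(2) z(2)])
      then show False using dA nk y(1) z(1) by (auto simp: disjoint_family_on_def)
    qed
  qed
  have "{x\<in>regular. regular_map x \<in> B} = (\<Union>n. A n)"
  proof -
    have U: "(\<Union>n. E n) = regular"
    proof -
      have "(\<Union>n. dom (from_nat n)) = (\<Union>i. dom i)" by (metis UN_extend_simps(10) surj_from_nat)
      then show ?thesis unfolding E_def UN_disjointed_eq by (simp add: regular_def)
    qed
    have e: "x \<in> E n \<Longrightarrow> regular_map x = br (from_nat n) x" for x n using Ed by (intro regular_map_dom) auto
    show ?thesis unfolding U[symmetric] A_def using e by auto
  qed
  then have "emeasure lborel {x\<in>regular. regular_map x \<in> B} = (\<Sum>n. emeasure lborel (A n))"
    using suminf_emeasure[of A lborel] As dA by (simp add: image_subset_iff)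
  also have "\<dots> = (\<Sum>n. emeasure lborel (V n))" unfolding V_def by (simp add: emeasure_br_image(2)[OF As])
  also have "\<dots> = emeasure lborel (\<Union>n. V n)"
    using suminf_emeasure[of V lborel] emeasure_br_image(1)[OF As] dV by (simp add: V_def image_subset_iff)
  also have "\<dots> \<le> emeasure lborel B"
    using AV B by (intro emeasure_mono) auto
  finally show ?thesis .
qed

lemma emeasure_preimage_le:
  assumes B: "B \<in> sets m"
  shows "emeasure m (regular_map -` B \<inter> space m) \<le> emeasure m B"
proof -
  have B': "B \<in> sets borel" "B \<subseteq> collision_space L" using B by (auto simp: sets_m_iff)
  have s: "{x\<in>regular. regular_map x \<in> B} \<in> sets borel"
  proof -
    have "{x\<in>regular. regular_map x \<in> B} = regular \<inter> (regular_map -` B \<inter> space borel)" by auto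
    then show ?thesis using measurable_sets[OF regular_map_borel B'(1)] by simp
  qed
  have sub: "{x\<in>regular. regular_map x \<in> B} \<subseteq> collision_space L" using dom_subset unfolding regular_def by blast
  have sm: "{x\<in>regular. regular_map x \<in> B} \<in> sets m" using s sub by (simp add: sets_m_iff)
  have "emeasure m (regular_map -` B \<inter> space m) = emeasure m {x\<in>regular. regular_map x \<in> B}"
  proof (rule emeasure_eq_AE)
    show "AE x in m. x \<in> regular_map -` B \<inter> space m \<longleftrightarrow> x \<in> {x\<in>regular. regular_map x \<in> B}"
      using AE_m_regular AE_space by eventually_elim auto
  qed (use sm measurable_sets[OF regular_map_m B] in auto)
  also have "\<dots> = ennreal (1 / (2 * L)) * emeasure lborel {x\<in>regular. regular_map x \<in> B}"
    by (rule emeasure_m[OF sm])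
  also have "\<dots> \<le> ennreal (1 / (2 * L)) * emeasure lborel B"
    by (intro mult_left_mono emeasure_regular_preimage B') auto
  also have "\<dots> = emeasure m B" by (rule emeasure_m[OF B, symmetric])
  finally show ?thesis .
qed

text \<open>Two probability measures, one of which is bounded by the other on all sets, are equal;
  the reverse inequality comes from complements.\<close>

lemma distr_regular_map: "distr m m regular_map = m"
proof (rule measure_eqI)
  interpret d: prob_space "distr m m regular_map" by (rule m.prob_space_distr) simp
  fix B assume "B \<in> sets (distr m m regular_map)"
  then have B: "B \<in> sets m" by simp
  have le: "measure (distr m m regular_map) A \<le> measure m A" if A: "A \<in> sets m" for A
    using emeasure_preimage_le[OF A] A
    by (simp add: emeasure_distr d.emeasure_eq_measure[symmetric] m.emeasure_eq_measure[symmetric] flip: ennreal_le_iff)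
  have "measure m (space m - B) = 1 - measure m B" "measure (distr m m regular_map) (space m - B) = 1 - measure (distr m m regular_map) B"
    using m.prob_compl[OF B] d.prob_compl[of B] B by simp_all
  then have "measure (distr m m regular_map) B = measure m B"
    using le[OF B] le[of "space m - B"] B by auto
  then show "emeasure (distr m m regular_map) B = emeasure m B"
    by (simp only: d.emeasure_eq_measure m.emeasure_eq_measure)
qed simp

end

section \<open>The derivative of the billiard map\<close>

definition mat2 :: "real \<Rightarrow> real \<Rightarrow> real \<Rightarrow> real \<Rightarrow> real^2^2" where
  "mat2 a b c d = vector [vector [a, b], vector [c, d]]"

lemma mat2_nth[simp]:
  "mat2 a b c d $ 1 $ 1 = a" "mat2 a b c d $ 1 $ 2 = b" "mat2 a b c d $ 2 $ 1 = c" "mat2 a b c d $ 2 $ 2 = d"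
  by (simp_all add: mat2_def)

lemma det_mat2: "det (mat2 a b c d) = a * d - b * c"
  by (simp add: det_2)

lemma mat2_mult: "mat2 a b c d *v v = vector [a * v $ 1 + b * v $ 2, c * v $ 1 + d * v $ 2]"
  by (simp add: vec_eq_iff forall_2 matrix_vector_mult_def sum_2)

lemma borel_measurable_mat2[measurable (raw)]:
  assumes [measurable]: "a \<in> borel_measurable M" "b \<in> borel_measurable M"
    "c \<in> borel_measurable M" "d \<in> borel_measurable M"
  shows "(\<lambda>x. mat2 (a x) (b x) (c x) (d x)) \<in> borel_measurable M"
proof -
  have "(\<lambda>x. mat2 (a x) (b x) (c x) (d x)) =
    (\<lambda>x. a x *\<^sub>R mat2 1 0 0 0 + b x *\<^sub>R mat2 0 1 0 0 + c x *\<^sub>R mat2 0 0 1 0 + d x *\<^sub>R mat2 0 0 0 1)"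
    by (simp add: fun_eq_iff vec_eq_iff forall_2)
  then show ?thesis by simp
qed

lemma onorm_mat2_le: "onorm ((*v) (mat2 a b c d)) \<le> \<bar>a\<bar> + \<bar>b\<bar> + \<bar>c\<bar> + \<bar>d\<bar>"
  using onorm_le_matrix_component_sum[of "mat2 a b c d"] by (simp add: sum_2)

text \<open>The derivative of the arcsine, that is, the reciprocal of the cosine of the collision
  angle; it blows up at tangential collisions.\<close>

definition sec_arcsin :: "real \<Rightarrow> real" where
  "sec_arcsin s = inverse (sqrt (1 - s\<^sup>2))"

lemma sec_arcsin_ge_1: "\<bar>s\<bar> < 1 \<Longrightarrow> 1 \<le> sec_arcsin s"
proof -
  assume s: "\<bar>s\<bar> < 1"
  then have "0 < sqrt (1 - s\<^sup>2)" by (simp add: abs_square_less_1)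
  moreover have "sqrt (1 - s\<^sup>2) \<le> 1" by simp
  ultimately show "1 \<le> sec_arcsin s" unfolding sec_arcsin_def by (rule one_le_inverse)
qed

lemma sec_arcsin_mono:
  assumes "0 \<le> s" "s \<le> t" "t < 1"
  shows "sec_arcsin s \<le> sec_arcsin t"
  unfolding sec_arcsin_def
proof (rule le_imp_inverse_le)
  have "s\<^sup>2 \<le> t\<^sup>2" using assms by (intro power_mono) auto
  then show "sqrt (1 - t\<^sup>2) \<le> sqrt (1 - s\<^sup>2)" by simp
  show "0 < sqrt (1 - t\<^sup>2)" using assms by (simp add: abs_square_less_1)
qed

lemma sec_arcsin_large:
  assumes "s0 < 1"
  obtains s where "s0 < s" "s < 1" "0 \<le> s" "V \<le> sec_arcsin s"
proof -
  define W where "W = max V 1"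
  have W: "1 \<le> W" "V \<le> W" by (auto simp: W_def)
  \<comment> \<open>The last term of the maximum gives 1 - s^2 \<le> 2 (1 - s) \<le> 1 / W^2; the
    others keep \<open>s\<close> above \<open>s0\<close> and non-negative.\<close>
  define s where "s = max (max ((s0 + 1) / 2) 0) (1 - 1 / (2 * W\<^sup>2))"
  have s: "s < 1" "0 \<le> s" "1 - s \<le> 1 / (2 * W\<^sup>2)" using assms W by (auto simp: s_def)
  have "s0 < (s0 + 1) / 2" using assms by simp
  also have "\<dots> \<le> s" unfolding s_def by (rule max.coboundedI1[OF max.cobounded1])
  finally have s0: "s0 < s" .
  have "1 - s\<^sup>2 = (1 - s) * (1 + s)" by (simp add: power2_eq_square algebra_simps)
  also have "\<dots> \<le> 1 / (2 * W\<^sup>2) * 2" using s by (intro mult_mono) auto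
  finally have "1 - s\<^sup>2 \<le> (1 / W)\<^sup>2" using W by (simp add: power_divide)
  then have "sqrt (1 - s\<^sup>2) \<le> sqrt ((1 / W)\<^sup>2)" by (rule real_sqrt_le_mono)
  then have le: "sqrt (1 - s\<^sup>2) \<le> 1 / W" using W by simp
  have "0 < sqrt (1 - s\<^sup>2)" using s by (simp add: abs_square_less_1)
  from le_imp_inverse_le[OF le this] have "W \<le> sec_arcsin s" by (simp add: sec_arcsin_def)
  then show thesis using s s0 W by (intro that[of s]) auto
qed

lemma sec_arcsin_measurable[measurable]: "sec_arcsin \<in> borel_measurable borel"
  unfolding sec_arcsin_def[abs_def] by measurable

text \<open>The singularities at \<plusminus>1 are integrable because the arcsine is a continuous
  antiderivative on the closed interval.\<close>

lemma nn_integral_sec_arcsin: "(\<integral>\<^sup>+s. ennreal (sec_arcsin s * indicator {-1..1} s) \<partial>lborel) = ennreal pi"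
proof (rule nn_integral_has_integral_lborel)
  show "0 \<le> sec_arcsin s * indicator {-1..1} s" for s
    by (auto simp: sec_arcsin_def indicator_def abs_square_le_1 abs_le_iff)
  have "(sec_arcsin has_integral (arcsin 1 - arcsin (-1))) {-1..1}"
  proof (rule fundamental_theorem_of_calculus_interior)
    show "continuous_on {- 1..1} arcsin" by (rule continuous_on_arcsin')
    fix s :: real assume "s \<in> {-1<..<1}"
    then show "(arcsin has_vector_derivative sec_arcsin s) (at s)"
      unfolding has_real_derivative_iff_has_vector_derivative[symmetric] sec_arcsin_def
      by (intro DERIV_arcsin) auto
  qed simp
  then have "((\<lambda>s. if s \<in> {-1..1} then sec_arcsin s else 0) has_integral pi) UNIV"
    by (subst has_integral_restrict_UNIV) simp
  also have "(\<lambda>s. if s \<in> {-1..1} then sec_arcsin s else 0) = (\<lambda>s. sec_arcsin s * indicator {-1..1} s)"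
    by (auto simp: fun_eq_iff)
  finally show "((\<lambda>s. sec_arcsin s * indicator {-1..1} s) has_integral pi) UNIV" .
qed measurable

lemma DERIV_asin_clip:
  assumes "\<bar>s\<bar> < 1"
  shows "(asin_clip has_real_derivative sec_arcsin s) (at s)"
proof (rule has_field_derivative_transform_within_open[of arcsin _ _ "{-1<..<1}"])
  show "(arcsin has_real_derivative sec_arcsin s) (at s)"
    unfolding sec_arcsin_def using assms by (intro DERIV_arcsin) auto
qed (use assms in \<open>auto simp: asin_clip_eq\<close>)

lemma DERIV_Im_cis: "((\<lambda>\<theta>. Im (cis (- \<theta>) * d)) has_real_derivative - Re (cis (- \<theta>) * d)) (at \<theta>)"
proof -
  have "((\<lambda>\<theta>. cos \<theta> * Im d - sin \<theta> * Re d) has_real_derivative - sin \<theta> * Im d - cos \<theta> * Re d) (at \<theta>)"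
    by (auto intro!: derivative_eq_intros)
  also have "(\<lambda>\<theta>. cos \<theta> * Im d - sin \<theta> * Re d) = (\<lambda>\<theta>. Im (cis (- \<theta>) * d))" by (simp add: fun_eq_iff)
  also have "- sin \<theta> * Im d - cos \<theta> * Re d = - Re (cis (- \<theta>) * d)" by simp
  finally show ?thesis .
qed

section \<open>The Jacobian of a branch and integrability of its logarithm\<close>

context lemon_billiard
begin

text \<open>The derivative with respect to \<theta> of the displacement term in
  \<open>next_s\<close>; it vanishes for collisions that stay on one arc.\<close>

definition turn :: "bool \<Rightarrow> bool \<Rightarrow> real \<Rightarrow> real" where
  "turn j k \<theta> = - Re (cis (- \<theta>) * (c k - c j))"

text \<open>The chain rule through \<theta>: the second row is the derivative of \<open>s1\<close>,
  the first that of \<open>R k * (\<theta> - arcsin s1)\<close>.\<close>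

definition jac :: "bool \<Rightarrow> bool \<Rightarrow> real \<Rightarrow> real \<Rightarrow> real \<Rightarrow> real^2^2" where
  "jac j k \<theta> s s1 =
     (let u = sec_arcsin s; u1 = sec_arcsin s1; p = turn j k \<theta> / (R j * R k); q = (R j - u * turn j k \<theta>) / R k
      in mat2 (R k * (1 / R j - p * u1)) (R k * (- u - q * u1)) p q)"

lemma det_jac: "det (jac j k \<theta> s s1) = 1"
  using R_pos[of j] R_pos[of k] by (simp add: jac_def Let_def det_mat2 field_simps)

lemma branch_derivative:
  assumes s: "\<bar>snd x\<bar> < 1" and s1: "\<bar>snd (branch j \<beta> k \<beta>' n x)\<bar> < 1"
  defines "d\<theta> \<equiv> \<lambda>h. fst h / R j - snd h * sec_arcsin (snd x)"
  defines "ds \<equiv> \<lambda>h. (R j * snd h + d\<theta> h * turn j k (direction j \<beta> x)) / R k"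
  shows "(branch j \<beta> k \<beta>' n has_derivative
     (\<lambda>h. (R k * (d\<theta> h - ds h * sec_arcsin (snd (branch j \<beta> k \<beta>' n x))), ds h))) (at x)"
proof -
  let ?s1 = "\<lambda>x. next_s j k (direction j \<beta> x) (snd x)"
  have s1_eq: "snd (branch j \<beta> k \<beta>' n x) = ?s1 x" by (simp add: branch_def Let_def)
  have snd: "(snd has_derivative snd) (at x)" by (rule has_derivative_snd[OF has_derivative_ident])
  have fst: "(fst has_derivative fst) (at x)" by (rule has_derivative_fst[OF has_derivative_ident])
  have "((\<lambda>x. asin_clip (snd x)) has_derivative (\<lambda>h. snd h * sec_arcsin (snd x))) (at x)"
    by (rule DERIV_compose_FDERIV[OF DERIV_asin_clip[OF s] snd])
  then have d: "(direction j \<beta> has_derivative d\<theta>) (at x)"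
    unfolding direction_def[abs_def] d\<theta>_def
    using R_pos[of j] by (auto intro!: derivative_eq_intros fst)
  have e: "((\<lambda>x. Im (cis (- direction j \<beta> x) * (c k - c j))) has_derivative (\<lambda>h. d\<theta> h * turn j k (direction j \<beta> x))) (at x)"
    unfolding turn_def by (rule DERIV_compose_FDERIV[OF DERIV_Im_cis d])
  have n: "(?s1 has_derivative ds) (at x)"
    unfolding next_s_def ds_def
    by (intro bounded_linear.has_derivative[OF bounded_linear_divide] has_derivative_add e
        has_derivative_mult_right snd)
  have a: "((\<lambda>x. asin_clip (?s1 x)) has_derivative (\<lambda>h. ds h * sec_arcsin (?s1 x))) (at x)"
    by (rule DERIV_compose_FDERIV[OF DERIV_asin_clip n]) (use s1 s1_eq in simp)
  have "((\<lambda>x. R k * (direction j \<beta> x - asin_clip (?s1 x) - \<beta>' + 2 * pi * of_int n)) has_derivative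
      (\<lambda>h. R k * (d\<theta> h - ds h * sec_arcsin (?s1 x) - 0 + 0))) (at x)"
    by (intro has_derivative_mult_right has_derivative_add has_derivative_diff d a has_derivative_const)
  from has_derivative_Pair[OF this n]
  show ?thesis unfolding s1_eq branch_def[abs_def] Let_def by simp
qed

lemma domE:
  assumes "x \<in> dom i"
  obtains j a b k a' b' n where "i = ((j, a, b), (k, a', b'), n)" "\<bar>snd x\<bar> < 1" "\<bar>snd (br i x)\<bar> < 1"
    "br i = branch j (beta (j, a, b)) k (beta (k, a', b')) n"
proof -
  obtain j a b k a' b' n where i: "i = ((j, a, b), (k, a', b'), n)" by (metis prod.collapse)
  show thesis
  proof (rule that[OF i])
    show "\<bar>snd x\<bar> < 1" "\<bar>snd (br i x)\<bar> < 1"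
      using assms by (auto simp: dom_def strip_def i split: if_splits)
    show "br i = branch j (beta (j, a, b)) k (beta (k, a', b')) n" by (simp add: br_def i)
  qed
qed

definition deriv_br :: "index \<Rightarrow> real \<times> real \<Rightarrow> real^2^2" where
  "deriv_br = (\<lambda>((j, a, b), (k, a', b'), n) x. jac j k (direction j (beta (j, a, b)) x) (snd x)
     (snd (branch j (beta (j, a, b)) k (beta (k, a', b')) n x)))"

lemma jacobian_dom:
  assumes x: "x \<in> dom i"
  shows "jacobian2 (billiard_map D L \<gamma>) x = deriv_br i x"
proof -
  obtain j a b k a' b' n where i: "i = ((j, a, b), (k, a', b'), n)" "\<bar>snd x\<bar> < 1" "\<bar>snd (br i x)\<bar> < 1"
    and br: "br i = branch j (beta (j, a, b)) k (beta (k, a', b')) n"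
    using x by (rule domE)
  let ?\<beta> = "beta (j, a, b)"
  define d\<theta> where "d\<theta> h = fst h / R j - snd h * sec_arcsin (snd x)" for h :: "real \<times> real"
  define ds where "ds h = (R j * snd h + d\<theta> h * turn j k (direction j ?\<beta> x)) / R k" for h
  have "(br i has_derivative (\<lambda>h. (R k * (d\<theta> h - ds h * sec_arcsin (snd (br i x))), ds h))) (at x)"
    unfolding br ds_def d\<theta>_def by (rule branch_derivative) (use i br in simp_all)
  then have "(billiard_map D L \<gamma> has_derivative (\<lambda>h. (R k * (d\<theta> h - ds h * sec_arcsin (snd (br i x))), ds h))) (at x)"
    by (rule has_derivative_transform_within_open[OF _ open_dom x]) (simp add: dom_collision(2))
  then have f: "frechet_derivative (billiard_map D L \<gamma>) (at x) = (\<lambda>h. (R k * (d\<theta> h - ds h * sec_arcsin (snd (br i x))), ds h))"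
    by (rule frechet_derivative_at[symmetric])
  have 1: "d\<theta> (1, 0) = 1 / R j" "d\<theta> (0, 1) = - sec_arcsin (snd x)"
    "ds (1, 0) = turn j k (direction j ?\<beta> x) / (R j * R k)"
    "ds (0, 1) = (R j - sec_arcsin (snd x) * turn j k (direction j ?\<beta> x)) / R k"
    by (simp_all add: d\<theta>_def ds_def)
  show ?thesis
    unfolding jacobian2_def f Let_def fst_conv snd_conv 1
    by (simp add: deriv_br_def i(1) jac_def Let_def mat2_def br[unfolded i(1)])
qed

lemma deriv_br_measurable[measurable]: "deriv_br i \<in> borel_measurable borel"
proof -
  obtain j a b k a' b' n where i: "i = ((j, a, b), (k, a', b'), n)" by (metis prod.collapse)
  have [measurable]: "turn j k \<in> borel_measurable borel"
    unfolding turn_def[abs_def] by (intro borel_measurable_continuous_onI continuous_intros)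
  have [measurable]: "direction j (beta (j, a, b)) \<in> borel_measurable borel"
    unfolding direction_def[abs_def]
    by (intro borel_measurable_continuous_onI continuous_intros) (use R_pos[of j] in auto)
  have [measurable]: "branch j (beta (j, a, b)) k (beta (k, a', b')) n \<in> borel_measurable borel"
    by (rule borel_measurable_continuous_onI[OF continuous_branch])
  have [measurable]: "(snd :: real \<times> real \<Rightarrow> real) \<in> borel_measurable borel"
    by (intro borel_measurable_continuous_onI continuous_intros)
  show ?thesis
    unfolding deriv_br_def i prod.case jac_def Let_def by measurable
qed

text \<open>The identity matrix as default keeps the determinant condition true at every
  point.\<close>

definition deriv_map :: "real \<times> real \<Rightarrow> real^2^2" where
  "deriv_map x = (if x \<in> regular then jacobian2 (billiard_map D L \<gamma>) x else mat 1)"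

lemma deriv_map_dom: "x \<in> dom i \<Longrightarrow> deriv_map x = deriv_br i x"
proof -
  assume x: "x \<in> dom i"
  then have "x \<in> regular" unfolding regular_def by blast
  then show ?thesis by (simp add: deriv_map_def jacobian_dom[OF x])
qed

lemma deriv_map_measurable: "deriv_map \<in> borel_measurable m"
proof -
  have "deriv_map \<in> borel_measurable borel"
  proof (rule measurable_regular_piecewise)
    show "\<exists>g. g \<in> borel_measurable borel \<and> (\<forall>x\<in>dom i. deriv_map x = g x)" for i
      by (intro exI[of _ "deriv_br i"]) (auto simp: deriv_map_dom)
    show "\<exists>g. g \<in> borel_measurable borel \<and> (\<forall>x\<in>- regular. deriv_map x = g x)"
      by (intro exI[of _ "\<lambda>x. mat 1"]) (auto simp: deriv_map_def)
  qed
  then show ?thesis by (simp add: measurable_m_iff measurable_restrict_space1)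
qed

lemma det_deriv_br: "det (deriv_br i x) = 1"
proof -
  obtain j a b k a' b' n where i: "i = ((j, a, b), (k, a', b'), n)" by (metis prod.collapse)
  show ?thesis unfolding deriv_br_def i prod.case by (rule det_jac)
qed

lemma det_deriv_map: "\<bar>det (deriv_map x)\<bar> = 1"
proof (cases "x \<in> regular")
  case True
  then obtain i where i: "x \<in> dom i" unfolding regular_def by blast
  show ?thesis unfolding deriv_map_dom[OF i] det_deriv_br by simp
qed (simp add: deriv_map_def)

lemma AE_jacobian: "AE x in m. jacobian2 (billiard_map D L \<gamma>) x = deriv_map x"
  using AE_m_regular by eventually_elim (simp add: deriv_map_def)

text \<open>Each of the two secants enters an entry at most to the first power, so a constant times
  their product bounds all four entries.\<close>

lemma onorm_jac_le:
  fixes j k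
  defines "p \<equiv> cmod (c k - c j) / (R j * R k)"
  defines "q \<equiv> (R j + cmod (c k - c j)) / R k"
  assumes s: "\<bar>s\<bar> < 1" "\<bar>s1\<bar> < 1"
  shows "onorm ((*v) (jac j k \<theta> s s1)) \<le> (R k * (1 / R j + p) + R k * (1 + q) + p + q) * (sec_arcsin s * sec_arcsin s1)"
proof -
  let ?u = "sec_arcsin s" and ?u1 = "sec_arcsin s1"
  let ?w = "?u * ?u1" and ?t = "turn j k \<theta>" and ?d = "cmod (c k - c j)"
  define P where "P = ?t / (R j * R k)"
  define Q where "Q = (R j - ?u * ?t) / R k"
  have u: "1 \<le> ?u" "1 \<le> ?u1" using s by (auto intro: sec_arcsin_ge_1)
  have w: "1 \<le> ?w" "?u \<le> ?w" "?u1 \<le> ?w"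
    using mult_mono[of 1 ?u 1 ?u1] mult_mono[of ?u ?u 1 ?u1] mult_mono[of 1 ?u ?u1 ?u1] u by auto
  note R = R_pos[of j] R_pos[of k]
  have t: "\<bar>?t\<bar> \<le> ?d" using abs_Re_le_cmod[of "cis (- \<theta>) * (c k - c j)"] by (simp add: turn_def norm_mult)
  have p0: "0 \<le> p" "0 \<le> q" using R by (auto simp: p_def q_def)
  have P: "\<bar>P\<bar> \<le> p" using t R by (simp add: P_def p_def abs_mult divide_right_mono)
  have Q: "\<bar>Q\<bar> \<le> q * ?u"
  proof -
    have "\<bar>R j - ?u * ?t\<bar> \<le> \<bar>R j\<bar> + \<bar>?u * ?t\<bar>" by (rule abs_triangle_ineq4)
    also have "\<dots> = R j * 1 + ?u * \<bar>?t\<bar>" using R u by (simp add: abs_mult)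
    also have "\<dots> \<le> R j * ?u + ?u * ?d" using R u t by (intro add_mono mult_left_mono) auto
    finally have "\<bar>R j - ?u * ?t\<bar> \<le> (R j + ?d) * ?u" by (simp add: algebra_simps)
    then show ?thesis using R by (simp add: Q_def q_def divide_right_mono)
  qed
  have a: "\<bar>R k * (1 / R j - P * ?u1)\<bar> \<le> R k * (1 / R j + p) * ?w"
  proof -
    have "\<bar>1 / R j - P * ?u1\<bar> \<le> 1 / R j + \<bar>P\<bar> * ?u1"
      using abs_triangle_ineq4[of "1 / R j" "P * ?u1"] R u by (simp add: abs_mult)
    also have "\<dots> \<le> 1 / R j * ?w + p * ?w"
    proof (intro add_mono mult_mono P w)
      show "1 / R j \<le> 1 / R j * ?w" using mult_left_mono[OF w(1), of "1 / R j"] R by simp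
    qed (use p0 u in auto)
    finally have "\<bar>1 / R j - P * ?u1\<bar> \<le> (1 / R j + p) * ?w" by (simp only: distrib_right)
    then show ?thesis using mult_left_mono[of _ _ "R k"] R by (simp add: abs_mult mult.assoc)
  qed
  have b: "\<bar>R k * (- ?u - Q * ?u1)\<bar> \<le> R k * (1 + q) * ?w"
  proof -
    have "\<bar>- ?u - Q * ?u1\<bar> \<le> ?u + \<bar>Q\<bar> * ?u1"
      using abs_triangle_ineq4[of "- ?u" "Q * ?u1"] u by (simp add: abs_mult)
    also have "\<dots> \<le> ?w + q * ?u * ?u1"
    proof (rule add_mono)
      show "?u \<le> ?w" by (rule w)
      show "\<bar>Q\<bar> * ?u1 \<le> q * ?u * ?u1" using u by (intro mult_right_mono Q) simp
    qed
    finally have "\<bar>- ?u - Q * ?u1\<bar> \<le> (1 + q) * ?w" by (simp add: algebra_simps)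
    then show ?thesis using mult_left_mono[of _ _ "R k"] R by (simp add: abs_mult mult.assoc)
  qed
  have pw: "\<bar>P\<bar> \<le> p * ?w" using mult_mono[OF P w(1)] p0 by simp
  have qw: "\<bar>Q\<bar> \<le> q * ?w" using Q mult_left_mono[OF w(2) p0(2)] by linarith
  have "jac j k \<theta> s s1 = mat2 (R k * (1 / R j - P * ?u1)) (R k * (- ?u - Q * ?u1)) P Q"
    by (simp add: jac_def Let_def P_def Q_def)
  then have "onorm ((*v) (jac j k \<theta> s s1)) \<le>
      \<bar>R k * (1 / R j - P * ?u1)\<bar> + \<bar>R k * (- ?u - Q * ?u1)\<bar> + \<bar>P\<bar> + \<bar>Q\<bar>"
    by (simp only: onorm_mat2_le)
  also have "\<dots> \<le> R k * (1 / R j + p) * ?w + R k * (1 + q) * ?w + p * ?w + q * ?w"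
    by (intro add_mono a b pw qw)
  finally show ?thesis by (simp only: distrib_right)
qed

text \<open>The logarithm splits the product of the two secants into a sum, and
  \<open>ln u \<le> u - 1\<close> reduces integrability to that of the secants themselves.\<close>

lemma log_bound:
  obtains C where "\<And>x. x \<in> regular \<Longrightarrow>
    \<bar>ln (onorm ((*v) (deriv_map x)))\<bar> \<le> C + sec_arcsin (snd x) + sec_arcsin (snd (regular_map x))"
proof -
  define p where "p j k = cmod (c k - c j) / (R j * R k)" for j k
  define q where "q j k = (R j + cmod (c k - c j)) / R k" for j k
  define B where "B j k = R k * (1 / R j + p j k) + R k * (1 + q j k) + p j k + q j k" for j k
  have B0: "0 \<le> B j k" for j k
    using R_pos[of j] R_pos[of k] by (auto simp: B_def p_def q_def intro!: add_nonneg_nonneg)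
  \<comment> \<open>One constant dominates all four pairs of arcs; the summand 1 makes it positive
    for the logarithm.\<close>
  define C where "C = B True True + B True False + B False True + B False False + 1"
  have C: "B j k \<le> C" "0 < C" for j k
    using B0[of True True] B0[of True False] B0[of False True] B0[of False False]
    by (cases j; cases k; simp add: C_def)+
  show thesis
  proof (rule that[of "ln C"])
    fix x assume "x \<in> regular"
    then obtain i where x: "x \<in> dom i" unfolding regular_def by blast
    then obtain j a b k a' b' n where i: "i = ((j, a, b), (k, a', b'), n)" "\<bar>snd x\<bar> < 1" "\<bar>snd (br i x)\<bar> < 1"
      and br: "br i = branch j (beta (j, a, b)) k (beta (k, a', b')) n"
      by (rule domE)
    let ?u = "sec_arcsin (snd x)" and ?u1 = "sec_arcsin (snd (br i x))" and ?N = "onorm ((*v) (deriv_map x))"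
    have u: "1 \<le> ?u" "1 \<le> ?u1" using i by (auto intro: sec_arcsin_ge_1)
    have "deriv_map x = jac j k (direction j (beta (j, a, b)) x) (snd x) (snd (br i x))"
      by (simp add: deriv_map_dom[OF x] deriv_br_def i(1) br[unfolded i(1)])
    then have "?N \<le> B j k * (?u * ?u1)"
      unfolding B_def p_def q_def by (simp only: onorm_jac_le[OF i(2,3)])
    also have "\<dots> \<le> C * (?u * ?u1)" using C u by (intro mult_right_mono) auto
    finally have N: "?N \<le> C * (?u * ?u1)" .
    have N1: "1 \<le> ?N" by (rule onorm_ge_1[OF det_deriv_map])
    have "ln ?N \<le> ln (C * (?u * ?u1))" using N N1 by simp
    also have "\<dots> = ln C + (ln ?u + ln ?u1)" using C u by (simp add: ln_mult)
    also have "\<dots> \<le> ln C + (?u + ?u1)"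
      using ln_le_minus_one[of ?u] ln_le_minus_one[of ?u1] u by linarith
    finally show "\<bar>ln ?N\<bar> \<le> ln C + ?u + sec_arcsin (snd (regular_map x))"
      using N1 by (simp add: regular_map_dom[OF x])
  qed
qed

lemma snd_m_measurable[measurable]: "snd \<in> borel_measurable m"
proof -
  have "(snd :: real \<times> real \<Rightarrow> real) \<in> borel_measurable borel"
    by (intro borel_measurable_continuous_onI continuous_intros)
  then show ?thesis by (simp add: measurable_m_iff measurable_restrict_space1)
qed

lemma integrable_sec_arcsin: "integrable m (\<lambda>x. sec_arcsin (snd x))"
proof (rule integrableI_nonneg)
  show "AE x in m. 0 \<le> sec_arcsin (snd x)"
    using AE_space by eventually_elim
      (auto simp: space_m collision_space_def sec_arcsin_def abs_square_le_1 abs_le_iff)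
  have [measurable]: "(snd :: real \<times> real \<Rightarrow> real) \<in> borel_measurable borel"
    by (intro borel_measurable_continuous_onI continuous_intros)
  have "(\<integral>\<^sup>+x. ennreal (sec_arcsin (snd x)) \<partial>m)
    = ennreal (1 / (2 * L)) * (\<integral>\<^sup>+u. ennreal (sec_arcsin (snd u)) * indicator (collision_space L) u \<partial>lborel)"
    by (rule nn_integral_m) measurable
  also have "(\<integral>\<^sup>+u. ennreal (sec_arcsin (snd u)) * indicator (collision_space L) u \<partial>lborel)
    = (\<integral>\<^sup>+r. (\<integral>\<^sup>+s. ennreal (sec_arcsin (snd (r, s))) * indicator (collision_space L) (r, s) \<partial>lborel) \<partial>lborel)"
    by (rule nn_integral_lborel_pair) measurable
  also have "\<dots> = (\<integral>\<^sup>+r. (\<integral>\<^sup>+s. indicator {0..<L} r * ennreal (sec_arcsin s * indicator {-1..1} s) \<partial>lborel) \<partial>lborel)"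
    by (rule nn_integral_cong, rule nn_integral_cong) (auto simp: collision_space_def split: split_indicator)
  also have "\<dots> = (\<integral>\<^sup>+r. indicator {0..<L} r * ennreal pi \<partial>lborel)"
    by (subst nn_integral_cmult) (auto simp: nn_integral_sec_arcsin)
  also have "\<dots> = ennreal L * ennreal pi"
    using L_pos by (subst nn_integral_multc) auto
  finally show "(\<integral>\<^sup>+x. ennreal (sec_arcsin (snd x)) \<partial>m) < \<infinity>"
    by (simp add: ennreal_mult_less_top)
qed measurable

text \<open>By invariance of the measure the secant at the next collision is integrable because the
  one at the present collision is.\<close>

lemma integrable_log: "integrable m (\<lambda>x. ln (onorm ((*v) (deriv_map x))))"
proof -
  obtain C where C: "\<And>x. x \<in> regular \<Longrightarrow>
    \<bar>ln (onorm ((*v) (deriv_map x)))\<bar> \<le> C + sec_arcsin (snd x) + sec_arcsin (snd (regular_map x))"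
    using log_bound by blast
  have "integrable (distr m m regular_map) (\<lambda>x. sec_arcsin (snd x))"
    unfolding distr_regular_map by (rule integrable_sec_arcsin)
  then have "integrable m (\<lambda>x. sec_arcsin (snd (regular_map x)))"
    by (rule integrable_distr[OF regular_map_m])
  then have "integrable m (\<lambda>x. C + sec_arcsin (snd x) + sec_arcsin (snd (regular_map x)))"
    using integrable_sec_arcsin by (intro Bochner_Integration.integrable_add) auto
  then show ?thesis
  proof (rule Bochner_Integration.integrable_bound)
    show "(\<lambda>x. ln (onorm ((*v) (deriv_map x)))) \<in> borel_measurable m"
      using deriv_map_measurable by measurable
    show "AE x in m. norm (ln (onorm ((*v) (deriv_map x)))) \<le>
        norm (C + sec_arcsin (snd x) + sec_arcsin (snd (regular_map x)))"
      using AE_m_regular by eventually_elim (use C in force)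
  qed
qed

end

section \<open>Shears and transitions between the arcs\<close>

lemma shear_image:
  "(*v) (mat2 1 t 0 1) ` {v. \<bar>v $ 1\<bar> < K * \<bar>v $ 2\<bar>} = {w. \<bar>w $ 1 - t * w $ 2\<bar> < K * \<bar>w $ 2\<bar>}"
proof (intro set_eqI iffI)
  fix w :: "real^2"
  assume "w \<in> {w. \<bar>w $ 1 - t * w $ 2\<bar> < K * \<bar>w $ 2\<bar>}"
  then show "w \<in> (*v) (mat2 1 t 0 1) ` {v. \<bar>v $ 1\<bar> < K * \<bar>v $ 2\<bar>}"
    by (intro image_eqI[of _ _ "vector [w $ 1 - t * w $ 2, w $ 2]"]) (simp_all add: mat2_mult vec_eq_iff forall_2)
qed (auto simp: mat2_mult)

text \<open>A vector in both images would have the quotient of its coordinates within distance less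
  than \<open>K\<close> of both \<open>t\<close> and \<open>t'\<close>.\<close>

lemma shear_images_disjoint:
  assumes "2 * K \<le> \<bar>t - t'\<bar>"
  shows "(*v) (mat2 1 t 0 1) ` {v. \<bar>v $ 1\<bar> < K * \<bar>v $ 2\<bar>} \<inter> (*v) (mat2 1 t' 0 1) ` {v. \<bar>v $ 1\<bar> < K * \<bar>v $ 2\<bar>} = {}"
proof -
  have False if "\<bar>x - t * y\<bar> < K * \<bar>y\<bar>" "\<bar>x - t' * y\<bar> < K * \<bar>y\<bar>" for x y :: real
  proof -
    have "\<bar>t - t'\<bar> * \<bar>y\<bar> = \<bar>(x - t' * y) - (x - t * y)\<bar>" by (simp add: abs_mult[symmetric] algebra_simps)
    also have "\<dots> \<le> \<bar>x - t' * y\<bar> + \<bar>x - t * y\<bar>" by (rule abs_triangle_ineq4)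
    finally have "\<bar>t - t'\<bar> * \<bar>y\<bar> < 2 * K * \<bar>y\<bar>" using that by linarith
    then show False using mult_right_mono[OF assms, of "\<bar>y\<bar>"] by simp
  qed
  then show ?thesis unfolding shear_image by blast
qed

text \<open>All shears fix the horizontal direction, and the vectors missed by the first image are
  nearly horizontal. Since \<open>p\<close> is bounded away from 0, the inverse of
  \<open>mat2 a b p q\<close> tilts horizontal vectors by a definite amount and so brings the missed
  vectors into the cone.\<close>

lemma pingpong_shears:
  assumes p: "0 < p0" "p0 \<le> \<bar>p\<bar>" and M: "\<bar>a\<bar> \<le> M" "\<bar>b\<bar> \<le> M" "\<bar>q\<bar> \<le> M"
    and det: "a * q - b * p = 1"
    and T: "\<bar>t1\<bar> \<le> T" and K: "K = T + 2 + 4 * M / p0"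
    and sep: "2 * K \<le> \<bar>t1 - t2\<bar>" "2 * K \<le> \<bar>t1 - t3\<bar>" "2 * K \<le> \<bar>t2 - t3\<bar>"
  shows "pingpong {v. \<bar>v $ 1\<bar> < K * \<bar>v $ 2\<bar>} (mat2 1 t1 0 1) (mat2 1 t2 0 1) (mat2 1 t3 0 1) (mat2 a b p q)"
proof -
  have M0: "0 \<le> M" and T0: "0 \<le> T" using M(1) T by linarith+
  have "w \<in> (*v) (mat2 a b p q) ` {v. \<bar>v $ 1\<bar> < K * \<bar>v $ 2\<bar>}"
    if w: "w \<noteq> 0" "\<not> \<bar>w $ 1 - t1 * w $ 2\<bar> < K * \<bar>w $ 2\<bar>" for w :: "real^2"
  proof -
    define x where "x = w $ 1"
    define y where "y = w $ 2"
    have "K * \<bar>y\<bar> \<le> \<bar>x\<bar> + \<bar>t1\<bar> * \<bar>y\<bar>" using w(2) abs_triangle_ineq4[of x "t1 * y"] by (simp add: x_def y_def abs_mult)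
    also have "\<dots> \<le> \<bar>x\<bar> + T * \<bar>y\<bar>" using T by (intro add_left_mono mult_right_mono) auto
    \<comment> \<open>The surplus 2 + 4 M / p0 of \<open>K\<close> over \<open>T\<close> measures
      how strongly the first coordinate dominates outside the first image.\<close>
    finally have xy: "2 * \<bar>y\<bar> + 4 * M / p0 * \<bar>y\<bar> \<le> \<bar>x\<bar>" by (simp add: K algebra_simps)
    have y1: "0 \<le> 4 * M / p0 * \<bar>y\<bar>" using M0 p by simp
    have y2: "\<bar>y\<bar> \<le> \<bar>x\<bar>" using xy y1 by simp
    have y3: "4 * (M * \<bar>y\<bar>) \<le> p0 * \<bar>x\<bar>"
    proof -
      have "4 * M / p0 * \<bar>y\<bar> \<le> \<bar>x\<bar>" using xy by simp
      from mult_left_mono[OF this, of p0] show ?thesis using p by simp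
    qed
    have x0: "0 < \<bar>x\<bar>"
    proof (rule ccontr)
      assume "\<not> 0 < \<bar>x\<bar>"
      then have "x = 0" "y = 0" using y2 by auto
      then show False using w(1) by (simp add: vec_eq_iff forall_2 x_def y_def)
    qed
    have "\<bar>q * x - b * y\<bar> \<le> \<bar>q\<bar> * \<bar>x\<bar> + \<bar>b\<bar> * \<bar>y\<bar>"
      using abs_triangle_ineq4[of "q * x" "b * y"] by (simp add: abs_mult)
    also have "\<dots> \<le> M * \<bar>x\<bar> + M * \<bar>x\<bar>"
      using M M0 y2 by (intro add_mono mult_mono) auto
    finally have 1: "\<bar>q * x - b * y\<bar> \<le> 2 * (M * \<bar>x\<bar>)" by simp
    have "p0 * \<bar>x\<bar> \<le> \<bar>p\<bar> * \<bar>x\<bar>" using p by (intro mult_right_mono) auto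
    also have "\<dots> = \<bar>(p * x - a * y) + a * y\<bar>" by (simp add: abs_mult)
    also have "\<dots> \<le> \<bar>- p * x + a * y\<bar> + \<bar>a\<bar> * \<bar>y\<bar>"
      using abs_triangle_ineq[of "p * x - a * y" "a * y"] abs_minus_commute[of "p * x" "a * y"] by (simp add: abs_mult)
    also have "\<bar>a\<bar> * \<bar>y\<bar> \<le> M * \<bar>y\<bar>" using M by (intro mult_right_mono) auto
    finally have 2: "3 / 4 * (p0 * \<bar>x\<bar>) \<le> \<bar>- p * x + a * y\<bar>" using y3 by linarith
    \<comment> \<open>Combined with \<open>2\<close> this makes the right-hand side of
      \<open>main\<close> at least 3 M \<bar>x\<bar> + (3/2) p0 \<bar>x\<bar>, above the bound in
      \<open>1\<close>.\<close>
    have "4 * M / p0 + 2 \<le> K" using K T0 by simp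
    from mult_mono[OF this 2] have "(4 * M / p0 + 2) * (3 / 4 * (p0 * \<bar>x\<bar>)) \<le> K * \<bar>- p * x + a * y\<bar>"
      using K T0 M0 p by simp
    moreover have "(4 * M / p0 + 2) * (3 / 4 * (p0 * \<bar>x\<bar>)) = 3 * (M * \<bar>x\<bar>) + 3 / 2 * (p0 * \<bar>x\<bar>)"
      using p by (simp add: field_simps)
    moreover have "0 < p0 * \<bar>x\<bar>" "0 \<le> M * \<bar>x\<bar>" using p x0 M0 by auto
    ultimately have main: "\<bar>q * x - b * y\<bar> < K * \<bar>- p * x + a * y\<bar>" using 1 by linarith
    have e: "a * (q * x - b * y) + b * (- p * x + a * y) = (a * q - b * p) * x"
      "p * (q * x - b * y) + q * (- p * x + a * y) = (a * q - b * p) * y" by algebra+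
    show ?thesis
    proof (rule image_eqI)
      show "w = mat2 a b p q *v vector [q * x - b * y, - p * x + a * y]"
        unfolding mat2_mult vector_2 e det by (simp add: vec_eq_iff forall_2 x_def y_def)
      show "vector [q * x - b * y, - p * x + a * y] \<in> {v :: real^2. \<bar>v $ 1\<bar> < K * \<bar>v $ 2\<bar>}" using main by simp
    qed
  qed
  then show ?thesis
    unfolding pingpong_def using shear_images_disjoint[OF sep(1)] shear_images_disjoint[OF sep(2)] shear_images_disjoint[OF sep(3)]
    unfolding shear_image by blast
qed

section \<open>Crossing collisions, nearly tangential collisions and the ping-pong sets\<close>

context lemon_billiard
begin

lemma measure_open_pos:
  assumes U: "open U" "U \<noteq> {}" "U \<subseteq> collision_space L"
  shows "U \<in> sets m" "0 < measure m U"
proof -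
  show s: "U \<in> sets m" using U by (simp add: sets_m_iff)
  have "emeasure lborel U \<noteq> 0"
  proof
    assume "emeasure lborel U = 0"
    then have "U \<in> null_sets lborel" using U(1) by (intro null_setsI) auto
    then have "U \<in> null_sets lebesgue" by (rule null_sets_completionI)
    then have "negligible U" by (simp add: negligible_iff_null_sets)
    then show False using open_not_negligible[OF U(1,2)] by simp
  qed
  then have "emeasure m U \<noteq> 0" unfolding emeasure_m[OF s] using L_pos by simp
  then show "0 < measure m U" by (simp add: m.emeasure_eq_measure zero_less_measure_iff)
qed

text \<open>The point of the circle \<open>j\<close> closest to the other centre lies strictly inside the other disc:
  otherwise the two circles would touch there and nowhere else.\<close>

lemma arc_nonempty: "arc j \<noteq> {}"
proof -
  define k where "k = (\<not> j)"
  define d where "d = cmod (c k - c j)"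
  have d: "0 < d" using c_distinct by (cases j) (auto simp: d_def k_def)
  define u where "u = (c k - c j) / of_real d"
  have u1: "cmod u = 1" using d by (simp add: u_def norm_divide) (simp add: d_def)
  have du: "c k = c j + of_real d * u" using d by (simp add: u_def)
  have uu: "u * cnj u = 1" using u1 complex_norm_square[of u] by simp
  define z where "z = c j + of_real (R j) * u"
  have zj: "cmod (z - c j) = R j" using u1 R_pos[of j] by (simp add: z_def norm_mult)
  have zk: "cmod (z - c k) = \<bar>R j - d\<bar>"
  proof -
    have "z - c k = of_real (R j - d) * u" by (simp add: z_def du algebra_simps)
    then show ?thesis using u1 by (simp only: norm_mult norm_of_real) simp
  qed
  have "cmod (z - c k) < R k"
  proof (rule ccontr)
    assume "\<not> cmod (z - c k) < R k"
    then have le: "(R k)\<^sup>2 \<le> (R j - d)\<^sup>2" using zk R_pos[of k] by (simp add: abs_le_square_iff[symmetric])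
    have "w = z" if w: "w \<in> corners" for w
    proof -
      have wj: "cmod (w - c j) = R j" and wk: "cmod (w - c k) = R k"
        using w by (cases j; simp add: corners_def k_def dist_norm norm_minus_commute)+
      define \<zeta> where "\<zeta> = (w - c j) * cnj u"
      have z1: "cmod \<zeta> = R j" using wj u1 by (simp add: \<zeta>_def norm_mult)
      have wz: "w - c j = \<zeta> * u"
      proof -
        have "\<zeta> * u = (w - c j) * (u * cnj u)" by (simp add: \<zeta>_def)
        then show ?thesis by (simp only: uu mult_1_right)
      qed
      have "w - c k = (\<zeta> - of_real d) * u" using wz by (simp add: du algebra_simps)
      then have "cmod (\<zeta> - of_real d) = R k" using wk u1 by (simp add: norm_mult)
      then have "(Re \<zeta> - d)\<^sup>2 + (Im \<zeta>)\<^sup>2 = (R k)\<^sup>2" using cmod_power2[of "\<zeta> - of_real d"] by simp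
      moreover have r: "(Re \<zeta>)\<^sup>2 + (Im \<zeta>)\<^sup>2 = (R j)\<^sup>2" using cmod_power2[of \<zeta>] z1 by simp
      ultimately have "2 * d * R j \<le> 2 * d * Re \<zeta>" using le by (simp add: power2_eq_square algebra_simps)
      then have ge: "R j \<le> Re \<zeta>" using d by simp
      then have "(R j)\<^sup>2 \<le> (Re \<zeta>)\<^sup>2" using R_pos[of j] by (intro power_mono) auto
      then have "(Im \<zeta>)\<^sup>2 \<le> 0" using r by linarith
      then have im: "Im \<zeta> = 0" by simp
      then have "Re \<zeta> = R j" using ge complex_Re_le_cmod[of \<zeta>] z1 by linarith
      then have "\<zeta> = of_real (R j)" using im by (simp add: complex_eq_iff)
      then show "w = z" using wz by (simp add: z_def algebra_simps)
    qed
    moreover obtain a b where "a \<noteq> b" "corners = {a, b}" by (rule two_corners)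
    ultimately show False by (metis insertI1 insertI2)
  qed
  then have "z \<in> arc j" using zj by (simp add: arc_iff k_def)
  then show ?thesis by blast
qed

text \<open>Pieces avoid the base point. If the chosen point of the arc has parameter 0, a small
  positive parameter is taken instead, since the inequality for the other disc is strict.\<close>

lemma arc_parameter:
  obtains r where "0 < r" "r < L" "\<gamma> r \<in> arc j"
proof -
  obtain z where z: "z \<in> arc j" using arc_nonempty by blast
  then have "z \<in> frontier D" by (rule arc_frontier)
  then obtain r0 where r0: "0 \<le> r0" "r0 < L" "\<gamma> r0 = z" using gamma_image[symmetric] by auto
  show thesis
  proof (cases "r0 = 0")
    case False
    then show thesis using r0 z by (intro that[of r0]) auto
  next
    case True
    define f where "f t = cmod (\<gamma> t - c (\<not> j))" for t
    have "continuous_on {0..L} f" unfolding f_def by (intro continuous_intros continuous_gamma)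
    moreover have f0: "0 < R (\<not> j) - f 0" using z r0 True by (simp add: arc_iff f_def)
    ultimately obtain \<delta> where \<delta>: "0 < \<delta>" "\<And>t. t \<in> {0..L} \<Longrightarrow> dist t 0 < \<delta> \<Longrightarrow> dist (f t) (f 0) < R (\<not> j) - f 0"
      using L_pos unfolding continuous_on_iff by (metis atLeastAtMost_iff order_refl less_imp_le)
    define t where "t = min (\<delta> / 2) (L / 2)"
    have t: "0 < t" "t < L" "t < \<delta>" using \<delta>(1) L_pos by (auto simp: t_def min_def)
    have "dist (f t) (f 0) < R (\<not> j) - f 0" by (rule \<delta>(2)) (use t in auto)
    then have ft: "f t < R (\<not> j)" by (simp add: dist_real_def)
    have "\<gamma> t \<in> frontier D" using t by (intro gamma_frontier) auto
    then have "\<gamma> t \<in> corners \<or> \<gamma> t \<in> arc True \<or> \<gamma> t \<in> arc False" by (simp only: frontier_cases)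
    moreover have "\<gamma> t \<notin> corners"
      using ft by (cases j) (auto simp: corners_def f_def dist_norm norm_minus_commute)
    moreover have "\<gamma> t \<notin> arc (\<not> j)" using ft by (auto simp: arc_iff f_def)
    ultimately have "\<gamma> t \<in> arc j" by (cases j) auto
    then show thesis using t by (intro that[of t])
  qed
qed

lemma arc_valid:
  assumes r: "0 < r" "r < L" "\<gamma> r \<in> arc j"
  obtains a b where "valid (j, a, b)" "of_rat a < r" "r < of_rat b"
proof -
  have "\<gamma> r \<notin> corners" using r(3) by (cases j) (auto simp: arc_iff corners_def dist_norm norm_minus_commute)
  then obtain j' a b where v: "valid (j', a, b)" "of_rat a < r" "r < of_rat b" using valid_exists[OF r(1,2)] by blast
  have "j' = j" by (rule arc_disjoint[OF pieceD(3)[OF valid_piece[OF v(1)] v(2,3)] r(3)])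
  then show thesis using v that by blast
qed

text \<open>By strict convexity a point strictly between two boundary points is interior, so a ray
  starting on the boundary meets it at most once more.\<close>

lemma frontier_ray_le:
  assumes p: "p \<in> frontier D" and q: "p + of_real t * v \<in> frontier D" and q': "p + of_real t' * v \<in> frontier D"
    and t: "0 < t" "0 < t'" "v \<noteq> 0"
  shows "t \<le> t'"
proof (rule ccontr)
  assume "\<not> t \<le> t'"
  then have "t' < t" by simp
  have le: "cmod (p - c i) \<le> R i" "cmod (p + of_real t * v - c i) \<le> R i" for i
    using p q by (auto simp: frontier_D D_iff)
  have "cmod ((1 - of_real (t' / t)) * p + of_real (t' / t) * (p + of_real t * v) - c i) < R i" for i
    using t \<open>t' < t\<close> by (intro open_segment_in_ball le) auto
  moreover have "(1 - of_real (t' / t)) * p + of_real (t' / t) * (p + of_real t * v) = p + of_real t' * v"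
    using t by (simp add: algebra_simps)
  ultimately have "p + of_real t' * v \<in> interior D" by (simp add: interior_D_iff)
  then show False using q' by (simp add: frontier_D)
qed

text \<open>The chord from a point of the circle to a point of the open disc makes an acute angle
  with the inward normal, hence the required velocity is not tangential.\<close>

lemma velocity_towards:
  assumes p: "piece j \<beta> a b" and r: "a < r" "r < b" and q: "cmod (q - c j) < R j"
  obtains s t where "\<bar>s\<bar> < 1" "0 < t" "q = \<gamma> r + of_real t * post_velocity \<gamma> (r, s)"
proof -
  let ?p = "\<gamma> r" and ?n = "inward_normal \<gamma> r"
  have pc: "cmod (?p - c j) = R j" using pieceD(3)[OF p r] by (simp add: arc_iff)
  have nd: "\<gamma> differentiable (at r)" by (rule piece_derivative[OF p r])
  have n: "of_real (R j) * ?n = - (?p - c j)"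
    unfolding piece_derivative(2)[OF p r] pieceD(4)[OF p r] by simp
  have n1: "cmod ?n = 1" by (rule normal_unit[OF nd])
  have nn: "?n * cnj ?n = 1" using n1 complex_norm_square[of ?n] by simp
  define t where "t = cmod (q - ?p)"
  have t: "0 < t" using pc q by (auto simp: t_def)
  define w where "w = (q - ?p) / of_real t"
  have w1: "cmod w = 1" using t by (simp add: w_def norm_divide) (simp add: t_def)
  have q_eq: "q = ?p + of_real t * w" using t by (simp add: w_def)
  define \<omega> where "\<omega> = w * cnj ?n"
  have o1: "(Re \<omega>)\<^sup>2 + (Im \<omega>)\<^sup>2 = 1"
    using cmod_power2[of \<omega>] w1 n1 by (simp add: \<omega>_def norm_mult)
  have o2: "0 < Re \<omega>"
  proof -
    have "q - c j = of_real t * w - of_real (R j) * ?n" using n q_eq by (simp add: algebra_simps)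
    then have "(q - c j) * cnj ?n = (of_real t * w - of_real (R j) * ?n) * cnj ?n" by (rule arg_cong)
    also have "\<dots> = of_real t * \<omega> - of_real (R j) * (?n * cnj ?n)" unfolding \<omega>_def by algebra
    finally have "(q - c j) * cnj ?n = of_real t * \<omega> - of_real (R j)" unfolding nn by simp
    then have "Re ((q - c j) * cnj ?n) = t * Re \<omega> - R j" by (rule arg_cong[where f = Re, THEN trans]) simp
    moreover have "- Re ((q - c j) * cnj ?n) \<le> cmod ((q - c j) * cnj ?n)"
      using abs_Re_le_cmod[of "(q - c j) * cnj ?n"] by linarith
    moreover have "cmod ((q - c j) * cnj ?n) < R j" using q n1 by (simp only: norm_mult complex_mod_cnj mult_1_right)
    ultimately have "0 < t * Re \<omega>" by linarith
    then show ?thesis using t by (simp add: zero_less_mult_iff)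
  qed
  define s where "s = - Im \<omega>"
  have ss: "1 - s\<^sup>2 = (Re \<omega>)\<^sup>2" using o1 unfolding s_def power2_minus by linarith
  have s: "\<bar>s\<bar> < 1"
  proof -
    have "0 < (Re \<omega>)\<^sup>2" using o2 by simp
    then show ?thesis unfolding ss[symmetric] by (simp add: abs_square_less_1)
  qed
  have "cos (arcsin s) = Re \<omega>"
    using s o2 ss by (simp add: cos_arcsin abs_less_iff)
  moreover have "sin (arcsin s) = - Im \<omega>" using s by (simp add: abs_less_iff s_def[symmetric])
  ultimately have cis: "cis (- arcsin s) = \<omega>" by (simp add: complex_eq_iff)
  have "post_velocity \<gamma> (r, s) = ?n * \<omega>" unfolding post_velocity_def prod.case cis ..
  also have "\<dots> = w * (?n * cnj ?n)" unfolding \<omega>_def by (simp only: mult_ac)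
  also have "\<dots> = w" unfolding nn by (rule mult_1_right)
  finally have "q = \<gamma> r + of_real t * post_velocity \<gamma> (r, s)" using q_eq by (simp only:)
  with s t show thesis by (rule that)
qed

text \<open>The target lies strictly inside disc \<open>j\<close>, so it can be aimed at. The ray
  meets the boundary only once after departure, hence the collision supplied by
  \<open>branch_exists\<close> takes place at the target.\<close>

lemma crossing_branch:
  assumes p: "piece j \<beta> a b" and r: "a < r" "r < b" and p': "piece k \<beta>' a' b'" and r1: "a' < r1" "r1 < b'"
    and jk: "j \<noteq> k"
  shows "\<exists>s n s1. \<bar>s\<bar> < 1 \<and> \<bar>s1\<bar> < 1 \<and> branch j \<beta> k \<beta>' n (r, s) = (r1, s1)"
proof -
  have fr: "\<gamma> r \<in> frontier D" "\<gamma> r1 \<in> frontier D"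
    using pieceD(3)[OF p r] pieceD(3)[OF p' r1] by (simp_all only: arc_frontier)
  have "cmod (\<gamma> r1 - c j) < R j" using pieceD(3)[OF p' r1] jk by (cases j; cases k) (auto simp: arc_iff)
  from velocity_towards[OF p r this] obtain s t
    where s: "\<bar>s\<bar> < 1" "0 < t" "\<gamma> r1 = \<gamma> r + of_real t * post_velocity \<gamma> (r, s)" .
  show ?thesis
  proof (rule branch_exists[OF p r s(1)])
    fix T q
    assume T: "0 < T" and q: "q = \<gamma> r + of_real T * post_velocity \<gamma> (r, s)" "q \<in> frontier D"
      and ex: "\<And>k \<beta>' a' b' r1. piece k \<beta>' a' b' \<Longrightarrow> a' < r1 \<Longrightarrow> r1 < b' \<Longrightarrow> \<gamma> r1 = q \<Longrightarrow>
       \<exists>n s1. \<bar>s1\<bar> < 1 \<and> branch j \<beta> k \<beta>' n (r, s) = (r1, s1)"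
    have v0: "post_velocity \<gamma> (r, s) \<noteq> 0"
      using normal_unit[OF piece_derivative(1)[OF p r]] by (auto simp: post_velocity_def)
    have "t = T"
      using frontier_ray_le[OF fr(1) fr(2)[unfolded s(3)] q(2)[unfolded q(1)] s(2) T v0]
        frontier_ray_le[OF fr(1) q(2)[unfolded q(1)] fr(2)[unfolded s(3)] T s(2) v0] by (rule antisym)
    then have "\<gamma> r1 = q" unfolding s(3) q(1) by (simp only:)
    from ex[OF p' r1 this] s(1) show ?thesis by blast
  qed
qed

lemma crossing_exists: "\<exists>x a b a' b' n. x \<in> dom ((True, a, b), (False, a', b'), n)"
proof -
  obtain r where r: "0 < r" "r < L" "\<gamma> r \<in> arc True" by (rule arc_parameter)
  obtain r1 where r1: "0 < r1" "r1 < L" "\<gamma> r1 \<in> arc False" by (rule arc_parameter)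
  obtain a b where v: "valid (True, a, b)" "of_rat a < r" "r < of_rat b" by (rule arc_valid[OF r])
  obtain a' b' where v': "valid (False, a', b')" "of_rat a' < r1" "r1 < of_rat b'" by (rule arc_valid[OF r1])
  obtain s n s1 where s: "\<bar>s\<bar> < 1" "\<bar>s1\<bar> < 1"
    and br: "branch True (beta (True, a, b)) False (beta (False, a', b')) n (r, s) = (r1, s1)"
    using crossing_branch[OF valid_piece[OF v(1)] v(2,3) valid_piece[OF v'(1)] v'(2,3)] by auto
  have "(r, s) \<in> dom ((True, a, b), (False, a', b'), n)"
    unfolding dom_def br_def prod.case fst_conv snd_conv Int_iff vimage_eq br
    using v v' s by (simp add: strip_def abs_less_iff)
  then show ?thesis by blast
qed

text \<open>\<open>turn\<close> vanishes when the direction is perpendicular to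
  \<open>c k - c j\<close>. Moving \<open>r\<close> rotates the direction by a small angle \<delta>,
  and the new value is \<plusminus>sin \<delta> times the distance of the centres.\<close>

lemma turn_nonzero:
  assumes U: "open U" "x \<in> U" and jk: "c j \<noteq> c k"
  obtains x' where "x' \<in> U" "turn j k (direction j \<beta> x') \<noteq> 0"
proof (cases "turn j k (direction j \<beta> x) = 0")
  case True
  obtain e where e: "0 < e" "ball x e \<subseteq> U" using U open_contains_ball by blast
  \<comment> \<open>Moving \<open>r\<close> by \<open>R j * \<delta>\<close> stays inside the ball,
    and the bound 1 keeps sin \<delta> positive.\<close>
  define \<delta> where "\<delta> = min (e / 2 / R j) 1"
  have \<delta>: "0 < \<delta>" "\<delta> < pi" "R j * \<delta> < e"
  proof -
    show "0 < \<delta>" using e R_pos[of j] by (simp add: \<delta>_def)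
    show "\<delta> < pi" using pi_gt3 by (simp add: \<delta>_def min_def)
    have "R j * \<delta> \<le> R j * (e / 2 / R j)" using R_pos[of j] by (intro mult_left_mono) (auto simp: \<delta>_def)
    then show "R j * \<delta> < e" using e R_pos[of j] by simp
  qed
  define x' where "x' = (fst x + R j * \<delta>, snd x)"
  define w where "w = cis (- direction j \<beta> x) * (c k - c j)"
  have "dist x' x = R j * \<delta>" using \<delta> R_pos[of j] by (simp add: x'_def dist_prod_def dist_real_def)
  then have "x' \<in> U" using \<delta> e(2) by (auto simp: dist_commute)
  moreover have "turn j k (direction j \<beta> x') \<noteq> 0"
  proof -
    have "direction j \<beta> x' = direction j \<beta> x + \<delta>" using R_pos[of j] by (simp add: direction_def x'_def add_divide_distrib)
    then have c: "cis (- direction j \<beta> x') = cis (- \<delta>) * cis (- direction j \<beta> x)" by (simp add: cis_mult algebra_simps)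
    have re: "Re w = 0" using True by (simp only: turn_def w_def neg_equal_0_iff_equal)
    moreover have "w \<noteq> 0" using jk by (simp add: w_def)
    ultimately have "Im w \<noteq> 0" by (simp add: complex_eq_iff)
    moreover have "turn j k (direction j \<beta> x') = - Re (cis (- \<delta>) * w)" unfolding turn_def c w_def by (simp only: mult.assoc)
    then have "turn j k (direction j \<beta> x') = - (sin \<delta> * Im w)" using re by simp
    ultimately show ?thesis using sin_gt_zero[OF \<delta>(1,2)] by simp
  qed
  ultimately show thesis by (rule that)
qed (use U that in blast)

text \<open>The lower left entry of a crossing derivative is a multiple of \<open>turn\<close>,
  non-zero on a non-empty open set. The sets \<open>Y N\<close> with uniform bounds on the entries
  exhaust this set, so one of them has positive measure.\<close>

lemma twist_set:
  obtains Y M p0 where "Y \<in> sets m" "0 < measure m Y" "0 < p0"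
    "\<forall>y\<in>Y. \<exists>a b p q. deriv_map y = mat2 a b p q \<and> p0 \<le> \<bar>p\<bar> \<and> \<bar>a\<bar> \<le> M \<and> \<bar>b\<bar> \<le> M \<and> \<bar>q\<bar> \<le> M \<and> a * q - b * p = 1"
proof -
  obtain x0 a b a' b' n where x0: "x0 \<in> dom ((True, a, b), (False, a', b'), n)" using crossing_exists by blast
  define i :: index where "i = ((True, a, b), (False, a', b'), n)"
  define g where "g x = turn True False (direction True (beta (True, a, b)) x)" for x
  define U where "U = dom i \<inter> g -` (- {0})"
  have "continuous_on UNIV g"
    unfolding g_def turn_def direction_def using R_pos[of True] by (intro continuous_intros) auto
  then have U: "open U" unfolding U_def by (intro open_Int open_dom open_vimage) auto
  obtain x where "x \<in> dom i" "g x \<noteq> 0"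
    using turn_nonzero[OF open_dom x0 c_distinct] unfolding i_def g_def by blast
  then have Une: "U \<noteq> {}" by (auto simp: U_def)
  have Ucs: "U \<subseteq> collision_space L" using dom_subset unfolding U_def by blast
  note Um = measure_open_pos[OF U Une Ucs]
  define e where "e k l x = deriv_br i x $ k $ l" for k l x
  have [measurable]: "e k l \<in> borel_measurable borel" for k l
    unfolding e_def[abs_def]
    by (rule measurable_compose[OF deriv_br_measurable])
       (intro borel_measurable_continuous_onI continuous_intros)
  have e21: "e 2 1 x = g x / (R True * R False)" for x
    by (simp add: e_def deriv_br_def i_def jac_def Let_def g_def)
  define Y where "Y N = {x\<in>U. 1 / (real N + 1) \<le> \<bar>e 2 1 x\<bar> \<and> \<bar>e 1 1 x\<bar> \<le> real N \<and> \<bar>e 1 2 x\<bar> \<le> real N \<and> \<bar>e 2 2 x\<bar> \<le> real N}" for N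
  have [measurable]: "U \<in> sets borel" using U by simp
  have Ys: "Y N \<in> sets m" for N
  proof -
    have "{x \<in> space borel. x \<in> U \<and> 1 / (real N + 1) \<le> \<bar>e 2 1 x\<bar> \<and> \<bar>e 1 1 x\<bar> \<le> real N \<and> \<bar>e 1 2 x\<bar> \<le> real N \<and> \<bar>e 2 2 x\<bar> \<le> real N} \<in> sets borel"
      by measurable
    then have "Y N \<in> sets borel" by (simp add: Y_def)
    moreover have "Y N \<subseteq> collision_space L" using Ucs by (auto simp: Y_def)
    ultimately show ?thesis by (simp add: sets_m_iff)
  qed
  have "(\<Union>N. Y N) = U"
  proof (intro equalityI subsetI)
    fix x assume x: "x \<in> U"
    then have "e 2 1 x \<noteq> 0" using R_pos by (simp add: U_def e21 less_imp_neq[symmetric])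
    define V where "V = 1 / \<bar>e 2 1 x\<bar> + \<bar>e 1 1 x\<bar> + \<bar>e 1 2 x\<bar> + \<bar>e 2 2 x\<bar>"
    obtain N where "V \<le> real N" using real_arch_simple by blast
    then have N: "1 / \<bar>e 2 1 x\<bar> \<le> real N" "\<bar>e 1 1 x\<bar> \<le> real N" "\<bar>e 1 2 x\<bar> \<le> real N" "\<bar>e 2 2 x\<bar> \<le> real N"
    proof -
      have "0 \<le> 1 / \<bar>e 2 1 x\<bar>" by simp
      then show "1 / \<bar>e 2 1 x\<bar> \<le> real N" "\<bar>e 1 1 x\<bar> \<le> real N" "\<bar>e 1 2 x\<bar> \<le> real N" "\<bar>e 2 2 x\<bar> \<le> real N"
        using \<open>V \<le> real N\<close> unfolding V_def by linarith+
    qed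
    have "1 \<le> real N * \<bar>e 2 1 x\<bar>" using N(1) \<open>e 2 1 x \<noteq> 0\<close> by (simp add: divide_le_eq)
    then have "1 \<le> \<bar>e 2 1 x\<bar> * (real N + 1)" by (simp add: algebra_simps)
    then have "1 / (real N + 1) \<le> \<bar>e 2 1 x\<bar>" by (simp add: divide_le_eq)
    then show "x \<in> (\<Union>N. Y N)" using x N by (auto simp: Y_def)
  qed (auto simp: Y_def)
  moreover have "emeasure m U \<noteq> 0" using Um(2) by (simp add: m.emeasure_eq_measure)
  ultimately have "\<not> (\<forall>N. emeasure m (Y N) = 0)"
    using emeasure_UN_eq_0[of m Y] Ys by (metis image_subsetI)
  then obtain N where N: "emeasure m (Y N) \<noteq> 0" by blast
  show thesis
  proof (rule that[OF Ys, of N "1 / (real N + 1)" "real N"])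
    show "0 < measure m (Y N)" using N by (simp add: m.emeasure_eq_measure zero_less_measure_iff)
    show "\<forall>y\<in>Y N. \<exists>a b p q. deriv_map y = mat2 a b p q \<and> 1 / (real N + 1) \<le> \<bar>p\<bar> \<and> \<bar>a\<bar> \<le> real N \<and> \<bar>b\<bar> \<le> real N \<and> \<bar>q\<bar> \<le> real N \<and> a * q - b * p = 1"
    proof
      fix y assume y: "y \<in> Y N"
      then have "y \<in> dom i" by (simp add: Y_def U_def)
      then have "deriv_map y = mat2 (e 1 1 y) (e 1 2 y) (e 2 1 y) (e 2 2 y)"
        by (simp add: deriv_map_dom e_def vec_eq_iff forall_2)
      moreover have "e 1 1 y * e 2 2 y - e 1 2 y * e 2 1 y = 1"
        using det_deriv_br[of i y] by (simp add: det_2 e_def)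
      ultimately show "\<exists>a b p q. deriv_map y = mat2 a b p q \<and> 1 / (real N + 1) \<le> \<bar>p\<bar> \<and> \<bar>a\<bar> \<le> real N \<and> \<bar>b\<bar> \<le> real N \<and> \<bar>q\<bar> \<le> real N \<and> a * q - b * p = 1"
        using y unfolding Y_def by blast
    qed
  qed simp
qed

text \<open>Nearly tangential trajectories return to the same arc, and the derivative of such a collision
  is an arbitrarily strong shear.\<close>

lemma shear_domain:
  obtains i j r0 s0 where "0 \<le> s0" "s0 < 1" "\<forall>s. s0 < s \<and> s < 1 \<longrightarrow> (r0, s) \<in> dom i"
    "\<forall>x\<in>dom i. deriv_map x = mat2 1 (- (2 * R j * sec_arcsin (snd x))) 0 1"
proof -
  define j where "j = True"
  obtain r where r: "0 < r" "r < L" "\<gamma> r \<in> arc j" by (rule arc_parameter)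
  obtain a b where v: "valid (j, a, b)" "of_rat a < r" "r < of_rat b" using arc_valid[OF r] by blast
  define i :: index where "i = ((j, a, b), (j, a, b), 0)"
  have next_s: "next_s j j \<theta> s = s" for \<theta> s using R_pos[of j] by (simp add: next_s_def)
  \<comment> \<open>On one circle \<open>s\<close> is preserved and the parameter advances by
    \<open>R j * (pi - 2 * arcsin s)\<close>, which tends to 0 as \<open>s\<close> tends to 1; so
    the trajectory returns to the same piece.\<close>
  have br: "br i (r, s) = (r + R j * (pi - 2 * asin_clip s), s)" for s
    using R_pos[of j] by (simp add: br_def i_def branch_def Let_def next_s direction_def algebra_simps)
  define f where "f s = r + R j * (pi - 2 * asin_clip s)" for s
  have "continuous_on UNIV f" unfolding f_def by (intro continuous_intros)
  then have "(f \<longlongrightarrow> f 1) (at 1)" by (simp add: continuous_on_def)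
  moreover have "f 1 < of_rat b" using v by (simp add: f_def asin_clip_eq)
  ultimately have "eventually (\<lambda>s. f s < of_rat b) (at 1)" by (rule order_tendstoD(2))
  then obtain \<delta> where \<delta>: "0 < \<delta>" "\<And>s. s \<noteq> 1 \<Longrightarrow> dist s 1 < \<delta> \<Longrightarrow> f s < of_rat b"
    unfolding eventually_at by auto
  define s0 where "s0 = max 0 (1 - \<delta>)"
  show thesis
  proof (rule that[of s0 r i j])
    show "0 \<le> s0" "s0 < 1" using \<delta> by (auto simp: s0_def)
    show "\<forall>s. s0 < s \<and> s < 1 \<longrightarrow> (r, s) \<in> dom i"
    proof (intro allI impI)
      fix s assume "s0 < s \<and> s < 1"
      then have s: "0 < s" "1 - \<delta> < s" "s < 1" by (auto simp: s0_def)
      have "f s < of_rat b" using s by (intro \<delta>(2)) (auto simp: dist_real_def)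
      moreover have "r \<le> f s"
      proof -
        have "asin_clip s \<le> pi / 2" using s arcsin_bounded[of s] by (simp add: asin_clip_eq)
        then show ?thesis using R_pos[of j] by (simp add: f_def)
      qed
      ultimately have "(r, s) \<in> strip (j, a, b)" "(f s, s) \<in> strip (j, a, b)"
        using v s by (simp_all add: strip_def)
      moreover have "br i (r, s) = (f s, s)" by (simp only: br f_def)
      moreover have "fst i = (j, a, b)" "fst (snd i) = (j, a, b)" by (simp_all add: i_def)
      ultimately show "(r, s) \<in> dom i" by (simp add: dom_def)
    qed
    show "\<forall>x\<in>dom i. deriv_map x = mat2 1 (- (2 * R j * sec_arcsin (snd x))) 0 1"
    proof
      fix x assume x: "x \<in> dom i"
      have t: "turn j j \<theta> = 0" for \<theta> by (simp add: turn_def)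
      have "snd (branch j (beta (j, a, b)) j (beta (j, a, b)) 0 x) = snd x"
        by (simp add: branch_def Let_def next_s)
      then show "deriv_map x = mat2 1 (- (2 * R j * sec_arcsin (snd x))) 0 1"
        unfolding deriv_map_dom[OF x]
        using R_pos[of j] by (simp add: deriv_br_def i_def jac_def Let_def t vec_eq_iff forall_2)
    qed
  qed
qed

text \<open>The shear strength \<open>h\<close> increases with \<open>s\<close> and is unbounded, so
  three strips of values of \<open>s\<close> with gaps between them give well separated shears.
  \<open>K\<close> depends only on the first strip and on the bounds for \<open>Y\<close>, and is
  fixed before the other strips are chosen.\<close>

lemma pingpong_sets:
  obtains S X1 X2 X3 Y where "S \<in> sets borel"
    "X1 \<in> sets m" "X2 \<in> sets m" "X3 \<in> sets m" "Y \<in> sets m"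
    "0 < measure m X1" "0 < measure m X2" "0 < measure m X3" "0 < measure m Y"
    "\<forall>x1\<in>X1. \<forall>x2\<in>X2. \<forall>x3\<in>X3. \<forall>y\<in>Y.
      pingpong S (deriv_map x1) (deriv_map x2) (deriv_map x3) (deriv_map y)"
proof -
  obtain Y M p0 where Y: "Y \<in> sets m" "0 < measure m Y" "0 < p0" and
    Y': "\<forall>y\<in>Y. \<exists>a b p q. deriv_map y = mat2 a b p q \<and> p0 \<le> \<bar>p\<bar> \<and> \<bar>a\<bar> \<le> M \<and> \<bar>b\<bar> \<le> M \<and> \<bar>q\<bar> \<le> M \<and> a * q - b * p = 1"
    by (rule twist_set)
  obtain i j r0 s0 where s0: "0 \<le> s0" "s0 < 1" and D0: "\<forall>s. s0 < s \<and> s < 1 \<longrightarrow> (r0, s) \<in> dom i"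
    and sh: "\<forall>x\<in>dom i. deriv_map x = mat2 1 (- (2 * R j * sec_arcsin (snd x))) 0 1"
    by (rule shear_domain)
  define X where "X lo hi = dom i \<inter> snd -` {lo<..<hi}" for lo hi :: real
  have X: "X lo hi \<in> sets m" "0 < measure m (X lo hi)" if h: "s0 \<le> lo" "lo < hi" "hi \<le> 1" for lo hi
  proof -
    have o: "open (X lo hi)" unfolding X_def by (intro open_Int open_dom open_vimage continuous_intros)
    have "(r0, (lo + hi) / 2) \<in> X lo hi" using h D0[rule_format, of "(lo + hi) / 2"] by (auto simp: X_def)
    then have ne: "X lo hi \<noteq> {}" by blast
    have "X lo hi \<subseteq> collision_space L" using dom_subset unfolding X_def by blast
    from measure_open_pos[OF o ne this] show "X lo hi \<in> sets m" "0 < measure m (X lo hi)" by auto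
  qed
  define h where "h s = 2 * R j * sec_arcsin s" for s
  have h_mono: "h s \<le> h t" if "0 \<le> s" "s \<le> t" "t < 1" for s t
    unfolding h_def using R_pos[of j] by (intro mult_left_mono sec_arcsin_mono that) auto
  have h_pos: "0 \<le> h s" if "0 \<le> s" "s < 1" for s
    unfolding h_def using R_pos[of j] sec_arcsin_ge_1[of s] that by simp
  have h_large: "\<exists>s. t < s \<and> s < 1 \<and> V \<le> h s" if t: "t < 1" for t V
  proof -
    obtain s where "t < s" "s < 1" "V / (2 * R j) \<le> sec_arcsin s" using sec_arcsin_large[OF t] by blast
    then show ?thesis using R_pos[of j] by (intro exI[of _ s]) (simp add: h_def divide_le_eq mult.commute)
  qed
  have M0: "0 \<le> M"
  proof -
    have "Y \<noteq> {}" using Y(2) by auto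
    then show ?thesis using Y' by fastforce
  qed
  define s1 where "s1 = (s0 + 1) / 2"
  have s1: "s0 < s1" "s1 < 1" using s0 by (auto simp: s1_def)
  define K where "K = h s1 + 2 + 4 * M / p0"
  have K: "0 \<le> K" using h_pos[of s1] s0 s1 M0 Y(3) by (simp add: K_def)
  obtain s2 where s2: "s1 < s2" "s2 < 1" "h s1 + 2 * K \<le> h s2" using h_large[OF s1(2)] by blast
  \<comment> \<open>An upper end for the second strip keeps its shears bounded, so that the third
    strip can be placed beyond them.\<close>
  define s2' where "s2' = (s2 + 1) / 2"
  have s2': "s2 < s2'" "s2' < 1" using s2 by (auto simp: s2'_def)
  obtain s3 where s3: "s2' < s3" "s3 < 1" "h s2' + 2 * K \<le> h s3" using h_large[OF s2'(2)] by blast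
  show thesis
  proof (rule that[of "{v :: real^2. \<bar>v $ 1\<bar> < K * \<bar>v $ 2\<bar>}" "X s0 s1" "X s2 s2'" "X s3 1" Y])
    have "open {v :: real^2. \<bar>v $ 1\<bar> < K * \<bar>v $ 2\<bar>}" by (intro open_Collect_less continuous_intros)
    then show "{v :: real^2. \<bar>v $ 1\<bar> < K * \<bar>v $ 2\<bar>} \<in> sets borel" by simp
    show "\<forall>x1\<in>X s0 s1. \<forall>x2\<in>X s2 s2'. \<forall>x3\<in>X s3 1. \<forall>y\<in>Y.
      pingpong {v. \<bar>v $ 1\<bar> < K * \<bar>v $ 2\<bar>} (deriv_map x1) (deriv_map x2) (deriv_map x3) (deriv_map y)"
    proof (intro ballI)
      fix x1 x2 x3 y assume x: "x1 \<in> X s0 s1" "x2 \<in> X s2 s2'" "x3 \<in> X s3 1" and y: "y \<in> Y"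
      obtain a b p q where e: "deriv_map y = mat2 a b p q" and b: "p0 \<le> \<bar>p\<bar>" "\<bar>a\<bar> \<le> M" "\<bar>b\<bar> \<le> M" "\<bar>q\<bar> \<le> M" "a * q - b * p = 1"
        using bspec[OF Y' y] by blast
      have d: "deriv_map x1 = mat2 1 (- h (snd x1)) 0 1" "deriv_map x2 = mat2 1 (- h (snd x2)) 0 1" "deriv_map x3 = mat2 1 (- h (snd x3)) 0 1"
        using x sh by (auto simp: X_def h_def)
      have "snd x3 < 1"
        using x(3) unfolding X_def by simp
      then have hs: "0 \<le> h (snd x1)" "h (snd x1) \<le> h s1" "h s2 \<le> h (snd x2)" "h (snd x2) \<le> h s2'" "h s3 \<le> h (snd x3)"
        using x s0 s1 s2 s2' s3 by (auto simp: X_def intro!: h_pos h_mono)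
      show "pingpong {v. \<bar>v $ 1\<bar> < K * \<bar>v $ 2\<bar>} (deriv_map x1) (deriv_map x2) (deriv_map x3) (deriv_map y)"
        unfolding d e
        by (rule pingpong_shears[OF Y(3) b, of _ "h s1"]) (use hs s2 s3 K K_def in auto)
    qed
  qed (use X Y s0 s1 s2 s2' s3 in auto)
qed

text \<open>The abstract results are instantiated with the versions \<open>regular_map\<close> and
  \<open>deriv_map\<close>; the almost everywhere equalities lead back to the billiard map and its
  derivative.\<close>

theorem random_billiard_ergodic_hyperbolic:
  assumes "0 < \<epsilon>" "noise_density \<epsilon> \<rho>" "random_billiard D L \<gamma> \<rho> P"
  shows "markov_ergodic m P \<and> markov_hyperbolic m P (jacobian2 (billiard_map D L \<gamma>))"
proof -
  interpret noisy_map L \<epsilon> \<rho> "billiard_map D L \<gamma>" regular_map P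
  proof
    show "0 < \<epsilon>" "noise_density \<epsilon> \<rho>" by fact+
    show "regular_map \<in> m \<rightarrow>\<^sub>M m" "distr m m regular_map = m" "AE x in m. billiard_map D L \<gamma> x = regular_map x"
      by (rule regular_map_m, rule distr_regular_map, rule AE_billiard_map)
    show "P \<in> m \<rightarrow>\<^sub>M prob_algebra m" "AE x in m. \<forall>B\<in>sets m. emeasure (P x) B = perturbed L \<rho> (billiard_map D L \<gamma> x) B"
      using assms(3) unfolding random_billiard_def by blast+
  qed
  obtain \<kappa> where gap: "spectral_gap m P \<kappa>" using spectral_gap_exists by blast
  obtain S X1 X2 X3 Y where sets: "S \<in> sets borel"
    "X1 \<in> sets m" "X2 \<in> sets m" "X3 \<in> sets m" "Y \<in> sets m"
    and pos: "0 < measure m X1" "0 < measure m X2" "0 < measure m X3" "0 < measure m Y"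
    and pp: "\<forall>x1\<in>X1. \<forall>x2\<in>X2. \<forall>x3\<in>X3. \<forall>y\<in>Y.
      pingpong S (deriv_map x1) (deriv_map x2) (deriv_map x3) (deriv_map y)"
    by (rule pingpong_sets)
  have "hyperbolic_cocycle m P \<kappa> deriv_map S X1 X2 X3 Y"
    by (intro hyperbolic_cocycle.intro gap hyperbolic_cocycle_axioms.intro deriv_map_measurable
        det_deriv_map integrable_log sets pos pp[rule_format])
  then show ?thesis
    using spectral_gap.ergodic[OF gap] hyperbolic_cocycle.hyperbolic AE_jacobian by blast
qed

end

theorem theorem4p9:
  fixes D :: "complex set" and L \<epsilon> :: real and \<gamma> :: "real \<Rightarrow> complex"
    and \<rho> :: "real \<times> real \<Rightarrow> real" and P :: "real \<times> real \<Rightarrow> (real \<times> real) measure"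
  assumes "lemon_table D"
    and "arclength_boundary D L \<gamma>"
    and "0 < \<epsilon>"
    and "noise_density \<epsilon> \<rho>"
    and "random_billiard D L \<gamma> \<rho> P"
  shows "markov_ergodic (collision_measure L) P \<and>
         markov_hyperbolic (collision_measure L) P (jacobian2 (billiard_map D L \<gamma>))"
proof -
  obtain c1 R1 c2 R2 where D: "D = cball c1 R1 \<inter> cball c2 R2" "card (sphere c1 R1 \<inter> sphere c2 R2) = 2"
    using assms(1) unfolding lemon_table_def by blast
  interpret lemon_billiard "\<lambda>j. if j then c1 else c2" "\<lambda>j. if j then R1 else R2" D L \<gamma>
    by unfold_locales (simp_all add: D(2) D(1)[symmetric] assms(2))
  show ?thesis by (rule random_billiard_ergodic_hyperbolic[OF assms(3-5)])
qed

end
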